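(* Let $D\subset X_{\mathbb C}$ be a $G$-invariant domain (open connected subset) with $X\subset D$ on which $G$ acts properly. Then: (i) $\partial_s\Xi\cap D=\emptyset$; (ii) $\partial_n\Xi\not\subset D$. In particular, if $\partial_n\Xi\cap D=\emptyset$, then $D\subset\Xi$.
   Context: $G$ is a connected non-compact Lie group with simple Lie algebra $\mathfrak g=\mathfrak k\oplus\mathfrak p$, $K=\exp\mathfrak k$, $G_{\mathbb C}$ its universal complexification, $K_{\mathbb C}$ the analytic subgroup with Lie algebra $\mathfrak k_{\mathbb C}$, $X_{\mathbb C}=G_{\mathbb C}/K_{\mathbb C}$, $x_0=eK_{\mathbb C}$, and $X=G/K$ embedded as $G.x_0\subset X_{\mathbb C}$. $\mathfrak a\subset\mathfrak p$ is maximal abelian, $\Omega=\{Y\in\mathfrak a:|\alpha(Y)|<1\ \forall\alpha\in\Sigma(\mathfrak g,\mathfrak a)\}$. The crown domain is $\Xi=G\exp(i\pi\Omega/2).x_0$, $\partial\Xi$ is its topological boundary in $X_{\mathbb C}$, $\partial_s\Xi=G\exp(i\pi\partial\Omega/2).x_0\subset\partial\Xi$ is its semisimple part, and $\partial_n\Xi=\partial\Xi\setminus\partial_s\Xi$. *)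

theory Defs
  imports "HOL-Analysis.Analysis" "HOL-Algebra.Generated_Groups" "HOL-Library.Function_Algebras"
begin

section \<open>Smooth functions of several variables over the reals or the complex numbers\<close>

text \<open>
  Everything up to the exponential map is parametric in a field \<open>'k\<close>, used at \<open>real\<close> (where
  ``smooth'' is \<open>C\<^sup>\<infinity>\<close>) and at \<open>complex\<close> (where ``smooth'' is holomorphic).
  The space \<open>'k\<^sup>n\<close> is the set of sequences vanishing from index \<open>n\<close> on. The product topology of
  \<open>nat \<Rightarrow> 'k\<close> induces the usual topology on it. Having all \<open>n\<close> in one type makes it possible to
  quantify over Lie groups of all dimensions, as a universal property requires.
\<close>

definition kspace :: "nat \<Rightarrow> (nat \<Rightarrow> 'k::real_normed_field) set" where
  "kspace n = {x. \<forall>i\<ge>n. x i = 0}"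

primrec Ck_on :: "nat \<Rightarrow> nat \<Rightarrow> (nat \<Rightarrow> 'k::real_normed_field) set \<Rightarrow> ((nat \<Rightarrow> 'k) \<Rightarrow> 'k) \<Rightarrow> bool" where
  "Ck_on n 0 U f \<longleftrightarrow> continuous_on U f"
| "Ck_on n (Suc m) U f \<longleftrightarrow> continuous_on U f \<and>
     (\<exists>D. \<forall>i<n. (\<forall>x\<in>U. ((\<lambda>t. f (x(i := t))) has_field_derivative D i x) (at (x i))) \<and>
                Ck_on n m U (D i))"

text \<open>Used only for \<open>U\<close> open in \<open>kspace n\<close>.\<close>

definition smooth_on :: "nat \<Rightarrow> (nat \<Rightarrow> 'k::real_normed_field) set \<Rightarrow> ((nat \<Rightarrow> 'k) \<Rightarrow> 'k) \<Rightarrow> bool" where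
  "smooth_on n U f \<longleftrightarrow> (\<forall>m. Ck_on n m U f)"


section \<open>Manifolds\<close>

text \<open>A chart is a pair of its domain and its coordinate map.\<close>

record ('a, 'k) manifold =
  mtop :: "'a topology"
  mdim :: nat
  atlas :: "('a set \<times> ('a \<Rightarrow> nat \<Rightarrow> 'k)) set"

definition smooth_fun ::
    "('a, 'k::real_normed_field) manifold \<Rightarrow> 'a set \<Rightarrow> ('a \<Rightarrow> 'k) \<Rightarrow> bool" where
  "smooth_fun M U f \<longleftrightarrow>
     (\<forall>(V, \<phi>) \<in> atlas M. smooth_on (mdim M) (\<phi> ` (U \<inter> V)) (\<lambda>x. f (inv_into V \<phi> x)))"

definition is_manifold :: "('a, 'k::real_normed_field) manifold \<Rightarrow> bool" where
  "is_manifold M \<longleftrightarrow>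
     Hausdorff_space (mtop M) \<and> second_countable (mtop M) \<and>
     topspace (mtop M) = (\<Union>(U, \<phi>) \<in> atlas M. U) \<and>
     (\<forall>(U, \<phi>) \<in> atlas M.
        openin (mtop M) U \<and>
        openin (top_of_set (kspace (mdim M))) (\<phi> ` U) \<and>
        homeomorphic_map (subtopology (mtop M) U) (top_of_set (\<phi> ` U)) \<phi> \<and>
        (\<forall>i < mdim M. smooth_fun M U (\<lambda>x. \<phi> x i)))"

definition smooth_map ::
    "('a, 'k::real_normed_field) manifold \<Rightarrow> ('b, 'k) manifold \<Rightarrow> ('a \<Rightarrow> 'b) \<Rightarrow> bool" where
  "smooth_map M N f \<longleftrightarrow>
     continuous_map (mtop M) (mtop N) f \<and>
     (\<forall>(V, \<psi>) \<in> atlas N. \<forall>i < mdim N.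
        smooth_fun M {x \<in> topspace (mtop M). f x \<in> V} (\<lambda>x. \<psi> (f x) i))"

definition prod_manifold ::
    "('a, 'k::real_normed_field) manifold \<Rightarrow> ('b, 'k) manifold \<Rightarrow> ('a \<times> 'b, 'k) manifold" where
  "prod_manifold M N =
     \<lparr>mtop = prod_topology (mtop M) (mtop N),
      mdim = mdim M + mdim N,
      atlas = {(U \<times> V, \<lambda>(a, b) i. if i < mdim M then \<phi> a i else \<psi> b (i - mdim M)) | U V \<phi> \<psi>.
                 (U, \<phi>) \<in> atlas M \<and> (V, \<psi>) \<in> atlas N}\<rparr>"

definition line :: "('k::real_normed_field, 'k) manifold" where
  "line = \<lparr>mtop = euclidean, mdim = 1, atlas = {(UNIV, \<lambda>t i. if i = 0 then t else 0)}\<rparr>"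

text \<open>
  The real manifold underlying a complex one: a chart with coordinates \<open>z\<^sub>0, z\<^sub>1, \<dots>\<close> becomes
  one with coordinates \<open>Re z\<^sub>0, Im z\<^sub>0, Re z\<^sub>1, Im z\<^sub>1, \<dots>\<close>
\<close>

definition realification :: "('a, complex) manifold \<Rightarrow> ('a, real) manifold" where
  "realification M =
     \<lparr>mtop = mtop M,
      mdim = 2 * mdim M,
      atlas = {(U, \<lambda>a i. if even i then Re (\<phi> a (i div 2)) else Im (\<phi> a (i div 2))) | U \<phi>.
                 (U, \<phi>) \<in> atlas M}\<rparr>"


section \<open>Lie groups, their Lie algebras and exponential maps\<close>

record ('a, 'k) lie_group = "'a monoid" +
  mfd :: "('a, 'k) manifold"

abbreviation gtop :: "('a, 'k) lie_group \<Rightarrow> 'a topology" where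
  "gtop G \<equiv> mtop (mfd G)"

definition is_lie_group :: "('a, 'k::real_normed_field) lie_group \<Rightarrow> bool" where
  "is_lie_group G \<longleftrightarrow>
     group G \<and> is_manifold (mfd G) \<and> topspace (gtop G) = carrier G \<and>
     smooth_map (prod_manifold (mfd G) (mfd G)) (mfd G) (\<lambda>(x, y). x \<otimes>\<^bsub>G\<^esub> y) \<and>
     smooth_map (mfd G) (mfd G) (\<lambda>x. inv\<^bsub>G\<^esub> x)"

definition smooth_near_one :: "('a, 'k::real_normed_field) lie_group \<Rightarrow> ('a \<Rightarrow> 'k) \<Rightarrow> bool" where
  "smooth_near_one G f \<longleftrightarrow> (\<exists>U. openin (gtop G) U \<and> \<one>\<^bsub>G\<^esub> \<in> U \<and> smooth_fun (mfd G) U f)"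

text \<open>
  The tangent space at the identity: derivations of the algebra of germs at \<open>\<one>\<close> of smooth
  functions, made zero outside the functions that are smooth near \<open>\<one>\<close>.
\<close>

definition lie_algebra :: "('a, 'k::real_normed_field) lie_group \<Rightarrow> (('a \<Rightarrow> 'k) \<Rightarrow> 'k) set" where
  "lie_algebra G = {v.
     (\<forall>f. \<not> smooth_near_one G f \<longrightarrow> v f = 0) \<and>
     (\<forall>f g. smooth_near_one G f \<longrightarrow> smooth_near_one G g \<longrightarrow>
        (\<exists>U. openin (gtop G) U \<and> \<one>\<^bsub>G\<^esub> \<in> U \<and> (\<forall>x\<in>U. f x = g x)) \<longrightarrow> v f = v g) \<and>
     (\<forall>f g. smooth_near_one G f \<longrightarrow> smooth_near_one G g \<longrightarrow>
        v (\<lambda>x. f x + g x) = v f + v g \<and>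
        v (\<lambda>x. f x * g x) = v f * g \<one>\<^bsub>G\<^esub> + f \<one>\<^bsub>G\<^esub> * v g) \<and>
     (\<forall>c f. smooth_near_one G f \<longrightarrow> v (\<lambda>x. c * f x) = c * v f)}"

text \<open>The left invariant vector field of \<open>v\<close> maps \<open>f\<close> to \<open>\<lambda>g. v (\<lambda>h. f (g h))\<close>. The bracket is the
  value at \<open>\<one>\<close> of the commutator of vector fields.\<close>

definition lie_bracket :: "('a, 'k::real_normed_field) lie_group \<Rightarrow>
    (('a \<Rightarrow> 'k) \<Rightarrow> 'k) \<Rightarrow> (('a \<Rightarrow> 'k) \<Rightarrow> 'k) \<Rightarrow> (('a \<Rightarrow> 'k) \<Rightarrow> 'k)" where
  "lie_bracket G v w = (\<lambda>f. if smooth_near_one G f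
     then v (\<lambda>g. w (\<lambda>h. f (g \<otimes>\<^bsub>G\<^esub> h))) - w (\<lambda>g. v (\<lambda>h. f (g \<otimes>\<^bsub>G\<^esub> h)))
     else 0)"

definition one_parameter_subgroup ::
    "('a, 'k::real_normed_field) lie_group \<Rightarrow> (('a \<Rightarrow> 'k) \<Rightarrow> 'k) \<Rightarrow> ('k \<Rightarrow> 'a) \<Rightarrow> bool" where
  "one_parameter_subgroup G v \<gamma> \<longleftrightarrow>
     smooth_map line (mfd G) \<gamma> \<and>
     (\<forall>s t. \<gamma> (s + t) = \<gamma> s \<otimes>\<^bsub>G\<^esub> \<gamma> t) \<and>
     (\<forall>f. smooth_near_one G f \<longrightarrow> ((\<lambda>t. f (\<gamma> t)) has_field_derivative v f) (at 0))"

definition lie_exp :: "('a, 'k::real_normed_field) lie_group \<Rightarrow> (('a \<Rightarrow> 'k) \<Rightarrow> 'k) \<Rightarrow> 'a" where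
  "lie_exp G v = (THE g. \<exists>\<gamma>. one_parameter_subgroup G v \<gamma> \<and> g = \<gamma> 1)"


section \<open>Simple Lie algebras, Cartan decompositions and restricted roots\<close>

text \<open>A Lie algebra is given by its underlying set \<open>L\<close> of \<open>'k\<close>-valued functions, with pointwise
  linear structure, and its bracket \<open>br\<close>.\<close>

definition fscale :: "'k::field \<Rightarrow> ('x \<Rightarrow> 'k) \<Rightarrow> 'x \<Rightarrow> 'k" (infixr \<open>*\<^sub>F\<close> 75) where
  "c *\<^sub>F f = (\<lambda>x. c * f x)"

global_interpretation fnvs: vector_space "fscale :: 'k::field \<Rightarrow> ('x \<Rightarrow> 'k) \<Rightarrow> 'x \<Rightarrow> 'k"
  by unfold_locales (auto simp: fscale_def fun_eq_iff algebra_simps)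

definition abelian_on :: "('v \<Rightarrow> 'v \<Rightarrow> 'v::zero) \<Rightarrow> 'v set \<Rightarrow> bool" where
  "abelian_on br A \<longleftrightarrow> (\<forall>X\<in>A. \<forall>Y\<in>A. br X Y = 0)"

definition simple_lie_algebra ::
    "('x \<Rightarrow> 'k::field) set \<Rightarrow> (('x \<Rightarrow> 'k) \<Rightarrow> ('x \<Rightarrow> 'k) \<Rightarrow> ('x \<Rightarrow> 'k)) \<Rightarrow> bool" where
  "simple_lie_algebra L br \<longleftrightarrow>
     \<not> abelian_on br L \<and>
     (\<forall>I. fnvs.subspace I \<and> I \<subseteq> L \<and> (\<forall>X\<in>L. \<forall>Y\<in>I. br X Y \<in> I) \<longrightarrow> I = {0} \<or> I = L)"

definition trace_on :: "('x \<Rightarrow> 'k::field) set \<Rightarrow> (('x \<Rightarrow> 'k) \<Rightarrow> ('x \<Rightarrow> 'k)) \<Rightarrow> 'k" where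
  "trace_on L F =
     (let B = (SOME B. fnvs.independent B \<and> fnvs.span B = L)
      in \<Sum>b\<in>B. fnvs.representation B (F b) b)"

definition killing_form :: "('x \<Rightarrow> 'k::field) set \<Rightarrow> (('x \<Rightarrow> 'k) \<Rightarrow> ('x \<Rightarrow> 'k) \<Rightarrow> ('x \<Rightarrow> 'k)) \<Rightarrow>
    ('x \<Rightarrow> 'k) \<Rightarrow> ('x \<Rightarrow> 'k) \<Rightarrow> 'k" where
  "killing_form L br X Y = trace_on L (\<lambda>Z. br X (br Y Z))"

definition cartan_involution ::
    "('x \<Rightarrow> real) set \<Rightarrow> (('x \<Rightarrow> real) \<Rightarrow> ('x \<Rightarrow> real) \<Rightarrow> ('x \<Rightarrow> real)) \<Rightarrow>
     (('x \<Rightarrow> real) \<Rightarrow> ('x \<Rightarrow> real)) \<Rightarrow> bool" where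
  "cartan_involution L br \<theta> \<longleftrightarrow>
     (\<forall>X\<in>L. \<theta> X \<in> L \<and> \<theta> (\<theta> X) = X) \<and>
     (\<forall>X\<in>L. \<forall>Y\<in>L. \<theta> (X + Y) = \<theta> X + \<theta> Y \<and> \<theta> (br X Y) = br (\<theta> X) (\<theta> Y)) \<and>
     (\<forall>c. \<forall>X\<in>L. \<theta> (c *\<^sub>F X) = c *\<^sub>F \<theta> X) \<and>
     (\<forall>X\<in>L. X \<noteq> 0 \<longrightarrow> - killing_form L br X (\<theta> X) > 0)"

definition cartan_decomposition ::
    "('x \<Rightarrow> real) set \<Rightarrow> (('x \<Rightarrow> real) \<Rightarrow> ('x \<Rightarrow> real) \<Rightarrow> ('x \<Rightarrow> real)) \<Rightarrow>
     ('x \<Rightarrow> real) set \<Rightarrow> ('x \<Rightarrow> real) set \<Rightarrow> bool" where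
  "cartan_decomposition L br k p \<longleftrightarrow>
     (\<exists>\<theta>. cartan_involution L br \<theta> \<and> k = {X\<in>L. \<theta> X = X} \<and> p = {X\<in>L. \<theta> X = - X})"

definition maximal_abelian_in ::
    "(('x \<Rightarrow> real) \<Rightarrow> ('x \<Rightarrow> real) \<Rightarrow> ('x \<Rightarrow> real)) \<Rightarrow> ('x \<Rightarrow> real) set \<Rightarrow> ('x \<Rightarrow> real) set \<Rightarrow> bool"
  where
  "maximal_abelian_in br p a \<longleftrightarrow>
     fnvs.subspace a \<and> a \<subseteq> p \<and> abelian_on br a \<and>
     (\<forall>b. fnvs.subspace b \<and> b \<subseteq> p \<and> abelian_on br b \<and> a \<subseteq> b \<longrightarrow> b = a)"

definition restricted_roots ::
    "('x \<Rightarrow> real) set \<Rightarrow> (('x \<Rightarrow> real) \<Rightarrow> ('x \<Rightarrow> real) \<Rightarrow> ('x \<Rightarrow> real)) \<Rightarrow>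
     ('x \<Rightarrow> real) set \<Rightarrow> (('x \<Rightarrow> real) \<Rightarrow> real) set" where
  "restricted_roots L br a = {\<alpha> \<in> extensional a.
     (\<forall>X\<in>a. \<forall>Y\<in>a. \<alpha> (X + Y) = \<alpha> X + \<alpha> Y) \<and> (\<forall>c. \<forall>X\<in>a. \<alpha> (c *\<^sub>F X) = c * \<alpha> X) \<and>
     (\<exists>H\<in>a. \<alpha> H \<noteq> 0) \<and>
     (\<exists>X\<in>L. X \<noteq> 0 \<and> (\<forall>H\<in>a. br H X = \<alpha> H *\<^sub>F X))}"

definition Omega :: "('a, real) lie_group \<Rightarrow> (('a \<Rightarrow> real) \<Rightarrow> real) set \<Rightarrow> (('a \<Rightarrow> real) \<Rightarrow> real) set" where
  "Omega G a = {Y\<in>a. \<forall>\<alpha> \<in> restricted_roots (lie_algebra G) (lie_bracket G) a. \<bar>\<alpha> Y\<bar> < 1}"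

text \<open>The boundary is taken in \<open>a\<close>. The topology of pointwise convergence induces on the
  finite-dimensional space \<open>a\<close> its unique Hausdorff vector space topology.\<close>

definition boundary_Omega ::
    "('a, real) lie_group \<Rightarrow> (('a \<Rightarrow> real) \<Rightarrow> real) set \<Rightarrow> (('a \<Rightarrow> real) \<Rightarrow> real) set" where
  "boundary_Omega G a = top_of_set a frontier_of Omega G a"


section \<open>Universal complexification\<close>

definition real_to_complex_lie_hom ::
    "('a, real) lie_group \<Rightarrow> ('b, complex) lie_group \<Rightarrow> ('a \<Rightarrow> 'b) \<Rightarrow> bool" where
  "real_to_complex_lie_hom G H \<phi> \<longleftrightarrow>
     \<phi> \<in> hom G H \<and> smooth_map (mfd G) (realification (mfd H)) \<phi>"

text \<open>
  A second countable manifold has at most continuum many points, so every complex Lie group is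
  isomorphic to one whose carrier is a subset of \<open>real\<close> (with an unrelated group structure,
  topology and atlas). Thus the quantifier over \<open>H\<close> covers all complex Lie groups.
\<close>

definition universal_complexification ::
    "('a, real) lie_group \<Rightarrow> ('b, complex) lie_group \<Rightarrow> ('a \<Rightarrow> 'b) \<Rightarrow> bool" where
  "universal_complexification G GC \<iota> \<longleftrightarrow>
     is_lie_group GC \<and> real_to_complex_lie_hom G GC \<iota> \<and>
     (\<forall>(H :: (real, complex) lie_group) \<phi>.
        is_lie_group H \<and> real_to_complex_lie_hom G H \<phi> \<longrightarrow>
        (\<exists>!\<psi>. \<psi> \<in> extensional (carrier GC) \<and> \<psi> \<in> hom GC H \<and>
              smooth_map (mfd GC) (mfd H) \<psi> \<and> (\<forall>g \<in> carrier G. \<psi> (\<iota> g) = \<phi> g)))"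

text \<open>The derivative \<open>d\<iota>\<close> at the identity, as a map from the real Lie algebra of \<open>G\<close> into the complex
  Lie algebra of \<open>GC\<close>, whose elements are derivations of germs of holomorphic functions.\<close>

definition lie_diff :: "('b, complex) lie_group \<Rightarrow> ('a \<Rightarrow> 'b) \<Rightarrow>
    (('a \<Rightarrow> real) \<Rightarrow> real) \<Rightarrow> (('b \<Rightarrow> complex) \<Rightarrow> complex)" where
  "lie_diff GC \<iota> Y = (\<lambda>f. if smooth_near_one GC f
     then Complex (Y (\<lambda>x. Re (f (\<iota> x)))) (Y (\<lambda>x. Im (f (\<iota> x)))) else 0)"


section \<open>The crown domain\<close>

definition K_C :: "('b, complex) lie_group \<Rightarrow> ('a \<Rightarrow> 'b) \<Rightarrow> (('a \<Rightarrow> real) \<Rightarrow> real) set \<Rightarrow> 'b set" where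
  "K_C GC \<iota> k = generate GC (lie_exp GC ` fnvs.span (lie_diff GC \<iota> ` k))"

definition quotient_topology :: "'a topology \<Rightarrow> ('a \<Rightarrow> 'b) \<Rightarrow> 'b topology" where
  "quotient_topology T q =
     topology (\<lambda>U. U \<subseteq> q ` topspace T \<and> openin T {x \<in> topspace T. q x \<in> U})"

lemma openin_quotient_topology:
  "openin (quotient_topology T q) U \<longleftrightarrow> U \<subseteq> q ` topspace T \<and> openin T {x \<in> topspace T. q x \<in> U}"
proof -
  have 1: "{x \<in> topspace T. q x \<in> S \<inter> S'} = {x \<in> topspace T. q x \<in> S} \<inter> {x \<in> topspace T. q x \<in> S'}"
    for S S' by blast
  have 2: "{x \<in> topspace T. q x \<in> \<Union>\<K>} = \<Union>((\<lambda>S. {x \<in> topspace T. q x \<in> S}) ` \<K>)" for \<K>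
    by blast
  have "istopology (\<lambda>U. U \<subseteq> q ` topspace T \<and> openin T {x \<in> topspace T. q x \<in> U})"
    unfolding istopology_def 1 2 by blast
  then show ?thesis
    by (simp add: quotient_topology_def)
qed

lemma quotient_map_quotient_topology: "quotient_map T (quotient_topology T q) q"
proof -
  have "{x \<in> topspace T. q x \<in> q ` topspace T} = topspace T" by blast
  then have "openin (quotient_topology T q) (q ` topspace T)"
    by (simp add: openin_quotient_topology)
  then have "topspace (quotient_topology T q) = q ` topspace T"
    by (metis openin_quotient_topology openin_subset openin_topspace subset_antisym)
  then show ?thesis
    by (auto simp: quotient_map_def openin_quotient_topology)
qed

text \<open>\<open>X\<^sub>C = GC / K_C\<close>, the space of left cosets. The group \<open>G\<close> acts on it through \<open>\<iota>\<close>.\<close>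

definition X_C :: "('b, complex) lie_group \<Rightarrow> ('a \<Rightarrow> 'b) \<Rightarrow> (('a \<Rightarrow> real) \<Rightarrow> real) set \<Rightarrow> 'b set topology" where
  "X_C GC \<iota> k = quotient_topology (gtop GC) (\<lambda>g. g <#\<^bsub>GC\<^esub> K_C GC \<iota> k)"

definition base_point :: "('b, complex) lie_group \<Rightarrow> ('a \<Rightarrow> 'b) \<Rightarrow> (('a \<Rightarrow> real) \<Rightarrow> real) set \<Rightarrow> 'b set" where
  "base_point GC \<iota> k = \<one>\<^bsub>GC\<^esub> <#\<^bsub>GC\<^esub> K_C GC \<iota> k"

definition act :: "('b, complex) lie_group \<Rightarrow> ('a \<Rightarrow> 'b) \<Rightarrow> 'a \<Rightarrow> 'b set \<Rightarrow> 'b set" where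
  "act GC \<iota> g x = \<iota> g <#\<^bsub>GC\<^esub> x"

text \<open>\<open>G/K\<close> as a subset of \<open>X\<^sub>C\<close>.\<close>

definition X_real :: "('a, real) lie_group \<Rightarrow> ('b, complex) lie_group \<Rightarrow> ('a \<Rightarrow> 'b) \<Rightarrow>
    (('a \<Rightarrow> real) \<Rightarrow> real) set \<Rightarrow> 'b set set" where
  "X_real G GC \<iota> k = {act GC \<iota> g (base_point GC \<iota> k) | g. g \<in> carrier G}"

text \<open>The set \<open>G exp(i \<pi> S / 2).x\<^sub>0\<close> for \<open>S \<subseteq> a\<close>.\<close>

definition G_exp_orbit :: "('a, real) lie_group \<Rightarrow> ('b, complex) lie_group \<Rightarrow> ('a \<Rightarrow> 'b) \<Rightarrow>
    (('a \<Rightarrow> real) \<Rightarrow> real) set \<Rightarrow> (('a \<Rightarrow> real) \<Rightarrow> real) set \<Rightarrow> 'b set set" where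
  "G_exp_orbit G GC \<iota> k S =
     {act GC \<iota> g (lie_exp GC ((\<i> * complex_of_real pi / 2) *\<^sub>F lie_diff GC \<iota> Y)
                    <#\<^bsub>GC\<^esub> base_point GC \<iota> k) | g Y. g \<in> carrier G \<and> Y \<in> S}"

definition crown :: "('a, real) lie_group \<Rightarrow> ('b, complex) lie_group \<Rightarrow> ('a \<Rightarrow> 'b) \<Rightarrow>
    (('a \<Rightarrow> real) \<Rightarrow> real) set \<Rightarrow> (('a \<Rightarrow> real) \<Rightarrow> real) set \<Rightarrow> 'b set set" where
  "crown G GC \<iota> k a = G_exp_orbit G GC \<iota> k (Omega G a)"

definition crown_boundary :: "('a, real) lie_group \<Rightarrow> ('b, complex) lie_group \<Rightarrow> ('a \<Rightarrow> 'b) \<Rightarrow>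
    (('a \<Rightarrow> real) \<Rightarrow> real) set \<Rightarrow> (('a \<Rightarrow> real) \<Rightarrow> real) set \<Rightarrow> 'b set set" where
  "crown_boundary G GC \<iota> k a = X_C GC \<iota> k frontier_of crown G GC \<iota> k a"

definition crown_boundary_s :: "('a, real) lie_group \<Rightarrow> ('b, complex) lie_group \<Rightarrow> ('a \<Rightarrow> 'b) \<Rightarrow>
    (('a \<Rightarrow> real) \<Rightarrow> real) set \<Rightarrow> (('a \<Rightarrow> real) \<Rightarrow> real) set \<Rightarrow> 'b set set" where
  "crown_boundary_s G GC \<iota> k a = G_exp_orbit G GC \<iota> k (boundary_Omega G a)"

definition crown_boundary_n :: "('a, real) lie_group \<Rightarrow> ('b, complex) lie_group \<Rightarrow> ('a \<Rightarrow> 'b) \<Rightarrow>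
    (('a \<Rightarrow> real) \<Rightarrow> real) set \<Rightarrow> (('a \<Rightarrow> real) \<Rightarrow> real) set \<Rightarrow> 'b set set" where
  "crown_boundary_n G GC \<iota> k a = crown_boundary G GC \<iota> k a - crown_boundary_s G GC \<iota> k a"

text \<open>The action is proper if \<open>G \<times> D \<rightarrow> D \<times> D\<close>, \<open>(g, x) \<mapsto> (g.x, x)\<close>, is a proper map.\<close>

definition acts_properly_on :: "('a, real) lie_group \<Rightarrow> ('b, complex) lie_group \<Rightarrow> ('a \<Rightarrow> 'b) \<Rightarrow>
    (('a \<Rightarrow> real) \<Rightarrow> real) set \<Rightarrow> 'b set set \<Rightarrow> bool" where
  "acts_properly_on G GC \<iota> k D \<longleftrightarrow>
     proper_map (prod_topology (gtop G) (subtopology (X_C GC \<iota> k) D))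
       (prod_topology (subtopology (X_C GC \<iota> k) D) (subtopology (X_C GC \<iota> k) D))
       (\<lambda>(g, x). (act GC \<iota> g x, x))"

end

theory Submission
  imports Defs "Jordan_Normal_Form.Spectral_Radius"
begin

text \<open>
  Let \<open>Y\<close> be in the boundary of \<open>\<Omega>\<close> and \<open>E\<close> a root vector with \<open>[Y, E] = E\<close>, put \<open>P = E - \<theta> E\<close>, \<open>U = E + \<theta> E\<close>
  and \<open>b = exp(i \<pi> Y / 2)\<close>. As \<open>Ad(b)\<close> maps \<open>-i U\<close> to \<open>P\<close>, the non-compact group \<open>exp(\<real> P)\<close> fixes
  \<open>b.x\<^sub>0\<close>, which a proper action forbids. This is (i).

  For (ii) choose \<open>Y\<close> on which every root has absolute value at most \<open>1\<close>, and \<open>H\<close> in \<open>a\<close>, \<open>\<omega> > 0\<close>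
  with \<open>[H, E] = E\<close> and \<open>[U, P] = \<omega>\<^sup>2 H\<close>. Then \<open>N\<^sub>\<plusminus> = H \<plusminus> i P / \<omega>\<close> are eigenvectors of \<open>ad U\<close>, so the points
  \<open>exp(\<plusminus>s P) b exp(-i \<delta> Y).x\<^sub>0\<close> of the crown with \<open>\<delta> = 2 exp(-\<omega> s)\<close> converge to
  \<open>p\<^sub>\<plusminus> = b exp(-i N\<^sub>\<plusminus>).x\<^sub>0\<close> as \<open>s\<close> grows. The group elements \<open>exp(2 s P)\<close> leave every compact set and move the
  first sequence to the second, so \<open>p\<^sub>+\<close> and \<open>p\<^sub>-\<close> cannot both lie in \<open>D\<close>.

  That \<open>p\<^sub>\<plusminus>\<close> is not in \<open>G exp(i a).x\<^sub>0\<close> is seen in the complexified adjoint representation, which exists on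
  \<open>GC\<close> by its universal property: for \<open>z = g exp(i Z) \<kappa>\<close> with \<open>Z\<close> in \<open>a\<close> and \<open>\<kappa>\<close> in \<open>K\<^sub>C\<close>, the operator
  \<open>g\<^sup>-\<^sup>1 z \<theta> z\<^sup>-\<^sup>1 g\<close> is unitary for the Hermitian form induced by the Killing form and \<open>\<theta>\<close>, whereas for
  \<open>z = b exp(-i N\<^sub>\<plusminus>)\<close> it adds to the real vector \<open>g\<^sup>-\<^sup>1 P\<close> a non-zero imaginary one.

  If \<open>p = 0\<close>, the stabiliser of \<open>x\<^sub>0\<close> is compact and contains the image of the exponential map. A nearest point argument
  shows that it is open, so \<open>G\<close> would be compact.
\<close>

section \<open>Calculus on \<open>kspace n\<close>\<close>

text \<open>Lie algebras consist of derivations of germs, \<open>lie_exp\<close> is a definite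
  description and \<open>X_C\<close> a bare quotient space. The exponential map and its continuity
  are therefore obtained from Picard iteration in a chart, over a field \<open>'k\<close> that
  serves the real and the complex group alike. \<open>K_C\<close> is given only by generators, so
  neither its closedness nor separation of points in \<open>X_C\<close> is at hand: limits are taken
  in \<open>GC\<close> and pushed down by open sets, and a point is kept out of an orbit by what all
  generators of \<open>K_C\<close> respect, namely commutation with \<theta>.

  Under Ad(exp(-i s U)) the component of Y along the growing eigenvector of ad U gets the
  coefficient exp(\<omega> s) / 2, and \<delta> is its reciprocal. Two limit points are needed for
  (ii) because one alone gives no contradiction: a proper action forbids only a pair of limits
  joined by group elements that escape to infinity.\<close>

abbreviation kopen :: "nat => (nat => 'k::real_normed_field) set => bool" where
 "kopen n U \<equiv> openin (top_of_set (kspace n)) U"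

definition kbox :: "nat => (nat => 'k::real_normed_field) => real => (nat => 'k) set" where
 "kbox n x e = {y \<in> kspace n. \<forall>i<n. dist (y i) (x i) < e}"

lemma finite_min_eps:
 assumes "\<And>i. i < (n::nat) ==> \<exists>e>0::real. P i e"
  and mono: "\<And>i e e'. P i e ==> 0 < e' ==> e' \<le> e ==> P i e'"
 shows "\<exists>e>0. \<forall>i<n. P i e"
 using assms(1)
proof (induction n)
 case 0
 then show ?case by (auto intro: exI[of _ 1])
next
 case (Suc n)
 then obtain e where e: "e > 0" "\<forall>i<n. P i e" by auto
 obtain e' where e': "e' > 0" "P n e'" using Suc.prems by blast
 have "\<forall>i<Suc n. P i (min e e')"
  using e e' mono by (metis less_SucE min.cobounded1 min.cobounded2 min_less_iff_conj)
 then show ?case using e e' by (intro exI[of _ "min e e'"]) auto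
qed

lemma kopen_subset: "kopen n U ==> U \<subseteq> kspace n"
 by (metis openin_subset topspace_euclidean_subtopology)

lemma continuous_on_coord [continuous_intros]: "continuous_on S (%x::nat => 'k::topological_space. x i)"
 by (rule continuous_on_product_then_coordinatewise) (rule continuous_on_id)

lemma kopen_kbox: "kopen n (kbox n x e)"
proof -
 have "open {y :: nat => 'a. \<forall>i<n. dist (y i) (x i) < e}"
 proof -
  have "{y :: nat => 'a. \<forall>i<n. dist (y i) (x i) < e} = (\<Inter>i\<in>{..<n}. {y. dist (y i) (x i) < e})"
   by auto
  moreover have "open {y :: nat => 'a. dist (y i) (x i) < e}" for i
   by (intro open_Collect_less continuous_intros)
  ultimately show ?thesis by (simp add: open_INT)
 qed
 then show ?thesis
  by (auto simp: openin_open kbox_def)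
qed

lemma kbox_mono: "e \<le> e' ==> kbox n x e \<subseteq> kbox n x e'"
 by (force simp: kbox_def)

lemma center_in_kbox: "x \<in> kspace n ==> e > 0 ==> x \<in> kbox n x e"
 by (auto simp: kbox_def)

text \<open>All coordinates from \<open>n\<close> on vanish on \<open>kspace n\<close>, so of a
  basic open set of the infinite product only the first \<open>n\<close> factors restrict anything,
  and these finitely many admit a common radius.\<close>

lemma kopen_contains_kbox:
 fixes U :: "(nat => 'k::real_normed_field) set"
 assumes "kopen n U" "x \<in> U"
 shows "\<exists>e>0. kbox n x e \<subseteq> U"
proof -
 obtain T where T: "open T" "U = kspace n \<inter> T" using assms by (auto simp: openin_open)
 have "openin (product_topology (%_. euclidean) UNIV) T"
  using T by (simp add: open_fun_def)
 then obtain X where X: "x \<in> PiE UNIV X" "\<And>i. openin euclidean (X i)" "PiE UNIV X \<subseteq> T"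
  using product_topology_open_contains_basis[of "%_. euclidean" UNIV T] assms T by blast
 have "\<exists>e>0. ball (x i) e \<subseteq> X i" if "i < n" for i
  using X(1) X(2)[of i] by (auto simp: open_contains_ball PiE_def Pi_def)
 then have "\<exists>e>0. \<forall>i<n. ball (x i) e \<subseteq> X i"
  by (intro finite_min_eps[where P = "%i e. ball (x i) e \<subseteq> X i"]) (auto simp: subset_iff)
 then obtain e where e: "e > 0" "\<forall>i<n. ball (x i) e \<subseteq> X i" by blast
 have "kbox n x e \<subseteq> U"
 proof
  fix y assume y: "y \<in> kbox n x e"
  have "y i \<in> X i" for i
  proof (cases "i < n")
   case True
   then show ?thesis using e y by (auto simp: kbox_def dist_commute subset_iff)
  next
   case False
   then have "y i = x i" using y assms T by (auto simp: kbox_def kspace_def)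
   then show ?thesis using X(1) by (auto simp: PiE_def Pi_def)
  qed
  then show "y \<in> U" using X(3) T y by (auto simp: kbox_def)
 qed
 with e show ?thesis by blast
qed

lemma continuous_on_kopenD:
 fixes f :: "(nat => 'k::real_normed_field) => 'k"
 assumes "kopen n U" "continuous_on U f" "x \<in> U" "e > 0"
 shows "\<exists>d>0. kbox n x d \<subseteq> U \<and> (\<forall>y\<in>kbox n x d. dist (f y) (f x) < e)"
proof -
 have "openin (top_of_set U) (U \<inter> f -` ball (f x) e)"
  using assms(2) continuous_on_open_gen by (metis continuous_openin_preimage_gen open_ball)
 then have "kopen n (U \<inter> f -` ball (f x) e)" using assms(1) openin_trans by blast
 then obtain d where "d > 0" "kbox n x d \<subseteq> U \<inter> f -` ball (f x) e"
  using kopen_contains_kbox[of n _ x] assms by (metis IntI centre_in_ball vimageI)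
 then show ?thesis by (intro exI[of _ d]) (auto simp: subset_iff dist_commute)
qed

lemma kopen_upd:
 assumes "kopen n U" "x \<in> U" "i < n"
 shows "\<forall>\<^sub>F t in nhds (x i). x(i := t) \<in> U"
proof -
 obtain e where e: "e > 0" "kbox n x e \<subseteq> U" using kopen_contains_kbox[OF assms(1,2)] by blast
 have "x \<in> kspace n" using assms kopen_subset by blast
 then have "x(i := t) \<in> U" if "dist t (x i) < e" for t
  using e that assms by (intro subsetD[OF e(2)]) (auto simp: kbox_def kspace_def)
 then show ?thesis using e(1) by (auto simp: eventually_nhds_metric)
qed

text \<open>A canonical partial derivative, so that the existentially quantified family in
  \<open>Ck_on\<close> can be named. It is meaningful only where the derivative exists.\<close>

definition pd :: "nat => ((nat => 'k::real_normed_field) => 'k) => (nat => 'k) => 'k" where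
 "pd i f x = deriv (%t. f (x(i := t))) (x i)"

lemma Ck_on_continuous: "Ck_on n m U f ==> continuous_on U f"
 by (cases m) auto

lemma pderiv_cong:
 assumes "kopen n U" "x \<in> U" "i < n" "\<And>x. x \<in> U ==> f x = g x"
 shows "((%t. f (x(i := t))) has_field_derivative d) (at (x i)) \<longleftrightarrow>
     ((%t. g (x(i := t))) has_field_derivative d) (at (x i))"
proof (rule DERIV_cong_ev[OF refl _ refl])
 show "\<forall>\<^sub>F t in nhds (x i). f (x(i := t)) = g (x(i := t))"
  using kopen_upd[OF assms(1-3)] by eventually_elim (use assms(4) in blast)
qed

lemma Ck_on_cong:
 assumes "kopen n U" "Ck_on n m U f" "\<And>x. x \<in> U ==> f x = g x"
 shows "Ck_on n m U g"
proof (cases m)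
 case 0
 then show ?thesis using assms by (simp cong: continuous_on_cong)
next
 case (Suc m')
 then obtain D where D: "\<forall>i<n. (\<forall>x\<in>U. ((%t. f (x(i := t))) has_field_derivative D i x) (at (x i))) \<and> Ck_on n m' U (D i)"
  using assms by auto
 have "continuous_on U g" using assms Ck_on_continuous by (metis continuous_on_cong)
 moreover have "((%t. g (x(i := t))) has_field_derivative D i x) (at (x i))" if "x \<in> U" "i < n" for i x
  using D that pderiv_cong[OF assms(1) that, of f g] assms(3) by blast
 ultimately show ?thesis using D Suc by auto
qed

text \<open>Derivatives are unique, so on \<open>U\<close> any family \<open>D\<close> agrees with
  \<open>pd\<close>; openness lets this agreement pass to the lower orders.\<close>

lemma Ck_on_Suc_iff:
 assumes "kopen n U"
 shows "Ck_on n (Suc m) U f \<longleftrightarrow> continuous_on U f \<and>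
  (\<forall>i<n. (\<forall>x\<in>U. ((%t. f (x(i := t))) has_field_derivative pd i f x) (at (x i))) \<and> Ck_on n m U (pd i f))"
  (is "?L \<longleftrightarrow> ?R")
proof
 assume ?L
 then obtain D where D: "continuous_on U f"
  "\<forall>i<n. (\<forall>x\<in>U. ((%t. f (x(i := t))) has_field_derivative D i x) (at (x i))) \<and> Ck_on n m U (D i)"
  by auto
 have eq: "pd i f x = D i x" if "i < n" "x \<in> U" for i x
  unfolding pd_def using D(2) that by (blast intro: DERIV_imp_deriv)
 then have "Ck_on n m U (pd i f)" if "i < n" for i
  using D(2) that by (metis Ck_on_cong[OF assms])
 then show ?R using D eq by auto
next
 assume ?R
 then show ?L unfolding Ck_on.simps(2) by (intro conjI exI[of _ "%i. pd i f"]) blast+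
qed

lemma Ck_on_SucD:
 assumes "kopen n U" "Ck_on n (Suc m) U f" "i < n"
 shows "x \<in> U ==> ((%t. f (x(i := t))) has_field_derivative pd i f x) (at (x i))"
  and "Ck_on n m U (pd i f)"
 using assms by (simp_all add: Ck_on_Suc_iff del: Ck_on.simps)

lemma Ck_on_mono_Suc: "Ck_on n (Suc m) U f ==> Ck_on n m U f"
proof (induction m arbitrary: f)
 case (Suc m)
 then obtain D where "continuous_on U f"
  "\<forall>i<n. (\<forall>x\<in>U. ((%t. f (x(i := t))) has_field_derivative D i x) (at (x i))) \<and> Ck_on n (Suc m) U (D i)"
  unfolding Ck_on.simps(2)[of n "Suc m"] by blast
 then show ?case using Suc.IH unfolding Ck_on.simps(2)[of n m] by blast
qed auto

lemma Ck_on_subset: "Ck_on n m U f ==> V \<subseteq> U ==> Ck_on n m V f"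
proof (induction m arbitrary: f)
 case 0
 then show ?case by (auto intro: continuous_on_subset)
next
 case (Suc m)
 then obtain D where D: "continuous_on U f" "\<forall>i<n. (\<forall>x\<in>U. ((%t. f (x(i := t))) has_field_derivative D i x) (at (x i))) \<and> Ck_on n m U (D i)"
  by auto
 then show ?case unfolding Ck_on.simps(2) using Suc.IH Suc.prems(2)
  by (intro conjI exI[of _ D] allI impI ballI) (auto intro: continuous_on_subset)
qed

lemma Ck_on_local:
 assumes "kopen n U" "\<And>x. x \<in> U ==> \<exists>V. kopen n V \<and> x \<in> V \<and> Ck_on n m V f"
 shows "Ck_on n m U f"
proof -
 have *: "continuous_on U f" if L: "\<And>x. x \<in> U ==> \<exists>V. kopen n V \<and> x \<in> V \<and> continuous_on V f" for f
 proof (subst continuous_on_eq_continuous_within, intro ballI)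
  fix x assume "x \<in> U"
  then obtain V where V: "kopen n V" "x \<in> V" "continuous_on V f" using L by blast
  obtain T where T: "open T" "V = kspace n \<inter> T" using V by (auto simp: openin_open)
  have "continuous (at x within V) f" using V(2,3) unfolding continuous_on_eq_continuous_within by blast
  \<comment> \<open>Relative to \<open>kspace n\<close> the set \<open>V\<close> is a neighbourhood
    of \<open>x\<close>, so both sets have the same limits at \<open>x\<close>.\<close>
  moreover have "at x within V = at x within kspace n"
   using T V(2) by (intro at_within_nhd[of _ T]) auto
  ultimately have "continuous (at x within kspace n) f" by metis
  then show "continuous (at x within U) f"
   by (rule continuous_within_subset[OF _ kopen_subset[OF assms(1)]])
 qed
 show ?thesis
  using assms(2)
 proof (induction m arbitrary: f)
 case 0
 show ?case unfolding Ck_on.simps by (rule *) (use 0 in simp)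
next
 case (Suc m)
 have 1: "continuous_on U f"
 proof (rule *)
  fix x assume "x \<in> U"
  then obtain V where "kopen n V" "x \<in> V" "Ck_on n (Suc m) V f" using Suc.prems[OF \<open>x \<in> U\<close>] by blast
  then show "\<exists>V. kopen n V \<and> x \<in> V \<and> continuous_on V f" using Ck_on_continuous by blast
 qed
 have 2: "((%t. f (x(i := t))) has_field_derivative pd i f x) (at (x i))" if i: "i < n" "x \<in> U" for i x
 proof -
  obtain V where "kopen n V" "x \<in> V" "Ck_on n (Suc m) V f" using Suc.prems[OF i(2)] by blast
  then show ?thesis using Ck_on_SucD(1) i(1) by blast
 qed
 have 3: "Ck_on n m U (pd i f)" if "i < n" for i
 proof (rule Suc.IH)
  fix x assume "x \<in> U"
  then obtain V where "kopen n V" "x \<in> V" "Ck_on n (Suc m) V f" using Suc.prems[OF \<open>x \<in> U\<close>] by blast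
  then show "\<exists>V. kopen n V \<and> x \<in> V \<and> Ck_on n m V (pd i f)" using Ck_on_SucD(2) that by blast
 qed
 show ?case by (subst Ck_on_Suc_iff[OF assms(1)]) (intro conjI allI impI ballI 1 2 3)
qed
qed

lemma Ck_on_const: "Ck_on n m U (%_. c)"
proof (induction m arbitrary: c)
 case (Suc m)
 show ?case unfolding Ck_on.simps(2)
  by (intro conjI exI[of _ "%_ _. 0"] allI impI ballI Suc continuous_on_const DERIV_const)
qed simp

lemma Ck_on_coord: "Ck_on n m U (%x. x j)"
proof (cases m)
 case 0 then show ?thesis by (simp add: continuous_on_coord)
next
 case (Suc m')
 have "((%t. (x(i := t)) j) has_field_derivative (if i = j then 1 else 0)) (at (x i))" for x :: "nat => 'a" and i
  by (cases "i = j") auto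
 then show ?thesis unfolding Suc Ck_on.simps(2)
  by (intro conjI exI[of _ "%i _. if i = j then 1 else 0"] allI impI ballI Ck_on_const continuous_on_coord)
qed

section \<open>Algebra of functions of class C^m\<close>

lemma Ck_on_add: "Ck_on n m U f ==> Ck_on n m U g ==> Ck_on n m U (%x. f x + g x)"
proof (induction m arbitrary: f g)
 case 0 then show ?case by (auto intro: continuous_on_add)
next
 case (Suc m)
 then obtain D D' where D: "continuous_on U f" "\<forall>i<n. (\<forall>x\<in>U. ((%t. f (x(i := t))) has_field_derivative D i x) (at (x i))) \<and> Ck_on n m U (D i)"
  "continuous_on U g" "\<forall>i<n. (\<forall>x\<in>U. ((%t. g (x(i := t))) has_field_derivative D' i x) (at (x i))) \<and> Ck_on n m U (D' i)"
  by auto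
 then show ?case unfolding Ck_on.simps(2)
  by (intro conjI exI[of _ "%i x. D i x + D' i x"] allI impI ballI continuous_on_add DERIV_add Suc.IH) auto
qed

lemma Ck_on_mult:
 fixes f g :: "(nat => 'k::real_normed_field) => 'k"
 shows "Ck_on n m U f ==> Ck_on n m U g ==> Ck_on n m U (%x. f x * g x)"
proof (induction m arbitrary: f g)
 case 0 then show ?case by (auto intro: continuous_on_mult)
next
 case (Suc m)
 then obtain D D' where D: "continuous_on U f" "\<forall>i<n. (\<forall>x\<in>U. ((%t. f (x(i := t))) has_field_derivative D i x) (at (x i))) \<and> Ck_on n m U (D i)"
  "continuous_on U g" "\<forall>i<n. (\<forall>x\<in>U. ((%t. g (x(i := t))) has_field_derivative D' i x) (at (x i))) \<and> Ck_on n m U (D' i)"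
  by auto
 have fg: "Ck_on n m U f" "Ck_on n m U g" using Suc.prems Ck_on_mono_Suc by blast+
 have "((%t. f (x(i := t)) * g (x(i := t))) has_field_derivative D i x * g x + D' i x * f x) (at (x i))"
  if "i < n" "x \<in> U" for i x
  using DERIV_mult[of "%t. f (x(i := t))" "D i x" "x i" UNIV "%t. g (x(i := t))" "D' i x"] D that by simp
 moreover have "Ck_on n m U (%x. D i x * g x + D' i x * f x)" if "i < n" for i
  using D(2,4) that by (intro Ck_on_add Suc.IH fg) auto
 ultimately show ?case using D(1,3) unfolding Ck_on.simps(2)
  by (intro conjI exI[of _ "%i x. D i x * g x + D' i x * f x"] allI impI ballI continuous_on_mult)
qed

lemma Ck_on_sum: "finite I ==> (\<And>i. i \<in> I ==> Ck_on n m U (f i)) ==> Ck_on n m U (%x. \<Sum>i\<in>I. f i x)"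
 by (induction I rule: finite_induct) (auto intro: Ck_on_const Ck_on_add)

lemma Ck_on_prod: "finite I ==> (\<And>i. i \<in> I ==> Ck_on n m U (f i)) ==> Ck_on n m U (%x. \<Prod>i\<in>I. f i x)"
 by (induction I rule: finite_induct) (auto intro: Ck_on_const Ck_on_mult)

lemma Ck_on_inverse:
 fixes f :: "(nat => 'k::real_normed_field) => 'k"
 shows "Ck_on n m U f ==> (\<And>x. x \<in> U ==> f x \<noteq> 0) ==> Ck_on n m U (%x. inverse (f x))"
proof (induction m)
 case 0 then show ?case by (auto intro!: continuous_on_inverse)
next
 case (Suc m)
 then obtain D where D: "continuous_on U f" "\<forall>i<n. (\<forall>x\<in>U. ((%t. f (x(i := t))) has_field_derivative D i x) (at (x i))) \<and> Ck_on n m U (D i)"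
  by auto
 have f: "Ck_on n m U (%x. inverse (f x))" using Suc Ck_on_mono_Suc by blast
 have "((%t. inverse (f (x(i := t)))) has_field_derivative - 1 * (inverse (f x) * D i x * inverse (f x))) (at (x i))"
  if "i < n" "x \<in> U" for i x
  using DERIV_inverse'[of "%t. f (x(i := t))" "D i x" "x i" UNIV] D that Suc.prems(2) by simp
 moreover have "Ck_on n m U (%x. - 1 * (inverse (f x) * D i x * inverse (f x)))" if "i < n" for i
  using D that f by (intro Ck_on_mult Ck_on_const) auto
 ultimately show ?case using D(1) Suc.prems(2) unfolding Ck_on.simps(2)
  by (intro conjI exI[of _ "%i x. - 1 * (inverse (f x) * D i x * inverse (f x))"] allI impI ballI continuous_on_inverse)
qed

text \<open>Mean value estimate: the coordinates of \<open>x\<close> are replaced by those of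
  \<open>y\<close> one at a time, all intermediate points staying in the box. With
  \<open>c = 0\<close> it gives a Lipschitz bound, with \<open>c\<close> the gradient at the centre
  it gives differentiability. Only the one-variable inequality on convex balls enters, which holds
  over both fields.\<close>

lemma kbox_telescope:
 fixes f :: "(nat => 'k::real_normed_field) => 'k"
 assumes D: "\<And>i w. i < n ==> w \<in> kbox n x0 e ==> ((%t. f (w(i := t))) has_field_derivative D i w) (at (w i))"
  and B: "\<And>i w. i < n ==> w \<in> kbox n x0 e ==> norm (D i w - c i) \<le> B i"
  and xy: "x \<in> kbox n x0 e" "y \<in> kbox n x0 e"
 shows "norm (f y - f x - (\<Sum>i<n. c i * (y i - x i))) \<le> (\<Sum>i<n. B i * norm (y i - x i))"
proof -
 define z where "z j = (%i. if i < j then y i else x i)" for j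
 have z0: "z 0 = x" by (simp add: z_def)
 have zn: "z n = y" using xy by (auto simp: z_def kbox_def kspace_def fun_eq_iff)
 have zu: "z (Suc j) = (z j)(j := y j)" "z j = (z j)(j := x j)" for j
  by (auto simp: z_def fun_eq_iff less_Suc_eq)
 have step: "norm (f (z (Suc j)) - f (z j) - c j * (y j - x j)) \<le> B j * norm (y j - x j)" if j: "j < n" for j
 proof -
  let ?h = "%t. f ((z j)(j := t)) - c j * t"
  have "norm (?h (y j) - ?h (x j)) \<le> B j * norm (y j - x j)"
  proof (rule field_differentiable_bound[where S = "ball (x0 j) e" and f' = "%t. D j ((z j)(j := t)) - c j"])
   fix t assume t: "t \<in> ball (x0 j) e"
   have w: "(z j)(j := t) \<in> kbox n x0 e"
    using xy t j by (auto simp: z_def kbox_def kspace_def dist_commute)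
   have "((%s. f (((z j)(j := t))(j := s))) has_field_derivative D j ((z j)(j := t))) (at (((z j)(j := t)) j))"
    by (rule D[OF j w])
   then have "((%s. f ((z j)(j := s))) has_field_derivative D j ((z j)(j := t))) (at t)"
    by simp
   then show "(?h has_field_derivative (D j ((z j)(j := t)) - c j)) (at t within ball (x0 j) e)"
    by (rule has_field_derivative_at_within[OF DERIV_diff[OF _ DERIV_cmult_Id]])
   show "norm (D j ((z j)(j := t)) - c j) \<le> B j" by (rule B[OF j w])
  qed (use xy j in \<open>auto simp: kbox_def dist_commute\<close>)
  moreover have "?h (y j) - ?h (x j) = f (z (Suc j)) - f (z j) - c j * (y j - x j)"
   using arg_cong[OF zu(1), of f j] arg_cong[OF zu(2), of f j] by (simp add: right_diff_distrib)
  ultimately show ?thesis by metis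
 qed
 have "f y - f x - (\<Sum>i<n. c i * (y i - x i)) = (\<Sum>j<n. f (z (Suc j)) - f (z j) - c j * (y j - x j))"
  using sum_lessThan_telescope[of "%j. f (z j)" n] by (simp add: sum_subtractf z0 zn)
 then show ?thesis using step by (auto intro!: sum_norm_le)
qed

text \<open>Continuous partial derivatives make \<open>f\<close> totally differentiable at
  \<open>c s\<close>: by \<open>est\<close> the error is at most \<open>e\<close> times the
  displacement, and the difference quotients of the curve stay bounded.\<close>

lemma chain_rule_curve:
 fixes f :: "(nat => 'k::real_normed_field) => 'k"
 assumes U: "kopen n U" "c s \<in> U"
  and D: "\<And>i w. i < n ==> w \<in> U ==> ((%t. f (w(i := t))) has_field_derivative D i w) (at (w i))"
  and Dc: "\<And>i. i < n ==> continuous_on U (D i)"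
  and c': "\<And>i. i < n ==> ((%t. c t i) has_field_derivative c' i) (at s)"
  and ck: "\<forall>\<^sub>F t in at s. c t \<in> kspace n"
 shows "((%t. f (c t)) has_field_derivative (\<Sum>i<n. D i (c s) * c' i)) (at s)"
proof -
 let ?x = "c s"
 have est: "\<exists>d>0. \<forall>y\<in>kbox n ?x d. norm (f y - f ?x - (\<Sum>i<n. D i ?x * (y i - ?x i))) \<le> e * (\<Sum>i<n. norm (y i - ?x i))"
  if e: "e > 0" for e
 proof -
  have "\<exists>d>0. \<forall>i<n. kbox n ?x d \<subseteq> U \<and> (\<forall>y\<in>kbox n ?x d. dist (D i y) (D i ?x) < e)"
  proof (rule finite_min_eps[where P = "%i d. kbox n ?x d \<subseteq> U \<and> (\<forall>y\<in>kbox n ?x d. dist (D i y) (D i ?x) < e)"])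
   show "\<exists>d>0. kbox n ?x d \<subseteq> U \<and> (\<forall>y\<in>kbox n ?x d. dist (D i y) (D i ?x) < e)" if "i < n" for i
    using continuous_on_kopenD[OF U(1) Dc U(2) e] that by blast
   fix d d' :: real and i assume a: "kbox n ?x d \<subseteq> U \<and> (\<forall>y\<in>kbox n ?x d. dist (D i y) (D i ?x) < e)" "d' \<le> d"
   then show "kbox n ?x d' \<subseteq> U \<and> (\<forall>y\<in>kbox n ?x d'. dist (D i y) (D i ?x) < e)"
    using kbox_mono[OF a(2), of n ?x] by blast
  qed
  then obtain d1 where d1: "d1 > 0" "\<And>i y. i < n ==> y \<in> kbox n ?x d1 ==> dist (D i y) (D i ?x) < e"
   by blast
  obtain d2 where d2: "d2 > 0" "kbox n ?x d2 \<subseteq> U" using kopen_contains_kbox[OF U] by blast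
  define d where "d = min d1 d2"
  have d: "d > 0" "kbox n ?x d \<subseteq> kbox n ?x d1" "kbox n ?x d \<subseteq> U"
   using d1(1) d2 kbox_mono[of d d1 n ?x] kbox_mono[of d d2 n ?x] by (auto simp: d_def)
  have "norm (f y - f ?x - (\<Sum>i<n. D i ?x * (y i - ?x i))) \<le> (\<Sum>i<n. e * norm (y i - ?x i))"
   if y: "y \<in> kbox n ?x d" for y
  proof (rule kbox_telescope[where D = D and e = d and ?x0.0 = ?x])
   show "norm (D i w - D i ?x) \<le> e" if "i < n" "w \<in> kbox n ?x d" for i w
    using d1(2)[of i w] that d by (force simp: dist_norm)
   show "((%t. f (w(i := t))) has_field_derivative D i w) (at (w i))" if "i < n" "w \<in> kbox n ?x d" for i w
    using D that d(3) by blast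
   show "?x \<in> kbox n ?x d" using d(1) U kopen_subset center_in_kbox by blast
  qed (rule y)
  then show ?thesis using d(1) by (intro exI[of _ d]) (simp add: sum_distrib_left)
 qed
 have lin: "((%t. (\<Sum>i<n. D i ?x * ((c t i - ?x i) / (t - s)))) \<longlongrightarrow> (\<Sum>i<n. D i ?x * c' i)) (at s)"
  by (intro tendsto_sum tendsto_mult tendsto_const) (use c' in \<open>auto simp: has_field_derivative_iff\<close>)
 \<comment> \<open>Bounds the difference quotients of the curve near \<open>s\<close>; the added 1
   makes it positive and leaves room for a strict inequality.\<close>
 define M where "M = (\<Sum>i<n. norm (c' i)) + 1"
 have M0: "M > 0" by (simp add: M_def add_nonneg_pos sum_nonneg)
 have "((%t. (\<Sum>i<n. norm ((c t i - ?x i) / (t - s)))) \<longlongrightarrow> (\<Sum>i<n. norm (c' i))) (at s)"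
  by (intro tendsto_sum tendsto_norm) (use c' in \<open>auto simp: has_field_derivative_iff\<close>)
 then have Mb: "\<forall>\<^sub>F t in at s. (\<Sum>i<n. norm ((c t i - ?x i) / (t - s))) < M"
  by (rule order_tendstoD) (simp add: M_def)
 have box: "\<forall>\<^sub>F t in at s. c t \<in> kbox n ?x d" if d: "d > 0" for d
 proof -
  have "\<forall>\<^sub>F t in at s. dist (c t i) (?x i) < d" if "i < n" for i
   using DERIV_isCont[OF c'[OF that]] d by (auto simp: isCont_def tendsto_iff)
  then have "\<forall>\<^sub>F t in at s. \<forall>i\<in>{..<n}. dist (c t i) (?x i) < d"
   by (intro eventually_ball_finite) auto
  then show ?thesis using ck by eventually_elim (auto simp: kbox_def)
 qed
 have "((%t. (f (c t) - f ?x) / (t - s) - (\<Sum>i<n. D i ?x * ((c t i - ?x i) / (t - s)))) \<longlongrightarrow> 0) (at s)"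
 proof (rule tendstoI)
  fix e :: real assume e: "e > 0"
  obtain d where d: "d > 0" "\<And>y. y \<in> kbox n ?x d ==> norm (f y - f ?x - (\<Sum>i<n. D i ?x * (y i - ?x i))) \<le> e / M * (\<Sum>i<n. norm (y i - ?x i))"
   using est[of "e / M"] e M0 by auto
  show "\<forall>\<^sub>F t in at s. dist ((f (c t) - f ?x) / (t - s) - (\<Sum>i<n. D i ?x * ((c t i - ?x i) / (t - s)))) 0 < e"
   using box[OF d(1)] Mb eventually_at_ball[OF d(1), of s UNIV] eventually_neq_at_within[of s s UNIV]
  proof eventually_elim
   fix t assume t: "c t \<in> kbox n ?x d" "(\<Sum>i<n. norm ((c t i - ?x i) / (t - s))) < M" "t \<noteq> s"
   have "(f (c t) - f ?x) / (t - s) - (\<Sum>i<n. D i ?x * ((c t i - ?x i) / (t - s)))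
     = (f (c t) - f ?x - (\<Sum>i<n. D i ?x * (c t i - ?x i))) / (t - s)"
    by (simp add: diff_divide_distrib[of _ "\<Sum>i<n. _ i"] diff_divide_distrib[of "f _ - f _"] sum_divide_distrib)
   then have "norm ((f (c t) - f ?x) / (t - s) - (\<Sum>i<n. D i ?x * ((c t i - ?x i) / (t - s))))
     \<le> e / M * (\<Sum>i<n. norm (c t i - ?x i)) / norm (t - s)"
    using divide_right_mono[OF d(2)[OF t(1)], of "norm (t - s)"] by (simp only: norm_divide) simp
   also have "\<dots> = e / M * (\<Sum>i<n. norm ((c t i - ?x i) / (t - s)))"
    by (simp add: norm_divide sum_divide_distrib[symmetric])
   also have "\<dots> < e / M * M" using t(2) e M0 by (intro mult_strict_left_mono) auto
   finally show "dist ((f (c t) - f ?x) / (t - s) - (\<Sum>i<n. D i ?x * ((c t i - ?x i) / (t - s)))) 0 < e"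
    using M0 by simp
  qed
 qed
 from tendsto_add[OF this lin] show ?thesis by (simp add: has_field_derivative_iff)
qed

text \<open>Induction on the order with \<open>f\<close> varying: the chain rule writes a partial
  derivative of the composition as a sum of products whose factors \<open>pd j f (c x)\<close> are
  again compositions, of one order less.\<close>

lemma Ck_on_compose:
 fixes f :: "(nat => 'k::real_normed_field) => 'k"
 assumes "kopen n U" "kopen l V" "\<And>x. x \<in> U ==> c x \<in> V"
  and "\<And>j. j < l ==> Ck_on n m U (%x. c x j)" "Ck_on l m V f"
 shows "Ck_on n m U (%x. f (c x))"
proof -
 have cont: "continuous_on U (%x. f (c x))" if "\<And>j. j < l ==> continuous_on U (%x. c x j)" "continuous_on V f" for f :: "(nat => 'k) => 'k"
 proof (rule continuous_on_compose2[OF that(2)])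
  have "continuous_on U (%x. c x j)" for j
  proof (cases "j < l")
   case False
   then have "c x j = 0" if "x \<in> U" for x
    using assms(3)[OF that] kopen_subset[OF assms(2)] by (auto simp: kspace_def)
   then show ?thesis by (metis (mono_tags, lifting) continuous_on_cong continuous_on_const)
  qed (use that in auto)
  then show "continuous_on U c" by (intro continuous_on_coordinatewise_then_product) auto
 qed (use assms(3) in auto)
 show ?thesis
  using assms(4,5)
 proof (induction m arbitrary: f)
 case 0
 then show ?case using cont by simp
next
 case (Suc m)
 have f: "continuous_on V f" "\<And>j w. j < l ==> w \<in> V ==> ((%t. f (w(j := t))) has_field_derivative pd j f w) (at (w j))"
   "\<And>j. j < l ==> Ck_on l m V (pd j f)"
  by (fact Ck_on_continuous[OF Suc.prems(2)] Ck_on_SucD[OF assms(2) Suc.prems(2)])+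
 have c: "\<And>j i x. j < l ==> i < n ==> x \<in> U ==> ((%t. c (x(i := t)) j) has_field_derivative pd i (%x. c x j) x) (at (x i))"
  "\<And>j i. j < l ==> i < n ==> Ck_on n m U (pd i (%x. c x j))"
  "\<And>j. j < l ==> continuous_on U (%x. c x j)"
  by (rule Ck_on_SucD[OF assms(1) Suc.prems(1)] Ck_on_continuous[OF Suc.prems(1)]; assumption)+
 have 1: "((%t. f (c (x(i := t)))) has_field_derivative (\<Sum>j<l. pd j f (c x) * pd i (%x. c x j) x)) (at (x i))"
  if "i < n" "x \<in> U" for i x
 proof -
  have "((%t. f (c (x(i := t)))) has_field_derivative (\<Sum>j<l. pd j f (c (x(i := x i))) * pd i (%x. c x j) x)) (at (x i))"
  proof (rule chain_rule_curve[OF assms(2), where c = "%t. c (x(i := t))" and f = f and D = "%j. pd j f"])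
   show "\<forall>\<^sub>F t in at (x i). c (x(i := t)) \<in> kspace l"
    using kopen_upd[OF assms(1) that(2,1)]
    by (simp add: eventually_at_filter) (auto elim!: eventually_mono intro: subsetD[OF kopen_subset[OF assms(2)] assms(3)])
   show "c (x(i := x i)) \<in> V" using assms(3) that by simp
   show "continuous_on V (pd j f)" if "j < l" for j using Ck_on_continuous[OF f(3)[OF that]] .
   show "((%t. c (x(i := t)) j) has_field_derivative pd i (%x. c x j) x) (at (x i))" if "j < l" for j
    using c(1)[OF that \<open>i < n\<close> \<open>x \<in> U\<close>] .
  qed (fact f(2))
  then show ?thesis by simp
 qed
 have 2: "Ck_on n m U (%x. \<Sum>j<l. pd j f (c x) * pd i (%x. c x j) x)" if "i < n" for i
  using that f c Suc.IH Ck_on_mono_Suc[OF Suc.prems(1)]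
  by (intro Ck_on_sum Ck_on_mult) auto
 show ?case unfolding Ck_on.simps(2)
  by (intro conjI exI[of _ "%i x. \<Sum>j<l. pd j f (c x) * pd i (%x. c x j) x"] allI impI ballI cont[OF c(3) f(1)] 1 2)
qed
qed

text \<open>The homotopy along which Hadamard's lemma integrates. It fixes the first
  \<open>m\<close> coordinates and contracts the rest to \<open>x0\<close>, so that the first ones
  act as parameters.\<close>

definition shrink :: "nat => (nat => 'k::real_normed_field) => real => (nat => 'k) => nat => 'k" where
 "shrink m x0 t x = (%i. if i < m then x i else x0 i + of_real t * (x i - x0 i))"

lemma shrink_1 [simp]: "shrink m x0 1 x = x"
 by (auto simp: shrink_def)

lemma shrink_in_kbox:
 assumes "x0 \<in> kspace n" "x \<in> kbox n x0 e" "t \<in> cbox 0 1"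
 shows "shrink m x0 t x \<in> kbox n x0 e"
proof -
 have "norm (of_real t * (x i - x0 i)) < e" if "i < n" for i
 proof -
  have "norm (of_real t * (x i - x0 i)) \<le> 1 * norm (x i - x0 i)"
   unfolding norm_mult using assms(3) by (intro mult_right_mono) auto
  then show ?thesis using assms(2) that by (auto simp: kbox_def dist_norm)
 qed
 then show ?thesis using assms by (auto simp: kbox_def shrink_def kspace_def dist_norm)
qed

lemma continuous_on_shrink:
 assumes "continuous_on S a" "continuous_on S b"
 shows "continuous_on S (%p. shrink m x0 (b p) (a p))"
proof (rule continuous_on_coordinatewise_then_product)
 fix i
 have "continuous_on S (%p. a p i)"
  by (rule continuous_on_product_then_coordinatewise[OF assms(1)])
 then show "continuous_on S (%p. shrink m x0 (b p) (a p) i)"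
  using assms(2) by (cases "i < m") (auto simp: shrink_def intro!: continuous_intros)
qed

lemma continuous_on_shrink_compose:
 fixes h :: "(nat => 'k::real_normed_field) => 'k"
 assumes "x0 \<in> kspace n" "continuous_on (kbox n x0 e) h" "continuous_on S a" "continuous_on S b"
  and "\<And>p. p \<in> S ==> a p \<in> kbox n x0 e" "\<And>p. p \<in> S ==> b p \<in> cbox 0 1"
 shows "continuous_on S (%p. of_real (b p) ^ l * h (shrink m x0 (b p) (a p)))"
proof (intro continuous_on_mult continuous_on_power continuous_on_of_real assms)
 show "continuous_on S (%p. h (shrink m x0 (b p) (a p)))"
  by (rule continuous_on_compose2[OF assms(2) continuous_on_shrink[OF assms(3,4)]])
   (use assms(1,5,6) shrink_in_kbox in blast)
qed

text \<open>Differentiating under the integral in a contracted coordinate produces a factor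
  \<open>t\<close>, hence the general power \<open>l\<close> in the induction.\<close>

lemma integral_shrink_Ck:
 fixes h :: "(nat => 'k::{real_normed_field,banach}) => 'k"
 assumes x0: "x0 \<in> kspace n" and h: "Ck_on n q (kbox n x0 e) h"
 shows "Ck_on n q (kbox n x0 e) (%x. integral (cbox 0 1) (%t. of_real t ^ l * h (shrink m x0 t x)))"
 using h
proof (induction q arbitrary: h l)
 case 0
 have "continuous_on (kbox n x0 e) (%x. integral (cbox 0 1) (%t. of_real t ^ l * h (shrink m x0 t x)))"
  unfolding Ck_on.simps
  by (rule integral_continuous_on_param, unfold split_beta, rule continuous_on_shrink_compose[OF x0])
   (use 0 in \<open>auto intro!: continuous_on_fst continuous_on_snd continuous_on_id\<close>)
 then show ?case by simp
next
 case (Suc q)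
 let ?B = "kbox n x0 e"
 let ?I = "%l h x. integral (cbox 0 1) (%t. of_real t ^ l * h (shrink m x0 t x))"
 let ?l = "%i. if i < m then l else Suc l"
 have ch: "continuous_on ?B h" using Suc.prems by (rule Ck_on_continuous)
 have 0: "continuous_on ?B (?I l h)"
  by (rule integral_continuous_on_param, unfold split_beta, rule continuous_on_shrink_compose[OF x0 ch])
   (auto intro!: continuous_on_fst continuous_on_snd continuous_on_id)
 have 1: "((%s. ?I l h (x(i := s))) has_field_derivative ?I (?l i) (pd i h) x) (at (x i))"
  if i: "i < n" and x: "x \<in> ?B" for i x
 proof -
  have xs: "x(i := s) \<in> ?B" if "s \<in> ball (x0 i) e" for s
   using x i that by (auto simp: kbox_def kspace_def dist_commute)
  have xi: "x i \<in> ball (x0 i) e" using x i by (auto simp: kbox_def dist_commute)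
  have cupd: "continuous_on T (%p. x(i := fst p))" for T :: "('k \<times> real) set"
  proof (rule continuous_on_coordinatewise_then_product)
   show "continuous_on T (%p. (x(i := fst p)) j)" for j
    by (cases "j = i") (auto intro!: continuous_on_fst continuous_on_id continuous_on_const)
  qed
  have cpd: "continuous_on ?B (pd i h)" using Ck_on_SucD(2)[OF kopen_kbox Suc.prems i] by (rule Ck_on_continuous)
  have "((%s. ?I l h (x(i := s))) has_field_derivative ?I (?l i) (pd i h) (x(i := x i))) (at (x i) within ball (x0 i) e)"
  proof (rule leibniz_rule_field_derivative[OF _ _ _ xi convex_ball,
     where fx = "%s t. of_real t ^ ?l i * pd i h (shrink m x0 t (x(i := s)))"])
   fix s t assume s: "s \<in> ball (x0 i) e" and t: "t \<in> cbox 0 (1::real)"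
   let ?y = "shrink m x0 t (x(i := s))"
   have y: "?y \<in> ?B" by (rule shrink_in_kbox[OF x0 xs[OF s] t])
   have D: "((%u. h (?y(i := u))) has_field_derivative pd i h ?y) (at (?y i))"
    by (rule Ck_on_SucD(1)[OF kopen_kbox Suc.prems i y])
   have yi: "?y i = (if i < m then s else x0 i + of_real t * (s - x0 i))" by (simp add: shrink_def)
   have "((%u. if i < m then u else x0 i + of_real t * (u - x0 i)) has_field_derivative (if i < m then 1 else of_real t)) (at s)"
    by (cases "i < m") (auto intro!: derivative_eq_intros)
   then have "((%u. h (?y(i := if i < m then u else x0 i + of_real t * (u - x0 i)))) has_field_derivative pd i h ?y * (if i < m then 1 else of_real t)) (at s)"
    using D unfolding yi by (rule DERIV_chain2[rotated])
   moreover have "?y(i := if i < m then u else x0 i + of_real t * (u - x0 i)) = shrink m x0 t (x(i := u))" for u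
    by (auto simp: shrink_def fun_eq_iff)
   ultimately have "((%u. of_real t ^ l * h (shrink m x0 t (x(i := u)))) has_field_derivative of_real t ^ l * (pd i h ?y * (if i < m then 1 else of_real t))) (at s)"
    by (intro DERIV_cmult) simp
   then show "((%u. of_real t ^ l * h (shrink m x0 t (x(i := u)))) has_field_derivative of_real t ^ ?l i * pd i h ?y) (at s within ball (x0 i) e)"
    by (cases "i < m") (auto simp: algebra_simps intro: has_field_derivative_at_within)
  next
   fix s assume s: "s \<in> ball (x0 i) e"
   show "(%t. of_real t ^ l * h (shrink m x0 t (x(i := s)))) integrable_on cbox 0 1"
    by (intro integrable_continuous continuous_on_shrink_compose[OF x0 ch]) (auto simp: xs[OF s] intro!: continuous_on_const continuous_on_id)
  next
   show "continuous_on (ball (x0 i) e \<times> cbox 0 1) (%(s, t). of_real t ^ ?l i * pd i h (shrink m x0 t (x(i := s))))"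
    unfolding split_beta
    by (intro continuous_on_shrink_compose[OF x0 cpd] cupd) (auto simp: xs intro!: continuous_on_snd continuous_on_id)
  qed
  then show ?thesis using xi by (simp add: at_within_open[of _ "ball (x0 i) e"])
 qed
 show ?case unfolding Ck_on.simps(2)
  by (intro conjI exI[of _ "%i. ?I (?l i) (pd i h)"] allI impI ballI 0 1 Suc.IH Ck_on_SucD(2)[OF kopen_kbox Suc.prems])
qed

text \<open>Hadamard's lemma in the last coordinates, the first \<open>m\<close> being parameters.\<close>

lemma hadamard:
 fixes f :: "(nat => 'k::{real_normed_field,banach}) => 'k"
 assumes U: "kopen n U" "x0 \<in> U" and f: "smooth_on n U f" and m: "m \<le> n"
 shows "\<exists>e>0. kbox n x0 e \<subseteq> U \<and> (\<exists>g. (\<forall>j<n. smooth_on n (kbox n x0 e) (g j)) \<and>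
  (\<forall>x\<in>kbox n x0 e. f x = f (shrink m x0 0 x) + (\<Sum>j=m..<n. (x j - x0 j) * g j x)))"
proof -
 obtain e where e: "e > 0" "kbox n x0 e \<subseteq> U" using kopen_contains_kbox[OF U] by blast
 let ?B = "kbox n x0 e"
 have x0: "x0 \<in> kspace n" using U kopen_subset by blast
 have fB: "Ck_on n q ?B f" for q using f e(2) Ck_on_subset unfolding smooth_on_def by blast
 \<comment> \<open>The average of the partial derivative along the contraction; the trivial factor
   \<open>of_real t ^ 0\<close> gives it the shape of \<open>integral_shrink_Ck\<close>.\<close>
 define g where "g j x = integral (cbox 0 1) (%t. of_real t ^ 0 * pd j f (shrink m x0 t x))" for j x
 have pdf: "Ck_on n q ?B (pd j f)" if "j < n" for q j
  by (rule Ck_on_SucD(2)[OF kopen_kbox fB that])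
 have g: "smooth_on n ?B (g j)" if "j < n" for j
  unfolding smooth_on_def g_def using integral_shrink_Ck[OF x0 pdf[OF that]] by blast
 have "f x = f (shrink m x0 0 x) + (\<Sum>j=m..<n. (x j - x0 j) * g j x)" if x: "x \<in> ?B" for x
 proof -
  let ?c = "%s i. if i < m then x i else x0 i + s * (x i - x0 i)"
  have cs: "?c (of_real t) = shrink m x0 t x" for t by (simp add: shrink_def)
  have vd: "((%t. f (shrink m x0 t x)) has_vector_derivative (\<Sum>j=m..<n. (x j - x0 j) * pd j f (shrink m x0 t x))) (at t within {0..1})"
   if t: "t \<in> {0..1}" for t
  proof -
   have "((%s. f (?c s)) has_field_derivative (\<Sum>j<n. pd j f (?c (of_real t)) * (if j < m then 0 else x j - x0 j))) (at (of_real t))"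
   proof (rule chain_rule_curve[where U = ?B and c = ?c and D = "%j. pd j f" and n = n])
    show "?c (of_real t) \<in> ?B" unfolding cs by (rule shrink_in_kbox[OF x0 x]) (use t in auto)
    show "((%s. ?c s i) has_field_derivative (if i < m then 0 else x i - x0 i)) (at (of_real t))" for i
     by (cases "i < m") (auto intro!: derivative_eq_intros)
    show "\<forall>\<^sub>F s in at (of_real t). ?c s \<in> kspace n"
     using x x0 m by (auto simp: kspace_def kbox_def)
    show "continuous_on ?B (pd j f)" if "j < n" for j using pdf[OF that] by (rule Ck_on_continuous)
    show "((%t. f (w(i := t))) has_field_derivative pd i f w) (at (w i))" if "i < n" "w \<in> ?B" for i w
     by (rule Ck_on_SucD(1)[OF kopen_kbox fB that])
   qed (rule kopen_kbox)
   moreover have "(\<Sum>j<n. pd j f (?c (of_real t)) * (if j < m then 0 else x j - x0 j)) = (\<Sum>j=m..<n. (x j - x0 j) * pd j f (shrink m x0 t x))"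
    unfolding cs by (rule sum.mono_neutral_cong_right) (auto simp: mult.commute)
   ultimately have "((%s. f (?c s)) has_field_derivative (\<Sum>j=m..<n. (x j - x0 j) * pd j f (shrink m x0 t x))) (at (of_real t))"
    by simp
   from has_vector_derivative_real_field[OF this] show ?thesis unfolding cs by simp
  qed
  have "((%t. \<Sum>j=m..<n. (x j - x0 j) * pd j f (shrink m x0 t x)) has_integral f (shrink m x0 1 x) - f (shrink m x0 0 x)) {0..1}"
   by (rule fundamental_theorem_of_calculus[OF _ vd]) auto
  moreover have "((%t. \<Sum>j=m..<n. (x j - x0 j) * pd j f (shrink m x0 t x)) has_integral (\<Sum>j=m..<n. (x j - x0 j) * g j x)) {0..1}"
  proof (intro has_integral_sum has_integral_mult_right)
   fix j assume "j \<in> {m..<n}"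
   then have j: "j < n" by simp
   have "(%t. of_real t ^ 0 * pd j f (shrink m x0 t x)) integrable_on cbox 0 1"
    by (intro integrable_continuous continuous_on_shrink_compose[OF x0 Ck_on_continuous[OF pdf[OF j]]])
      (auto simp: x intro!: continuous_on_const continuous_on_id)
   then have "((%t. of_real t ^ 0 * pd j f (shrink m x0 t x)) has_integral g j x) (cbox 0 1)"
    unfolding g_def by (rule integrable_integral)
   then show "((%t. pd j f (shrink m x0 t x)) has_integral g j x) {0..1}" by simp
  qed simp
  ultimately have "f (shrink m x0 1 x) - f (shrink m x0 0 x) = (\<Sum>j=m..<n. (x j - x0 j) * g j x)"
   by (rule has_integral_unique)
  then show ?thesis by (simp add: algebra_simps)
 qed
 with e g show ?thesis by (intro exI[of _ e] conjI exI[of _ g]) auto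
qed

section \<open>Local solutions of differential equations\<close>

text \<open>Integrating radially gives a primitive in the real and the complex case. Differentiation
  under the integral leads to the integrand \<open>f (t z) + t z f' (t z)\<close>, which is the
  derivative of \<open>t f (t z)\<close> in \<open>t\<close>, so the fundamental theorem on the unit
  interval returns \<open>f z\<close>.\<close>

lemma primitive_on_ball:
 fixes f :: "'k::{real_normed_field,banach} => 'k"
 assumes f: "\<And>z. z \<in> ball 0 r ==> (f has_field_derivative f' z) (at z)"
  and f': "continuous_on (ball 0 r) f'" and z: "z \<in> ball 0 r"
 shows "((%z. z * integral (cbox 0 1) (%t. f (of_real t * z))) has_field_derivative f z) (at z)"
proof -
 have tz: "of_real t * z \<in> ball 0 r" if "t \<in> cbox 0 1" "z \<in> ball 0 r" for t and z :: 'k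
 proof -
  have "norm (of_real t * z) \<le> 1 * norm z" unfolding norm_mult using that by (intro mult_right_mono) auto
  then show ?thesis using that by (auto simp: dist_norm)
 qed
 have cf: "continuous_on (ball 0 r) f"
  using f by (meson DERIV_continuous_on has_field_derivative_at_within)
 have I: "((%z. integral (cbox 0 1) (%t. f (of_real t * z))) has_field_derivative
   integral (cbox 0 1) (%t. of_real t * f' (of_real t * z))) (at z within ball 0 r)"
 proof (rule leibniz_rule_field_derivative[OF _ _ _ z convex_ball, where fx = "%z t. of_real t * f' (of_real t * z)"])
  fix z :: 'k and t :: real assume "z \<in> ball 0 r" "t \<in> cbox 0 1"
  have "((%z. f (of_real t * z)) has_field_derivative f' (of_real t * z) * of_real t) (at z)"
   by (rule DERIV_chain2[where f = f and g = "%z. of_real t * z", OF f[OF tz]]) (use \<open>z \<in> ball 0 r\<close> \<open>t \<in> cbox 0 1\<close> in \<open>auto intro!: derivative_eq_intros\<close>)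
  then show "((%z. f (of_real t * z)) has_field_derivative of_real t * f' (of_real t * z)) (at z within ball 0 r)"
   by (auto simp: mult.commute intro: has_field_derivative_at_within)
 next
  fix z :: 'k assume "z \<in> ball 0 r"
  then show "(%t. f (of_real t * z)) integrable_on cbox 0 1"
   by (intro integrable_continuous continuous_on_compose2[OF cf]) (use tz in \<open>auto intro!: continuous_intros\<close>)
 next
  show "continuous_on (ball 0 r \<times> cbox 0 1) (%(z, t). of_real t * f' (of_real t * z))"
   unfolding split_beta
   by (intro continuous_on_mult continuous_on_compose2[OF f']) (use tz in \<open>auto intro!: continuous_intros\<close>)
 qed
 have iF: "(%t. f (of_real t * z)) integrable_on cbox 0 1"
  by (intro integrable_continuous continuous_on_compose2[OF cf]) (use tz z in \<open>auto intro!: continuous_intros\<close>)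
 have iF': "(%t. of_real t * f' (of_real t * z)) integrable_on cbox 0 1"
  by (intro integrable_continuous continuous_on_mult continuous_on_compose2[OF f']) (use tz z in \<open>auto intro!: continuous_intros\<close>)
 have h1: "((%t. f (of_real t * z) + z * (of_real t * f' (of_real t * z))) has_integral of_real 1 * f (of_real 1 * z) - of_real 0 * f (of_real 0 * z)) {0..1}"
 proof (rule fundamental_theorem_of_calculus)
  fix t :: real assume "t \<in> {0..1}"
  then have t: "of_real t * z \<in> ball 0 r" using tz z by auto
  have "((%s. f (s * z)) has_field_derivative f' (of_real t * z) * z) (at (of_real t))"
   by (rule DERIV_chain2[where f = f and g = "%s. s * z", OF f[OF t]]) (auto intro!: derivative_eq_intros)
  then have "((%s. s * f (s * z)) has_field_derivative f (of_real t * z) + z * (of_real t * f' (of_real t * z))) (at (of_real t))"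
   by (auto intro!: derivative_eq_intros simp: algebra_simps)
  then show "((%s. of_real s * f (of_real s * z)) has_vector_derivative f (of_real t * z) + z * (of_real t * f' (of_real t * z))) (at t within {0..1})"
   by (rule has_vector_derivative_real_field)
 qed simp
 have h2: "((%t. f (of_real t * z) + z * (of_real t * f' (of_real t * z))) has_integral
   integral (cbox 0 1) (%t. f (of_real t * z)) + z * integral (cbox 0 1) (%t. of_real t * f' (of_real t * z))) {0..1}"
  using iF iF' by (intro has_integral_add has_integral_mult_right) auto
 have eq: "f z = integral (cbox 0 1) (%t. f (of_real t * z)) + z * integral (cbox 0 1) (%t. of_real t * f' (of_real t * z))"
  using has_integral_unique[OF h1 h2] by simp
 have "((%z. integral (cbox 0 1) (%t. f (of_real t * z))) has_field_derivative
   integral (cbox 0 1) (%t. of_real t * f' (of_real t * z))) (at z)"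
  using I z by (simp add: at_within_open[of _ "ball 0 r"])
 from DERIV_mult[OF DERIV_ident this] show ?thesis by (simp add: eq algebra_simps)
qed


text \<open>The integral from 0 to \<open>z\<close> is written as the radial primitive of
  \<open>primitive_on_ball\<close>, so the time may be complex.\<close>

primrec picard :: "nat => (nat => (nat => 'k::{real_normed_field,banach}) => 'k) => (nat => 'k) => nat => 'k => nat => 'k" where
 "picard n F x0 0 = (%z. x0)"
| "picard n F x0 (Suc q) = (%z i. if i < n then x0 i + z * integral (cbox 0 1) (%t. F i (picard n F x0 q (of_real t * z))) else 0)"

declare picard.simps(2) [simp del]

lemma picard_0: "i < n ==> picard n F x0 q 0 i = x0 i"
 by (cases q) (auto simp: picard.simps(2))

lemma picard_kspace: "x0 \<in> kspace n ==> picard n F x0 q z \<in> kspace n"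
 by (cases q) (auto simp: kspace_def picard.simps(2))

text \<open>\<open>C\<close> and \<open>K\<close> bound the field and its partial derivatives.
  \<open>rC\<close> keeps all iterates in the box, and \<open>rK\<close> makes a Picard step
  contract the sum of the coordinate distances by 1/2.\<close>

locale ode_box =
 fixes n :: nat and F :: "nat => (nat => 'k::{real_normed_field,banach}) => 'k" and x0 :: "nat => 'k"
  and \<rho> r C K :: real
 assumes x0: "x0 \<in> kspace n" and pos: "\<rho> > 0" "r > 0" "C \<ge> 0" "K \<ge> 0"
  and C1: "\<And>i. i < n ==> Ck_on n 1 (kbox n x0 \<rho>) (F i)"
  and bF: "\<And>i w. i < n ==> w \<in> kbox n x0 \<rho> ==> norm (F i w) \<le> C"
  and bD: "\<And>i j w. i < n ==> j < n ==> w \<in> kbox n x0 \<rho> ==> norm (pd j (F i) w) \<le> K"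
  and rC: "r * C \<le> \<rho> / 2" and rK: "real n * K * r \<le> 1 / 2"
begin

lemma lipschitz:
 assumes "i < n" "x \<in> kbox n x0 \<rho>" "y \<in> kbox n x0 \<rho>"
 shows "norm (F i y - F i x) \<le> K * (\<Sum>j<n. norm (y j - x j))"
proof -
 have "norm (F i y - F i x - (\<Sum>j<n. 0 * (y j - x j))) \<le> (\<Sum>j<n. K * norm (y j - x j))"
 proof (rule kbox_telescope[where D = "%j. pd j (F i)" and e = \<rho> and ?x0.0 = x0, OF _ _ assms(2,3)])
  show "((%t. F i (w(j := t))) has_field_derivative pd j (F i) w) (at (w j))" if "j < n" "w \<in> kbox n x0 \<rho>" for j w
   using Ck_on_SucD(1)[OF kopen_kbox C1[OF assms(1), unfolded One_nat_def] that] .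
 qed (use bD[OF assms(1)] in auto)
 then show ?thesis by (simp add: sum_distrib_left)
qed

abbreviation "pc \<equiv> picard n F x0"

text \<open>The three parts need each other: the next iterate is differentiable by
  \<open>primitive_on_ball\<close>, which asks that the present one has continuous derivatives and
  stays in the box.\<close>

lemma picard_step:
 "(\<forall>z\<in>ball 0 r. pc q z \<in> kbox n x0 \<rho> \<and> (\<forall>i<n. norm (pc q z i - x0 i) \<le> C * norm z)) \<and>
  (\<exists>d. \<forall>i<n. continuous_on (ball 0 r) (d i) \<and> (\<forall>z\<in>ball 0 r. ((%z. pc q z i) has_field_derivative d i z) (at z))) \<and>
  (\<forall>i<n. \<forall>z\<in>ball 0 r. ((%z. pc (Suc q) z i) has_field_derivative F i (pc q z)) (at z))"
proof -
 have main: "(\<forall>i<n. \<forall>z\<in>ball 0 r. ((%z. pc (Suc q) z i) has_field_derivative F i (pc q z)) (at z)) \<and>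
   (\<forall>i<n. continuous_on (ball 0 r) (%z. F i (pc q z)))"
  if B: "\<forall>z\<in>ball 0 r. pc q z \<in> kbox n x0 \<rho>"
   and d: "\<forall>i<n. continuous_on (ball 0 r) (d i) \<and> (\<forall>z\<in>ball 0 r. ((%z. pc q z i) has_field_derivative d i z) (at z))" for q d
 proof -
  have pck: "pc q z \<in> kspace n" for z
   using x0 by (rule picard_kspace)
  have cpc: "continuous_on (ball 0 r) (pc q)"
  proof (rule continuous_on_coordinatewise_then_product)
   fix i
   show "continuous_on (ball 0 r) (%z. pc q z i)"
   proof (cases "i < n")
    case True
    then show ?thesis using d DERIV_continuous_on has_field_derivative_at_within by meson
   next
    case False
    then have "(%z. pc q z i) = (%z. 0)" using pck by (auto simp: kspace_def)
    then show ?thesis using continuous_on_const[of _ "0::'k"] by metis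
   qed
  qed
  have comp: "continuous_on (ball 0 r) (%z. h (pc q z))" if "continuous_on (kbox n x0 \<rho>) h" for h :: "(nat => 'k) => 'k"
   by (rule continuous_on_compose2[OF that cpc]) (use B in auto)
  have ch: "((%z. F i (pc q z)) has_field_derivative (\<Sum>j<n. pd j (F i) (pc q z) * d j z)) (at z)"
   if i: "i < n" and z: "z \<in> ball 0 r" for i z
  proof (rule chain_rule_curve[where U = "kbox n x0 \<rho>" and c = "pc q" and D = "%j. pd j (F i)" and n = n, OF kopen_kbox])
   show "((%t. F i (w(j := t))) has_field_derivative pd j (F i) w) (at (w j))" if "j < n" "w \<in> kbox n x0 \<rho>" for j w
    using Ck_on_SucD(1)[OF kopen_kbox C1[OF i, unfolded One_nat_def] that] .
   show "continuous_on (kbox n x0 \<rho>) (pd j (F i))" if "j < n" for j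
    using Ck_on_SucD(2)[OF kopen_kbox C1[OF i, unfolded One_nat_def] that] by simp
  qed (use B z d pck in auto)
  have cch: "continuous_on (ball 0 r) (%z. \<Sum>j<n. pd j (F i) (pc q z) * d j z)" if i: "i < n" for i
  proof (intro continuous_on_sum continuous_on_mult comp)
   fix j assume "j \<in> {..<n}"
   then show "continuous_on (kbox n x0 \<rho>) (pd j (F i))" "continuous_on (ball 0 r) (d j)"
    using Ck_on_SucD(2)[OF kopen_kbox C1[OF i, unfolded One_nat_def], of j] d by auto
  qed
  have "((%z. pc (Suc q) z i) has_field_derivative F i (pc q z)) (at z)" if i: "i < n" and z: "z \<in> ball 0 r" for i z
   using DERIV_add[OF DERIV_const[of "x0 i"] primitive_on_ball[OF ch[OF i] cch[OF i] z]] i by (simp add: picard.simps(2))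
  moreover have "continuous_on (ball 0 r) (%z. F i (pc q z))" if "i < n" for i
   using comp Ck_on_continuous[OF C1[OF that]] by blast
  ultimately show ?thesis by blast
 qed
 show ?thesis
 proof (induction q)
  case 0
  have "\<forall>z\<in>ball 0 r. pc 0 z \<in> kbox n x0 \<rho>" using x0 pos by (simp add: center_in_kbox)
  moreover have "\<forall>i<n. continuous_on (ball 0 r) (%_. 0::'k) \<and> (\<forall>z\<in>ball 0 r. ((%z. pc 0 z i) has_field_derivative 0) (at z))"
   by simp
  moreover have "\<exists>d. \<forall>i<n. continuous_on (ball 0 r) (d i) \<and> (\<forall>z\<in>ball 0 r. ((%z. pc 0 z i) has_field_derivative d i z) (at z))"
   by (rule exI[of _ "%_ _. 0"]) simp
  ultimately show ?case using main[of 0 "%_ _. 0"] pos(3) by simp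
 next
  case (Suc q)
  then obtain d where d: "\<forall>i<n. continuous_on (ball 0 r) (d i) \<and> (\<forall>z\<in>ball 0 r. ((%z. pc q z i) has_field_derivative d i z) (at z))" by blast
  have B: "\<forall>z\<in>ball 0 r. pc q z \<in> kbox n x0 \<rho>" using Suc by blast
  note m = main[OF B d]
  have bd: "norm (pc (Suc q) z i - x0 i) \<le> C * norm z" if i: "i < n" and z: "z \<in> ball 0 r" for i z
  proof -
   have "norm (pc (Suc q) z i - pc (Suc q) 0 i) \<le> C * norm (z - 0)"
   proof (rule field_differentiable_bound[of "ball 0 r" "%z. pc (Suc q) z i" "%z. F i (pc q z)"])
    fix w :: 'k assume w: "w \<in> ball 0 r"
    have "((%z. pc (Suc q) z i) has_field_derivative F i (pc q w)) (at w)" using m i w by blast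
    then show "((%z. pc (Suc q) z i) has_field_derivative F i (pc q w)) (at w within ball 0 r)"
     by (rule has_field_derivative_at_within)
    show "norm (F i (pc q w)) \<le> C" using B bF i w by blast
   qed (use z pos in auto)
   then show ?thesis using i by (simp add: picard_0)
  qed
  have B': "\<forall>z\<in>ball 0 r. pc (Suc q) z \<in> kbox n x0 \<rho>"
  proof
   fix z :: 'k assume z: "z \<in> ball 0 r"
   have "norm (pc (Suc q) z i - x0 i) < \<rho>" if "i < n" for i
   proof -
    have "C * norm z \<le> C * r" using z pos by (intro mult_left_mono) auto
    then show ?thesis using bd[OF that z] rC pos by (simp add: mult.commute)
   qed
   then show "pc (Suc q) z \<in> kbox n x0 \<rho>" using picard_kspace[OF x0] by (auto simp: kbox_def dist_norm)
  qed
  have d': "\<forall>i<n. continuous_on (ball 0 r) (%z. F i (pc q z)) \<and> (\<forall>z\<in>ball 0 r. ((%z. pc (Suc q) z i) has_field_derivative F i (pc q z)) (at z))"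
   using m by blast
  show ?case using B' bd d' main[OF B' d'] by (intro conjI exI[of _ "%i z. F i (pc q z)"] ballI allI impI) blast+
 qed
qed

lemma picard_diff:
 "z \<in> ball 0 r ==> (\<Sum>i<n. norm (pc (Suc q) z i - pc q z i)) \<le> (real n * C * r) * (1/2) ^ q"
proof (induction q arbitrary: z)
 case 0
 have "norm (pc (Suc 0) z i - x0 i) \<le> C * r" if "i < n" for i
 proof -
  have "norm (pc (Suc 0) z i - x0 i) \<le> C * norm z" using picard_step[of "Suc 0"] 0 that by blast
  also have "\<dots> \<le> C * r" using 0 pos by (intro mult_left_mono) auto
  finally show ?thesis .
 qed
 then have "(\<Sum>i<n. norm (pc (Suc 0) z i - x0 i)) \<le> (\<Sum>i<n. C * r)" by (intro sum_mono) auto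
 then show ?case by (simp add: mult.assoc)
next
 case (Suc q)
 let ?A = "(real n * C * r) * (1/2) ^ q"
 have "norm (pc (Suc (Suc q)) z i - pc (Suc q) z i) \<le> K * ?A * r" if i: "i < n" for i
 proof -
  let ?g = "%z. pc (Suc (Suc q)) z i - pc (Suc q) z i"
  have "norm (?g z - ?g 0) \<le> (K * ?A) * norm (z - 0)"
  proof (rule field_differentiable_bound[where S = "ball 0 r" and f' = "%z. F i (pc (Suc q) z) - F i (pc q z)"])
   fix w :: 'k assume w: "w \<in> ball 0 r"
   show "(?g has_field_derivative (F i (pc (Suc q) w) - F i (pc q w))) (at w within ball 0 r)"
    using DERIV_diff[of "%z. pc (Suc (Suc q)) z i" _ w UNIV "%z. pc (Suc q) z i"]
     picard_step[of q] picard_step[of "Suc q"] w i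
    by (blast intro: has_field_derivative_at_within)
   have "norm (F i (pc (Suc q) w) - F i (pc q w)) \<le> K * (\<Sum>j<n. norm (pc (Suc q) w j - pc q w j))"
    using picard_step[of q] picard_step[of "Suc q"] w by (intro lipschitz i) blast+
   also have "\<dots> \<le> K * ?A" using Suc.IH[OF w] pos by (intro mult_left_mono) auto
   finally show "norm (F i (pc (Suc q) w) - F i (pc q w)) \<le> K * ?A" .
  qed (use Suc.prems pos in auto)
  also have "\<dots> \<le> K * ?A * r" using Suc.prems pos by (intro mult_left_mono) auto
  finally show ?thesis using i by (simp add: picard_0)
 qed
 then have "(\<Sum>i<n. norm (pc (Suc (Suc q)) z i - pc (Suc q) z i)) \<le> (\<Sum>i<n. K * ?A * r)" by (intro sum_mono) auto
 also have "\<dots> = (real n * K * r) * ?A" by simp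
 also have "\<dots> \<le> 1 / 2 * ?A" using rK pos by (intro mult_right_mono) auto
 finally show ?case by simp
qed

lemma local_solution:
 "\<exists>\<gamma>. \<gamma> 0 = x0 \<and> (\<forall>z\<in>ball 0 r. \<gamma> z \<in> kbox n x0 \<rho> \<and> (\<forall>i<n. ((%z. \<gamma> z i) has_field_derivative F i (\<gamma> z)) (at z)))"
proof -
 define A where "A = real n * C * r"
 have A0: "A \<ge> 0" using pos by (simp add: A_def)
 \<comment> \<open>The bracket is the geometric sum from \<open>q\<close> to
   \<open>q + l - 1\<close> in closed form.\<close>
 have pcdiff: "norm (pc (q + l) z i - pc q z i) \<le> A * (2 * (1/2) ^ q - 2 * (1/2) ^ (q + l))" if "i < n" "z \<in> ball 0 r" for q l z i
 proof (induction l)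
  case (Suc l)
  have "norm (pc (Suc (q + l)) z i - pc (q + l) z i) \<le> (\<Sum>i<n. norm (pc (Suc (q + l)) z i - pc (q + l) z i))"
   using that by (intro member_le_sum) auto
  also have "\<dots> \<le> A * (1/2) ^ (q + l)" using picard_diff[OF that(2)] by (simp add: A_def)
  finally have "norm (pc (Suc (q + l)) z i - pc q z i) \<le> A * (1/2) ^ (q + l) + A * (2 * (1/2) ^ q - 2 * (1/2) ^ (q + l))"
   using Suc norm_triangle_le[of "pc (Suc (q + l)) z i - pc (q + l) z i" "pc (q + l) z i - pc q z i"] by simp
  then show ?case by (simp add: algebra_simps)
 qed simp
 have pcb: "norm (pc l z i - pc q z i) \<le> 2 * A * (1/2) ^ q" if "i < n" "z \<in> ball 0 r" "q \<le> l" for q l z i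
  using pcdiff[OF that(1,2), of q "l - q"] that(3) A0 by (simp add: algebra_simps) (smt (verit) mult_nonneg_nonneg zero_le_power divide_nonneg_nonneg)
 have to0: "(%q. 2 * A * (1/2) ^ q) \<longlonglongrightarrow> 0"
  by (auto intro!: tendsto_eq_intros LIMSEQ_power_zero)
 have conv: "convergent (%q. pc q z i)" if "i < n" "z \<in> ball 0 r" for z i
 proof (rule Cauchy_convergent, rule metric_CauchyI)
  fix e :: real assume e: "e > 0"
  obtain N where N: "2 * A * (1/2) ^ N < e / 2"
   using order_tendstoD(2)[OF to0, of "e/2"] e by (auto simp: eventually_sequentially)
  have "dist (pc m z i) (pc l z i) < e" if "m \<ge> N" "l \<ge> N" for m l
  proof -
   have "dist (pc m z i) (pc l z i) \<le> dist (pc m z i) (pc N z i) + dist (pc l z i) (pc N z i)" by (rule dist_triangle2)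
   then show ?thesis using pcb[OF \<open>i < n\<close> \<open>z \<in> ball 0 r\<close> that(1)] pcb[OF \<open>i < n\<close> \<open>z \<in> ball 0 r\<close> that(2)] N
    unfolding dist_norm by linarith
  qed
  then show "\<exists>M. \<forall>m\<ge>M. \<forall>n\<ge>M. dist (pc m z i) (pc n z i) < e" by blast
 qed
 define \<gamma> where "\<gamma> z i = (if i < n then lim (%q. pc q z i) else 0)" for z i
 have lim: "(%q. pc q z i) \<longlonglongrightarrow> \<gamma> z i" if "i < n" "z \<in> ball 0 r" for z i
  using conv[OF that] that(1) by (simp add: \<gamma>_def convergent_LIMSEQ_iff)
 have tail: "norm (\<gamma> z i - pc q z i) \<le> 2 * A * (1/2) ^ q" if "i < n" "z \<in> ball 0 r" for q z i
 proof (rule Lim_norm_ubound[OF _ tendsto_diff[OF lim[OF that] tendsto_const]])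
  show "\<forall>\<^sub>F l in sequentially. norm (pc l z i - pc q z i) \<le> 2 * A * (1/2) ^ q"
   using eventually_ge_at_top[of q] by eventually_elim (use pcb[OF that] in auto)
 qed simp
 have box: "\<gamma> z \<in> kbox n x0 \<rho>" if z: "z \<in> ball 0 r" for z
 proof -
  have "norm (\<gamma> z i - x0 i) \<le> C * norm z" if "i < n" for i
   by (rule Lim_norm_ubound[OF _ tendsto_diff[OF lim[OF that z] tendsto_const]]) (use picard_step z that in auto)
  moreover have "C * norm z \<le> \<rho> / 2"
  proof -
   have "C * norm z \<le> C * r" using z pos by (intro mult_left_mono) auto
   then show ?thesis using rC by (simp add: mult.commute)
  qed
  ultimately have "norm (\<gamma> z i - x0 i) < \<rho>" if "i < n" for i
   using pos(1) that by fastforce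
  then show ?thesis by (auto simp: kbox_def kspace_def dist_norm \<gamma>_def)
 qed
 have der: "((%z. \<gamma> z i) has_field_derivative F i (\<gamma> z)) (at z)" if i: "i < n" and z: "z \<in> ball 0 r" for z i
 proof -
  \<comment> \<open>The limit is differentiated by uniform convergence of the derivatives
    \<open>F i (pc q x)\<close> to \<open>F i (\<gamma> x)\<close>; the equation itself comes out as
    the derivative of the limit.\<close>
  have "\<exists>g. \<forall>x\<in>ball 0 r. (%q. pc (Suc q) x i) \<longlonglongrightarrow> g x \<and> (g has_derivative (*) (F i (\<gamma> x))) (at x within ball 0 r)"
  proof (rule has_derivative_sequence[where f' = "%q x. (*) (F i (pc q x))"])
   show "((%x. pc (Suc q) x i) has_derivative (*) (F i (pc q x))) (at x within ball 0 r)" if "x \<in> ball 0 r" for q x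
   proof -
    have "((%x. pc (Suc q) x i) has_field_derivative F i (pc q x)) (at x within ball 0 r)"
     using picard_step[of q] i that by (blast intro: has_field_derivative_at_within)
    then show ?thesis by (simp add: has_field_derivative_def)
   qed
   show "\<forall>\<^sub>F q in sequentially. \<forall>x\<in>ball 0 r. \<forall>h. norm (F i (pc q x) * h - F i (\<gamma> x) * h) \<le> e * norm h" if e: "e > 0" for e
   proof -
    have "(%q. K * (real n * (2 * A * (1/2) ^ q))) \<longlonglongrightarrow> K * (real n * 0)"
     by (intro tendsto_mult_left to0)
    then have "\<forall>\<^sub>F q in sequentially. K * (real n * (2 * A * (1/2) ^ q)) < e"
     using order_tendstoD(2) e by (metis mult_zero_right)
    then show ?thesis
    proof eventually_elim
     case (elim q)
     have "norm (F i (pc q x) - F i (\<gamma> x)) \<le> e" if x: "x \<in> ball 0 r" for x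
     proof -
      have "norm (F i (pc q x) - F i (\<gamma> x)) \<le> K * (\<Sum>j<n. norm (pc q x j - \<gamma> x j))"
       using picard_step[of q] x by (intro lipschitz i box) blast+
      also have "\<dots> \<le> K * (\<Sum>j<n. 2 * A * (1/2) ^ q)"
       using tail[OF _ x] pos by (intro mult_left_mono sum_mono) (auto simp: norm_minus_commute)
      also have "\<dots> \<le> e" using elim by simp
      finally show ?thesis .
     qed
     then show ?case by (auto simp: left_diff_distrib[symmetric] norm_mult intro!: mult_right_mono)
    qed
   qed
   show "(0::'k) \<in> ball 0 r" using pos by simp
   show "(%q. pc (Suc q) 0 i) \<longlonglongrightarrow> x0 i" using i by (simp add: picard_0)
  qed (rule convex_ball)
  then obtain g where g: "\<And>x. x \<in> ball 0 r ==> (%q. pc (Suc q) x i) \<longlonglongrightarrow> g x"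
   "\<And>x. x \<in> ball 0 r ==> (g has_derivative (*) (F i (\<gamma> x))) (at x within ball 0 r)" by blast
  have eq: "g x = \<gamma> x i" if "x \<in> ball 0 r" for x
   using LIMSEQ_unique[OF g(1)[OF that] LIMSEQ_Suc[OF lim[OF i that]]] .
  have "(g has_field_derivative F i (\<gamma> z)) (at z)"
   using g(2)[OF z] z by (simp add: has_field_derivative_def at_within_open[of _ "ball 0 r"])
  then show ?thesis
   by (rule has_field_derivative_transform_within_open[OF _ open_ball z]) (use eq in auto)
 qed
 have "\<gamma> 0 = x0"
 proof
  fix i
  show "\<gamma> 0 i = x0 i"
   using x0 by (cases "i < n") (auto simp: \<gamma>_def kspace_def picard_0)
 qed
 then show ?thesis using box der by blast
qed

text \<open>The supremum \<open>S\<close> of the distance of the two solutions is finite because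
  both stay in the box, and the mean value inequality with \<open>rK\<close> gives
  \<open>S \<le> S / 2 + n r \<epsilon>\<close>. This is what later makes the exponential map
  continuous.\<close>

lemma solution_dependence:
 assumes \<gamma>: "\<gamma> 0 = x0" "\<And>z. z \<in> ball 0 r ==> \<gamma> z \<in> kbox n x0 \<rho>"
   "\<And>z i. i < n ==> z \<in> ball 0 r ==> ((%z. \<gamma> z i) has_field_derivative F i (\<gamma> z)) (at z)"
  and \<delta>: "\<delta> 0 = x0" "\<And>z. z \<in> ball 0 r ==> \<delta> z \<in> kbox n x0 \<rho>"
   "\<And>z i. i < n ==> z \<in> ball 0 r ==> ((%z. \<delta> z i) has_field_derivative F' i (\<delta> z)) (at z)"
  and F': "\<And>i w. i < n ==> w \<in> kbox n x0 \<rho> ==> norm (F' i w - F i w) \<le> \<epsilon>"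
  and z: "z \<in> ball 0 r" and i: "i < n"
 shows "norm (\<delta> z i - \<gamma> z i) \<le> 2 * real n * r * \<epsilon>"
proof -
 let ?s = "%z. \<Sum>i<n. norm (\<delta> z i - \<gamma> z i)"
 define S where "S = (SUP z\<in>ball 0 r. ?s z)"
 have nb: "norm (\<delta> z i - \<gamma> z i) \<le> 2 * \<rho>" if "i < n" "z \<in> ball 0 r" for z i
 proof -
  have "dist (\<delta> z i) (\<gamma> z i) \<le> dist (\<delta> z i) (x0 i) + dist (\<gamma> z i) (x0 i)" by (rule dist_triangle2)
  also have "\<dots> \<le> \<rho> + \<rho>" using \<gamma>(2) \<delta>(2) that by (intro add_mono) (auto simp: kbox_def less_imp_le)
  finally show ?thesis by (simp add: dist_norm)
 qed
 have "?s z \<le> (\<Sum>i<n. 2 * \<rho>)" if "z \<in> ball 0 r" for z using nb that by (intro sum_mono) auto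
 then have bdd: "bdd_above (?s ` ball 0 r)" by (intro bdd_aboveI2)
 have sS: "?s z \<le> S" if "z \<in> ball 0 r" for z unfolding S_def by (rule cSUP_upper[OF that bdd])
 have \<epsilon>0: "\<epsilon> \<ge> 0" using F'[OF i, of x0] center_in_kbox[OF x0 pos(1)] norm_ge_zero order_trans by blast
 have S0: "S \<ge> 0" using sS[of 0] pos sum_nonneg[of "{..<n}" "%i. norm (\<delta> 0 i - \<gamma> 0 i)"] by auto
 have comp: "norm (\<delta> z i - \<gamma> z i) \<le> r * (K * S + \<epsilon>)" if "i < n" "z \<in> ball 0 r" for z i
 proof -
  have "norm ((\<delta> z i - \<gamma> z i) - (\<delta> 0 i - \<gamma> 0 i)) \<le> (K * S + \<epsilon>) * norm (z - 0)"
  proof (rule field_differentiable_bound[where S = "ball 0 r" and f' = "%z. F' i (\<delta> z) - F i (\<gamma> z)"])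
   fix w :: 'k assume w: "w \<in> ball 0 r"
   show "((%z. \<delta> z i - \<gamma> z i) has_field_derivative (F' i (\<delta> w) - F i (\<gamma> w))) (at w within ball 0 r)"
    using DERIV_diff[OF \<delta>(3)[OF that(1) w] \<gamma>(3)[OF that(1) w]] by (rule has_field_derivative_at_within)
   have "norm (F i (\<delta> w) - F i (\<gamma> w)) \<le> K * S"
    using lipschitz[OF that(1) \<gamma>(2)[OF w] \<delta>(2)[OF w]] mult_left_mono[OF sS[OF w] pos(4)] by linarith
   then show "norm (F' i (\<delta> w) - F i (\<gamma> w)) \<le> K * S + \<epsilon>"
    using F'[OF that(1) \<delta>(2)[OF w]] norm_triangle_ineq[of "F' i (\<delta> w) - F i (\<delta> w)" "F i (\<delta> w) - F i (\<gamma> w)"] by simp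
  qed (use that pos in auto)
  also have "\<dots> \<le> (K * S + \<epsilon>) * r" using that S0 \<epsilon>0 pos by (intro mult_left_mono) auto
  finally show ?thesis using \<gamma>(1) \<delta>(1) by (simp add: mult.commute)
 qed
 have "?s z \<le> S / 2 + real n * r * \<epsilon>" if "z \<in> ball 0 r" for z
 proof -
  have "?s z \<le> (\<Sum>i<n. r * (K * S + \<epsilon>))" using comp that by (intro sum_mono) auto
  also have "\<dots> = (real n * K * r) * S + real n * r * \<epsilon>" by (simp add: algebra_simps)
  also have "\<dots> \<le> 1 / 2 * S + real n * r * \<epsilon>" using mult_right_mono[OF rK S0] by simp
  finally show ?thesis by simp
 qed
 then have "S \<le> S / 2 + real n * r * \<epsilon>" unfolding S_def using pos by (intro cSUP_least) auto
 then have "S \<le> 2 * real n * r * \<epsilon>" by simp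
 moreover have "norm (\<delta> z i - \<gamma> z i) \<le> ?s z" using i by (intro member_le_sum) auto
 ultimately show ?thesis using sS[OF z] by linarith
qed

end

section \<open>Smooth functions on manifolds\<close>

text \<open>The topological half of \<open>is_manifold\<close>. It and \<open>premfd\<close> leave
  out Hausdorffness and countability, so that products are handled by their charts alone.\<close>

definition charted :: "('a, 'k::real_normed_field) manifold => bool" where
 "charted M \<longleftrightarrow> topspace (mtop M) = (\<Union>(U, \<phi>) \<in> atlas M. U) \<and>
   (\<forall>(U, \<phi>) \<in> atlas M. openin (mtop M) U \<and> kopen (mdim M) (\<phi> ` U) \<and>
    homeomorphic_map (subtopology (mtop M) U) (top_of_set (\<phi> ` U)) \<phi>)"

definition premfd :: "('a, 'k::real_normed_field) manifold => bool" where
 "premfd M \<longleftrightarrow> charted M \<and> (\<forall>(U, \<phi>) \<in> atlas M. \<forall>i < mdim M. smooth_fun M U (%x. \<phi> x i))"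

lemma is_manifold_premfd: "is_manifold M ==> premfd M"
 unfolding is_manifold_def premfd_def charted_def by blast

lemma premfd_charted: "premfd M ==> charted M"
 by (simp add: premfd_def)

context
 fixes M :: "('a, 'k::real_normed_field) manifold"
 assumes M: "charted M"
begin

lemma chart_at: "p \<in> topspace (mtop M) ==> \<exists>U \<phi>. (U, \<phi>) \<in> atlas M \<and> p \<in> U"
 using M unfolding charted_def by auto

context
 fixes U \<phi>
 assumes U: "(U, \<phi>) \<in> atlas M"
begin

lemma chart_open: "openin (mtop M) U"
 using M U unfolding charted_def by auto

lemma chart_image: "kopen (mdim M) (\<phi> ` U)"
 using M U unfolding charted_def by auto

lemma chart_homeo: "homeomorphic_map (subtopology (mtop M) U) (top_of_set (\<phi> ` U)) \<phi>"
 using M U unfolding charted_def by auto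

lemma chart_subset: "U \<subseteq> topspace (mtop M)"
 by (rule openin_subset[OF chart_open])

lemma topspace_chart: "topspace (subtopology (mtop M) U) = U"
 using chart_subset by auto

lemma chart_inj: "inj_on \<phi> U"
 using homeomorphic_imp_injective_map[OF chart_homeo] unfolding topspace_chart .

lemma chart_inv: "p \<in> U ==> inv_into U \<phi> (\<phi> p) = p"
 by (rule inv_into_f_f[OF chart_inj])

lemma chart_kspace: "p \<in> U ==> \<phi> p \<in> kspace (mdim M)"
 using kopen_subset[OF chart_image] by blast

lemma chart_maps: "homeomorphic_maps (subtopology (mtop M) U) (top_of_set (\<phi> ` U)) \<phi> (inv_into U \<phi>)"
proof -
 obtain g where g: "homeomorphic_maps (subtopology (mtop M) U) (top_of_set (\<phi> ` U)) \<phi> g"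
  using chart_homeo homeomorphic_map_maps by blast
 then have "\<forall>x\<in>U. g (\<phi> x) = x" unfolding homeomorphic_maps_def topspace_chart by blast
 then show ?thesis
  by (intro homeomorphic_maps_eq[OF g]) (auto simp: chart_inv)
qed

lemma chart_open_image:
 assumes "openin (mtop M) W" "W \<subseteq> U"
 shows "kopen (mdim M) (\<phi> ` W)"
proof -
 have "openin (subtopology (mtop M) U) W" using assms by (metis openin_subtopology inf.absorb1)
 then have "openin (top_of_set (\<phi> ` U)) (\<phi> ` W)"
  using homeomorphic_imp_open_map[OF chart_homeo] unfolding open_map_def by blast
 then show ?thesis using chart_image openin_trans by blast
qed

lemma chart_open_preimage:
 assumes "kopen (mdim M) B"
 shows "openin (mtop M) {q \<in> U. \<phi> q \<in> B}"
proof -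
 have "openin (top_of_set (\<phi> ` U)) (\<phi> ` U \<inter> B)"
  using assms chart_image kopen_subset by (metis openin_Int openin_subset_trans inf_le1)
 moreover have "continuous_map (subtopology (mtop M) U) (top_of_set (\<phi> ` U)) \<phi>"
  using chart_maps homeomorphic_maps_def by blast
 ultimately have "openin (subtopology (mtop M) U) {q \<in> topspace (subtopology (mtop M) U). \<phi> q \<in> \<phi> ` U \<inter> B}"
  using openin_continuous_map_preimage by blast
 moreover have "{q \<in> topspace (subtopology (mtop M) U). \<phi> q \<in> \<phi> ` U \<inter> B} = {q \<in> U. \<phi> q \<in> B}"
  unfolding topspace_chart by blast
 ultimately show ?thesis using chart_open openin_trans_full by metis
qed

lemma smooth_funD: "smooth_fun M W f ==> smooth_on (mdim M) (\<phi> ` (W \<inter> U)) (%x. f (inv_into U \<phi> x))"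
 using U unfolding smooth_fun_def by blast

end

end

section \<open>Smooth functions at a point and smooth maps\<close>

lemma smooth_on_subset: "smooth_on n U f ==> V \<subseteq> U ==> smooth_on n V f"
 unfolding smooth_on_def using Ck_on_subset by blast

lemma smooth_on_cong:
 "kopen n U ==> smooth_on n U f ==> (\<And>x. x \<in> U ==> f x = g x) ==> smooth_on n U g"
 unfolding smooth_on_def using Ck_on_cong by blast

lemma smooth_on_local:
 assumes "kopen n U" "\<And>x. x \<in> U ==> \<exists>V. kopen n V \<and> x \<in> V \<and> smooth_on n V f"
 shows "smooth_on n U f"
 unfolding smooth_on_def
proof (intro allI Ck_on_local[OF assms(1)])
 fix m x assume "x \<in> U"
 then obtain V where "kopen n V" "x \<in> V" "smooth_on n V f" using assms(2) by blast
 then show "\<exists>V. kopen n V \<and> x \<in> V \<and> Ck_on n m V f" unfolding smooth_on_def by blast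
qed

lemma smooth_on_compose:
 assumes "kopen n U" "kopen l V" "\<And>x. x \<in> U ==> c x \<in> V"
  and "\<And>j. j < l ==> smooth_on n U (%x. c x j)" "smooth_on l V f"
 shows "smooth_on n U (%x. f (c x))"
 unfolding smooth_on_def
proof
 fix m show "Ck_on n m U (%x. f (c x))"
  by (rule Ck_on_compose[OF assms(1-3)]) (use assms(4,5) in \<open>auto simp: smooth_on_def\<close>)
qed

lemma smooth_on_const: "smooth_on n U (%_. c)"
 by (simp add: smooth_on_def Ck_on_const)

lemma smooth_on_coord: "smooth_on n U (%x. x j)"
 by (simp add: smooth_on_def Ck_on_coord)

lemma smooth_fun_subset: "smooth_fun M W f ==> W' \<subseteq> W ==> smooth_fun M W' f"
 unfolding smooth_fun_def by (fast intro: smooth_on_subset)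

text \<open>Smoothness as a property of germs: derivations see nothing else, and questions of
  smoothness can be settled point by point.\<close>

definition smooth_at :: "('a, 'k::real_normed_field) manifold => 'a => ('a => 'k) => bool" where
 "smooth_at M p f \<longleftrightarrow> (\<exists>W. openin (mtop M) W \<and> p \<in> W \<and> smooth_fun M W f)"

lemma smooth_near_one_iff: "smooth_near_one G f \<longleftrightarrow> smooth_at (mfd G) \<one>\<^bsub>G\<^esub> f"
 unfolding smooth_near_one_def smooth_at_def ..

lemma smooth_fun_cong:
 assumes "charted M" "openin (mtop M) W" "smooth_fun M W f" "\<And>x. x \<in> W ==> f x = g x"
 shows "smooth_fun M W g"
 unfolding smooth_fun_def
proof (intro ballI, clarify)
 fix U \<phi> assume U: "(U, \<phi>) \<in> atlas M"
 have "kopen (mdim M) (\<phi> ` (W \<inter> U))"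
  by (rule chart_open_image[OF assms(1) U]) (use assms(2) chart_open[OF assms(1) U] in auto)
 then show "smooth_on (mdim M) (\<phi> ` (W \<inter> U)) (%x. g (inv_into U \<phi> x))"
  by (rule smooth_on_cong[OF _ smooth_funD[OF assms(1) U assms(3)]]) (auto simp: chart_inv[OF assms(1) U] assms(4))
qed

lemma smooth_fun_local:
 assumes M: "charted M" and W: "openin (mtop M) W" and f: "\<And>p. p \<in> W ==> smooth_at M p f"
 shows "smooth_fun M W f"
 unfolding smooth_fun_def
proof (intro ballI, clarify)
 fix U \<phi> assume U: "(U, \<phi>) \<in> atlas M"
 have o: "kopen (mdim M) (\<phi> ` (W' \<inter> U))" if "openin (mtop M) W'" for W'
  by (rule chart_open_image[OF M U]) (use that chart_open[OF M U] in auto)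
 show "smooth_on (mdim M) (\<phi> ` (W \<inter> U)) (%x. f (inv_into U \<phi> x))"
 proof (rule smooth_on_local[OF o[OF W]])
  fix x assume "x \<in> \<phi> ` (W \<inter> U)"
  then obtain q where q: "x = \<phi> q" "q \<in> W" "q \<in> U" by blast
  obtain W' where W': "openin (mtop M) W'" "q \<in> W'" "smooth_fun M W' f"
   using f[OF q(2)] unfolding smooth_at_def by blast
  show "\<exists>V. kopen (mdim M) V \<and> x \<in> V \<and> smooth_on (mdim M) V (%x. f (inv_into U \<phi> x))"
   using o[OF W'(1)] smooth_funD[OF M U W'(3)] q W'(2) by blast
 qed
qed

lemma smooth_atD: "smooth_at M p f ==> \<exists>W. openin (mtop M) W \<and> p \<in> W \<and> (\<forall>q\<in>W. smooth_at M q f)"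
 unfolding smooth_at_def by blast

lemma smooth_at_cong:
 assumes "charted M" "openin (mtop M) W" "p \<in> W" "\<And>x. x \<in> W ==> f x = g x"
 shows "smooth_at M p f \<longleftrightarrow> smooth_at M p g"
proof -
 have "smooth_at M p g" if f: "smooth_at M p f" and eq: "\<And>x. x \<in> W ==> f x = g x" for f g
 proof -
  obtain W' where W': "openin (mtop M) W'" "p \<in> W'" "smooth_fun M W' f"
   using f unfolding smooth_at_def by blast
  have "openin (mtop M) (W' \<inter> W)" using W' assms by auto
  moreover have "smooth_fun M (W' \<inter> W) g"
   by (rule smooth_fun_cong[OF assms(1) calculation smooth_fun_subset[OF W'(3)]]) (use eq in auto)
  ultimately show ?thesis unfolding smooth_at_def using W'(2) assms(3) by blast
 qed
 then show ?thesis using assms(4) by metis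
qed

lemma smooth_at_binop:
 assumes "\<And>U f g. smooth_on (mdim M) U f ==> smooth_on (mdim M) U g ==> smooth_on (mdim M) U (%x. h (f x) (g x))"
  and "smooth_at M p f" "smooth_at M p g"
 shows "smooth_at M p (%x. h (f x) (g x))"
proof -
 obtain W W' where W: "openin (mtop M) W" "p \<in> W" "smooth_fun M W f" "openin (mtop M) W'" "p \<in> W'" "smooth_fun M W' g"
  using assms(2,3) unfolding smooth_at_def by blast
 have "smooth_fun M (W \<inter> W') f" "smooth_fun M (W \<inter> W') g" using W smooth_fun_subset by blast+
 then have "smooth_fun M (W \<inter> W') (%x. h (f x) (g x))"
  unfolding smooth_fun_def using assms(1) by (auto simp: split_beta)
 then show ?thesis unfolding smooth_at_def using W by (intro exI[of _ "W \<inter> W'"]) auto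
qed

lemma smooth_at_add: "smooth_at M p f ==> smooth_at M p g ==> smooth_at M p (%x. f x + g x)"
 by (rule smooth_at_binop) (auto simp: smooth_on_def Ck_on_add)

lemma smooth_at_mult: "smooth_at M p f ==> smooth_at M p g ==> smooth_at M p (%x. f x * g x)"
 by (rule smooth_at_binop) (auto simp: smooth_on_def Ck_on_mult)

lemma smooth_at_const: "p \<in> topspace (mtop M) ==> smooth_at M p (%_. c)"
 unfolding smooth_at_def smooth_fun_def
 by (intro exI[of _ "topspace (mtop M)"]) (auto simp: smooth_on_const)

lemma smooth_at_topspace: "smooth_at M p f ==> p \<in> topspace (mtop M)"
 unfolding smooth_at_def using openin_subset by blast

lemma smooth_at_cmult: "smooth_at M p f ==> smooth_at M p (%x. c * f x)"
 by (intro smooth_at_mult smooth_at_const) (auto dest: smooth_at_topspace)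

lemma smooth_at_uminus: "smooth_at M p f ==> smooth_at M p (%x. - f x)"
 using smooth_at_cmult[of M p f "-1"] by simp

lemma smooth_at_diff: "smooth_at M p f ==> smooth_at M p g ==> smooth_at M p (%x. f x - g x)"
 using smooth_at_add[of M p f "%x. - g x"] smooth_at_uminus[of M p g] by simp

lemma smooth_at_sum:
 "finite I ==> p \<in> topspace (mtop M) ==> (\<And>i. i \<in> I ==> smooth_at M p (f i)) ==> smooth_at M p (%x. \<Sum>i\<in>I. f i x)"
 by (induction I rule: finite_induct) (auto intro: smooth_at_const smooth_at_add)

lemma smooth_at_coord:
 assumes "premfd M" "(U, \<phi>) \<in> atlas M" "p \<in> U" "i < mdim M"
 shows "smooth_at M p (%x. \<phi> x i)"
 using assms chart_open[OF premfd_charted[OF assms(1)] assms(2)] unfolding premfd_def smooth_at_def by blast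

text \<open>One chart is enough because its coordinates are smooth functions on the manifold: the
  expression in any other chart is a composition with the transition map.\<close>

lemma smooth_fun_chartI:
 assumes M: "premfd M" and U: "(U, \<phi>) \<in> atlas M" and W: "openin (mtop M) W" "W \<subseteq> U"
  and f: "smooth_on (mdim M) (\<phi> ` W) (%x. f (inv_into U \<phi> x))"
 shows "smooth_fun M W f"
 unfolding smooth_fun_def
proof (intro ballI, clarify)
 note M' = premfd_charted[OF M]
 fix V \<psi> assume V: "(V, \<psi>) \<in> atlas M"
 have o: "kopen (mdim M) (\<psi> ` (W \<inter> V))"
  by (rule chart_open_image[OF M' V]) (use W chart_open[OF M' V] in auto)
 have "smooth_on (mdim M) (\<psi> ` (W \<inter> V)) (%x. f (inv_into U \<phi> (\<phi> (inv_into V \<psi> x))))"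
 proof (rule smooth_on_compose[OF o chart_open_image[OF M' U W] _ _ f])
  show "\<phi> (inv_into V \<psi> x) \<in> \<phi> ` W" if "x \<in> \<psi> ` (W \<inter> V)" for x
   using that by (auto simp: chart_inv[OF M' V])
  fix j assume "j < mdim M"
  then have "smooth_fun M U (%x. \<phi> x j)" using M U unfolding premfd_def by blast
  then have "smooth_on (mdim M) (\<psi> ` (U \<inter> V)) (%x. \<phi> (inv_into V \<psi> x) j)" by (rule smooth_funD[OF M' V])
  then show "smooth_on (mdim M) (\<psi> ` (W \<inter> V)) (%x. \<phi> (inv_into V \<psi> x) j)"
   by (rule smooth_on_subset) (use W in auto)
 qed
 then show "smooth_on (mdim M) (\<psi> ` (W \<inter> V)) (%x. f (inv_into V \<psi> x))"
  by (rule smooth_on_cong[OF o]) (use W in \<open>auto simp: chart_inv[OF M' V] chart_inv[OF M' U]\<close>)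
qed

lemma smooth_at_continuous:
 assumes M: "charted M" and f: "smooth_at M p f" and e: "e > 0"
 shows "\<exists>W. openin (mtop M) W \<and> p \<in> W \<and> (\<forall>q\<in>W. dist (f q) (f p) < e)"
proof -
 obtain W where W: "openin (mtop M) W" "p \<in> W" "smooth_fun M W f" using f unfolding smooth_at_def by blast
 obtain U \<phi> where U: "(U, \<phi>) \<in> atlas M" "p \<in> U" using chart_at[OF M smooth_at_topspace[OF f]] by blast
 have o: "kopen (mdim M) (\<phi> ` (W \<inter> U))"
  by (rule chart_open_image[OF M U(1)]) (use W chart_open[OF M U(1)] in auto)
 have "Ck_on (mdim M) 0 (\<phi> ` (W \<inter> U)) (%x. f (inv_into U \<phi> x))"
  using smooth_funD[OF M U(1) W(3)] unfolding smooth_on_def by blast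
 then have c: "continuous_on (\<phi> ` (W \<inter> U)) (%x. f (inv_into U \<phi> x))" by simp
 obtain d where d: "d > 0" "\<forall>y\<in>kbox (mdim M) (\<phi> p) d. dist (f (inv_into U \<phi> y)) (f (inv_into U \<phi> (\<phi> p))) < e"
  using continuous_on_kopenD[OF o c _ e, of "\<phi> p"] W U by blast
 show ?thesis
  using chart_open_preimage[OF M U(1) kopen_kbox[of _ "\<phi> p" d]] d U center_in_kbox[OF chart_kspace[OF M U] d(1)]
  by (intro exI[of _ "{q \<in> U. \<phi> q \<in> kbox (mdim M) (\<phi> p) d}"]) (auto simp: chart_inv[OF M U(1)])
qed

lemma smooth_at_compose:
 assumes M: "charted M" and N: "charted N" and F: "smooth_map M N F"
  and p: "p \<in> topspace (mtop M)" and f: "smooth_at N (F p) f"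
 shows "smooth_at M p (%x. f (F x))"
proof -
 obtain W where W: "openin (mtop N) W" "F p \<in> W" "smooth_fun N W f" using f unfolding smooth_at_def by blast
 obtain V \<psi> where V: "(V, \<psi>) \<in> atlas N" "F p \<in> V" using chart_at[OF N smooth_at_topspace[OF f]] by blast
 define Z where "Z = {x \<in> topspace (mtop M). F x \<in> W \<inter> V}"
 have Z: "openin (mtop M) Z" unfolding Z_def
  by (rule openin_continuous_map_preimage) (use F W chart_open[OF N V(1)] in \<open>auto simp: smooth_map_def\<close>)
 have oW: "kopen (mdim N) (\<psi> ` (W \<inter> V))"
  by (rule chart_open_image[OF N V(1)]) (use W chart_open[OF N V(1)] in auto)
 have "smooth_fun M Z (%x. f (F x))"
  unfolding smooth_fun_def
 proof (intro ballI, clarify)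
  fix U \<phi> assume U: "(U, \<phi>) \<in> atlas M"
  have o: "kopen (mdim M) (\<phi> ` (Z \<inter> U))"
   by (rule chart_open_image[OF M U]) (use Z chart_open[OF M U] in auto)
  have "smooth_on (mdim M) (\<phi> ` (Z \<inter> U)) (%x. f (inv_into V \<psi> (\<psi> (F (inv_into U \<phi> x)))))"
  proof (rule smooth_on_compose[OF o oW _ _ smooth_funD[OF N V(1) W(3)]])
   show "\<psi> (F (inv_into U \<phi> x)) \<in> \<psi> ` (W \<inter> V)" if "x \<in> \<phi> ` (Z \<inter> U)" for x
    using that by (auto simp: chart_inv[OF M U] Z_def)
   fix j assume "j < mdim N"
   then have "smooth_fun M {x \<in> topspace (mtop M). F x \<in> V} (%x. \<psi> (F x) j)" using F V(1) unfolding smooth_map_def by blast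
   from smooth_funD[OF M U this] show "smooth_on (mdim M) (\<phi> ` (Z \<inter> U)) (%x. \<psi> (F (inv_into U \<phi> x)) j)"
    by (rule smooth_on_subset) (auto simp: Z_def)
  qed
  then show "smooth_on (mdim M) (\<phi> ` (Z \<inter> U)) (%x. f (F (inv_into U \<phi> x)))"
   by (rule smooth_on_cong[OF o]) (auto simp: Z_def chart_inv[OF M U] chart_inv[OF N V(1)])
 qed
 then show ?thesis unfolding smooth_at_def using Z p W V by (auto simp: Z_def)
qed

lemma smooth_mapI:
 assumes M: "charted M" and N: "charted N" and c: "continuous_map (mtop M) (mtop N) F"
  and F: "\<And>p V \<psi> i. p \<in> topspace (mtop M) ==> (V, \<psi>) \<in> atlas N ==> F p \<in> V ==> i < mdim N ==> smooth_at M p (%x. \<psi> (F x) i)"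
 shows "smooth_map M N F"
 unfolding smooth_map_def
proof (intro conjI c ballI, clarify)
 fix V \<psi> i assume V: "(V, \<psi>) \<in> atlas N" and i: "i < mdim N"
 have "openin (mtop M) {x \<in> topspace (mtop M). F x \<in> V}"
  by (rule openin_continuous_map_preimage[OF c chart_open[OF N V]])
 then show "smooth_fun M {x \<in> topspace (mtop M). F x \<in> V} (%x. \<psi> (F x) i)"
  by (rule smooth_fun_local[OF M]) (use F V i in blast)
qed

lemma smooth_map_continuous: "smooth_map M N F ==> continuous_map (mtop M) (mtop N) F"
 by (simp add: smooth_map_def)

lemma smooth_map_into: "smooth_map M N F ==> p \<in> topspace (mtop M) ==> F p \<in> topspace (mtop N)"
 by (auto simp: smooth_map_def continuous_map_def Pi_iff)

lemma smooth_map_coord: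
 assumes "charted N" "smooth_map M N F" "p \<in> topspace (mtop M)" "(V, \<psi>) \<in> atlas N" "F p \<in> V" "i < mdim N"
 shows "smooth_at M p (%x. \<psi> (F x) i)"
proof -
 have "openin (mtop M) {x \<in> topspace (mtop M). F x \<in> V}"
  by (rule openin_continuous_map_preimage[OF smooth_map_continuous[OF assms(2)] chart_open[OF assms(1,4)]])
 moreover have "smooth_fun M {x \<in> topspace (mtop M). F x \<in> V} (%x. \<psi> (F x) i)"
  using assms unfolding smooth_map_def by blast
 ultimately show ?thesis unfolding smooth_at_def using assms(3,5) by blast
qed

lemma smooth_map_compose:
 assumes "charted M" "charted N" "charted P" "smooth_map M N F" "smooth_map N P E"
 shows "smooth_map M P (%x. E (F x))"
proof (rule smooth_mapI[OF assms(1,3)])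
 show "continuous_map (mtop M) (mtop P) (%x. E (F x))"
  using continuous_map_compose[OF assms(4,5)[THEN smooth_map_continuous]] by (simp add: o_def)
 fix p V \<psi> i assume h: "p \<in> topspace (mtop M)" "(V, \<psi>) \<in> atlas P" "E (F p) \<in> V" "i < mdim P"
 show "smooth_at M p (%x. \<psi> (E (F x)) i)"
  by (rule smooth_at_compose[OF assms(1,2,4) h(1)], rule smooth_map_coord[OF assms(3,5)])
   (use h smooth_map_into[OF assms(4)] in auto)
qed

lemma smooth_map_id:
 assumes "premfd M" shows "smooth_map M M (%x. x)"
 by (rule smooth_mapI) (use assms smooth_at_coord premfd_charted in auto)

lemma smooth_map_const:
 assumes "charted M" "charted N" "c \<in> topspace (mtop N)" shows "smooth_map M N (%_. c)"
 by (rule smooth_mapI) (use assms in \<open>auto intro: smooth_at_const\<close>)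

subsection \<open>Products\<close>

definition ktake :: "nat => (nat => 'k::zero) => nat => 'k" where
 "ktake m x = (%i. if i < m then x i else 0)"

definition kdrop :: "nat => (nat => 'k) => nat => 'k" where
 "kdrop m x = (%i. x (i + m))"

definition kjoin :: "nat => (nat => 'k) => (nat => 'k) => nat => 'k" where
 "kjoin m a b = (%i. if i < m then a i else b (i - m))"

lemma ktake_kjoin: "a \<in> kspace m ==> ktake m (kjoin m a b) = a"
 by (auto simp: ktake_def kjoin_def kspace_def fun_eq_iff)

lemma kdrop_kjoin: "kdrop m (kjoin m a b) = b"
 by (auto simp: kdrop_def kjoin_def fun_eq_iff)

lemma kjoin_take_drop: "kjoin m (ktake m x) (kdrop m x) = x"
 by (auto simp: ktake_def kdrop_def kjoin_def fun_eq_iff)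

lemma continuous_on_ktake: "continuous_on S (ktake m :: (nat => 'k::real_normed_field) => _)"
proof (rule continuous_on_coordinatewise_then_product)
 show "continuous_on S (%x. ktake m x i :: 'k)" for i
  by (cases "i < m") (auto simp: ktake_def continuous_on_coord)
qed

lemma continuous_on_kdrop: "continuous_on S (kdrop m :: (nat => 'k::real_normed_field) => _)"
 by (rule continuous_on_coordinatewise_then_product) (auto simp: kdrop_def continuous_on_coord)

context
 fixes M :: "('a, 'k::real_normed_field) manifold" and N :: "('b, 'k) manifold"
 assumes M: "charted M" and N: "charted N"
begin

abbreviation "pm \<equiv> prod_manifold M N"

definition pchart :: "('a => nat => 'k) => ('b => nat => 'k) => 'a \<times> 'b => nat => 'k" where
 "pchart \<phi> \<psi> = (%p. kjoin (mdim M) (\<phi> (fst p)) (\<psi> (snd p)))"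

lemma prod_simps: "mtop pm = prod_topology (mtop M) (mtop N)" "mdim pm = mdim M + mdim N"
 by (simp_all add: prod_manifold_def)

lemma prod_atlas: "atlas pm = {(U \<times> V, pchart \<phi> \<psi>) | U V \<phi> \<psi>. (U, \<phi>) \<in> atlas M \<and> (V, \<psi>) \<in> atlas N}"
proof -
 have "(%(a, b) i. if i < mdim M then \<phi> a i else \<psi> b (i - mdim M)) = pchart \<phi> \<psi>" for \<phi> \<psi>
  by (auto simp: pchart_def kjoin_def fun_eq_iff)
 then show ?thesis by (simp add: prod_manifold_def)
qed

context
 fixes U \<phi> V \<psi>
 assumes U: "(U, \<phi>) \<in> atlas M" and V: "(V, \<psi>) \<in> atlas N"
begin

lemma pchart_image: "pchart \<phi> \<psi> ` (U \<times> V) = {x \<in> kspace (mdim M + mdim N). ktake (mdim M) x \<in> \<phi> ` U \<and> kdrop (mdim M) x \<in> \<psi> ` V}"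
proof (intro equalityI subsetI)
 fix x assume "x \<in> pchart \<phi> \<psi> ` (U \<times> V)"
 then obtain a b where x: "x = kjoin (mdim M) (\<phi> a) (\<psi> b)" "a \<in> U" "b \<in> V" by (auto simp: pchart_def)
 then have "\<psi> b \<in> kspace (mdim N)" "\<phi> a \<in> kspace (mdim M)" using chart_kspace[OF N V] chart_kspace[OF M U] by auto
 then show "x \<in> {x \<in> kspace (mdim M + mdim N). ktake (mdim M) x \<in> \<phi> ` U \<and> kdrop (mdim M) x \<in> \<psi> ` V}"
  using x by (auto simp: ktake_kjoin kdrop_kjoin) (auto simp: kspace_def kjoin_def)
next
 fix x assume "x \<in> {x \<in> kspace (mdim M + mdim N). ktake (mdim M) x \<in> \<phi> ` U \<and> kdrop (mdim M) x \<in> \<psi> ` V}"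
 then obtain a b where "a \<in> U" "b \<in> V" "ktake (mdim M) x = \<phi> a" "kdrop (mdim M) x = \<psi> b" by auto
 then have "x = pchart \<phi> \<psi> (a, b)" unfolding pchart_def by (metis fst_conv snd_conv kjoin_take_drop)
 then show "x \<in> pchart \<phi> \<psi> ` (U \<times> V)" using \<open>a \<in> U\<close> \<open>b \<in> V\<close> by blast
qed

lemma pchart_inj: "inj_on (pchart \<phi> \<psi>) (U \<times> V)"
proof (rule inj_onI, clarify)
 fix a b a' b' assume h: "a \<in> U" "b \<in> V" "a' \<in> U" "b' \<in> V" "pchart \<phi> \<psi> (a, b) = pchart \<phi> \<psi> (a', b')"
 have "\<phi> a = \<phi> a'" using arg_cong[OF h(5), of "ktake (mdim M)"] chart_kspace[OF M U] h by (simp add: pchart_def ktake_kjoin)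
 moreover have "\<psi> b = \<psi> b'" using arg_cong[OF h(5), of "kdrop (mdim M)"] by (simp add: pchart_def kdrop_kjoin)
 ultimately show "a = a' \<and> b = b'" using h chart_inj[OF M U] chart_inj[OF N V] by (meson inj_onD)
qed

lemma pchart_inv:
 assumes "x \<in> pchart \<phi> \<psi> ` (U \<times> V)"
 shows "inv_into (U \<times> V) (pchart \<phi> \<psi>) x = (inv_into U \<phi> (ktake (mdim M) x), inv_into V \<psi> (kdrop (mdim M) x))"
proof -
 obtain a b where x: "x = pchart \<phi> \<psi> (a, b)" "a \<in> U" "b \<in> V" using assms by auto
 then have "ktake (mdim M) x = \<phi> a" "kdrop (mdim M) x = \<psi> b"
  using chart_kspace[OF M U] by (auto simp: pchart_def ktake_kjoin kdrop_kjoin)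
 then show ?thesis
  using x by (simp add: inv_into_f_f[OF pchart_inj] chart_inv[OF M U] chart_inv[OF N V])
qed

lemma pchart_kopen: "kopen (mdim M + mdim N) (pchart \<phi> \<psi> ` (U \<times> V))"
proof -
 have "kopen (mdim M + mdim N) (kspace (mdim M + mdim N) \<inter> ktake (mdim M) -` (\<phi> ` U))"
  by (rule continuous_openin_preimage[OF continuous_on_ktake _ chart_image[OF M U]]) (auto simp: kspace_def ktake_def)
 moreover have "kopen (mdim M + mdim N) (kspace (mdim M + mdim N) \<inter> kdrop (mdim M) -` (\<psi> ` V))"
  by (rule continuous_openin_preimage[OF continuous_on_kdrop _ chart_image[OF N V]]) (auto simp: kspace_def kdrop_def)
 moreover have "pchart \<phi> \<psi> ` (U \<times> V) = (kspace (mdim M + mdim N) \<inter> ktake (mdim M) -` (\<phi> ` U)) \<inter> (kspace (mdim M + mdim N) \<inter> kdrop (mdim M) -` (\<psi> ` V))"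
  unfolding pchart_image by blast
 ultimately show ?thesis using openin_Int by metis
qed

lemma pchart_homeo: "homeomorphic_map (subtopology (mtop pm) (U \<times> V)) (top_of_set (pchart \<phi> \<psi> ` (U \<times> V))) (pchart \<phi> \<psi>)"
proof -
 let ?S = "pchart \<phi> \<psi> ` (U \<times> V)" and ?m = "mdim M"
 let ?X = "subtopology (mtop M) U" and ?Y = "subtopology (mtop N) V"
 have T: "subtopology (mtop pm) (U \<times> V) = prod_topology ?X ?Y"
  by (simp add: prod_simps subtopology_Times)
 have cM: "continuous_map ?X (top_of_set (\<phi> ` U)) \<phi>" "continuous_map (top_of_set (\<phi> ` U)) ?X (inv_into U \<phi>)"
  using chart_maps[OF M U] homeomorphic_maps_def by blast+
 have cN: "continuous_map ?Y (top_of_set (\<psi> ` V)) \<psi>" "continuous_map (top_of_set (\<psi> ` V)) ?Y (inv_into V \<psi>)"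
  using chart_maps[OF N V] homeomorphic_maps_def by blast+
 have comp: "continuous_map Z euclidean (%x. f x i)" if "continuous_map Z (top_of_set A) f" for Z :: "'c topology" and A :: "(nat => 'k) set" and f i
 proof -
  have "continuous_map Z (product_topology (%_. euclidean) UNIV) f"
   using that by (simp add: continuous_map_in_subtopology euclidean_product_topology)
  then show ?thesis by (simp add: continuous_map_componentwise_UNIV)
 qed
 have "continuous_map (prod_topology ?X ?Y) euclidean (%p. pchart \<phi> \<psi> p i)" for i
 proof (cases "i < ?m")
  case True
  have "continuous_map (prod_topology ?X ?Y) euclidean ((%x. \<phi> x i) \<circ> fst)"
   by (rule continuous_map_compose[OF continuous_map_fst comp[OF cM(1)]])
  then show ?thesis using True by (simp add: pchart_def kjoin_def o_def)
 next
  case False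
  have "continuous_map (prod_topology ?X ?Y) euclidean ((%x. \<psi> x (i - ?m)) \<circ> snd)"
   by (rule continuous_map_compose[OF continuous_map_snd comp[OF cN(1)]])
  then show ?thesis using False by (simp add: pchart_def kjoin_def o_def)
 qed
 then have "continuous_map (prod_topology ?X ?Y) (product_topology (%_. euclidean) UNIV) (pchart \<phi> \<psi>)"
  by (simp add: continuous_map_componentwise_UNIV)
 then have c1: "continuous_map (prod_topology ?X ?Y) (top_of_set ?S) (pchart \<phi> \<psi>)"
  by (auto simp: continuous_map_in_subtopology euclidean_product_topology)
 have c2: "continuous_map (top_of_set ?S) (prod_topology ?X ?Y) (%x. (inv_into U \<phi> (ktake ?m x), inv_into V \<psi> (kdrop ?m x)))"
 proof (rule continuous_map_pairedI)
  have "continuous_map (top_of_set ?S) (top_of_set (\<phi> ` U)) (ktake ?m)"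
   by (auto simp: continuous_map_in_subtopology continuous_on_ktake pchart_image)
  from continuous_map_compose[OF this cM(2)] show "continuous_map (top_of_set ?S) ?X (%x. inv_into U \<phi> (ktake ?m x))"
   by (simp add: o_def)
  have "continuous_map (top_of_set ?S) (top_of_set (\<psi> ` V)) (kdrop ?m)"
   by (auto simp: continuous_map_in_subtopology continuous_on_kdrop pchart_image)
  from continuous_map_compose[OF this cN(2)] show "continuous_map (top_of_set ?S) ?Y (%x. inv_into V \<psi> (kdrop ?m x))"
   by (simp add: o_def)
 qed
 have "homeomorphic_maps (prod_topology ?X ?Y) (top_of_set ?S) (pchart \<phi> \<psi>) (%x. (inv_into U \<phi> (ktake ?m x), inv_into V \<psi> (kdrop ?m x)))"
  unfolding homeomorphic_maps_def
 proof (intro conjI c1 c2 ballI)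
  fix p assume "p \<in> topspace (prod_topology ?X ?Y)"
  then have p: "p \<in> U \<times> V" by auto
  then show "(inv_into U \<phi> (ktake ?m (pchart \<phi> \<psi> p)), inv_into V \<psi> (kdrop ?m (pchart \<phi> \<psi> p))) = p"
   using pchart_inv[of "pchart \<phi> \<psi> p"] inv_into_f_f[OF pchart_inj p] by auto
 next
  fix x assume "x \<in> topspace (top_of_set ?S)"
  then have x: "x \<in> ?S" by simp
  show "pchart \<phi> \<psi> (inv_into U \<phi> (ktake ?m x), inv_into V \<psi> (kdrop ?m x)) = x"
   using pchart_inv[OF x] f_inv_into_f[OF x] by simp
 qed
 then show ?thesis unfolding T by (rule homeomorphic_maps_imp_map)
qed

end

lemma charted_prod: "charted pm"
 unfolding charted_def
proof (intro conjI ballI)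
 show "topspace (mtop pm) = (\<Union>(U, \<phi>)\<in>atlas pm. U)"
 proof (intro equalityI subsetI)
  fix p assume "p \<in> topspace (mtop pm)"
  then have "fst p \<in> topspace (mtop M)" "snd p \<in> topspace (mtop N)" by (auto simp: prod_simps)
  then obtain U \<phi> V \<psi> where "(U, \<phi>) \<in> atlas M" "fst p \<in> U" "(V, \<psi>) \<in> atlas N" "snd p \<in> V"
   using chart_at[OF M] chart_at[OF N] by meson
  then have "(U \<times> V, pchart \<phi> \<psi>) \<in> atlas pm" "p \<in> U \<times> V" unfolding prod_atlas by (blast, simp add: mem_Times_iff)
  then show "p \<in> (\<Union>(U, \<phi>)\<in>atlas pm. U)" by blast
 next
  fix p assume "p \<in> (\<Union>(U, \<phi>)\<in>atlas pm. U)"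
  then obtain U \<phi> V \<psi> where "(U, \<phi>) \<in> atlas M" "(V, \<psi>) \<in> atlas N" "p \<in> U \<times> V"
   unfolding prod_atlas by blast
  then show "p \<in> topspace (mtop pm)" using chart_subset[OF M] chart_subset[OF N] unfolding prod_simps topspace_prod_topology by blast
 qed
 fix c assume "c \<in> atlas pm"
 then obtain U V \<phi> \<psi> where c: "c = (U \<times> V, pchart \<phi> \<psi>)" and U: "(U, \<phi>) \<in> atlas M" and V: "(V, \<psi>) \<in> atlas N"
  unfolding prod_atlas by blast
 show "case c of (W, \<xi>) => openin (mtop pm) W \<and> kopen (mdim pm) (\<xi> ` W) \<and> homeomorphic_map (subtopology (mtop pm) W) (top_of_set (\<xi> ` W)) \<xi>"
  unfolding c prod.case
  using pchart_kopen[OF U V] pchart_homeo[OF U V] chart_open[OF M U] chart_open[OF N V]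
  unfolding prod_simps openin_prod_Times_iff by blast
qed

lemma smooth_fun_fst:
 assumes "smooth_fun M W f" "openin (mtop M) W"
 shows "smooth_fun pm (W \<times> topspace (mtop N)) (%p. f (fst p))"
 unfolding smooth_fun_def
proof (intro ballI, clarify)
 fix T \<xi> assume "(T, \<xi>) \<in> atlas pm"
 then obtain U V \<phi> \<psi> where c: "T = U \<times> V" "\<xi> = pchart \<phi> \<psi>" and U: "(U, \<phi>) \<in> atlas M" and V: "(V, \<psi>) \<in> atlas N"
  unfolding prod_atlas by blast
 have at: "(T, \<xi>) \<in> atlas pm" by fact
 have o: "kopen (mdim pm) (\<xi> ` (W \<times> topspace (mtop N) \<inter> T))"
  by (rule chart_open_image[OF charted_prod at]) (use assms(2) chart_open[OF charted_prod at] in \<open>auto simp: prod_simps openin_prod_Times_iff\<close>)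
 have inv: "inv_into T \<xi> x = (inv_into U \<phi> (ktake (mdim M) x), inv_into V \<psi> (kdrop (mdim M) x))" if "x \<in> \<xi> ` (W \<times> topspace (mtop N) \<inter> T)" for x
  unfolding c by (rule pchart_inv[OF U V]) (use that in \<open>auto simp: c\<close>)
 have "smooth_on (mdim pm) (\<xi> ` (W \<times> topspace (mtop N) \<inter> T)) (%x. f (inv_into U \<phi> (ktake (mdim M) x)))"
 proof (rule smooth_on_compose[OF o _ _ _ smooth_funD[OF M U assms(1)], where c = "ktake (mdim M)"])
  show "kopen (mdim M) (\<phi> ` (W \<inter> U))"
   by (rule chart_open_image[OF M U]) (use assms(2) chart_open[OF M U] in auto)
  show "ktake (mdim M) x \<in> \<phi> ` (W \<inter> U)" if "x \<in> \<xi> ` (W \<times> topspace (mtop N) \<inter> T)" for x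
   using that chart_kspace[OF M U] by (auto simp: c pchart_def ktake_kjoin)
  show "smooth_on (mdim pm) (\<xi> ` (W \<times> topspace (mtop N) \<inter> T)) (%x. ktake (mdim M) x j)" if "j < mdim M" for j
   using that by (simp add: ktake_def smooth_on_coord)
 qed
 then show "smooth_on (mdim pm) (\<xi> ` (W \<times> topspace (mtop N) \<inter> T)) (%x. f (fst (inv_into T \<xi> x)))"
  by (rule smooth_on_cong[OF o]) (simp add: inv)
qed

lemma smooth_fun_snd:
 assumes "smooth_fun N W f" "openin (mtop N) W"
 shows "smooth_fun pm (topspace (mtop M) \<times> W) (%p. f (snd p))"
 unfolding smooth_fun_def
proof (intro ballI, clarify)
 fix T \<xi> assume "(T, \<xi>) \<in> atlas pm"
 then obtain U V \<phi> \<psi> where c: "T = U \<times> V" "\<xi> = pchart \<phi> \<psi>" and U: "(U, \<phi>) \<in> atlas M" and V: "(V, \<psi>) \<in> atlas N"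
  unfolding prod_atlas by blast
 have at: "(T, \<xi>) \<in> atlas pm" by fact
 have o: "kopen (mdim pm) (\<xi> ` (topspace (mtop M) \<times> W \<inter> T))"
  by (rule chart_open_image[OF charted_prod at]) (use assms(2) chart_open[OF charted_prod at] in \<open>auto simp: prod_simps openin_prod_Times_iff\<close>)
 have inv: "inv_into T \<xi> x = (inv_into U \<phi> (ktake (mdim M) x), inv_into V \<psi> (kdrop (mdim M) x))" if "x \<in> \<xi> ` (topspace (mtop M) \<times> W \<inter> T)" for x
  unfolding c by (rule pchart_inv[OF U V]) (use that in \<open>auto simp: c\<close>)
 have "smooth_on (mdim pm) (\<xi> ` (topspace (mtop M) \<times> W \<inter> T)) (%x. f (inv_into V \<psi> (kdrop (mdim M) x)))"
 proof (rule smooth_on_compose[OF o _ _ _ smooth_funD[OF N V assms(1)], where c = "kdrop (mdim M)"])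
  show "kopen (mdim N) (\<psi> ` (W \<inter> V))"
   by (rule chart_open_image[OF N V]) (use assms(2) chart_open[OF N V] in auto)
  show "kdrop (mdim M) x \<in> \<psi> ` (W \<inter> V)" if "x \<in> \<xi> ` (topspace (mtop M) \<times> W \<inter> T)" for x
   using that by (auto simp: c pchart_def kdrop_kjoin)
  show "smooth_on (mdim pm) (\<xi> ` (topspace (mtop M) \<times> W \<inter> T)) (%x. kdrop (mdim M) x j)" for j
   by (simp add: kdrop_def smooth_on_coord)
 qed
 then show "smooth_on (mdim pm) (\<xi> ` (topspace (mtop M) \<times> W \<inter> T)) (%x. f (snd (inv_into T \<xi> x)))"
  by (rule smooth_on_cong[OF o]) (simp add: inv)
qed

lemma smooth_at_fst: "smooth_at M (fst p) f ==> snd p \<in> topspace (mtop N) ==> smooth_at pm p (%p. f (fst p))"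
proof -
 assume "smooth_at M (fst p) f" and p: "snd p \<in> topspace (mtop N)"
 then obtain W where W: "openin (mtop M) W" "fst p \<in> W" "smooth_fun M W f" unfolding smooth_at_def by blast
 show ?thesis unfolding smooth_at_def
  using smooth_fun_fst[OF W(3,1)] W p
  by (intro exI[of _ "W \<times> topspace (mtop N)"]) (auto simp: prod_simps openin_prod_Times_iff mem_Times_iff)
qed

lemma smooth_at_snd: "smooth_at N (snd p) f ==> fst p \<in> topspace (mtop M) ==> smooth_at pm p (%p. f (snd p))"
proof -
 assume "smooth_at N (snd p) f" and p: "fst p \<in> topspace (mtop M)"
 then obtain W where W: "openin (mtop N) W" "snd p \<in> W" "smooth_fun N W f" unfolding smooth_at_def by blast
 show ?thesis unfolding smooth_at_def
  using smooth_fun_snd[OF W(3,1)] W p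
  by (intro exI[of _ "topspace (mtop M) \<times> W"]) (auto simp: prod_simps openin_prod_Times_iff mem_Times_iff)
qed

end

lemma premfd_prod:
 assumes "premfd M" "premfd N"
 shows "premfd (prod_manifold M N)"
proof -
 note M = premfd_charted[OF assms(1)] and N = premfd_charted[OF assms(2)]
 note pa = prod_atlas[OF M N] and ps = prod_simps[OF M N]
 have "smooth_fun (prod_manifold M N) T (%x. \<xi> x i)" if T: "(T, \<xi>) \<in> atlas (prod_manifold M N)" "i < mdim M + mdim N" for T \<xi> i
 proof (rule smooth_fun_local[OF charted_prod[OF M N] chart_open[OF charted_prod[OF M N] T(1)]])
  obtain U V \<phi> \<psi> where c: "T = U \<times> V" "\<xi> = pchart M \<phi> \<psi>" and U: "(U, \<phi>) \<in> atlas M" and V: "(V, \<psi>) \<in> atlas N"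
   using T(1) unfolding pa by blast
  fix p assume p: "p \<in> T"
  have pt: "fst p \<in> topspace (mtop M)" "snd p \<in> topspace (mtop N)"
   using p chart_subset[OF M U] chart_subset[OF N V] by (auto simp: c)
  show "smooth_at (prod_manifold M N) p (%x. \<xi> x i)"
  proof (cases "i < mdim M")
   case True
   show ?thesis using smooth_at_fst[OF M N smooth_at_coord[OF assms(1) U _ True] pt(2)] p True
    by (auto simp: c pchart_def[OF M N] kjoin_def)
  next
   case False
   then have i: "i - mdim M < mdim N" using T(2) by simp
   show ?thesis using smooth_at_snd[OF M N smooth_at_coord[OF assms(2) V _ i] pt(1)] p False
    by (auto simp: c pchart_def[OF M N] kjoin_def)
  qed
 qed
 then show ?thesis unfolding premfd_def ps using charted_prod[OF M N] by blast
qed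

lemma smooth_map_fst:
 assumes "premfd M" "premfd N" shows "smooth_map (prod_manifold M N) M fst"
proof -
 note M' = premfd_charted[OF assms(1)] and N' = premfd_charted[OF assms(2)]
 show ?thesis
 proof (rule smooth_mapI[OF charted_prod[OF M' N'] M'])
  show "continuous_map (mtop (prod_manifold M N)) (mtop M) fst"
   unfolding prod_simps[OF M' N'] by (rule continuous_map_fst)
  fix p V \<psi> i assume "p \<in> topspace (mtop (prod_manifold M N))" "(V, \<psi>) \<in> atlas M" "fst p \<in> V" "i < mdim M"
  then show "smooth_at (prod_manifold M N) p (%x. \<psi> (fst x) i)"
   using smooth_at_fst[OF M' N', of p "%x. \<psi> x i"] smooth_at_coord[OF assms(1)]
   by (auto simp: prod_simps[OF M' N'])
 qed
qed

lemma smooth_map_snd: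
 assumes "premfd M" "premfd N" shows "smooth_map (prod_manifold M N) N snd"
proof -
 note M' = premfd_charted[OF assms(1)] and N' = premfd_charted[OF assms(2)]
 show ?thesis
 proof (rule smooth_mapI[OF charted_prod[OF M' N'] N'])
  show "continuous_map (mtop (prod_manifold M N)) (mtop N) snd"
   unfolding prod_simps[OF M' N'] by (rule continuous_map_snd)
  fix p V \<psi> i assume "p \<in> topspace (mtop (prod_manifold M N))" "(V, \<psi>) \<in> atlas N" "snd p \<in> V" "i < mdim N"
  then show "smooth_at (prod_manifold M N) p (%x. \<psi> (snd x) i)"
   using smooth_at_snd[OF M' N', of p "%x. \<psi> x i"] smooth_at_coord[OF assms(2)]
   by (auto simp: prod_simps[OF M' N'])
 qed
qed

lemma smooth_map_pair:
 assumes P: "charted P" and M: "charted M" and N: "charted N" and F: "smooth_map P M F" and E: "smooth_map P N E"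
 shows "smooth_map P (prod_manifold M N) (%x. (F x, E x))"
proof (rule smooth_mapI[OF P charted_prod[OF M N]])
 show "continuous_map (mtop P) (mtop (prod_manifold M N)) (%x. (F x, E x))"
  unfolding prod_simps[OF M N] by (intro continuous_map_pairedI smooth_map_continuous F E)
 fix p T \<xi> i assume h: "p \<in> topspace (mtop P)" "(T, \<xi>) \<in> atlas (prod_manifold M N)" "(F p, E p) \<in> T" "i < mdim (prod_manifold M N)"
 obtain U V \<phi> \<psi> where c: "T = U \<times> V" "\<xi> = pchart M \<phi> \<psi>" and U: "(U, \<phi>) \<in> atlas M" and V: "(V, \<psi>) \<in> atlas N"
  using h(2) unfolding prod_atlas[OF M N] by blast
 show "smooth_at P p (%x. \<xi> (F x, E x) i)"
 proof (cases "i < mdim M")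
  case True
  then have "smooth_at P p (%x. \<phi> (F x) i)" using smooth_map_coord[OF M F h(1) U] h(3) c(1) by blast
  then show ?thesis using True by (simp add: c pchart_def[OF M N] kjoin_def)
 next
  case False
  then have "i - mdim M < mdim N" using h(4) by (simp add: prod_simps[OF M N])
  then have "smooth_at P p (%x. \<psi> (E x) (i - mdim M))" using smooth_map_coord[OF N E h(1) V] h(3) c(1) by blast
  then show ?thesis using False by (simp add: c pchart_def[OF M N] kjoin_def)
 qed
qed

subsection \<open>Hadamard's lemma on manifolds\<close>

lemma hadamard_manifold:
 fixes f :: "'a => 'k::{real_normed_field,banach}"
 assumes M: "premfd M" and U: "(U, \<phi>) \<in> atlas M" "p \<in> U" and f: "smooth_at M p f" and m: "m \<le> mdim M"
 shows "\<exists>W g. openin (mtop M) W \<and> p \<in> W \<and> W \<subseteq> U \<and> (\<forall>j<mdim M. smooth_fun M W (g j)) \<and>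
  (\<forall>q\<in>W. f q = f (inv_into U \<phi> (shrink m (\<phi> p) 0 (\<phi> q))) + (\<Sum>j=m..<mdim M. (\<phi> q j - \<phi> p j) * g j q))"
proof -
 note M' = premfd_charted[OF M]
 let ?n = "mdim M"
 obtain W0 where W0: "openin (mtop M) W0" "p \<in> W0" "smooth_fun M W0 f" using f unfolding smooth_at_def by blast
 have o: "kopen ?n (\<phi> ` (W0 \<inter> U))"
  by (rule chart_open_image[OF M' U(1)]) (use W0 chart_open[OF M' U(1)] in auto)
 obtain e g where e: "e > 0" "kbox ?n (\<phi> p) e \<subseteq> \<phi> ` (W0 \<inter> U)" and g: "\<forall>j<?n. smooth_on ?n (kbox ?n (\<phi> p) e) (g j)"
  "\<forall>x\<in>kbox ?n (\<phi> p) e. f (inv_into U \<phi> x) = f (inv_into U \<phi> (shrink m (\<phi> p) 0 x)) + (\<Sum>j=m..<?n. (x j - \<phi> p j) * g j x)"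
 proof -
  have "\<phi> p \<in> \<phi> ` (W0 \<inter> U)" using W0(2) U(2) by blast
  from hadamard[OF o this smooth_funD[OF M' U(1) W0(3)] m] show thesis
   by (elim exE conjE) (rule that; assumption)
 qed
 define W where "W = {q \<in> U. \<phi> q \<in> kbox ?n (\<phi> p) e}"
 have W: "openin (mtop M) W" unfolding W_def by (rule chart_open_preimage[OF M' U(1) kopen_kbox])
 have im: "\<phi> ` W = kbox ?n (\<phi> p) e" using e(2) by (auto simp: W_def)
 have "smooth_fun M W (%q. g j (\<phi> q))" if "j < ?n" for j
 proof (rule smooth_fun_chartI[OF M U(1) W])
  show "smooth_on ?n (\<phi> ` W) (%x. g j (\<phi> (inv_into U \<phi> x)))"
   by (rule smooth_on_cong[where f = "g j"]) (use g(1) that e(2) f_inv_into_f[of _ \<phi> U] in \<open>auto simp: im kopen_kbox subset_iff\<close>)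
 qed (auto simp: W_def)
 moreover have "f q = f (inv_into U \<phi> (shrink m (\<phi> p) 0 (\<phi> q))) + (\<Sum>j=m..<?n. (\<phi> q j - \<phi> p j) * g j (\<phi> q))" if "q \<in> W" for q
 proof -
  have "\<phi> q \<in> kbox ?n (\<phi> p) e" "q \<in> U" using that by (auto simp: W_def)
  then show ?thesis using bspec[OF g(2), of "\<phi> q"] chart_inv[OF M' U(1), of q] by simp
 qed
 moreover have "p \<in> W" using U(2) center_in_kbox[OF chart_kspace[OF M' U] e(1)] by (simp add: W_def)
 ultimately show ?thesis using W by (intro exI[of _ W] exI[of _ "%j q. g j (\<phi> q)"]) (auto simp: W_def)
qed

lemma hadamard_point:
 fixes f :: "'a => 'k::{real_normed_field,banach}"
 assumes M: "premfd M" and U: "(U, \<phi>) \<in> atlas M" "p \<in> U" and f: "smooth_at M p f"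
 shows "\<exists>W g. openin (mtop M) W \<and> p \<in> W \<and> W \<subseteq> U \<and> (\<forall>j<mdim M. smooth_fun M W (g j)) \<and>
  (\<forall>q\<in>W. f q = f p + (\<Sum>j<mdim M. (\<phi> q j - \<phi> p j) * g j q))"
proof -
 have "shrink 0 (\<phi> p) 0 x = \<phi> p" for x by (simp add: shrink_def)
 then show ?thesis
  using hadamard_manifold[OF M U f, of 0] unfolding lessThan_atLeast0 chart_inv[OF premfd_charted[OF M] U]
  by (simp only: chart_inv[OF premfd_charted[OF M] U])
qed

text \<open>Freezing the first \<open>mdim M\<close> coordinates makes the point of the first factor
  a parameter: the expansion is in the second variable about \<open>b\<close>, with coefficients
  smooth in both.\<close>

lemma hadamard_prod:
 fixes F :: "'a \<times> 'b => 'k::{real_normed_field,banach}"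
 assumes M: "premfd M" and N: "premfd N" and V: "(V, \<psi>) \<in> atlas N" "b \<in> V"
  and F: "smooth_at (prod_manifold M N) (a, b) F"
 shows "\<exists>W g. openin (mtop (prod_manifold M N)) W \<and> (a, b) \<in> W \<and> W \<subseteq> topspace (mtop M) \<times> V \<and>
  (\<forall>j<mdim N. smooth_fun (prod_manifold M N) W (g j)) \<and>
  (\<forall>(x, h)\<in>W. F (x, h) = F (x, b) + (\<Sum>j<mdim N. (\<psi> h j - \<psi> b j) * g j (x, h)))"
proof -
 note M' = premfd_charted[OF M] and N' = premfd_charted[OF N]
 let ?P = "prod_manifold M N"
 have "a \<in> topspace (mtop M)" using smooth_at_topspace[OF F] by (simp add: prod_simps[OF M' N'])
 then obtain U \<phi> where U: "(U, \<phi>) \<in> atlas M" "a \<in> U" using chart_at[OF M'] by blast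
 let ?\<xi> = "pchart M \<phi> \<psi>"
 have c: "(U \<times> V, ?\<xi>) \<in> atlas ?P" using U V by (auto simp: prod_atlas[OF M' N'])
 have "mdim M \<le> mdim ?P" by (simp add: prod_simps[OF M' N'])
 note H = hadamard_manifold[OF premfd_prod[OF M N] c _ F this]
 have "(a, b) \<in> U \<times> V" using U V by simp
 from H[OF this]
 obtain W g where W: "openin (mtop ?P) W" "(a, b) \<in> W" "W \<subseteq> U \<times> V"
  "\<forall>j<mdim ?P. smooth_fun ?P W (g j)"
  "\<forall>q\<in>W. F q = F (inv_into (U \<times> V) ?\<xi> (shrink (mdim M) (?\<xi> (a, b)) 0 (?\<xi> q))) + (\<Sum>j=mdim M..<mdim ?P. (?\<xi> q j - ?\<xi> (a, b) j) * g j q)"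
  by (elim exE conjE) (rule that; assumption)
 have sh: "shrink (mdim M) (?\<xi> (a, b)) 0 (?\<xi> (x, h)) = ?\<xi> (x, b)" for x h
  by (auto simp: shrink_def pchart_def[OF M' N'] kjoin_def fun_eq_iff)
 have "F (x, h) = F (x, b) + (\<Sum>j<mdim N. (\<psi> h j - \<psi> b j) * g (j + mdim M) (x, h))" if "(x, h) \<in> W" for x h
 proof -
  have xh: "x \<in> U" "h \<in> V" using that W(3) by auto
  have "inv_into (U \<times> V) ?\<xi> (?\<xi> (x, b)) = (x, b)"
   by (rule inv_into_f_f[OF pchart_inj[OF M' N' U(1) V(1)]]) (use xh V in auto)
  then have "F (x, h) = F (x, b) + (\<Sum>j=mdim M..<mdim ?P. (?\<xi> (x, h) j - ?\<xi> (a, b) j) * g j (x, h))"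
   using bspec[OF W(5) that] sh by simp
  also have "(\<Sum>j=mdim M..<mdim ?P. (?\<xi> (x, h) j - ?\<xi> (a, b) j) * g j (x, h)) = (\<Sum>j<mdim N. (\<psi> h j - \<psi> b j) * g (j + mdim M) (x, h))"
   using sum.shift_bounds_nat_ivl[of "%j. (?\<xi> (x, h) j - ?\<xi> (a, b) j) * g j (x, h)" 0 "mdim M" "mdim N"]
   by (simp add: prod_simps[OF M' N'] add.commute lessThan_atLeast0 pchart_def[OF M' N'] kjoin_def)
  finally show ?thesis .
 qed
 then show ?thesis using W(1-4) chart_subset[OF M' U(1)]
  by (intro exI[of _ W] exI[of _ "%j. g (j + mdim M)"]) (auto simp: prod_simps[OF M' N'])
qed

section \<open>Left invariant derivations on a Lie group\<close>

locale lie =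
 fixes G :: "('a, 'k::{real_normed_field,banach}) lie_group" (structure)
 assumes lie: "is_lie_group G"
begin

abbreviation "M \<equiv> mfd G"
abbreviation "L \<equiv> lie_algebra G"
abbreviation "nG \<equiv> mdim (mfd G)"
abbreviation "sm f \<equiv> smooth_at M \<one> f"

sublocale group G
 using lie by (simp add: is_lie_group_def)

lemma pM: "premfd M"
 using lie by (simp add: is_lie_group_def is_manifold_premfd)

lemma cM: "charted M"
 using pM by (rule premfd_charted)

lemma top: "topspace (mtop M) = carrier G"
 using lie by (simp add: is_lie_group_def)

lemma open_carrier: "openin (mtop M) (carrier G)"
 using top openin_topspace by metis

lemma pMM: "premfd (prod_manifold M M)"
 by (rule premfd_prod[OF pM pM])

lemmas cMM = premfd_charted[OF pMM]

lemma topP: "topspace (mtop (prod_manifold P M)) = topspace (mtop P) \<times> carrier G"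
 by (simp add: prod_manifold_def top)

lemma smooth_mult:
 assumes P: "charted P" and "smooth_map P M F" "smooth_map P M E"
 shows "smooth_map P M (%x. F x \<otimes> E x)"
 using smooth_map_compose[OF P charted_prod[OF cM cM] cM smooth_map_pair[OF P cM cM assms(2,3)], of "%(x, y). x \<otimes> y"] lie
 by (simp add: is_lie_group_def)

lemma smooth_inv:
 assumes P: "charted P" and "smooth_map P M F"
 shows "smooth_map P M (%x. inv (F x))"
 using smooth_map_compose[OF P cM cM assms(2), of "%x. inv x"] lie by (simp add: is_lie_group_def)

lemma smooth_id: "smooth_map M M (%x. x)"
 by (rule smooth_map_id[OF pM])

lemma smooth_const: "charted P ==> c \<in> carrier G ==> smooth_map P M (%_. c)"
 by (rule smooth_map_const[OF _ cM]) (simp_all add: top)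

lemma sm_compose:
 assumes "smooth_map M M F" "F p = q" "p \<in> carrier G" "smooth_at M q f"
 shows "smooth_at M p (%x. f (F x))"
 using smooth_at_compose[OF cM cM assms(1), of p f] assms top by simp

lemma sm_left: "a \<in> carrier G ==> x \<in> carrier G ==> smooth_at M (a \<otimes> x) f ==> smooth_at M x (%h. f (a \<otimes> h))"
 by (rule sm_compose[OF smooth_mult[OF cM smooth_const[OF cM] smooth_id]]) auto

lemma sm_left_one: "a \<in> carrier G ==> smooth_at M a f ==> sm (%h. f (a \<otimes> h))"
 by (rule sm_left) auto

lemma sm_conj: "a \<in> carrier G ==> sm f ==> sm (%h. f (a \<otimes> h \<otimes> inv a))"
 by (rule sm_compose[OF smooth_mult[OF cM smooth_mult[OF cM smooth_const[OF cM] smooth_id] smooth_const[OF cM]]]) auto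

lemma smooth_at_carrier: "smooth_at M p f ==> p \<in> carrier G"
 using smooth_at_topspace top by metis

lemma slice_snd:
 assumes "premfd P" "smooth_at (prod_manifold P M) (a, h) f"
 shows "smooth_at M h (%h. f (a, h))"
proof -
 have t: "a \<in> topspace (mtop P)" "h \<in> topspace (mtop M)" using smooth_at_topspace[OF assms(2)] by (auto simp: topP top)
 show ?thesis
  by (rule smooth_at_compose[OF cM charted_prod[OF premfd_charted[OF assms(1)] cM]
     smooth_map_pair[OF cM premfd_charted[OF assms(1)] cM smooth_map_const[OF cM premfd_charted[OF assms(1)] t(1)] smooth_id] t(2) assms(2)])
qed

lemma slice_fst:
 assumes "premfd P" "smooth_at (prod_manifold P M) (a, h) f"
 shows "smooth_at P a (%a. f (a, h))"
proof -
 note cP = premfd_charted[OF assms(1)]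
 have t: "a \<in> topspace (mtop P)" "h \<in> carrier G" using smooth_at_topspace[OF assms(2)] by (auto simp: topP)
 show ?thesis
  by (rule smooth_at_compose[OF cP charted_prod[OF cP cM]
     smooth_map_pair[OF cP cP cM smooth_map_id[OF assms(1)] smooth_const[OF cP t(2)]] t(1) assms(2)])
qed

subsection \<open>Derivations\<close>

text \<open>When \<open>f\<close> is not smooth near the identity, neither is \<open>g\<close>, and
  both values are the default 0.\<close>

lemma der_germ:
 assumes "v \<in> L" "openin (mtop M) W" "\<one> \<in> W" "\<And>x. x \<in> W ==> f x = g x"
 shows "v f = v g"
proof (cases "sm f")
 case True
 then have "sm g" using smooth_at_cong[OF cM assms(2,3), of f g] assms(4) by blast
 moreover have "\<exists>U. openin (gtop G) U \<and> \<one> \<in> U \<and> (\<forall>x\<in>U. f x = g x)" using assms by blast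
 ultimately show ?thesis using True assms(1) unfolding lie_algebra_def smooth_near_one_iff by simp
next
 case False
 then have "\<not> sm g" using smooth_at_cong[OF cM assms(2,3), of f g] assms(4) by blast
 then show ?thesis using False assms unfolding lie_algebra_def smooth_near_one_iff by simp
qed

lemma der_cong: "v \<in> L ==> (\<And>x. x \<in> carrier G ==> f x = g x) ==> v f = v g"
 by (rule der_germ[OF _ open_carrier]) auto

lemma der_not: "v \<in> L ==> \<not> sm f ==> v f = 0"
 unfolding lie_algebra_def smooth_near_one_iff by simp

lemma der_add: "v \<in> L ==> sm f ==> sm g ==> v (%x. f x + g x) = v f + v g"
 unfolding lie_algebra_def smooth_near_one_iff by simp

lemma der_mult: "v \<in> L ==> sm f ==> sm g ==> v (%x. f x * g x) = v f * g \<one> + f \<one> * v g"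
 unfolding lie_algebra_def smooth_near_one_iff by simp

lemma der_cmult: "v \<in> L ==> sm f ==> v (%x. c * f x) = c * v f"
 unfolding lie_algebra_def smooth_near_one_iff by simp

lemma sm_const: "sm (%_. c)"
 by (rule smooth_at_const) (simp add: top)

lemma der_const: "v \<in> L ==> v (%_. c) = 0"
proof -
 assume v: "v \<in> L"
 have "v (%_. 1 * 1) = v (%_. 1) * 1 + 1 * v (%_. 1)" by (rule der_mult[OF v sm_const sm_const])
 then have "v (%_. 1) = 0" by simp
 then show ?thesis using der_cmult[OF v sm_const, of c 1] by simp
qed

lemma der_sum:
 assumes v: "v \<in> L" and "finite I" "\<And>i. i \<in> I ==> sm (f i)"
 shows "v (%x. \<Sum>i\<in>I. f i x) = (\<Sum>i\<in>I. v (f i))"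
 using assms(2,3)
proof (induction I rule: finite_induct)
 case empty then show ?case by (simp add: der_const[OF v])
next
 case (insert i I)
 have "sm (%x. \<Sum>i\<in>I. f i x)" by (rule smooth_at_sum) (use insert in \<open>auto simp: top\<close>)
 then show ?case using insert by (simp add: der_add[OF v])
qed

lemma der_diff: "v \<in> L ==> sm f ==> sm g ==> v (%x. f x - g x) = v f - v g"
 using der_add[of v f "%x. - 1 * g x"] der_cmult[of v g "-1"] smooth_at_cmult[of M \<one> g "-1"] by simp

text \<open>Every \<open>y j\<close> vanishes at the identity, so the product rule keeps only the
  terms in which the derivation hits \<open>y j\<close>.\<close>

lemma der_hadamard:
 fixes n :: nat
 assumes v: "v \<in> L" and W: "openin (mtop M) W" "\<one> \<in> W"
  and f: "\<And>q. q \<in> W ==> f q = c + (\<Sum>j<n. y j q * g j q)"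
  and y: "\<And>j. j < n ==> sm (y j)" "\<And>j. j < n ==> y j \<one> = 0" and g: "\<And>j. j < n ==> sm (g j)"
 shows "v f = (\<Sum>j<n. v (y j) * g j \<one>)" "sm f"
proof -
 have s: "sm (%q. \<Sum>j<n. y j q * g j q)" by (rule smooth_at_sum[OF finite_lessThan]) (auto simp: top y g intro: smooth_at_mult)
 have "v f = v (%q. c + (\<Sum>j<n. y j q * g j q))" by (rule der_germ[OF v W]) (rule f)
 also have "\<dots> = (\<Sum>j<n. v (%q. y j q * g j q))"
  using der_add[OF v sm_const s] der_const[OF v] der_sum[OF v, of "{..<n}" "%j q. y j q * g j q"] y g
  by (simp add: smooth_at_mult)
 also have "\<dots> = (\<Sum>j<n. v (y j) * g j \<one>)"
  by (rule sum.cong) (simp_all add: der_mult[OF v] y g)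
 finally show "v f = (\<Sum>j<n. v (y j) * g j \<one>)" .
 show "sm f" using smooth_at_cong[OF cM W, of f "%q. c + (\<Sum>j<n. y j q * g j q)"] f smooth_at_add[OF sm_const s] by blast
qed

definition chart1 :: "'a set \<times> ('a => nat => 'k)" where
 "chart1 = (SOME c. c \<in> atlas M \<and> \<one> \<in> fst c)"

definition U1 where "U1 = fst chart1"
definition phi1 where "phi1 = snd chart1"
definition crd :: "nat => 'a => 'k" where "crd j h = phi1 h j - phi1 \<one> j"

lemma chart1: "(U1, phi1) \<in> atlas M" "\<one> \<in> U1"
proof -
 obtain U \<phi> where "(U, \<phi>) \<in> atlas M" "\<one> \<in> U" using chart_at[OF cM, of \<one>] top by auto
 then have "\<exists>c. c \<in> atlas M \<and> \<one> \<in> fst c" by (metis fst_conv)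
 then have "chart1 \<in> atlas M \<and> \<one> \<in> fst chart1" unfolding chart1_def by (rule someI_ex)
 then show "(U1, phi1) \<in> atlas M" "\<one> \<in> U1" by (simp_all add: U1_def phi1_def)
qed

lemma sm_coord1: "j < nG ==> p \<in> U1 ==> smooth_at M p (%h. phi1 h j)"
 by (rule smooth_at_coord[OF pM chart1(1)])

lemma sm_crd_at: "j < nG ==> p \<in> U1 ==> smooth_at M p (crd j)"
 unfolding crd_def
 by (intro smooth_at_diff sm_coord1 smooth_at_const) (use chart_subset[OF cM chart1(1)] in auto)

lemma sm_crd: "j < nG ==> sm (crd j)"
 by (rule sm_crd_at[OF _ chart1(2)])

lemma crd_one [simp]: "crd j \<one> = 0"
 by (simp add: crd_def)

text \<open>A product neighbourhood \<open>A \<times> B\<close> makes one expansion in the group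
  variable available for all parameters in \<open>A\<close> at once.\<close>

lemma param:
 assumes P: "premfd P" and F: "smooth_at (prod_manifold P M) (a, \<one>) F"
 shows "\<exists>A B g. openin (mtop P) A \<and> a \<in> A \<and> openin (mtop M) B \<and> \<one> \<in> B \<and>
  (\<forall>j<nG. \<forall>x\<in>A. \<forall>h\<in>B. smooth_at (prod_manifold P M) (x, h) (g j)) \<and>
  (\<forall>x\<in>A. \<forall>h\<in>B. F (x, h) = F (x, \<one>) + (\<Sum>j<nG. crd j h * g j (x, h)))"
proof -
 from hadamard_prod[OF P pM chart1 F]
 obtain W g where W: "openin (mtop (prod_manifold P M)) W" "(a, \<one>) \<in> W"
  "\<forall>j<nG. smooth_fun (prod_manifold P M) W (g j)"
  "\<forall>(x, h)\<in>W. F (x, h) = F (x, \<one>) + (\<Sum>j<nG. (phi1 h j - phi1 \<one> j) * g j (x, h))"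
  by (elim exE conjE) (rule that; assumption)
 obtain A B where AB: "openin (mtop P) A" "openin (mtop M) B" "a \<in> A" "\<one> \<in> B" "A \<times> B \<subseteq> W"
 proof -
  have "\<forall>x y. (x, y) \<in> W \<longrightarrow> (\<exists>U V. openin (mtop P) U \<and> openin (mtop M) V \<and> x \<in> U \<and> y \<in> V \<and> U \<times> V \<subseteq> W)"
   using W(1) by (simp add: prod_manifold_def openin_prod_topology_alt)
  then show thesis using W(2) that by blast
 qed
 have 1: "smooth_at (prod_manifold P M) (x, h) (g j)" if "j < nG" "x \<in> A" "h \<in> B" for j x h
  unfolding smooth_at_def using W(1,3) AB(5) that by blast
 have 2: "F (x, h) = F (x, \<one>) + (\<Sum>j<nG. crd j h * g j (x, h))" if "x \<in> A" "h \<in> B" for x h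
  using W(4) AB(5) that unfolding crd_def by fast
 show ?thesis
 proof (intro exI conjI)
  show "openin (mtop P) A" "a \<in> A" "openin (mtop M) B" "\<one> \<in> B" by fact+
  show "\<forall>j<nG. \<forall>x\<in>A. \<forall>h\<in>B. smooth_at (prod_manifold P M) (x, h) (g j)" using 1 by simp
  show "\<forall>x\<in>A. \<forall>h\<in>B. F (x, h) = F (x, \<one>) + (\<Sum>j<nG. crd j h * g j (x, h))" using 2 by fast
 qed
qed

lemma param_deriv:
 assumes P: "premfd P" and A: "x \<in> A" and B: "openin (mtop M) B" "\<one> \<in> B"
  and g: "\<forall>j<nG. \<forall>x\<in>A. \<forall>h\<in>B. smooth_at (prod_manifold P M) (x, h) (g j)"
  and F: "\<forall>x\<in>A. \<forall>h\<in>B. F (x, h) = F (x, \<one>) + (\<Sum>j<nG. crd j h * g j (x, h))" and v: "v \<in> L"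
 shows "v (%h. F (x, h)) = (\<Sum>j<nG. v (crd j) * g j (x, \<one>))"
 by (rule der_hadamard(1)[OF v B, where c = "F (x, \<one>)" and y = crd and g = "%j h. g j (x, h)"])
  (use F A in blast, auto simp: sm_crd intro!: slice_snd[OF P] g[rule_format, OF _ A B(2)])

text \<open>By \<open>param\<close> the derivative in the group variable is a fixed combination of
  the coefficients \<open>g j (x, \<one>)\<close>, which are smooth in the parameter. Smoothness of
  left invariant fields and of \<open>Ad\<close> comes from here.\<close>

lemma smooth_param:
 assumes P: "premfd P" and F: "smooth_at (prod_manifold P M) (a, \<one>) F" and v: "v \<in> L"
 shows "smooth_at P a (%x. v (%h. F (x, h)))"
proof -
 obtain A B g where A: "openin (mtop P) A" "a \<in> A" and B: "openin (mtop M) B" "\<one> \<in> B"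
  and g: "\<forall>j<nG. \<forall>x\<in>A. \<forall>h\<in>B. smooth_at (prod_manifold P M) (x, h) (g j)"
  and Fg: "\<forall>x\<in>A. \<forall>h\<in>B. F (x, h) = F (x, \<one>) + (\<Sum>j<nG. crd j h * g j (x, h))"
  using param[OF P F] by (elim exE conjE) (rule that; assumption)
 have "smooth_at P a (%x. \<Sum>j<nG. v (crd j) * g j (x, \<one>))"
  by (intro smooth_at_sum smooth_at_cmult slice_fst[OF P] g[rule_format, OF _ A(2) B(2)])
   (use A openin_subset in auto)
 then show ?thesis
  using smooth_at_cong[OF premfd_charted[OF P] A, of "%x. v (%h. F (x, h))" "%x. \<Sum>j<nG. v (crd j) * g j (x, \<one>)"]
   param_deriv[OF P _ B g Fg v] by blast
qed

lemma smooth_swap: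
 assumes F: "smooth_at (prod_manifold M M) (a, b) F"
 shows "smooth_at (prod_manifold M M) (b, a) (%p. F (snd p, fst p))"
proof -
 have t: "(b, a) \<in> topspace (mtop (prod_manifold M M))" using smooth_at_topspace[OF F] by (auto simp: topP top)
 show ?thesis
  using smooth_at_compose[OF cMM cMM smooth_map_pair[OF cMM cM cM smooth_map_snd[OF pM pM] smooth_map_fst[OF pM pM]] t, of F] F by simp
qed

text \<open>Symmetry of mixed derivatives: after Hadamard expansion both sides are the sum over
  \<open>j\<close> of \<open>w (crd j)\<close> times the \<open>v\<close>-derivative of
  \<open>g j\<close> in the first variable.\<close>

lemma der_commute:
 assumes F: "smooth_at (prod_manifold M M) (\<one>, \<one>) F" and v: "v \<in> L" and w: "w \<in> L"
 shows "v (%g. w (%h. F (g, h))) = w (%h. v (%g. F (g, h)))"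
proof -
 obtain A B g where A: "openin (mtop M) A" "\<one> \<in> A" and B: "openin (mtop M) B" "\<one> \<in> B"
  and g: "\<forall>j<nG. \<forall>x\<in>A. \<forall>h\<in>B. smooth_at (prod_manifold M M) (x, h) (g j)"
  and Fg: "\<forall>x\<in>A. \<forall>h\<in>B. F (x, h) = F (x, \<one>) + (\<Sum>j<nG. crd j h * g j (x, h))"
  using param[OF pM F] by (elim exE conjE) (rule that; assumption)
 have g1: "sm (%x. g j (x, h))" if "j < nG" "h \<in> B" for j h
  by (rule slice_fst[OF pM]) (use g A that in blast)
 have "v (%x. w (%h. F (x, h))) = v (%x. \<Sum>j<nG. w (crd j) * g j (x, \<one>))"
  by (rule der_germ[OF v A]) (rule param_deriv[OF pM _ B g Fg w])
 also have "\<dots> = (\<Sum>j<nG. w (crd j) * v (%x. g j (x, \<one>)))"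
  using der_sum[OF v, of "{..<nG}" "%j x. w (crd j) * g j (x, \<one>)"]
  by (simp add: smooth_at_cmult g1 B der_cmult[OF v])
 finally have 1: "v (%x. w (%h. F (x, h))) = (\<Sum>j<nG. w (crd j) * v (%x. g j (x, \<one>)))" .
 have F1: "sm (%x. F (x, \<one>))" by (rule slice_fst[OF pM F])
 have "w (%h. v (%x. F (x, h))) = (\<Sum>j<nG. w (crd j) * v (%x. g j (x, \<one>)))"
 proof (rule der_hadamard(1)[OF w B, where c = "v (%x. F (x, \<one>))" and y = crd and g = "%j h. v (%x. g j (x, h))"])
  fix h assume h: "h \<in> B"
  have "v (%x. F (x, h)) = v (%x. F (x, \<one>) + (\<Sum>j<nG. crd j h * g j (x, h)))"
   by (rule der_germ[OF v A]) (use Fg h in blast)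
  also have "\<dots> = v (%x. F (x, \<one>)) + (\<Sum>j<nG. v (%x. crd j h * g j (x, h)))"
   using der_add[OF v F1, of "%x. \<Sum>j<nG. crd j h * g j (x, h)"] der_sum[OF v, of "{..<nG}" "%j x. crd j h * g j (x, h)"]
    smooth_at_sum[of "{..<nG}" \<one> M "%j x. crd j h * g j (x, h)"] g1[OF _ h]
   by (simp add: smooth_at_cmult top)
  also have "\<dots> = v (%x. F (x, \<one>)) + (\<Sum>j<nG. crd j h * v (%x. g j (x, h)))"
   using g1[OF _ h] by (simp add: der_cmult[OF v])
  finally show "v (%x. F (x, h)) = v (%x. F (x, \<one>)) + (\<Sum>j<nG. crd j h * v (%x. g j (x, h)))" .
 next
  fix j assume j: "j < nG"
  have "smooth_at (prod_manifold M M) (\<one>, \<one>) (g j)" using g j A B by blast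
  from smooth_param[OF pM smooth_swap[OF this] v] show "sm (%h. v (%x. g j (x, h)))" by simp
 qed (simp_all add: sm_crd)
 then show ?thesis using 1 by simp
qed

text \<open>The difference \<open>F (h, h) - F (h, \<one>)\<close> is a Hadamard sum in
  \<open>crd j h\<close>; its derivative involves only the coefficients at the identity and
  therefore equals that of \<open>F (\<one>, h)\<close>.\<close>

lemma der_diag:
 assumes F: "smooth_at (prod_manifold M M) (\<one>, \<one>) F" and v: "v \<in> L"
 shows "v (%h. F (h, h)) = v (%h. F (h, \<one>)) + v (%h. F (\<one>, h))"
proof -
 obtain A B g where A: "openin (mtop M) A" "\<one> \<in> A" and B: "openin (mtop M) B" "\<one> \<in> B"
  and g: "\<forall>j<nG. \<forall>x\<in>A. \<forall>h\<in>B. smooth_at (prod_manifold M M) (x, h) (g j)"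
  and Fg: "\<forall>x\<in>A. \<forall>h\<in>B. F (x, h) = F (x, \<one>) + (\<Sum>j<nG. crd j h * g j (x, h))"
  using param[OF pM F] by (elim exE conjE) (rule that; assumption)
 have gd: "sm (%h. g j (h, h))" if j: "j < nG" for j
 proof -
  have "smooth_at (prod_manifold M M) (\<one>, \<one>) (g j)" using g j A B by blast
  then show ?thesis
   using smooth_at_compose[OF cM cMM smooth_map_pair[OF cM cM cM smooth_id smooth_id], of \<one> "g j"] by (simp add: top)
 qed
 have Fd: "sm (%h. F (h, h))"
  by (rule smooth_at_compose[OF cM cMM smooth_map_pair[OF cM cM cM smooth_id smooth_id], where f = F and p = \<one>])
   (simp_all only: top F one_closed)
 have 1: "v (%h. F (h, h) - F (h, \<one>)) = (\<Sum>j<nG. v (crd j) * g j (\<one>, \<one>))"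
 proof (rule der_hadamard(1)[OF v, where W = "A \<inter> B" and c = 0 and y = crd and g = "%j h. g j (h, h)"])
  show "openin (mtop M) (A \<inter> B)" using A B by (intro openin_Int)
  show "\<one> \<in> A \<inter> B" using A B by blast
  fix q assume "q \<in> A \<inter> B"
  then have "F (q, q) = F (q, \<one>) + (\<Sum>j<nG. crd j q * g j (q, q))" using Fg by blast
  then show "F (q, q) - F (q, \<one>) = 0 + (\<Sum>j<nG. crd j q * g j (q, q))" by simp
 qed (simp_all add: gd sm_crd)
 have 2: "v (%h. F (\<one>, h)) = (\<Sum>j<nG. v (crd j) * g j (\<one>, \<one>))" by (rule param_deriv[OF pM A(2) B g Fg v])
 have 3: "v (%h. F (h, h) - F (h, \<one>)) = v (%h. F (h, h)) - v (%h. F (h, \<one>))"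
  by (rule der_diff[OF v Fd slice_fst[OF pM F]])
 show ?thesis using 1 2 3 by (metis add.commute diff_add_cancel)
qed

subsection \<open>Left invariant vector fields and the bracket\<close>

definition hat :: "(('a => 'k) => 'k) => ('a => 'k) => 'a => 'k" where
 "hat v f g = v (%h. f (g \<otimes> h))"

lemma smooth_at_two:
 assumes "premfd P" "smooth_map (prod_manifold P M) M E" "(a, b) \<in> topspace (mtop (prod_manifold P M))" "smooth_at M (E (a, b)) f"
 shows "smooth_at (prod_manifold P M) (a, b) (%p. f (E p))"
 by (rule smooth_at_compose[OF charted_prod[OF premfd_charted[OF assms(1)] cM] cM assms(2,3,4)])

lemma smooth_hat: "v \<in> L ==> smooth_at M g f ==> smooth_at M g (hat v f)"
proof -
 assume v: "v \<in> L" and f: "smooth_at M g f"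
 have g: "g \<in> carrier G" by (rule smooth_at_carrier[OF f])
 have "smooth_at (prod_manifold M M) (g, \<one>) (%p. f (fst p \<otimes> snd p))"
  by (rule smooth_at_two[OF pM smooth_mult[OF cMM smooth_map_fst[OF pM pM] smooth_map_snd[OF pM pM]]]) (use g f in \<open>auto simp: topP top\<close>)
 from smooth_param[OF pM this v] show ?thesis unfolding hat_def by simp
qed

lemma hat_one: "v \<in> L ==> hat v f \<one> = v f"
 unfolding hat_def by (rule der_cong) auto

lemma hat_left: "v \<in> L ==> a \<in> carrier G ==> x \<in> carrier G ==> hat v (%h. f (a \<otimes> h)) x = hat v f (a \<otimes> x)"
 unfolding hat_def by (rule der_cong) (auto simp: m_assoc)

lemma hat_germ:
 assumes "v \<in> L" "openin (mtop M) W" "x \<in> W" "\<And>q. q \<in> W ==> f q = g q"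
 shows "hat v f x = hat v g x"
proof -
 have x: "x \<in> carrier G" using assms(2,3) openin_subset top by blast
 have "continuous_map (mtop M) (mtop M) (%h. x \<otimes> h)"
  by (rule smooth_map_continuous[OF smooth_mult[OF cM smooth_const[OF cM x] smooth_id]])
 from openin_continuous_map_preimage[OF this assms(2)]
 show ?thesis unfolding hat_def by (rule der_germ[OF assms(1)]) (use x assms in \<open>auto simp: top\<close>)
qed

lemma hat_add: "v \<in> L ==> smooth_at M x f ==> smooth_at M x g ==> hat v (%x. f x + g x) x = hat v f x + hat v g x"
 unfolding hat_def by (intro der_add sm_left_one) (auto dest: smooth_at_carrier)

lemma hat_mult: "v \<in> L ==> smooth_at M x f ==> smooth_at M x g ==> hat v (%x. f x * g x) x = hat v f x * g x + f x * hat v g x"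
 unfolding hat_def using der_mult[of v "%h. f (x \<otimes> h)" "%h. g (x \<otimes> h)"] sm_left_one[of x f] sm_left_one[of x g] smooth_at_carrier[of x f]
 by simp

abbreviation "br \<equiv> lie_bracket G"

lemma br_eq: "br v w f = (if sm f then v (hat w f) - w (hat v f) else 0)"
 unfolding lie_bracket_def hat_def smooth_near_one_iff ..

lemma LI:
 assumes "\<And>f. \<not> sm f ==> v f = 0"
  and "\<And>f g W. sm f ==> sm g ==> openin (mtop M) W ==> \<one> \<in> W ==> (\<And>x. x \<in> W ==> f x = g x) ==> v f = v g"
  and "\<And>f g. sm f ==> sm g ==> v (%x. f x + g x) = v f + v g"
  and "\<And>f g. sm f ==> sm g ==> v (%x. f x * g x) = v f * g \<one> + f \<one> * v g"
  and "\<And>c f. sm f ==> v (%x. c * f x) = c * v f"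
 shows "v \<in> L"
 unfolding lie_algebra_def smooth_near_one_iff
proof (intro CollectI conjI allI impI)
 fix f g assume "sm f" "sm g" "\<exists>U. openin (gtop G) U \<and> \<one> \<in> U \<and> (\<forall>x\<in>U. f x = g x)"
 then show "v f = v g" using assms(2)[of f g] by blast
qed (fact assms(1,3,4,5))+

lemma hat_hat_germ:
 assumes v: "v \<in> L" and w: "w \<in> L" and W: "openin (mtop M) W" "\<one> \<in> W" "\<And>x. x \<in> W ==> f x = g x"
 shows "v (hat w f) = v (hat w g)"
 by (rule der_germ[OF v W(1,2)]) (rule hat_germ[OF w W(1) _ W(3)])

lemma sm_near: "sm f ==> sm g ==> \<exists>W. openin (mtop M) W \<and> \<one> \<in> W \<and> (\<forall>q\<in>W. smooth_at M q f \<and> smooth_at M q g)"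
proof -
 assume "sm f" "sm g"
 then obtain W W' where "openin (mtop M) W" "\<one> \<in> W" "\<forall>q\<in>W. smooth_at M q f" "openin (mtop M) W'" "\<one> \<in> W'" "\<forall>q\<in>W'. smooth_at M q g"
  using smooth_atD[of M \<one> f] smooth_atD[of M \<one> g] by blast
 then show ?thesis by (intro exI[of _ "W \<inter> W'"]) auto
qed

lemma hat_add_der:
 assumes v: "v \<in> L" and w: "w \<in> L" and f: "sm f" and g: "sm g"
 shows "v (hat w (%x. f x + g x)) = v (hat w f) + v (hat w g)"
proof -
 obtain W where W: "openin (mtop M) W" "\<one> \<in> W" "\<forall>q\<in>W. smooth_at M q f \<and> smooth_at M q g" using sm_near[OF f g] by blast
 have "v (hat w (%x. f x + g x)) = v (%x. hat w f x + hat w g x)"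
  by (rule der_germ[OF v W(1,2)]) (use W hat_add[OF w] in blast)
 then show ?thesis by (simp add: der_add[OF v smooth_hat[OF w f] smooth_hat[OF w g]])
qed

text \<open>The two mixed terms are symmetric in \<open>v\<close> and \<open>w\<close>, so they
  cancel in the bracket, which is therefore again a derivation.\<close>

lemma hat_mult_der:
 assumes v: "v \<in> L" and w: "w \<in> L" and f: "sm f" and g: "sm g"
 shows "v (hat w (%x. f x * g x)) = v (hat w f) * g \<one> + w f * v g + v f * w g + f \<one> * v (hat w g)"
proof -
 obtain W where W: "openin (mtop M) W" "\<one> \<in> W" "\<forall>q\<in>W. smooth_at M q f \<and> smooth_at M q g" using sm_near[OF f g] by blast
 have "v (hat w (%x. f x * g x)) = v (%x. hat w f x * g x + f x * hat w g x)"
  by (rule der_germ[OF v W(1,2)]) (use W hat_mult[OF w] in blast)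
 then show ?thesis
  by (simp add: der_add[OF v] der_mult[OF v] smooth_at_mult smooth_hat[OF w] f g hat_one[OF w])
qed

lemma br_in:
 assumes v: "v \<in> L" and w: "w \<in> L" shows "br v w \<in> L"
proof (rule LI)
 fix f g W assume s: "sm f" "sm g" and W: "openin (mtop M) W" "\<one> \<in> W" "\<And>x. x \<in> W ==> f x = g x"
 have "v (hat w f) = v (hat w g)" by (rule hat_hat_germ[OF v w W(1,2)]) (rule W(3))
 moreover have "w (hat v f) = w (hat v g)" by (rule hat_hat_germ[OF w v W(1,2)]) (rule W(3))
 ultimately show "br v w f = br v w g" using s by (simp add: br_eq)
next
 fix f g assume f: "sm f" and g: "sm g"
 show "br v w (%x. f x + g x) = br v w f + br v w g"
  using f g by (simp add: br_eq smooth_at_add hat_add_der[OF v w] hat_add_der[OF w v])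
 show "br v w (%x. f x * g x) = br v w f * g \<one> + f \<one> * br v w g"
  using f g by (simp add: br_eq smooth_at_mult hat_mult_der[OF v w] hat_mult_der[OF w v] algebra_simps)
next
 fix c f assume f: "sm f"
 have *: "v (hat w (%x. c * f x)) = c * v (hat w f)" if v: "v \<in> L" and w: "w \<in> L" for v w
 proof -
  have "hat w (%_. c) = (%_. 0)" by (simp add: hat_def der_const[OF w] fun_eq_iff)
  then show ?thesis using hat_mult_der[OF v w sm_const[of c] f] by (simp add: der_const[OF v] der_const[OF w])
 qed
 show "br v w (%x. c * f x) = c * br v w f"
  using f by (simp add: br_eq smooth_at_cmult * v w algebra_simps)
qed (simp add: br_eq)

lemma subspace_L: "fnvs.subspace L"
proof (rule fnvs.subspaceI)
 show "0 \<in> L" by (rule LI) (simp_all only: zero_fun_apply mult_zero_left mult_zero_right add_0_left)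
 fix u v assume u: "u \<in> L" and v: "v \<in> L"
 show "u + v \<in> L"
 proof (rule LI)
  fix f g :: "'a => 'k" and W assume W: "openin (mtop M) W" "\<one> \<in> W" "\<And>x. x \<in> W ==> f x = g x"
  have "u f = u g" "v f = v g" by (rule der_germ[OF u W(1,2)] der_germ[OF v W(1,2)], rule W(3), assumption)+
  then show "(u + v) f = (u + v) g" by simp
 next
  fix f assume "\<not> sm f"
  then show "(u + v) f = 0" using der_not[OF u] der_not[OF v] by simp
 qed (simp_all add: der_add[OF u] der_add[OF v] der_mult[OF u] der_mult[OF v] der_cmult[OF u] der_cmult[OF v] algebra_simps)
next
 fix c u assume u: "u \<in> L"
 show "c *\<^sub>F u \<in> L"
 proof (rule LI)
  fix f g :: "'a => 'k" and W assume W: "openin (mtop M) W" "\<one> \<in> W" "\<And>x. x \<in> W ==> f x = g x"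
  have "u f = u g" by (rule der_germ[OF u W(1,2)]) (rule W(3))
  then show "(c *\<^sub>F u) f = (c *\<^sub>F u) g" by (simp add: fscale_def)
 next
  fix f assume "\<not> sm f"
  then show "(c *\<^sub>F u) f = 0" using der_not[OF u] by (simp add: fscale_def)
 qed (simp_all add: fscale_def der_add[OF u] der_mult[OF u] der_cmult[OF u] algebra_simps)
qed

lemma L_add: "u \<in> L ==> v \<in> L ==> u + v \<in> L"
 and L_scale: "u \<in> L ==> c *\<^sub>F u \<in> L"
 and L_diff: "u \<in> L ==> v \<in> L ==> u - v \<in> L"
 and L_0: "0 \<in> L"
 and L_uminus: "u \<in> L ==> - u \<in> L"
 using subspace_L by (auto intro: fnvs.subspace_add fnvs.subspace_scale fnvs.subspace_diff fnvs.subspace_0 fnvs.subspace_neg)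

lemma br_anti: "br v w = - br w v"
 by (auto simp: br_eq fun_eq_iff)

lemma br_add:
 assumes "u \<in> L" "v \<in> L" "w \<in> L" shows "br (u + v) w = br u w + br v w"
proof
 fix f
 have "w (hat (u + v) f) = w (hat u f) + w (hat v f)" if f: "sm f"
 proof -
  have "hat (u + v) f = (%x. hat u f x + hat v f x)" by (simp add: hat_def fun_eq_iff)
  then show ?thesis using der_add[OF assms(3) smooth_hat[OF assms(1) f] smooth_hat[OF assms(2) f]] by simp
 qed
 then show "br (u + v) w f = (br u w + br v w) f" by (simp add: br_eq)
qed

lemma br_scale:
 assumes "u \<in> L" "w \<in> L" shows "br (c *\<^sub>F u) w = c *\<^sub>F br u w"
proof
 fix f
 have "w (hat (c *\<^sub>F u) f) = c * w (hat u f)" if f: "sm f"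
 proof -
  have "hat (c *\<^sub>F u) f = (%x. c * hat u f x)" by (simp add: hat_def fun_eq_iff fscale_def)
  then show ?thesis using der_cmult[OF assms(2) smooth_hat[OF assms(1) f]] by simp
 qed
 then show "br (c *\<^sub>F u) w f = (c *\<^sub>F br u w) f" by (simp add: br_eq fscale_def algebra_simps)
qed

lemma br_add_right: "u \<in> L ==> v \<in> L ==> w \<in> L ==> br w (u + v) = br w u + br w v"
 using br_add[of u v w] br_anti[of w "u + v"] br_anti[of w u] br_anti[of w v] by simp

lemma br_scale_right: "u \<in> L ==> w \<in> L ==> br w (c *\<^sub>F u) = c *\<^sub>F br w u"
 using br_scale[of u w c] br_anti[of w "c *\<^sub>F u"] br_anti[of w u] by (auto simp: fscale_def fun_eq_iff)

lemma br_diff: "u \<in> L ==> v \<in> L ==> w \<in> L ==> br (u - v) w = br u w - br v w"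
 using br_add[of "u - v" v w] by (simp add: L_diff algebra_simps)

lemma hat_br:
 assumes v: "v \<in> L" and w: "w \<in> L" and f: "smooth_at M x f"
 shows "hat (br v w) f x = hat v (hat w f) x - hat w (hat v f) x"
proof -
 have x: "x \<in> carrier G" by (rule smooth_at_carrier[OF f])
 have *: "v (hat w (%h. f (x \<otimes> h))) = hat v (hat w f) x" if v: "v \<in> L" and w: "w \<in> L" for v w
  unfolding hat_def[of v] by (rule der_cong[OF v]) (rule hat_left[OF w x])
 show ?thesis using sm_left_one[OF x f] by (simp add: hat_def[of "br v w"] br_eq * v w)
qed

text \<open>Near the identity the field of a bracket is the commutator of the fields
  (\<open>hat_br\<close>), so this is the identity for commutators of operators.\<close>

lemma jacobi:
 assumes u: "u \<in> L" and v: "v \<in> L" and w: "w \<in> L"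
 shows "br (br u v) w = br u (br v w) - br v (br u w)"
proof
 fix f
 show "br (br u v) w f = (br u (br v w) - br v (br u w)) f"
 proof (cases "sm f")
  case True
  have near: "w (hat (br u v) f) = w (hat u (hat v f)) - w (hat v (hat u f))"
   if u: "u \<in> L" and v: "v \<in> L" and w: "w \<in> L" for u v w
  proof -
   obtain W where W: "openin (mtop M) W" "\<one> \<in> W" "\<forall>q\<in>W. smooth_at M q f" using smooth_atD[OF True] by blast
   have "w (hat (br u v) f) = w (%x. hat u (hat v f) x - hat v (hat u f) x)"
    by (rule der_germ[OF w W(1,2)]) (use hat_br[OF u v] W in blast)
   then show ?thesis by (simp add: der_diff[OF w] smooth_hat u v True)
  qed
  have br1: "br u v (hat w f) = u (hat v (hat w f)) - v (hat u (hat w f))" if "u \<in> L" "v \<in> L" "w \<in> L" for u v w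
   using smooth_hat[OF that(3) True] by (simp add: br_eq)
  have e: "br a b f = a (hat b f) - b (hat a f)" for a b using True by (simp add: br_eq)
  show ?thesis
   by (simp add: e near br1 u v w)
 next
  case False then show ?thesis by (simp add: br_eq)
 qed
qed

subsection \<open>The adjoint action\<close>

text \<open>The differential of conjugation; the value 0 off smooth germs is the normalisation that
  \<open>lie_algebra\<close> demands.\<close>

definition Ad :: "'a => (('a => 'k) => 'k) => (('a => 'k) => 'k)" where
 "Ad g v = (%f. if sm f then v (%h. f (g \<otimes> h \<otimes> inv g)) else 0)"

lemma Ad_in:
 assumes g: "g \<in> carrier G" and v: "v \<in> L" shows "Ad g v \<in> L"
proof (rule LI)
 fix f k W assume "sm f" "sm k" and W: "openin (mtop M) W" "\<one> \<in> W" "\<And>x. x \<in> W ==> f x = k x"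
 have "continuous_map (mtop M) (mtop M) (%h. g \<otimes> h \<otimes> inv g)"
  by (rule smooth_map_continuous[OF smooth_mult[OF cM smooth_mult[OF cM smooth_const[OF cM g] smooth_id] smooth_const[OF cM]]]) (use g in auto)
 from openin_continuous_map_preimage[OF this W(1)]
 have "v (%h. f (g \<otimes> h \<otimes> inv g)) = v (%h. k (g \<otimes> h \<otimes> inv g))"
  by (rule der_germ[OF v]) (use W g in \<open>auto simp: top\<close>)
 then show "Ad g v f = Ad g v k" using \<open>sm f\<close> \<open>sm k\<close> by (simp add: Ad_def)
qed (use g in \<open>auto simp: Ad_def smooth_at_add smooth_at_mult smooth_at_cmult der_add[OF v] der_mult[OF v] der_cmult[OF v] sm_conj\<close>)

lemma Ad_mult:
 assumes g: "g \<in> carrier G" and k: "k \<in> carrier G" and v: "v \<in> L" shows "Ad (g \<otimes> k) v = Ad g (Ad k v)"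
proof
 fix f
 have "v (%h. f (g \<otimes> k \<otimes> h \<otimes> inv (g \<otimes> k))) = v (%h. f (g \<otimes> (k \<otimes> h \<otimes> inv k) \<otimes> inv g))"
  by (rule der_cong[OF v]) (use g k in \<open>simp add: m_assoc inv_mult_group\<close>)
 then show "Ad (g \<otimes> k) v f = Ad g (Ad k v) f" using sm_conj[OF g, of f] by (simp add: Ad_def)
qed

lemma Ad_one: "v \<in> L ==> Ad \<one> v = v"
proof
 fix f assume v: "v \<in> L"
 have "v (%h. f (\<one> \<otimes> h \<otimes> inv \<one>)) = v f" by (rule der_cong[OF v]) auto
 then show "Ad \<one> v f = v f" using der_not[OF v, of f] by (simp add: Ad_def)
qed

lemma Ad_add: "Ad g (u + v) = Ad g u + Ad g v"
 by (auto simp: Ad_def fun_eq_iff)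

lemma Ad_scale: "Ad g (c *\<^sub>F u) = c *\<^sub>F Ad g u"
 by (auto simp: Ad_def fun_eq_iff fscale_def)

lemma smooth_Ad:
 assumes v: "v \<in> L" and f: "sm f" and g: "g \<in> carrier G" shows "smooth_at M g (%g. Ad g v f)"
proof -
 have "smooth_at (prod_manifold M M) (g, \<one>) (%p. f (fst p \<otimes> snd p \<otimes> inv (fst p)))"
  by (rule smooth_at_two[OF pM smooth_mult[OF cMM smooth_mult[OF cMM smooth_map_fst[OF pM pM] smooth_map_snd[OF pM pM]] smooth_inv[OF cMM smooth_map_fst[OF pM pM]]]])
   (use g f in \<open>auto simp: topP top\<close>)
 from smooth_param[OF pM this v] show ?thesis using f by (simp add: Ad_def)
qed

text \<open>Writing \<open>h k\<close> as \<open>(h k inv h) h\<close> and differentiating the outer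
  \<open>h\<close> and the conjugating one separately (\<open>der_diag\<close>) splits
  \<open>v (hat w f)\<close> into the derivative of \<open>Ad\<close> and, by
  \<open>der_commute\<close>, \<open>w (hat v f)\<close>.\<close>

lemma der_Ad:
 assumes v: "v \<in> L" and w: "w \<in> L" and f: "sm f"
 shows "v (%g. Ad g w f) = br v w f"
proof -
 let ?P = "prod_manifold M M"
 have s1: "smooth_map (prod_manifold ?P M) M (%p. fst (fst p))" "smooth_map (prod_manifold ?P M) M (%p. snd (fst p))"
  by (rule smooth_map_compose[OF charted_prod[OF cMM cM] cMM cM smooth_map_fst[OF pMM pM]], rule smooth_map_fst[OF pM pM] smooth_map_snd[OF pM pM])+
 note c3 = charted_prod[OF cMM cM]
 have "smooth_at (prod_manifold ?P M) ((\<one>, \<one>), \<one>) (%p. f (fst (fst p) \<otimes> snd p \<otimes> inv (fst (fst p)) \<otimes> snd (fst p)))"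
  by (rule smooth_at_two[OF pMM smooth_mult[OF c3 smooth_mult[OF c3 smooth_mult[OF c3 s1(1) smooth_map_snd[OF pMM pM]] smooth_inv[OF c3 s1(1)]] s1(2)]])
   (use f in \<open>auto simp: topP top\<close>)
 from smooth_param[OF pMM this w]
 have q: "smooth_at ?P (\<one>, \<one>) (%p. w (%k. f (fst p \<otimes> k \<otimes> inv (fst p) \<otimes> snd p)))" by simp
 have e1: "v (%h. w (%k. f (h \<otimes> k \<otimes> inv h \<otimes> h))) = v (hat w f)"
  unfolding hat_def by (rule der_cong[OF v], rule der_cong[OF w]) (simp add: m_assoc)
 have e2: "v (%h. w (%k. f (h \<otimes> k \<otimes> inv h \<otimes> \<one>))) = v (%g. Ad g w f)"
  unfolding Ad_def using f by (intro der_cong[OF v]) (auto intro!: der_cong[OF w])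
 have "smooth_at ?P (\<one>, \<one>) (%p. f (snd p \<otimes> fst p))"
  by (rule smooth_at_two[OF pM smooth_mult[OF cMM smooth_map_snd[OF pM pM] smooth_map_fst[OF pM pM]]]) (use f in \<open>auto simp: topP top\<close>)
 from der_commute[OF this v w]
 have "v (%h. w (%k. f (k \<otimes> h))) = w (hat v f)"
  by (simp add: hat_def[of v f, abs_def, symmetric])
 moreover have "v (%h. w (%k. f (\<one> \<otimes> k \<otimes> inv \<one> \<otimes> h))) = v (%h. w (%k. f (k \<otimes> h)))"
  by (rule der_cong[OF v], rule der_cong[OF w]) simp
 ultimately have e3: "v (%h. w (%k. f (\<one> \<otimes> k \<otimes> inv \<one> \<otimes> h))) = w (hat v f)" by simp
 show ?thesis using der_diag[OF q v] f unfolding fst_conv snd_conv e1 e2 e3 by (simp add: br_eq)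
qed

subsection \<open>Tangent vectors in coordinates\<close>

text \<open>Differentiate in the direction \<open>u\<close> at \<open>\<phi> s\<close> and translate
  back by \<open>inv s\<close>. At the identity this yields a basis of the Lie algebra; at a general
  \<open>s\<close> it supplies the direction of motion in the nearest point argument.\<close>

lemma exists_derivation:
 assumes U: "(U, \<phi>) \<in> atlas M" "s \<in> U"
 shows "\<exists>v\<in>L. \<forall>i<nG. v (%h. \<phi> (s \<otimes> h) i) = u i"
proof -
 have s: "s \<in> carrier G" using U chart_subset[OF cM U(1)] top by blast
 let ?E = "%f x. f (inv s \<otimes> inv_into U \<phi> x)"
 define v where "v f = (if sm f then \<Sum>j<nG. u j * pd j (?E f) (\<phi> s) else 0)" for f
 have loc: "\<exists>B. kopen nG B \<and> \<phi> s \<in> B \<and> B \<subseteq> \<phi> ` (W \<inter> U) \<and> Ck_on nG 1 B (?E f)" if f: "sm f" and W: "openin (mtop M) W" "s \<in> W" for f W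
 proof -
  have "smooth_at M s (%x. f (inv s \<otimes> x))" by (rule sm_left) (use f s in auto)
  then obtain W' where W': "openin (mtop M) W'" "s \<in> W'" "smooth_fun M W' (%x. f (inv s \<otimes> x))" unfolding smooth_at_def by blast
  have "smooth_on nG (\<phi> ` (W' \<inter> U)) (?E f)" using smooth_funD[OF cM U(1) W'(3)] .
  then have "smooth_on nG (\<phi> ` (W \<inter> W' \<inter> U)) (?E f)" by (rule smooth_on_subset) auto
  then have "Ck_on nG 1 (\<phi> ` (W \<inter> W' \<inter> U)) (?E f)" unfolding smooth_on_def by blast
  moreover have "kopen nG (\<phi> ` (W \<inter> W' \<inter> U))"
   by (rule chart_open_image[OF cM U(1)]) (use W W' chart_open[OF cM U(1)] in auto)
  ultimately show ?thesis using W W' U by (intro exI[of _ "\<phi> ` (W \<inter> W' \<inter> U)"]) auto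
 qed
 have D: "((%t. ?E f ((\<phi> s)(j := t))) has_field_derivative pd j (?E f) (\<phi> s)) (at (\<phi> s j))" if f: "sm f" and j: "j < nG" for f j
 proof -
  obtain B where B: "kopen nG B" "\<phi> s \<in> B" "Ck_on nG 1 B (?E f)" using loc[OF f open_carrier s] by blast
  show ?thesis using Ck_on_SucD(1)[OF B(1) B(3)[unfolded One_nat_def] j B(2)] .
 qed
 have E1: "?E f (\<phi> s) = f \<one>" for f using s U by (simp add: chart_inv[OF cM U(1)])
 have "v \<in> L"
 proof (rule LI)
  fix f g W assume f: "sm f" and g: "sm g" and W: "openin (mtop M) W" "\<one> \<in> W" "\<And>x. x \<in> W ==> f x = g x"
  have "continuous_map (mtop M) (mtop M) (%x. inv s \<otimes> x)"
   by (rule smooth_map_continuous[OF smooth_mult[OF cM smooth_const[OF cM] smooth_id]]) (use s in auto)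
  from openin_continuous_map_preimage[OF this W(1)]
  have o: "openin (mtop M) {x \<in> topspace (mtop M). inv s \<otimes> x \<in> W}" "s \<in> {x \<in> topspace (mtop M). inv s \<otimes> x \<in> W}"
   using s W by (auto simp: top)
  obtain B where B: "kopen nG B" "\<phi> s \<in> B" "B \<subseteq> \<phi> ` ({x \<in> topspace (mtop M). inv s \<otimes> x \<in> W} \<inter> U)" using loc[OF f o] by blast
  have "?E f x = ?E g x" if "x \<in> B" for x using that B(3) W(3) chart_inv[OF cM U(1)] by auto
  then have "((%t. ?E g ((\<phi> s)(j := t))) has_field_derivative pd j (?E f) (\<phi> s)) (at (\<phi> s j))" if "j < nG" for j
   using pderiv_cong[OF B(1,2) that, of "?E f" "?E g"] D[OF f that] by blast
  then have "pd j (?E g) (\<phi> s) = pd j (?E f) (\<phi> s)" if "j < nG" for j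
   using DERIV_unique D[OF g] that by blast
  then show "v f = v g" using f g by (simp add: v_def)
 next
  fix f g assume f: "sm f" and g: "sm g"
  have a: "pd j (?E (%x. f x + g x)) (\<phi> s) = pd j (?E f) (\<phi> s) + pd j (?E g) (\<phi> s)" if "j < nG" for j
   unfolding pd_def[of j "?E (%x. f x + g x)"] by (rule DERIV_imp_deriv) (rule DERIV_add[OF D[OF f that] D[OF g that]])
  then show "v (%x. f x + g x) = v f + v g" using f g
   by (simp add: v_def smooth_at_add sum.distrib algebra_simps)
  have m: "pd j (?E (%x. f x * g x)) (\<phi> s) = pd j (?E f) (\<phi> s) * g \<one> + pd j (?E g) (\<phi> s) * f \<one>" if "j < nG" for j
   unfolding pd_def[of j "?E (%x. f x * g x)"]
   by (rule DERIV_imp_deriv) (use DERIV_mult[OF D[OF f that] D[OF g that]] E1[of f] E1[of g] in \<open>simp only: fun_upd_triv\<close>)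
  have "v (%x. f x * g x) = (\<Sum>j<nG. u j * (pd j (?E f) (\<phi> s) * g \<one> + pd j (?E g) (\<phi> s) * f \<one>))"
   using smooth_at_mult[OF f g] by (simp add: v_def m)
  also have "\<dots> = (\<Sum>j<nG. u j * pd j (?E f) (\<phi> s)) * g \<one> + f \<one> * (\<Sum>j<nG. u j * pd j (?E g) (\<phi> s))"
   unfolding sum_distrib_left sum_distrib_right sum.distrib[symmetric] by (rule sum.cong) (simp_all add: algebra_simps)
  finally show "v (%x. f x * g x) = v f * g \<one> + f \<one> * v g" using f g by (simp add: v_def)
 next
  fix c f assume f: "sm f"
  have "pd j (?E (%x. c * f x)) (\<phi> s) = c * pd j (?E f) (\<phi> s)" if "j < nG" for j
   unfolding pd_def[of j "?E (%x. c * f x)"] by (rule DERIV_imp_deriv) (rule DERIV_cmult[OF D[OF f that]])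
  then show "v (%x. c * f x) = c * v f" using f
   by (simp add: v_def smooth_at_cmult sum_distrib_left algebra_simps)
 qed (simp add: v_def)
 moreover have "v (%h. \<phi> (s \<otimes> h) i) = u i" if i: "i < nG" for i
 proof -
  have f: "sm (%h. \<phi> (s \<otimes> h) i)" by (rule sm_left_one[OF s smooth_at_coord[OF pM U i]])
  obtain B where B: "kopen nG B" "\<phi> s \<in> B" "B \<subseteq> \<phi> ` (carrier G \<inter> U)" using loc[OF f open_carrier s] by blast
  have eq: "\<phi> (s \<otimes> (inv s \<otimes> inv_into U \<phi> x)) i = x i" if "x \<in> B" for x
   using that B(3) s by (auto simp: chart_inv[OF cM U(1)] m_assoc[symmetric])
  have "((%t. ((\<phi> s)(j := t)) i) has_field_derivative (if i = j then 1 else 0)) (at (\<phi> s j))" for j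
   by (cases "i = j") auto
  then have "((%t. \<phi> (s \<otimes> (inv s \<otimes> inv_into U \<phi> ((\<phi> s)(j := t)))) i) has_field_derivative (if i = j then 1 else 0)) (at (\<phi> s j))" if "j < nG" for j
   using pderiv_cong[OF B(1,2) that, of "%x. \<phi> (s \<otimes> (inv s \<otimes> inv_into U \<phi> x)) i" "%x. x i"] eq by blast
  then have "pd j (%x. \<phi> (s \<otimes> (inv s \<otimes> inv_into U \<phi> x)) i) (\<phi> s) = (if i = j then 1 else 0)" if "j < nG" for j
   unfolding pd_def using DERIV_imp_deriv that by blast
  then show ?thesis using f i by (simp add: v_def if_distrib[of "%x. u _ * x"] cong: if_cong)
 qed
 ultimately show ?thesis by blast
qed

definition bas :: "nat => ('a => 'k) => 'k" where
 "bas j = (SOME v. v \<in> L \<and> (\<forall>i<nG. v (crd i) = (if i = j then 1 else 0)))"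

lemma bas: "bas j \<in> L" "i < nG ==> bas j (crd i) = (if i = j then 1 else 0)"
proof -
 obtain v where v: "v \<in> L" "\<forall>i<nG. v (%h. phi1 (\<one> \<otimes> h) i) = (if i = j then 1 else 0)"
  using exists_derivation[OF chart1, of "%i. if i = j then 1 else 0"] by blast
 have "v (crd i) = v (%h. phi1 (\<one> \<otimes> h) i)" if "i < nG" for i
 proof -
  have "v (crd i) = v (%h. phi1 h i)"
   unfolding crd_def using der_diff[OF v(1) sm_coord1[OF that chart1(2)] sm_const] der_const[OF v(1)] by simp
  then show ?thesis using der_cong[OF v(1), of "%h. phi1 (\<one> \<otimes> h) i" "%h. phi1 h i"] by simp
 qed
 then have "\<exists>v. v \<in> L \<and> (\<forall>i<nG. v (crd i) = (if i = j then 1 else 0))" using v by auto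
 then have "bas j \<in> L \<and> (\<forall>i<nG. bas j (crd i) = (if i = j then 1 else 0))" unfolding bas_def by (rule someI_ex)
 then show "bas j \<in> L" "i < nG ==> bas j (crd i) = (if i = j then 1 else 0)" by auto
qed

text \<open>By Hadamard's lemma a derivation is determined by its values on the
  \<open>crd j\<close>, so the \<open>bas j\<close> are the basis dual to these coordinates.\<close>

lemma der_coords:
 assumes v: "v \<in> L" shows "v f = (\<Sum>j<nG. v (crd j) * bas j f)"
proof (cases "sm f")
 case True
 from hadamard_point[OF pM chart1 True]
 obtain W g where W: "openin (mtop M) W" "\<one> \<in> W" "\<forall>j<nG. smooth_fun M W (g j)"
  "\<forall>q\<in>W. f q = f \<one> + (\<Sum>j<nG. (phi1 q j - phi1 \<one> j) * g j q)" by (elim exE conjE) (rule that; assumption)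
 have g: "sm (g j)" if "j < nG" for j using W that unfolding smooth_at_def by blast
 have *: "v f = (\<Sum>j<nG. v (crd j) * g j \<one>)" if "v \<in> L" for v
  by (rule der_hadamard(1)[OF that W(1,2), where c = "f \<one>" and y = crd and g = g]) (use W(4) g sm_crd in \<open>auto simp: crd_def\<close>)
 have "bas j f = g j \<one>" if "j < nG" for j
  using *[OF bas(1), of j] that by (simp add: bas(2) if_distrib[of "%x. x * _"] cong: if_cong)
 then show ?thesis using *[OF v] by simp
next
 case False
 then show ?thesis using der_not[OF v False] der_not[OF bas(1) False] by simp
qed

lemma der_eqI: "v \<in> L ==> w \<in> L ==> (\<And>j. j < nG ==> v (crd j) = w (crd j)) ==> v = w"
proof
 fix f assume "v \<in> L" "w \<in> L" "\<And>j. j < nG ==> v (crd j) = w (crd j)"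
 then show "v f = w f" by (subst (1 2) der_coords) auto
qed

end

section \<open>One-parameter subgroups\<close>

lemma has_vector_derivative_iff_quotient:
 fixes f :: "real => 'k::real_normed_field"
 shows "(f has_vector_derivative D) (at t) \<longleftrightarrow> ((%s. (f s - f t) / of_real (s - t)) \<longlongrightarrow> D) (at t)"
proof -
 have "(f has_vector_derivative D) (at t) \<longleftrightarrow> ((%s. norm (f s - f t - (s - t) *\<^sub>R D) / norm (s - t)) \<longlongrightarrow> 0) (at t)"
  unfolding has_vector_derivative_def has_derivative_iff_norm by (auto intro: bounded_linear_scaleR_left)
 also have "\<dots> \<longleftrightarrow> ((%s. norm ((f s - f t) / of_real (s - t) - D)) \<longlongrightarrow> 0) (at t)"
 proof (rule tendsto_cong)
  show "\<forall>\<^sub>F s in at t. norm (f s - f t - (s - t) *\<^sub>R D) / norm (s - t) = norm ((f s - f t) / of_real (s - t) - D)"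
   using eventually_neq_at_within[of t t UNIV]
  proof eventually_elim
   case (elim s)
   then have "(f s - f t) / of_real (s - t) - D = (f s - f t - (s - t) *\<^sub>R D) / of_real (s - t)"
    by (simp add: diff_divide_distrib scaleR_conv_of_real)
   then show ?case by (metis norm_divide norm_of_real real_norm_def)
  qed
 qed
 also have "\<dots> \<longleftrightarrow> ((%s. (f s - f t) / of_real (s - t)) \<longlongrightarrow> D) (at t)"
  by (simp add: tendsto_norm_zero_iff LIM_zero_iff)
 finally show ?thesis .
qed

text \<open>Where one factor vanishes, the product rule asks only for continuity of the other.
  Hadamard coefficients along a curve are used in this way.\<close>

lemma vector_derivative_mult_zero:
 fixes y g :: "real => 'k::real_normed_field"
 assumes "(y has_vector_derivative d) (at t)" "y t = 0" "(g \<longlongrightarrow> g t) (at t)"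
 shows "((%s. y s * g s) has_vector_derivative d * g t) (at t)"
 using tendsto_mult[OF assms(1)[unfolded has_vector_derivative_iff_quotient] assms(3)] assms(2)
 unfolding has_vector_derivative_iff_quotient by simp

lemma field_derivative_mult_zero:
 fixes y g :: "'k::real_normed_field => 'k"
 assumes "(y has_field_derivative d) (at t)" "y t = 0" "(g \<longlongrightarrow> g t) (at t)"
 shows "((%s. y s * g s) has_field_derivative d * g t) (at t)"
 using tendsto_mult[OF assms(1)[unfolded has_field_derivative_iff] assms(3)] assms(2)
 unfolding has_field_derivative_iff by simp

lemma local_bound:
 fixes h :: "'i => (nat => 'k::real_normed_field) => 'k"
 assumes "finite I" "kopen n U" "x0 \<in> U" "\<And>k. k \<in> I ==> continuous_on U (h k)"
 shows "\<exists>\<rho>>0. kbox n x0 \<rho> \<subseteq> U \<and> (\<exists>C\<ge>0. \<forall>k\<in>I. \<forall>w\<in>kbox n x0 \<rho>. norm (h k w) \<le> C)"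
 using assms(1,4)
proof (induction I rule: finite_induct)
 case empty
 then show ?case using kopen_contains_kbox[OF assms(2,3)] by auto
next
 case (insert k I)
 then obtain \<rho> C where r: "\<rho> > 0" "kbox n x0 \<rho> \<subseteq> U" "C \<ge> 0" "\<forall>k\<in>I. \<forall>w\<in>kbox n x0 \<rho>. norm (h k w) \<le> C" by auto
 obtain d where d: "d > 0" "\<forall>y\<in>kbox n x0 d. dist (h k y) (h k x0) < 1"
  using continuous_on_kopenD[OF assms(2) insert.prems assms(3), of k 1] by auto
 have k: "norm (h k y) \<le> norm (h k x0) + 1" if "y \<in> kbox n x0 d" for y
 proof -
  have "norm (h k y - h k x0) < 1" using d(2) that by (simp add: dist_norm)
  then show ?thesis using norm_triangle_ineq2[of "h k y" "h k x0"] by linarith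
 qed
 let ?r = "min \<rho> d" and ?C = "max C (norm (h k x0) + 1)"
 have sub: "kbox n x0 ?r \<subseteq> kbox n x0 \<rho>" "kbox n x0 ?r \<subseteq> kbox n x0 d" by (rule kbox_mono, simp)+
 have "\<forall>k'\<in>insert k I. \<forall>w\<in>kbox n x0 ?r. norm (h k' w) \<le> ?C"
 proof (intro ballI)
  fix k' w assume k': "k' \<in> insert k I" and w: "w \<in> kbox n x0 ?r"
  show "norm (h k' w) \<le> ?C"
  proof (cases "k' = k")
   case True
   have "w \<in> kbox n x0 d" using w sub by blast
   then show ?thesis using k[of w] True by simp
  next
   case False
   then have "norm (h k' w) \<le> C" using r(4) k' w sub by blast
   then show ?thesis by simp
  qed
 qed
 moreover have "?r > 0" "kbox n x0 ?r \<subseteq> U" "?C \<ge> 0" using r d sub by auto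
 ultimately show ?case by blast
qed

section \<open>Curves in the group and their logarithmic derivatives\<close>

context lie
begin

text \<open>The indicator of \<open>W\<close> is constant near \<open>c t\<close>, hence smooth
  there as a germ; testing with it turns continuity of all \<open>f (c s)\<close> into continuity of
  the curve.\<close>

lemma curve_continuous:
 fixes c :: "'t::real_normed_vector => 'a"
 assumes ct: "c t \<in> carrier G" and D: "\<And>f. smooth_at M (c t) f ==> isCont (%s. f (c s)) t"
  and W: "openin (mtop M) W" "c t \<in> W"
 shows "\<forall>\<^sub>F s in nhds t. c s \<in> W"
proof -
 let ?f = "%x. if x \<in> W then 1 else 0 :: 'k"
 have "smooth_at M (c t) ?f"
  using smooth_at_cong[OF cM W, of ?f "%_. 1"] smooth_at_const[of "c t" M 1] ct top by simp
 then have "isCont (%s. ?f (c s)) t" by (rule D)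
 then have "((%s. ?f (c s)) \<longlongrightarrow> 1) (nhds t)"
  using W(2) by (simp add: continuous_at_imp_continuous_at_within tendsto_nhds_iff isCont_def)
 then have "\<forall>\<^sub>F s in nhds t. dist (?f (c s)) 1 < 1" by (rule tendstoD) simp
 then show ?thesis by eventually_elim (auto split: if_splits)
qed

text \<open>The velocity at time \<open>t\<close> is the left invariant field of \<open>v\<close>,
  tested on functions. Time is real even for a complex group, so one uniqueness lemma serves both
  fields.\<close>

definition logd :: "(real => 'a) => (('a => 'k) => 'k) => real => bool" where
 "logd c v t \<longleftrightarrow> c t \<in> carrier G \<and>
   (\<forall>f. smooth_at M (c t) f \<longrightarrow> ((%s. f (c s)) has_vector_derivative hat v f (c t)) (at t))"

lemma vd_isCont: "(f has_vector_derivative D) (at t) ==> isCont f t"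
 using has_vector_derivative_continuous by blast

lemma logd_continuous: "logd c v t ==> openin (mtop M) W ==> c t \<in> W ==> \<forall>\<^sub>F s in nhds t. c s \<in> W"
 by (rule curve_continuous) (auto simp: logd_def intro: vd_isCont)

lemma constant_curve:
 assumes A: "convex A" and u: "\<And>t. t \<in> A ==> u t \<in> carrier G"
  and D: "\<And>t f. t \<in> A ==> smooth_at M (u t) f ==> ((%s. f (u s)) has_vector_derivative 0) (at t)"
  and t: "t1 \<in> A" "t2 \<in> A"
 shows "u t1 = (u t2 :: 'a)"
proof (rule connected_local_const[OF convex_connected[OF A] t], rule ballI)
 fix a :: real assume a: "a \<in> A"
 obtain U \<phi> where U: "(U, \<phi>) \<in> atlas M" "u a \<in> U" using chart_at[OF cM] u[OF a] top by blast
 have "\<forall>\<^sub>F s in nhds a. u s \<in> U"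
  by (rule curve_continuous[where c = u and t = a and W = U]) (use u[OF a] chart_open[OF cM U(1)] U(2) in \<open>auto intro: vd_isCont D[OF a]\<close>)
 then obtain d where d: "d > 0" "\<And>s. dist s a < d ==> u s \<in> U" by (auto simp: eventually_nhds_metric)
 let ?S = "A \<inter> ball a d"
 have eq: "u s = u a" if s: "s \<in> ?S" for s
 proof -
  have "\<phi> (u s) i = \<phi> (u a) i" for i
  proof (cases "i < nG")
   case True
   have "\<exists>c. \<forall>x\<in>?S. \<phi> (u x) i = c"
   proof (rule has_derivative_zero_constant)
    fix x assume x: "x \<in> ?S"
    then have "u x \<in> U" using d(2) by (auto simp: dist_commute)
    then have "((%s. \<phi> (u s) i) has_vector_derivative 0) (at x)"
     using D x smooth_at_coord[OF pM U(1) _ True] by blast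
    then show "((%s. \<phi> (u s) i) has_derivative (%h. 0)) (at x within ?S)"
     by (simp add: has_vector_derivative_def has_derivative_at_withinI)
   qed (use A in \<open>auto intro: convex_Int\<close>)
   then show ?thesis using s a d(1) by (metis IntI centre_in_ball)
  next
   case False
   have "u s \<in> U" using d(2) s by (auto simp: dist_commute)
   then show ?thesis using chart_kspace[OF cM U(1)] U(2) False by (auto simp: kspace_def)
  qed
  then have "\<phi> (u s) = \<phi> (u a)" by blast
  moreover have "u s \<in> U" using d(2) s by (auto simp: dist_commute)
  ultimately show ?thesis using chart_inj[OF cM U(1)] U(2) by (meson inj_onD)
 qed
 show "\<forall>\<^sub>F b in at a within A. u a = u b"
  unfolding eventually_at using d(1) eq by (intro exI[of _ d]) (auto simp: dist_commute)
qed

text \<open>Both curves move by right multiplication with the same infinitesimal element, which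
  cancels in the quotient. To see this, \<open>f (c1 s \<otimes> inv (b \<otimes> h))\<close> with
  \<open>b = c2 t\<close> and \<open>h = inv b \<otimes> c2 s\<close> is expanded in
  \<open>h\<close> about the identity, with \<open>c1 s\<close> as parameter.\<close>

lemma quotient_derivative:
 assumes c1: "logd c1 v t" and c2: "logd c2 v t" and v: "v \<in> L"
  and f: "smooth_at M (c1 t \<otimes> inv (c2 t)) f" and c2c: "\<And>s. c2 s \<in> carrier G"
 shows "((%s. f (c1 s \<otimes> inv (c2 s))) has_vector_derivative 0) (at t)"
proof -
 let ?a = "c1 t" and ?b = "c2 t"
 have ab: "?a \<in> carrier G" "?b \<in> carrier G" using c1 c2 by (auto simp: logd_def)
 let ?P = "prod_manifold M M"
 let ?\<Phi> = "%p. f (fst p \<otimes> inv (?b \<otimes> snd p))"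
 have \<Phi>: "smooth_at ?P (?a, \<one>) ?\<Phi>"
  by (rule smooth_at_two[OF pM smooth_mult[OF cMM smooth_map_fst[OF pM pM] smooth_inv[OF cMM smooth_mult[OF cMM smooth_const[OF cMM ab(2)] smooth_map_snd[OF pM pM]]]]])
   (use ab f in \<open>auto simp: topP top\<close>)
 obtain A B g where A: "openin (mtop M) A" "?a \<in> A" and B: "openin (mtop M) B" "\<one> \<in> B"
  and g: "\<forall>j<nG. \<forall>x\<in>A. \<forall>h\<in>B. smooth_at ?P (x, h) (g j)"
  and Fg: "\<forall>x\<in>A. \<forall>h\<in>B. ?\<Phi> (x, h) = ?\<Phi> (x, \<one>) + (\<Sum>j<nG. crd j h * g j (x, h))"
  using param[OF pM \<Phi>] by (elim exE conjE) (rule that; assumption)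
 let ?h = "%s. inv ?b \<otimes> c2 s"
 have ht: "?h t = \<one>" using ab by simp
 have contL: "continuous_map (mtop M) (mtop M) (%x. inv ?b \<otimes> x)"
  by (rule smooth_map_continuous[OF smooth_mult[OF cM smooth_const[OF cM] smooth_id]]) (use ab in auto)
 have hW: "\<forall>\<^sub>F s in nhds t. ?h s \<in> W" if W: "openin (mtop M) W" "\<one> \<in> W" for W
 proof -
  have "\<forall>\<^sub>F s in nhds t. c2 s \<in> {x \<in> topspace (mtop M). inv ?b \<otimes> x \<in> W}"
   by (rule logd_continuous[OF c2 openin_continuous_map_preimage[OF contL W(1)]]) (use ab W in \<open>auto simp: top\<close>)
  then show ?thesis by eventually_elim auto
 qed
 have fst: "((%s. f (c1 s \<otimes> inv ?b)) has_vector_derivative v (%h. f (?a \<otimes> h \<otimes> inv ?b))) (at t)"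
 proof -
  have "smooth_at M ?a (%x. f (x \<otimes> inv ?b))"
   by (rule sm_compose[OF smooth_mult[OF cM smooth_id smooth_const[OF cM]]]) (use ab f in auto)
  then show ?thesis using c1 by (auto simp: logd_def hat_def)
 qed
 have snd: "((%s. crd j (?h s) * g j (c1 s, ?h s)) has_vector_derivative v (crd j) * g j (?a, \<one>)) (at t)" if j: "j < nG" for j
 proof -
  have "smooth_at M ?b (%x. crd j (inv ?b \<otimes> x))" by (rule sm_left) (use ab sm_crd[OF j] in auto)
  then have "((%s. crd j (?h s)) has_vector_derivative hat v (%x. crd j (inv ?b \<otimes> x)) ?b) (at t)"
   using c2 by (auto simp: logd_def)
  moreover have "hat v (%x. crd j (inv ?b \<otimes> x)) ?b = v (crd j)"
   using hat_left[OF v, of "inv ?b" ?b "crd j"] ab hat_one[OF v] by simp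
  ultimately have d: "((%s. crd j (?h s)) has_vector_derivative v (crd j)) (at t)" by simp
  have cont: "((%s. g j (c1 s, ?h s)) \<longlongrightarrow> g j (c1 t, ?h t)) (at t)"
  proof (rule tendstoI)
   fix e :: real assume e: "e > 0"
   have "smooth_at ?P (?a, \<one>) (g j)" using g j A B by blast
   from smooth_at_continuous[OF cMM this e] obtain W where W: "openin (mtop ?P) W" "(?a, \<one>) \<in> W" "\<forall>q\<in>W. dist (g j q) (g j (?a, \<one>)) < e" by blast
   have "\<forall>x y. (x, y) \<in> W \<longrightarrow> (\<exists>U V. openin (mtop M) U \<and> openin (mtop M) V \<and> x \<in> U \<and> y \<in> V \<and> U \<times> V \<subseteq> W)"
    using W(1) by (simp add: prod_manifold_def openin_prod_topology_alt)
   from this[rule_format, OF W(2)]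
   obtain U V where UV: "openin (mtop M) U" "openin (mtop M) V" "?a \<in> U" "\<one> \<in> V" "U \<times> V \<subseteq> W"
    by (elim exE conjE) (rule that; assumption)
   have "\<forall>\<^sub>F s in nhds t. dist (g j (c1 s, ?h s)) (g j (c1 t, ?h t)) < e"
    using logd_continuous[OF c1 UV(1,3)] hW[OF UV(2,4)]
   proof eventually_elim
    case (elim s)
    have "(c1 s, ?h s) \<in> W" by (rule subsetD[OF UV(5)]) (use elim in simp)
    then show ?case using W(3) ht by simp
   qed
   then show "\<forall>\<^sub>F s in at t. dist (g j (c1 s, ?h s)) (g j (c1 t, ?h t)) < e"
    unfolding eventually_at_filter by (rule eventually_mono) simp
  qed
  have "crd j (?h t) = 0" unfolding ht by simp
  from vector_derivative_mult_zero[where y = "%s. crd j (?h s)" and g = "%s. g j (c1 s, ?h s)", OF d this cont]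
  show ?thesis unfolding ht .
 qed
 have sum: "((%s. f (c1 s \<otimes> inv ?b) + (\<Sum>j<nG. crd j (?h s) * g j (c1 s, ?h s))) has_vector_derivative
   v (%h. f (?a \<otimes> h \<otimes> inv ?b)) + (\<Sum>j<nG. v (crd j) * g j (?a, \<one>))) (at t)"
  by (intro has_vector_derivative_add fst has_vector_derivative_sum snd) simp
 \<comment> \<open>On the diagonal \<open>h\<close> cancels, so \<open>der_diag\<close> for a
   function constant there says that the two contributions add up to 0.\<close>
 have zero: "v (%h. f (?a \<otimes> h \<otimes> inv ?b)) + (\<Sum>j<nG. v (crd j) * g j (?a, \<one>)) = 0"
 proof -
  let ?F = "%p. f ((?a \<otimes> fst p) \<otimes> inv (?b \<otimes> snd p))"
  have F: "smooth_at ?P (\<one>, \<one>) ?F"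
   by (rule smooth_at_two[OF pM smooth_mult[OF cMM smooth_mult[OF cMM smooth_const[OF cMM ab(1)] smooth_map_fst[OF pM pM]] smooth_inv[OF cMM smooth_mult[OF cMM smooth_const[OF cMM ab(2)] smooth_map_snd[OF pM pM]]]]])
    (use ab f in \<open>auto simp: topP top\<close>)
  have "v (%h. f ((?a \<otimes> h) \<otimes> inv (?b \<otimes> h))) = v (%_. f (?a \<otimes> inv ?b))"
  proof (rule der_cong[OF v])
   fix x assume x: "x \<in> carrier G"
   have "x \<otimes> (inv x \<otimes> inv ?b) = inv ?b" using x ab by (simp add: m_assoc[symmetric])
   then show "f ((?a \<otimes> x) \<otimes> inv (?b \<otimes> x)) = f (?a \<otimes> inv ?b)" using x ab by (simp add: inv_mult_group m_assoc)
  qed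
  moreover have "v (%h. f ((?a \<otimes> h) \<otimes> inv (?b \<otimes> \<one>))) = v (%h. f (?a \<otimes> h \<otimes> inv ?b))" using ab by simp
  moreover have "v (%h. f ((?a \<otimes> \<one>) \<otimes> inv (?b \<otimes> h))) = (\<Sum>j<nG. v (crd j) * g j (?a, \<one>))"
   using param_deriv[OF pM A(2) B g Fg v] ab by simp
  ultimately show ?thesis using der_diag[OF F v] der_const[OF v] unfolding fst_conv snd_conv by metis
 qed
 have ev: "\<forall>\<^sub>F s in nhds t. f (c1 s \<otimes> inv (c2 s)) = f (c1 s \<otimes> inv ?b) + (\<Sum>j<nG. crd j (?h s) * g j (c1 s, ?h s))"
  using logd_continuous[OF c1 A] hW[OF B]
 proof eventually_elim
  case (elim s)
  have "?b \<otimes> ?h s = c2 s" using ab c2c[of s] by (simp add: m_assoc[symmetric])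
  then show ?case using bspec[OF bspec[OF Fg elim(1)] elim(2)] ab by simp
 qed
 show ?thesis
  using sum unfolding zero
  by (subst has_vector_derivative_cong_ev[where g = "%s. f (c1 s \<otimes> inv ?b) + (\<Sum>j<nG. crd j (?h s) * g j (c1 s, ?h s))"])
   (use ev eventually_nhds_x_imp_x[OF ev] in \<open>auto elim: eventually_mono\<close>)
qed

lemma logd_unique:
 assumes A: "convex A" "t0 \<in> A" "t \<in> A" and v: "v \<in> L"
  and c: "\<And>t. t \<in> A ==> logd c1 v t" "\<And>t. t \<in> A ==> logd c2 v t" and cc: "\<And>s. c2 s \<in> carrier G"
 shows "c1 t \<otimes> inv (c2 t) = c1 t0 \<otimes> inv (c2 t0)"
proof (rule constant_curve[OF A(1) _ _ A(3,2)])
 show "c1 t \<otimes> inv (c2 t) \<in> carrier G" if "t \<in> A" for t using c(1)[OF that] cc by (simp add: logd_def)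
 show "((%s. f (c1 s \<otimes> inv (c2 s))) has_vector_derivative 0) (at t)" if "t \<in> A" "smooth_at M (c1 t \<otimes> inv (c2 t)) f" for t f
  by (rule quotient_derivative[OF c(1)[OF that(1)] c(2)[OF that(1)] v that(2) cc])
qed

end

section \<open>The exponential map from local flows\<close>

context lie
begin

abbreviation "x1 \<equiv> phi1 \<one>"
abbreviation "ps \<equiv> inv_into U1 phi1"

text \<open>Components of the left invariant basis fields in the chart. The field
  \<open>Fv v\<close> is linear in the coordinates of \<open>v\<close>, which makes all bounds
  uniform for bounded \<open>v\<close>.\<close>

definition Ef :: "nat => nat => (nat => 'k) => 'k" where
 "Ef i j x = hat (bas j) (%h. phi1 h i) (ps x)"

definition Fv :: "(('a => 'k) => 'k) => nat => (nat => 'k) => 'k" where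
 "Fv v i x = (\<Sum>j<nG. v (crd j) * Ef i j x)"

lemma Fv_eq: "v \<in> L ==> Fv v i x = hat v (%h. phi1 h i) (ps x)"
 unfolding Fv_def Ef_def hat_def by (rule der_coords[symmetric])

lemma U1_open: "openin (mtop M) U1" and U1_sub: "U1 \<subseteq> carrier G" and phi1_open: "kopen nG (phi1 ` U1)"
 using chart_open[OF cM chart1(1)] chart_subset[OF cM chart1(1)] chart_image[OF cM chart1(1)] by (auto simp: top)

lemma x1_in: "x1 \<in> phi1 ` U1" "x1 \<in> kspace nG"
 using chart1(2) chart_kspace[OF cM chart1] by auto

lemma ps_phi1: "p \<in> U1 ==> ps (phi1 p) = p"
 by (rule chart_inv[OF cM chart1(1)])

lemma smooth_Ef: "i < nG ==> smooth_on nG (phi1 ` U1) (Ef i j)"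
proof -
 assume i: "i < nG"
 have "smooth_fun M U1 (hat (bas j) (%h. phi1 h i))"
  by (rule smooth_fun_local[OF cM U1_open]) (rule smooth_hat[OF bas(1) sm_coord1[OF i]])
 from smooth_funD[OF cM chart1(1) this] show ?thesis unfolding Ef_def by simp
qed

text \<open>The box is fixed once, and the time radius depends only on a bound \<open>R\<close> for
  the coordinates of \<open>v\<close>; hence nearby \<open>v\<close> have solutions on a common
  ball.\<close>

lemma ode_setup:
 "\<exists>\<rho>>0. kbox nG x1 \<rho> \<subseteq> phi1 ` U1 \<and> (\<forall>R\<ge>0. \<exists>r>0. \<exists>C K. \<forall>v\<in>L. (\<Sum>j<nG. norm (v (crd j))) \<le> R \<longrightarrow>
   ode_box nG (Fv v) x1 \<rho> r C K)"
proof -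
 have CE: "Ck_on nG m (phi1 ` U1) (Ef i j)" if "i < nG" for i j m
  using smooth_Ef[OF that] unfolding smooth_on_def by blast
 \<comment> \<open>The index \<open>nG\<close> in the last place stands for the function itself, the
   smaller ones for its partial derivatives, so one application of \<open>local_bound\<close> covers
   both.\<close>
 define I where "I = ({..<nG} \<times> {..<nG}) \<times> {..nG}"
 define h where "h = (%((i, j), l). if l = nG then Ef i j else pd l (Ef i j))"
 have "continuous_on (phi1 ` U1) (h k)" if kI: "k \<in> I" for k
 proof -
  obtain i j l where k: "k = ((i, j), l)" "i < nG" "l \<le> nG" using kI by (auto simp: I_def)
  show ?thesis
  proof (cases "l = nG")
   case True
   then show ?thesis using CE[OF k(2), of 0 j] by (simp add: h_def k)
  next
   case False
   then have "l < nG" using k by simp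
   then show ?thesis using Ck_on_continuous[OF Ck_on_SucD(2)[OF phi1_open CE[OF k(2)]]] False by (simp add: h_def k)
  qed
 qed
 moreover have "finite I" by (simp add: I_def)
 ultimately obtain \<rho> C0 where \<rho>: "\<rho> > 0" "kbox nG x1 \<rho> \<subseteq> phi1 ` U1" "C0 \<ge> 0" and b: "\<forall>k\<in>I. \<forall>w\<in>kbox nG x1 \<rho>. norm (h k w) \<le> C0"
  using local_bound[OF _ phi1_open x1_in(1), of I h] by blast
 have bE: "norm (Ef i j w) \<le> C0" if "i < nG" "j < nG" "w \<in> kbox nG x1 \<rho>" for i j w
  using b[rule_format, of "((i, j), nG)" w] that by (simp add: I_def h_def)
 have bD: "norm (pd l (Ef i j) w) \<le> C0" if "i < nG" "j < nG" "l < nG" "w \<in> kbox nG x1 \<rho>" for i j l w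
  using b[rule_format, of "((i, j), l)" w] that by (simp add: I_def h_def)
 have CB: "Ck_on nG m (kbox nG x1 \<rho>) (Ef i j)" if "i < nG" for i j m
  by (rule Ck_on_subset[OF CE[OF that] \<rho>(2)])
 have main: "\<exists>r>0. \<exists>C K. \<forall>v\<in>L. (\<Sum>j<nG. norm (v (crd j))) \<le> R \<longrightarrow> ode_box nG (Fv v) x1 \<rho> r C K" if R: "R \<ge> 0" for R
 proof -
  let ?C = "R * C0"
  \<comment> \<open>The two entries give \<open>rC\<close> and \<open>rK\<close>; the added 1 avoids
    division by zero when the bounds vanish.\<close>
  define r where "r = min (\<rho> / 2 / (?C + 1)) (1 / 2 / (real nG * ?C + 1))"
  have C0: "?C \<ge> 0" "real nG * ?C \<ge> 0" using R \<rho> by auto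
  have p1: "?C + 1 > 0" "real nG * ?C + 1 > 0" using C0 by linarith+
  then have r: "r > 0" unfolding r_def min_less_iff_conj using \<rho>(1) by (intro conjI divide_pos_pos) auto
  have "r * ?C \<le> (\<rho> / 2 / (?C + 1)) * (?C + 1)" using C0 \<rho>(1) r by (intro mult_mono) (auto simp: r_def)
  moreover have "(\<rho> / 2 / (?C + 1)) * (?C + 1) = \<rho> / 2"
   by (subst times_divide_eq_left, rule nonzero_mult_div_cancel_right[OF less_imp_neq[OF p1(1), symmetric]])
  ultimately have r1: "r * ?C \<le> \<rho> / 2" by linarith
  have "r * (real nG * ?C) \<le> (1 / 2 / (real nG * ?C + 1)) * (real nG * ?C + 1)" using C0 r by (intro mult_mono) (auto simp: r_def)
  moreover have "(1 / 2 / (real nG * ?C + 1)) * (real nG * ?C + 1) = 1 / 2"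
   by (subst times_divide_eq_left, rule nonzero_mult_div_cancel_right[OF less_imp_neq[OF p1(2), symmetric]])
  ultimately have "r * (real nG * ?C) \<le> 1 / 2" by linarith
  then have r2: "real nG * ?C * r \<le> 1 / 2" by (metis mult.commute)
  have "ode_box nG (Fv v) x1 \<rho> r ?C ?C" if v: "v \<in> L" and vR: "(\<Sum>j<nG. norm (v (crd j))) \<le> R" for v
  proof
   have sumb: "norm (\<Sum>j<nG. v (crd j) * e j) \<le> ?C" if "\<And>j. j < nG ==> norm (e j) \<le> C0" for e
   proof -
    have "norm (\<Sum>j<nG. v (crd j) * e j) \<le> (\<Sum>j<nG. norm (v (crd j)) * C0)"
     by (rule sum_norm_le) (use that in \<open>auto simp: norm_mult intro!: mult_left_mono\<close>)
    also have "\<dots> \<le> ?C" using vR \<rho>(3) by (simp add: sum_distrib_right[symmetric] mult_right_mono)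
    finally show ?thesis .
   qed
   fix i assume i: "i < nG"
   show "Ck_on nG 1 (kbox nG x1 \<rho>) (Fv v i)"
    unfolding Fv_def[abs_def] by (intro Ck_on_sum Ck_on_mult Ck_on_const CB[OF i]) simp
   fix w assume w: "w \<in> kbox nG x1 \<rho>"
   show "norm (Fv v i w) \<le> ?C" unfolding Fv_def by (rule sumb) (rule bE[OF i _ w])
   fix l assume l: "l < nG"
   have "((%t. Fv v i (w(l := t))) has_field_derivative (\<Sum>j<nG. v (crd j) * pd l (Ef i j) w)) (at (w l))"
    unfolding Fv_def
    by (intro DERIV_sum DERIV_cmult Ck_on_SucD(1)[OF kopen_kbox CB[OF i] l w])
   then have "pd l (Fv v i) w = (\<Sum>j<nG. v (crd j) * pd l (Ef i j) w)"
    unfolding pd_def[of l "Fv v i"] by (rule DERIV_imp_deriv)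
   then show "norm (pd l (Fv v i) w) \<le> ?C" using sumb[of "%j. pd l (Ef i j) w"] bD[OF i _ l w] by simp
  qed (use \<rho> r C0 r1 r2 x1_in in auto)
  then show ?thesis using r by blast
 qed
 show ?thesis using \<rho> main by blast
qed

definition flow :: "(('a => 'k) => 'k) => real => ('k => 'a) => bool" where
 "flow v r \<gamma> \<longleftrightarrow> \<gamma> 0 = \<one> \<and> (\<forall>z\<in>ball 0 r. \<gamma> z \<in> carrier G \<and>
   (\<forall>f. smooth_at M (\<gamma> z) f \<longrightarrow> ((%z. f (\<gamma> z)) has_field_derivative hat v f (\<gamma> z)) (at z)))"

text \<open>The differential equation controls only the chart coordinates; Hadamard's expansion at
  the moving point carries the derivative over to every smooth \<open>f\<close>.\<close>

lemma flow_of_solution: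
 assumes v: "v \<in> L" and box: "kbox nG x1 \<rho> \<subseteq> phi1 ` U1"
  and g0: "\<gamma> 0 = x1" and g1: "\<And>z. z \<in> ball 0 r ==> \<gamma> z \<in> kbox nG x1 \<rho>"
  and g2: "\<And>z i. z \<in> ball 0 r ==> i < nG ==> ((%z. \<gamma> z i) has_field_derivative Fv v i (\<gamma> z)) (at z)"
 shows "flow v r (%z. ps (\<gamma> z))"
 unfolding flow_def
proof (intro conjI ballI allI impI)
 show "ps (\<gamma> 0) = \<one>" using g0 ps_phi1[OF chart1(2)] by simp
 have inU: "ps (\<gamma> z) \<in> U1" "phi1 (ps (\<gamma> z)) = \<gamma> z" if "z \<in> ball 0 r" for z
  using g1[OF that] box by (auto simp: subset_iff intro: inv_into_into f_inv_into_f)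
 fix z :: 'k assume z: "z \<in> ball 0 r"
 let ?p = "ps (\<gamma> z)"
 show p: "?p \<in> carrier G" using inU[OF z] U1_sub by blast
 fix f assume f: "smooth_at M ?p f"
 from hadamard_point[OF pM chart1(1) inU(1)[OF z] f]
 obtain W g where W: "openin (mtop M) W" "?p \<in> W" "W \<subseteq> U1" "\<forall>j<nG. smooth_fun M W (g j)"
  "\<forall>q\<in>W. f q = f ?p + (\<Sum>j<nG. (phi1 q j - phi1 ?p j) * g j q)" by (elim exE conjE) (rule that; assumption)
 have gs: "smooth_at M q (g j)" if "j < nG" "q \<in> W" for j q using W that unfolding smooth_at_def by blast
 have near: "\<forall>\<^sub>F w in nhds z. w \<in> ball 0 r \<and> ps (\<gamma> w) \<in> W'" if W': "openin (mtop M) W'" "?p \<in> W'" for W'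
 proof -
  have "openin (mtop M) (W' \<inter> U1)" using W'(1) U1_open by (rule openin_Int)
  then have "kopen nG (phi1 ` (W' \<inter> U1))" by (rule chart_open_image[OF cM chart1(1)]) auto
  moreover have "\<gamma> z \<in> phi1 ` (W' \<inter> U1)" using inU[OF z] W'(2) by (metis IntI imageI)
  ultimately obtain e where e: "e > 0" "kbox nG (\<gamma> z) e \<subseteq> phi1 ` (W' \<inter> U1)" using kopen_contains_kbox by blast
  have "\<forall>\<^sub>F w in nhds z. dist (\<gamma> w i) (\<gamma> z i) < e" if "i < nG" for i
  proof -
   have "((%w. \<gamma> w i) \<longlongrightarrow> \<gamma> z i) (nhds z)" using DERIV_isCont[OF g2[OF z that]] by (simp add: tendsto_nhds_iff isCont_def)
   then show ?thesis using e(1) by (rule tendstoD)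
  qed
  then have "\<forall>\<^sub>F w in nhds z. \<forall>i\<in>{..<nG}. dist (\<gamma> w i) (\<gamma> z i) < e" by (intro eventually_ball_finite) auto
  moreover have "\<forall>\<^sub>F w in nhds z. w \<in> ball 0 r" using z by (intro eventually_nhds_in_open) auto
  ultimately show ?thesis
  proof eventually_elim
   case (elim w)
   have "\<gamma> w \<in> kbox nG (\<gamma> z) e" using elim g1[OF elim(2)] by (auto simp: kbox_def)
   then obtain q where "q \<in> W'" "q \<in> U1" "\<gamma> w = phi1 q" using e(2) by blast
   then show ?case using elim(2) ps_phi1 by simp
  qed
 qed
 have gt: "((%w. g j (ps (\<gamma> w))) \<longlongrightarrow> g j ?p) (at z)" if j: "j < nG" for j
 proof (rule tendstoI)
  fix e :: real assume e: "e > 0"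
  obtain W' where W': "openin (mtop M) W'" "?p \<in> W'" "\<forall>q\<in>W'. dist (g j q) (g j ?p) < e"
   using smooth_at_continuous[OF cM gs[OF j W(2)] e] by blast
  have "\<forall>\<^sub>F w in nhds z. dist (g j (ps (\<gamma> w))) (g j ?p) < e" using near[OF W'(1,2)] by eventually_elim (use W'(3) in blast)
  then show "\<forall>\<^sub>F w in at z. dist (g j (ps (\<gamma> w))) (g j ?p) < e" unfolding eventually_at_filter by (rule eventually_mono) simp
 qed
 have tm: "((%w. (\<gamma> w j - \<gamma> z j) * g j (ps (\<gamma> w))) has_field_derivative Fv v j (\<gamma> z) * g j ?p) (at z)" if j: "j < nG" for j
 proof (rule field_derivative_mult_zero[where y = "%w. \<gamma> w j - \<gamma> z j" and g = "%w. g j (ps (\<gamma> w))", OF _ _ gt[OF j]])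
  show "((%w. \<gamma> w j - \<gamma> z j) has_field_derivative Fv v j (\<gamma> z)) (at z)"
   using DERIV_diff[OF g2[OF z j] DERIV_const[of "\<gamma> z j"]] by simp
 qed simp
 have "((%w. f ?p + (\<Sum>j<nG. (\<gamma> w j - \<gamma> z j) * g j (ps (\<gamma> w)))) has_field_derivative 0 + (\<Sum>j<nG. Fv v j (\<gamma> z) * g j ?p)) (at z)"
  by (intro DERIV_add DERIV_const DERIV_sum) (use tm in auto)
 moreover have "\<forall>\<^sub>F w in nhds z. f (ps (\<gamma> w)) = f ?p + (\<Sum>j<nG. (\<gamma> w j - \<gamma> z j) * g j (ps (\<gamma> w)))"
  using near[OF W(1,2)]
 proof eventually_elim
  case (elim w)
  then show ?case using bspec[OF W(5), of "ps (\<gamma> w)"] inU(2)[OF z] inU(2)[of w] by simp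
 qed
 ultimately have D: "((%w. f (ps (\<gamma> w))) has_field_derivative (\<Sum>j<nG. Fv v j (\<gamma> z) * g j ?p)) (at z)"
  by (subst DERIV_cong_ev[OF refl _ refl]) (assumption, simp)
 have "continuous_map (mtop M) (mtop M) (%x. ?p \<otimes> x)"
  by (rule smooth_map_continuous[OF smooth_mult[OF cM smooth_const[OF cM p] smooth_id]])
 from openin_continuous_map_preimage[OF this W(1)]
 have V: "openin (mtop M) {x \<in> topspace (mtop M). ?p \<otimes> x \<in> W}" "\<one> \<in> {x \<in> topspace (mtop M). ?p \<otimes> x \<in> W}"
  using p W(2) by (auto simp: top)
 have sj: "sm (%h. phi1 (?p \<otimes> h) j)" if "j < nG" for j
  by (rule sm_left_one[OF p sm_coord1[OF that inU(1)[OF z]]])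
 have "hat v f ?p = (\<Sum>j<nG. v (%h. phi1 (?p \<otimes> h) j - phi1 ?p j) * g j (?p \<otimes> \<one>))"
  unfolding hat_def
 proof (rule der_hadamard(1)[OF v V, where c = "f ?p" and y = "%j h. phi1 (?p \<otimes> h) j - phi1 ?p j" and g = "%j h. g j (?p \<otimes> h)"])
  show "f (?p \<otimes> q) = f ?p + (\<Sum>j<nG. (phi1 (?p \<otimes> q) j - phi1 ?p j) * g j (?p \<otimes> q))" if "q \<in> {x \<in> topspace (mtop M). ?p \<otimes> x \<in> W}" for q
   using W(5) that by blast
  show "sm (%h. phi1 (?p \<otimes> h) j - phi1 ?p j)" if "j < nG" for j by (rule smooth_at_diff[OF sj[OF that] sm_const])
  show "sm (%h. g j (?p \<otimes> h))" if "j < nG" for j by (rule sm_left_one[OF p gs[OF that W(2)]])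
  show "phi1 (?p \<otimes> \<one>) j - phi1 ?p j = 0" for j using p by simp
 qed
 also have "\<dots> = (\<Sum>j<nG. Fv v j (\<gamma> z) * g j ?p)"
 proof (rule sum.cong[OF refl])
  fix j assume "j \<in> {..<nG}"
  then have "v (%h. phi1 (?p \<otimes> h) j - phi1 ?p j) = Fv v j (\<gamma> z)"
   using der_diff[OF v sj sm_const] by (simp add: der_const[OF v] Fv_eq[OF v] hat_def)
  then show "v (%h. phi1 (?p \<otimes> h) j - phi1 ?p j) * g j (?p \<otimes> \<one>) = Fv v j (\<gamma> z) * g j ?p" using p by simp
 qed
 finally show "((%w. f (ps (\<gamma> w))) has_field_derivative hat v f ?p) (at z)" using D by simp
qed

lemma flow_logd:
 assumes \<gamma>: "flow v r \<gamma>" and v: "v \<in> L" and z: "s + of_real \<tau> * t \<in> ball 0 r"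
 shows "logd (%\<tau>. \<gamma> (s + of_real \<tau> * t)) (t *\<^sub>F v) \<tau>"
 unfolding logd_def
proof (intro conjI allI impI)
 show "\<gamma> (s + of_real \<tau> * t) \<in> carrier G" using \<gamma> z by (simp add: flow_def)
 fix f assume "smooth_at M (\<gamma> (s + of_real \<tau> * t)) f"
 then have D: "((%z. f (\<gamma> z)) has_field_derivative hat v f (\<gamma> (s + of_real \<tau> * t))) (at (s + of_real \<tau> * t))"
  using \<gamma> z unfolding flow_def by blast
 have "((%x. s + x * t) has_field_derivative t) (at (of_real \<tau>))" by (auto intro!: derivative_eq_intros)
 from DERIV_chain2[where f = "%z. f (\<gamma> z)" and g = "%x. s + x * t", OF D this]
 have "((%x. f (\<gamma> (s + x * t))) has_field_derivative hat v f (\<gamma> (s + of_real \<tau> * t)) * t) (at (of_real \<tau>))" .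
 from has_vector_derivative_real_field[OF this]
 show "((%\<tau>. f (\<gamma> (s + of_real \<tau> * t))) has_vector_derivative hat (t *\<^sub>F v) f (\<gamma> (s + of_real \<tau> * t))) (at \<tau>)"
  by (simp add: hat_def fscale_def mult.commute)
qed

text \<open>As functions of \<tau>, \<open>\<gamma> (s + \<tau> t)\<close> and
  \<open>\<gamma> (\<tau> t)\<close> have the same logarithmic derivative
  \<open>t *\<^sub>F v\<close>, so their quotient keeps its initial value
  \<open>\<gamma> s\<close>.\<close>

lemma flow_add:
 assumes \<gamma>: "flow v r \<gamma>" and v: "v \<in> L" and st: "s \<in> ball 0 r" "t \<in> ball 0 r" "s + t \<in> ball 0 r"
 shows "\<gamma> (s + t) = \<gamma> s \<otimes> \<gamma> t"
proof -
 have seg: "s + of_real \<tau> * t \<in> ball 0 r" "0 + of_real \<tau> * t \<in> ball 0 r" if "\<tau> \<in> {0..1}" for \<tau>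
 proof -
  have "(1 - \<tau>) *\<^sub>R s + \<tau> *\<^sub>R (s + t) \<in> ball 0 r" using that st by (intro convexD[OF convex_ball]) auto
  then show "s + of_real \<tau> * t \<in> ball 0 r" by (simp add: algebra_simps scaleR_conv_of_real)
  have "(1 - \<tau>) *\<^sub>R 0 + \<tau> *\<^sub>R t \<in> ball 0 r" using that st by (intro convexD[OF convex_ball]) (auto intro: le_less_trans[OF norm_ge_zero])
  then show "0 + of_real \<tau> * t \<in> ball 0 r" by (simp add: scaleR_conv_of_real)
 qed
 \<comment> \<open>The uniqueness lemma wants values in the group at all times, so the curve is
   continued by the identity outside the ball; derivatives are taken only inside.\<close>
 define c2 where "c2 \<tau> = (if of_real \<tau> * t \<in> ball 0 r then \<gamma> (of_real \<tau> * t) else \<one>)" for \<tau> :: real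
 have l2: "logd c2 (t *\<^sub>F v) \<tau>" if "\<tau> \<in> {0..1}" for \<tau>
 proof -
  have l: "logd (%\<tau>. \<gamma> (0 + of_real \<tau> * t)) (t *\<^sub>F v) \<tau>" by (rule flow_logd[OF \<gamma> v seg(2)[OF that]])
  have "open {\<tau>::real. of_real \<tau> * t \<in> ball 0 r}"
   by (simp add: open_Collect_less continuous_on_mult continuous_on_of_real continuous_on_norm)
  moreover have "\<tau> \<in> {\<tau>::real. of_real \<tau> * t \<in> ball 0 r}" using seg(2)[OF that] by simp
  ultimately have "\<forall>\<^sub>F x in nhds \<tau>. x \<in> {\<tau>::real. of_real \<tau> * t \<in> ball 0 r}" by (rule eventually_nhds_in_open)
  then have ev: "\<forall>\<^sub>F x in nhds \<tau>. c2 x = \<gamma> (0 + of_real x * t)" by eventually_elim (simp add: c2_def)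
  have e0: "c2 \<tau> = \<gamma> (0 + of_real \<tau> * t)" using eventually_nhds_x_imp_x[OF ev] .
  show ?thesis unfolding logd_def e0
  proof (intro conjI allI impI)
   show "\<gamma> (0 + of_real \<tau> * t) \<in> carrier G" using l by (simp add: logd_def)
   fix f assume "smooth_at M (\<gamma> (0 + of_real \<tau> * t)) f"
   then have "((%\<tau>. f (\<gamma> (0 + of_real \<tau> * t))) has_vector_derivative hat (t *\<^sub>F v) f (\<gamma> (0 + of_real \<tau> * t))) (at \<tau>)"
    using l unfolding logd_def by blast
   then show "((%s. f (c2 s)) has_vector_derivative hat (t *\<^sub>F v) f (\<gamma> (0 + of_real \<tau> * t))) (at \<tau>)"
    by (subst has_vector_derivative_cong_ev[where g = "%x. f (\<gamma> (0 + of_real x * t))"]) (use ev e0 in \<open>auto elim: eventually_mono\<close>)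
  qed
 qed
 have c2c: "c2 s \<in> carrier G" for s using \<gamma> by (auto simp: c2_def flow_def)
 have "\<gamma> (s + of_real 1 * t) \<otimes> inv (c2 1) = \<gamma> (s + of_real 0 * t) \<otimes> inv (c2 0)"
  by (rule logd_unique[where A = "{0..1}" and v = "t *\<^sub>F v" and ?c1.0 = "%\<tau>. \<gamma> (s + of_real \<tau> * t)", OF _ _ _ L_scale[OF v] flow_logd[OF \<gamma> v seg(1)] l2 c2c]) auto
 moreover have "c2 1 = \<gamma> t" "c2 0 = \<one>" using st \<gamma> by (auto simp: c2_def flow_def)
 moreover have "\<gamma> s \<in> carrier G" "\<gamma> t \<in> carrier G" "\<gamma> (s + t) \<in> carrier G" using st \<gamma> by (auto simp: flow_def)
 ultimately show ?thesis by (simp add: inv_solve_right')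
qed

lemma flow_pow:
 assumes \<gamma>: "flow v r \<gamma>" and v: "v \<in> L" and x: "real k * norm x < r"
 shows "\<gamma> (of_nat k * x) = \<gamma> x [^] k"
 using x
proof (induction k)
 case 0
 then show ?case using \<gamma> by (simp add: flow_def)
next
 case (Suc k)
 have le: "real k * norm x \<le> real (Suc k) * norm x" "1 * norm x \<le> real (Suc k) * norm x" by (intro mult_right_mono; simp)+
 have eq: "of_nat k * x + x = of_nat (Suc k) * x" by (simp add: algebra_simps)
 have "of_nat k * x + x \<in> ball 0 r" unfolding eq using Suc.prems by (simp add: norm_mult del: of_nat_Suc)
 moreover have "of_nat k * x \<in> ball 0 r" "x \<in> ball 0 r" using Suc.prems le by (auto simp: norm_mult simp del: of_nat_Suc)
 ultimately have "of_nat k * x \<in> ball 0 r" "x \<in> ball 0 r" "of_nat k * x + x \<in> ball 0 r" by blast+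
 from flow_add[OF \<gamma> v this] show ?case using Suc le unfolding eq by simp
qed

definition exp_curve :: "(('a => 'k) => 'k) => ('k => 'a) => bool" where
 "exp_curve v \<Gamma> \<longleftrightarrow> (\<forall>t. \<Gamma> t \<in> carrier G) \<and> (\<forall>s t. \<Gamma> (s + t) = \<Gamma> s \<otimes> \<Gamma> t) \<and>
   (\<forall>t f. smooth_at M (\<Gamma> t) f \<longrightarrow> ((%t. f (\<Gamma> t)) has_field_derivative hat v f (\<Gamma> t)) (at t))"

text \<open>The curve is the \<open>m\<close>-th power of the local flow at \<open>t / m\<close> for
  any large \<open>m\<close>; two choices agree through their product. Additivity needs that the
  flow at \<open>s / k\<close> and at \<open>t / k\<close> commute, which follows from
  \<open>flow_add\<close> in both orders.\<close>

lemma exp_curve_exists: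
 assumes v: "v \<in> L" shows "\<exists>\<Gamma>. exp_curve v \<Gamma>"
proof -
 have R0: "(\<Sum>j<nG. norm (v (crd j))) \<ge> 0" by (simp add: sum_nonneg)
 obtain \<rho> where \<rho>: "\<rho> > 0" "kbox nG x1 \<rho> \<subseteq> phi1 ` U1" and
  ex: "\<forall>R\<ge>0. \<exists>r>0. \<exists>C K. \<forall>v\<in>L. (\<Sum>j<nG. norm (v (crd j))) \<le> R \<longrightarrow> ode_box nG (Fv v) x1 \<rho> r C K"
  using ode_setup by (elim exE conjE) (rule that; assumption)
 from ex[rule_format, OF R0] obtain r C K where r: "r > 0" and "ode_box nG (Fv v) x1 \<rho> r C K" using v by blast
 from ode_box.local_solution[OF this(2)] obtain \<gamma>0 where
  "\<gamma>0 0 = x1" "\<And>z. z \<in> ball 0 r ==> \<gamma>0 z \<in> kbox nG x1 \<rho>"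
  "\<And>z i. z \<in> ball 0 r ==> i < nG ==> ((%z. \<gamma>0 z i) has_field_derivative Fv v i (\<gamma>0 z)) (at z)" by blast
 from flow_of_solution[OF v \<rho>(2) this] obtain \<gamma> where \<gamma>: "flow v r \<gamma>" by blast
 have \<gamma>c: "\<gamma> z \<in> carrier G" if "norm z < r" for z using \<gamma> that by (simp add: flow_def)
 define m where "m t = (SOME m. m > 0 \<and> norm t < r * real m)" for t :: 'k
 have exm: "\<exists>m>0. x < r * real m" for x
 proof -
  obtain n :: nat where "x / r < real n" using reals_Archimedean2 by blast
  then have "x < r * real (Suc n)" using r by (simp add: divide_less_eq algebra_simps)
  then show ?thesis by blast
 qed
 define \<Gamma> where "\<Gamma> t = \<gamma> (t / of_nat (m t)) [^] m t" for t
 have sm: "norm (t / of_nat k) < r" if "k > 0" "norm t < r * real k" for t :: 'k and k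
  using that by (simp add: norm_divide divide_less_eq mult.commute)
 have \<Gamma>: "\<Gamma> t = \<gamma> (t / of_nat k) [^] k" if k: "k > 0" "norm t < r * real k" for t k
 proof -
  have m: "m t > 0 \<and> norm t < r * real (m t)" unfolding m_def by (rule someI_ex) (use exm in blast)
  have *: "\<gamma> (t / of_nat a) [^] a = \<gamma> (t / of_nat (a * b)) [^] (a * b)" if "a > 0" "b > 0" "norm t < r * real a" for a b
  proof -
   have "real b * norm (t / of_nat (a * b)) = norm t / real a"
    using that by (simp add: norm_divide norm_mult)
   then have "real b * norm (t / of_nat (a * b)) < r" using that by (simp add: divide_less_eq mult.commute)
   from flow_pow[OF \<gamma> v this] have "\<gamma> (t / of_nat a) = \<gamma> (t / of_nat (a * b)) [^] b" using that by simp
   moreover have "norm (t / of_nat (a * b)) < r"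
   proof (rule sm)
    have "r * real a \<le> r * real (a * b)" using that r by (intro mult_left_mono) auto
    then show "norm t < r * real (a * b)" using that by linarith
   qed (use that in simp)
   ultimately show ?thesis using \<gamma>c by (simp add: nat_pow_pow mult.commute)
  qed
  show ?thesis unfolding \<Gamma>_def using *[of "m t" k] *[of k "m t"] m k by (simp add: mult.commute)
 qed
 have \<Gamma>c: "\<Gamma> t \<in> carrier G" for t using exm[of "norm t"] \<Gamma>[of _ t] sm[of _ t] \<gamma>c by (metis nat_pow_closed)
 have add: "\<Gamma> (s + t) = \<Gamma> s \<otimes> \<Gamma> t" for s t
 proof -
  obtain k where k: "k > 0" "norm s + norm t < r * real k" using exm by blast
  have n: "norm s < r * real k" "norm t < r * real k" "norm (s + t) < r * real k"
   using k norm_triangle_ineq[of s t] norm_ge_zero[of s] norm_ge_zero[of t] by linarith+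
  let ?s = "s / of_nat k" and ?t = "t / of_nat k"
  have b: "norm ?s < r" "norm ?t < r" "norm (?s + ?t) < r" using n sm[OF k(1)] by (auto simp: add_divide_distrib[symmetric])
  have "\<gamma> (?s + ?t) = \<gamma> ?s \<otimes> \<gamma> ?t" "\<gamma> (?t + ?s) = \<gamma> ?t \<otimes> \<gamma> ?s" using b by (intro flow_add[OF \<gamma> v]; simp add: add.commute)+
  then have "\<gamma> ((s + t) / of_nat k) = \<gamma> ?s \<otimes> \<gamma> ?t" "\<gamma> ?s \<otimes> \<gamma> ?t = \<gamma> ?t \<otimes> \<gamma> ?s" by (simp_all add: add_divide_distrib add.commute)
  moreover from this(2) have "(\<gamma> ?s \<otimes> \<gamma> ?t) [^] k = \<gamma> ?s [^] k \<otimes> \<gamma> ?t [^] k" using \<gamma>c b by (intro pow_mult_distrib) auto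
  ultimately show ?thesis using \<Gamma>[OF k(1) n(1)] \<Gamma>[OF k(1) n(2)] \<Gamma>[OF k(1) n(3)] by metis
 qed
 have small: "\<Gamma> t = \<gamma> t" if "norm t < r" for t using \<Gamma>[of 1 t] \<gamma>c that by simp
 have "((%t. f (\<Gamma> t)) has_field_derivative hat v f (\<Gamma> t)) (at t)" if f: "smooth_at M (\<Gamma> t) f" for t f
 proof -
  have "smooth_at M (\<gamma> 0) (%h. f (\<Gamma> t \<otimes> h))" using sm_left_one[OF \<Gamma>c f] \<gamma> by (simp add: flow_def)
  then have "((%z. f (\<Gamma> t \<otimes> \<gamma> z)) has_field_derivative hat v (%h. f (\<Gamma> t \<otimes> h)) (\<gamma> 0)) (at 0)"
  proof -
   have "0 \<in> ball (0::'k) r" using r by simp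
   then show ?thesis using \<gamma> \<open>smooth_at M (\<gamma> 0) (%h. f (\<Gamma> t \<otimes> h))\<close> unfolding flow_def by blast
  qed
  moreover have "hat v (%h. f (\<Gamma> t \<otimes> h)) (\<gamma> 0) = hat v f (\<Gamma> t)" using hat_left[OF v \<Gamma>c, of \<one>] \<gamma> \<Gamma>c by (simp add: flow_def)
  moreover have "\<forall>\<^sub>F z in nhds 0. f (\<Gamma> (t + z)) = f (\<Gamma> t \<otimes> \<gamma> z)"
  proof -
   have "\<forall>\<^sub>F z in nhds (0::'k). z \<in> ball 0 r" using r by (intro eventually_nhds_in_open) auto
   then show ?thesis by eventually_elim (simp add: add small)
  qed
  ultimately have "((%z. f (\<Gamma> (t + z))) has_field_derivative hat v f (\<Gamma> t)) (at 0)"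
   by (subst DERIV_cong_ev[OF refl _ refl]) (assumption, simp)
  then show ?thesis using DERIV_shift[of "%z. f (\<Gamma> z)" "hat v f (\<Gamma> t)" 0 t] by (simp add: add.commute)
 qed
 then show ?thesis using \<Gamma>c add unfolding exp_curve_def by blast
qed

text \<open>Only a real time and the derivative at 0 are mentioned, so restrictions of holomorphic
  one-parameter subgroups, conjugates and images under \<iota> all qualify and are identified by
  uniqueness.\<close>

definition hom_curve :: "(('a => 'k) => 'k) => (real => 'a) => bool" where
 "hom_curve v c \<longleftrightarrow> (\<forall>t. c t \<in> carrier G) \<and> (\<forall>s t. c (s + t) = c s \<otimes> c t) \<and>
   (\<forall>f. sm f \<longrightarrow> ((%t. f (c t)) has_vector_derivative v f) (at 0))"

lemma hom_curve_0: "hom_curve v c ==> c 0 = \<one>"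
proof -
 assume h: "hom_curve v c"
 then have "c 0 \<otimes> c 0 = c 0" "c 0 \<in> carrier G" unfolding hom_curve_def by (metis add_0, blast)
 then show ?thesis by (metis l_cancel_one)
qed

lemma hom_curve_logd:
 assumes c: "hom_curve v c" and v: "v \<in> L" shows "logd c v t"
 unfolding logd_def
proof (intro conjI allI impI)
 show ct: "c t \<in> carrier G" using c by (simp add: hom_curve_def)
 fix f assume f: "smooth_at M (c t) f"
 have "((%s. f (c t \<otimes> c s)) has_vector_derivative v (%h. f (c t \<otimes> h))) (at 0)"
  using c sm_left_one[OF ct f] unfolding hom_curve_def by blast
 then have "((%s. f (c (t + s))) has_vector_derivative hat v f (c t)) (at 0)"
  using c by (simp add: hom_curve_def hat_def)
 then have "(((%s. f (c (t + s))) \<circ> (%x. x - t)) has_vector_derivative 1 *\<^sub>R hat v f (c t)) (at t)"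
  by (intro vector_diff_chain_at) (auto intro!: derivative_eq_intros)
 then show "((%s. f (c s)) has_vector_derivative hat v f (c t)) (at t)" by (simp add: o_def)
qed

lemma hom_curve_unique:
 assumes "hom_curve v c1" "hom_curve v c2" "v \<in> L" shows "c1 t = c2 t"
proof -
 have "c1 t \<otimes> inv (c2 t) = c1 0 \<otimes> inv (c2 0)"
  by (rule logd_unique[where A = UNIV and v = v]) (use assms hom_curve_logd in \<open>auto simp: hom_curve_def\<close>)
 moreover have "c1 t \<in> carrier G" "c2 t \<in> carrier G" using assms by (auto simp: hom_curve_def)
 ultimately show ?thesis using hom_curve_0[OF assms(1)] hom_curve_0[OF assms(2)] by (simp add: inv_solve_right')
qed

lemma exp_curve_0: "exp_curve v \<Gamma> ==> \<Gamma> 0 = \<one>"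
proof -
 assume h: "exp_curve v \<Gamma>"
 then have "\<Gamma> 0 \<otimes> \<Gamma> 0 = \<Gamma> 0" "\<Gamma> 0 \<in> carrier G" unfolding exp_curve_def by (metis add_0, blast)
 then show ?thesis by (metis l_cancel_one)
qed

lemma exp_curve_hom_curve:
 assumes \<Gamma>: "exp_curve v \<Gamma>" and v: "v \<in> L"
 shows "hom_curve (t *\<^sub>F v) (%\<tau>. \<Gamma> (of_real \<tau> * t))"
 unfolding hom_curve_def
proof (intro conjI allI impI)
 show "\<Gamma> (of_real \<tau> * t) \<in> carrier G" for \<tau> using \<Gamma> by (simp add: exp_curve_def)
 show "\<Gamma> (of_real (s + \<tau>) * t) = \<Gamma> (of_real s * t) \<otimes> \<Gamma> (of_real \<tau> * t)" for s \<tau>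
  using \<Gamma> unfolding exp_curve_def of_real_add distrib_right by blast
 fix f assume f: "sm f"
 have fl: "flow v 1 \<Gamma>" using \<Gamma> exp_curve_0[OF \<Gamma>] by (simp add: flow_def exp_curve_def)
 have "logd (%\<tau>. \<Gamma> (0 + of_real \<tau> * t)) (t *\<^sub>F v) 0" by (rule flow_logd[OF fl v]) simp
 then show "((%\<tau>. f (\<Gamma> (of_real \<tau> * t))) has_vector_derivative (t *\<^sub>F v) f) (at 0)"
  using f exp_curve_0[OF \<Gamma>] hat_one[OF L_scale[OF v]] by (simp add: logd_def)
qed

lemma ops_hom_curve:
 assumes "one_parameter_subgroup G v \<gamma>" shows "hom_curve v (%\<tau>. \<gamma> (of_real \<tau>))"
 unfolding hom_curve_def
proof (intro conjI allI impI)
 show "\<gamma> (of_real \<tau>) \<in> carrier G" for \<tau>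
  using assms smooth_map_into[of line M \<gamma>] top by (simp add: one_parameter_subgroup_def line_def)
 show "\<gamma> (of_real (s + \<tau>)) = \<gamma> (of_real s) \<otimes> \<gamma> (of_real \<tau>)" for s \<tau>
  using assms by (simp add: one_parameter_subgroup_def)
 fix f assume "sm f"
 then have "((%t. f (\<gamma> t)) has_field_derivative v f) (at (of_real 0))"
  using assms by (simp add: one_parameter_subgroup_def smooth_near_one_iff)
 from has_vector_derivative_real_field[OF this] show "((%\<tau>. f (\<gamma> (of_real \<tau>))) has_vector_derivative v f) (at 0)" .
qed

lemma charted_line: "charted (line :: ('k, 'k) manifold)"
proof -
 let ?e = "%(t::'k) (i::nat). if i = 0 then t else 0"
 have im: "range ?e = kspace 1"
 proof (intro equalityI subsetI)
  fix x :: "nat => 'k" assume "x \<in> kspace 1"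
  then have "x = ?e (x 0)" by (auto simp: kspace_def fun_eq_iff)
  then show "x \<in> range ?e" by blast
 qed (auto simp: kspace_def)
 have "homeomorphic_maps euclidean (top_of_set (range ?e)) ?e (%x. x 0)"
  unfolding homeomorphic_maps_def
 proof (intro conjI ballI)
  have "continuous_on UNIV (%t. ?e t i)" for i by (cases "i = 0") auto
  then have "continuous_on UNIV ?e" by (intro continuous_on_coordinatewise_then_product)
  then show "continuous_map euclidean (top_of_set (range ?e)) ?e" by (auto simp: continuous_map_in_subtopology)
  show "continuous_map (top_of_set (range ?e)) euclidean (%x. x 0)" by (simp add: continuous_on_coord)
 qed auto
 then have "homeomorphic_map euclidean (top_of_set (range ?e)) ?e" by (rule homeomorphic_maps_imp_map)
 moreover have "kopen 1 (range ?e)" unfolding im by simp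
 ultimately show ?thesis unfolding charted_def line_def by simp
qed

text \<open>Bootstrapping: the derivative of \<open>f\<close> along the curve is
  \<open>hat v f\<close> along the curve, and \<open>hat v f\<close> is smooth again, so the order
  of differentiability can be raised indefinitely.\<close>

lemma exp_curve_ops:
 assumes \<Gamma>: "exp_curve v \<Gamma>" and v: "v \<in> L" shows "one_parameter_subgroup G v \<Gamma>"
proof -
 let ?e = "%(t::'k) (i::nat). if i = 0 then t else 0"
 have inv_e: "inv_into UNIV ?e (?e t) = t" for t
  by (rule inv_into_f_f) (auto simp: inj_on_def fun_eq_iff split: if_splits)
 have \<Gamma>c: "\<Gamma> t \<in> carrier G" for t using \<Gamma> by (simp add: exp_curve_def)
 have D: "smooth_at M (\<Gamma> t) f ==> ((%t. f (\<Gamma> t)) has_field_derivative hat v f (\<Gamma> t)) (at t)" for t f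
  using \<Gamma> by (simp add: exp_curve_def)
 have openV: "open {t. \<Gamma> t \<in> V}" if V: "openin (mtop M) V" for V
 proof (subst open_subopen, rule ballI)
  fix t assume "t \<in> {t. \<Gamma> t \<in> V}"
  then have "\<forall>\<^sub>F s in nhds t. \<Gamma> s \<in> V"
   by (intro curve_continuous[where c = \<Gamma> and t = t and W = V]) (use \<Gamma>c V in \<open>auto intro: DERIV_isCont D\<close>)
  then show "\<exists>T. open T \<and> t \<in> T \<and> T \<subseteq> {t. \<Gamma> t \<in> V}" by (auto simp: eventually_nhds)
 qed
 have Ck: "Ck_on 1 m (?e ` {t. \<Gamma> t \<in> V}) (%x. f (\<Gamma> (x 0)))"
  if V: "openin (mtop M) V" and f: "smooth_fun M V f" for V f m
  using f
 proof (induction m arbitrary: f)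
  case 0
  have "smooth_at M (\<Gamma> t) f" if "\<Gamma> t \<in> V" for t using that V 0 unfolding smooth_at_def by blast
  then have "continuous_on {t. \<Gamma> t \<in> V} (%t. f (\<Gamma> t))"
   by (intro continuous_at_imp_continuous_on ballI) (use D DERIV_isCont in blast)
  then have "continuous_on (?e ` {t. \<Gamma> t \<in> V}) (%x. f (\<Gamma> (x 0)))"
   by (rule continuous_on_compose2[OF _ continuous_on_coord]) auto
  then show ?case by simp
 next
  case (Suc m)
  have sf: "smooth_at M q f" if "q \<in> V" for q using that V Suc.prems unfolding smooth_at_def by blast
  have "smooth_fun M V (hat v f)" by (rule smooth_fun_local[OF cM V]) (rule smooth_hat[OF v sf])
  from Suc.IH[OF this] have IH: "Ck_on 1 m (?e ` {t. \<Gamma> t \<in> V}) (%x. hat v f (\<Gamma> (x 0)))" .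
  have c: "continuous_on (?e ` {t. \<Gamma> t \<in> V}) (%x. f (\<Gamma> (x 0)))"
   using Ck_on_continuous[OF Suc.IH[OF Suc.prems]] .
  show ?case unfolding Ck_on.simps(2)
  proof (intro conjI c exI[of _ "%i x. hat v f (\<Gamma> (x 0))"] allI impI ballI IH)
   fix i :: nat and x assume "i < 1" and "x \<in> ?e ` {t. \<Gamma> t \<in> V}"
   then have i: "i = 0" and x: "\<Gamma> (x 0) \<in> V" by auto
   show "((%t. f (\<Gamma> ((x(i := t)) 0))) has_field_derivative hat v f (\<Gamma> (x 0))) (at (x i))"
    using D[OF sf[OF x]] by (simp add: i)
  qed
 qed
 have "smooth_map line M \<Gamma>"
  unfolding smooth_map_def
 proof (intro conjI ballI, goal_cases)
  case 1
  show ?case using openV \<Gamma>c by (simp add: continuous_map line_def top image_subset_iff)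
 next
  case (2 c)
  obtain V \<psi> where c: "c = (V, \<psi>)" "(V, \<psi>) \<in> atlas M" using 2 by (cases c) auto
  note V = chart_open[OF cM c(2)]
  have "smooth_fun line {t \<in> topspace (mtop line). \<Gamma> t \<in> V} (%t. \<psi> (\<Gamma> t) i)" if i: "i < nG" for i
  proof -
   have sf: "smooth_fun M V (%x. \<psi> x i)" using pM c(2) i unfolding premfd_def by blast
   have o: "kopen 1 (?e ` {t. \<Gamma> t \<in> V})"
    using chart_open_image[OF charted_line, of UNIV ?e "{t. \<Gamma> t \<in> V}"] openV[OF V] by (simp add: line_def)
   have "smooth_on 1 (?e ` {t. \<Gamma> t \<in> V}) (%x. \<psi> (\<Gamma> (inv_into UNIV ?e x)) i)"
    by (rule smooth_on_cong[OF o, of "%x. \<psi> (\<Gamma> (x 0)) i"]) (use Ck[OF V sf] inv_e in \<open>auto simp: smooth_on_def\<close>)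
   then show ?thesis by (simp add: smooth_fun_def line_def)
  qed
  then show ?case by (simp add: c)
 qed
 moreover have "\<forall>s t. \<Gamma> (s + t) = \<Gamma> s \<otimes> \<Gamma> t" using \<Gamma> by (simp add: exp_curve_def)
 moreover have "((%t. f (\<Gamma> t)) has_field_derivative v f) (at 0)" if "sm f" for f
  using D[of 0 f] that exp_curve_0[OF \<Gamma>] hat_one[OF v] by simp
 ultimately show ?thesis unfolding one_parameter_subgroup_def smooth_near_one_iff by blast
qed

lemma lie_exp_eq:
 assumes \<Gamma>: "exp_curve v \<Gamma>" and v: "v \<in> L" shows "lie_exp G (t *\<^sub>F v) = \<Gamma> t"
proof -
 obtain \<Gamma>' where \<Gamma>': "exp_curve (t *\<^sub>F v) \<Gamma>'" using exp_curve_exists[OF L_scale[OF v]] by blast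
 have u: "\<gamma> 1 = \<Gamma> t" if "one_parameter_subgroup G (t *\<^sub>F v) \<gamma>" for \<gamma>
  using hom_curve_unique[OF ops_hom_curve[OF that] exp_curve_hom_curve[OF \<Gamma> v] L_scale[OF v], of 1] by simp
 show ?thesis unfolding lie_exp_def
 proof (rule the_equality)
  show "\<exists>\<gamma>. one_parameter_subgroup G (t *\<^sub>F v) \<gamma> \<and> \<Gamma> t = \<gamma> 1"
   using exp_curve_ops[OF \<Gamma>' L_scale[OF v]] u[OF exp_curve_ops[OF \<Gamma>' L_scale[OF v]]] by metis
 qed (use u in metis)
qed

lemma exp_curve_lie_exp:
 assumes v: "v \<in> L" shows "exp_curve v (%t. lie_exp G (t *\<^sub>F v))"
proof -
 obtain \<Gamma> where "exp_curve v \<Gamma>" using exp_curve_exists[OF v] by blast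
 moreover from this have "(%t. lie_exp G (t *\<^sub>F v)) = \<Gamma>" using lie_exp_eq[OF _ v] by auto
 ultimately show ?thesis by simp
qed

lemma gexp_in: "v \<in> L ==> lie_exp G v \<in> carrier G"
 using exp_curve_lie_exp[of v] unfolding exp_curve_def by (metis fnvs.scale_one)

lemma gexp_add: "v \<in> L ==> lie_exp G ((s + t) *\<^sub>F v) = lie_exp G (s *\<^sub>F v) \<otimes> lie_exp G (t *\<^sub>F v)"
 using exp_curve_lie_exp[of v] unfolding exp_curve_def by blast

lemma gexp_0: "lie_exp G 0 = \<one>"
 using exp_curve_0[OF exp_curve_lie_exp[OF L_0]] by simp

lemma gexp_minus: "v \<in> L ==> lie_exp G (- v) = inv (lie_exp G v)"
proof -
 assume v: "v \<in> L"
 have "lie_exp G (((- 1) + 1) *\<^sub>F v) = lie_exp G ((- 1) *\<^sub>F v) \<otimes> lie_exp G (1 *\<^sub>F v)" by (rule gexp_add[OF v])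
 then have "lie_exp G (- v) \<otimes> lie_exp G v = \<one>" by (simp add: gexp_0 fnvs.scale_minus_left)
 then show ?thesis using gexp_in[OF v] gexp_in[OF L_uminus[OF v]] by (simp add: inv_equality)
qed

lemma gexp_deriv:
 "v \<in> L ==> smooth_at M (lie_exp G (t *\<^sub>F v)) f ==> ((%t. f (lie_exp G (t *\<^sub>F v))) has_field_derivative hat v f (lie_exp G (t *\<^sub>F v))) (at t)"
 using exp_curve_lie_exp[of v] unfolding exp_curve_def by blast

lemma hom_curve_exp: "hom_curve v c ==> v \<in> L ==> c t = lie_exp G (of_real t *\<^sub>F v)"
 using hom_curve_unique[of v c "%\<tau>. lie_exp G ((of_real \<tau> * 1) *\<^sub>F v)" t] exp_curve_hom_curve[OF exp_curve_lie_exp, of v 1] by simp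

lemma gexp_conj:
 assumes g: "g \<in> carrier G" and v: "v \<in> L"
 shows "g \<otimes> lie_exp G v \<otimes> inv g = lie_exp G (Ad g v)"
proof -
 let ?c = "%\<tau>::real. g \<otimes> lie_exp G (of_real \<tau> *\<^sub>F v) \<otimes> inv g"
 have h: "hom_curve v (%\<tau>. lie_exp G (of_real \<tau> *\<^sub>F v))"
  using exp_curve_hom_curve[OF exp_curve_lie_exp[OF v] v, of 1] by simp
 have "hom_curve (Ad g v) ?c"
  unfolding hom_curve_def
 proof (intro conjI allI impI)
  have e: "lie_exp G (of_real \<tau> *\<^sub>F v) \<in> carrier G" for \<tau> :: real by (rule gexp_in[OF L_scale[OF v]])
  show "?c \<tau> \<in> carrier G" for \<tau> using e g by simp
  fix s \<tau>
  have "inv g \<otimes> (g \<otimes> (lie_exp G (of_real \<tau> *\<^sub>F v) \<otimes> inv g)) = lie_exp G (of_real \<tau> *\<^sub>F v) \<otimes> inv g"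
   using e g by (simp add: m_assoc[symmetric])
  then show "?c (s + \<tau>) = ?c s \<otimes> ?c \<tau>" using e g by (simp add: gexp_add[OF v] m_assoc)
 next
  fix f assume f: "sm f"
  have "((%\<tau>. f (?c \<tau>)) has_vector_derivative v (%h. f (g \<otimes> h \<otimes> inv g))) (at 0)"
   using h sm_conj[OF g f] unfolding hom_curve_def by blast
  then show "((%\<tau>. f (?c \<tau>)) has_vector_derivative Ad g v f) (at 0)" using f by (simp add: Ad_def)
 qed
 from hom_curve_exp[OF this Ad_in[OF g v], of 1] show ?thesis by simp
qed

text \<open>As a function of \<open>z\<close>, \<open>Ad\<close> of the exponential applied to
  \<open>E\<close> solves the linear equation with factor \<alpha>; multiplied by
  \<open>exp (- (z * \<alpha>))\<close> it is constant.\<close>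

lemma Ad_exp_eigen:
 assumes Y: "Y \<in> L" and E: "E \<in> L" and al: "br Y E = \<alpha> *\<^sub>F E"
 shows "Ad (lie_exp G (z *\<^sub>F Y)) E = (exp (z * \<alpha>)) *\<^sub>F E"
proof
 fix f
 show "Ad (lie_exp G (z *\<^sub>F Y)) E f = ((exp (z * \<alpha>)) *\<^sub>F E) f"
 proof (cases "sm f")
  case False
  then show ?thesis using der_not[OF E False] by (simp add: Ad_def fscale_def)
 next
  case True
  let ?g = "%z. lie_exp G (z *\<^sub>F Y)"
  have gc: "?g z \<in> carrier G" for z by (rule gexp_in[OF L_scale[OF Y]])
  have D: "((%z. Ad (?g z) E f) has_field_derivative \<alpha> * Ad (?g z) E f) (at z)" for z
  proof -
   have "hat Y (%g. Ad g E f) (?g z) = Y (%h. Ad (?g z) (Ad h E) f)"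
    unfolding hat_def by (rule der_cong[OF Y]) (simp add: Ad_mult[OF gc _ E])
   also have "\<dots> = Y (%h. Ad h E (%k. f (?g z \<otimes> k \<otimes> inv (?g z))))"
    using True by (simp add: Ad_def[of "?g z"])
   also have "\<dots> = (\<alpha> *\<^sub>F E) (%k. f (?g z \<otimes> k \<otimes> inv (?g z)))"
    using der_Ad[OF Y E sm_conj[OF gc True]] al by simp
   also have "\<dots> = \<alpha> * Ad (?g z) E f" using True by (simp add: Ad_def fscale_def)
   finally show ?thesis using gexp_deriv[OF Y, of z "%g. Ad g E f"] smooth_Ad[OF E True gc] by simp
  qed
  have "((%z. exp (- (z * \<alpha>)) * Ad (?g z) E f) has_field_derivative 0) (at z)" for z
   by (rule derivative_eq_intros D refl | simp)+
  then have "\<exists>c. \<forall>z\<in>UNIV. exp (- (z * \<alpha>)) * Ad (?g z) E f = c"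
   by (intro has_field_derivative_zero_constant) auto
  then have "exp (- (z * \<alpha>)) * Ad (?g z) E f = exp (- (0 * \<alpha>)) * Ad (?g 0) E f" by (metis UNIV_I)
  also have "\<dots> = E f" using Ad_one[OF E] by (simp add: gexp_0)
  finally have "exp (- (z * \<alpha>)) * Ad (?g z) E f = E f" .
  then have "Ad (?g z) E f = exp (z * \<alpha>) * E f" by (auto simp: exp_minus field_simps)
  then show ?thesis by (simp add: fscale_def)
 qed
qed

lemma flow_eq_exp:
 assumes \<gamma>: "flow v r \<gamma>" and v: "v \<in> L" and t: "t \<in> ball 0 r"
 shows "\<gamma> t = lie_exp G (t *\<^sub>F v)"
proof -
 have r: "r > 0" using t by (metis dist_0_norm le_less_trans mem_ball norm_ge_zero)
 have seg: "0 + of_real \<tau> * t \<in> ball 0 r" if "\<tau> \<in> {0..1}" for \<tau>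
 proof -
  have "(1 - \<tau>) *\<^sub>R 0 + \<tau> *\<^sub>R t \<in> ball 0 r" using that t r by (intro convexD[OF convex_ball]) auto
  then show ?thesis by (simp add: scaleR_conv_of_real)
 qed
 note h = exp_curve_hom_curve[OF exp_curve_lie_exp[OF v] v, of t]
 have "\<gamma> (0 + of_real 1 * t) \<otimes> inv (lie_exp G ((of_real 1 * t) *\<^sub>F v)) = \<gamma> (0 + of_real 0 * t) \<otimes> inv (lie_exp G ((of_real 0 * t) *\<^sub>F v))"
  by (rule logd_unique[where A = "{0..1}" and v = "t *\<^sub>F v" and ?c1.0 = "%\<tau>. \<gamma> (0 + of_real \<tau> * t)" and ?c2.0 = "%\<tau>. lie_exp G ((of_real \<tau> * t) *\<^sub>F v)",
     OF _ _ _ L_scale[OF v] flow_logd[OF \<gamma> v seg] hom_curve_logd[OF h L_scale[OF v]]]) (auto simp: gexp_in L_scale v)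
 moreover have "\<gamma> t \<in> carrier G" "\<gamma> 0 = \<one>" using \<gamma> t by (auto simp: flow_def)
 ultimately show ?thesis using gexp_in[OF L_scale[OF v], of t] by (simp add: gexp_0 inv_solve_right')
qed

lemma gexp_pow: "v \<in> L ==> lie_exp G (of_nat k *\<^sub>F v) = lie_exp G v [^] k"
proof (induction k)
 case 0 then show ?case by (metis gexp_0 fnvs.scale_zero_left of_nat_0 nat_pow_0)
next
 case (Suc k)
 have "lie_exp G ((of_nat k + 1) *\<^sub>F v) = lie_exp G (of_nat k *\<^sub>F v) \<otimes> lie_exp G (1 *\<^sub>F v)" by (rule gexp_add[OF Suc.prems])
 then show ?case using Suc by (simp add: add.commute)
qed

text \<open>Dividing by \<open>m\<close> brings the time into the common ball of
  \<open>ode_setup\<close>, where \<open>solution_dependence\<close> compares the solutions for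
  \<open>v\<close> and \<open>vk k\<close>; the \<open>m\<close>-th power, a continuous map, leads
  back.\<close>

lemma gexp_continuous:
 assumes v: "v \<in> L" and vk: "\<And>k. vk k \<in> L" and lim: "\<And>j. j < nG ==> (%k. vk k (crd j)) \<longlonglongrightarrow> v (crd j)"
  and W: "openin (mtop M) W" "lie_exp G v \<in> W"
 shows "\<forall>\<^sub>F k in sequentially. lie_exp G (vk k) \<in> W"
proof -
 \<comment> \<open>The added 1 makes the bound hold for all \<open>vk k\<close> close to
   \<open>v\<close>, and also for each \<open>bas j\<close>, whose coordinates have norms summing to
   1.\<close>
 define R where "R = (\<Sum>j<nG. norm (v (crd j))) + 1"
 have R0: "R \<ge> 0" by (simp add: R_def sum_nonneg add_nonneg_nonneg)
 obtain \<rho> where \<rho>: "\<rho> > 0" "kbox nG x1 \<rho> \<subseteq> phi1 ` U1" and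
  ex: "\<forall>R\<ge>0. \<exists>r>0. \<exists>C K. \<forall>v\<in>L. (\<Sum>j<nG. norm (v (crd j))) \<le> R \<longrightarrow> ode_box nG (Fv v) x1 \<rho> r C K"
  using ode_setup by (elim exE conjE) (rule that; assumption)
 from ex[rule_format, OF R0] obtain r C K where r: "r > 0" and
  box: "\<And>v. v \<in> L ==> (\<Sum>j<nG. norm (v (crd j))) \<le> R ==> ode_box nG (Fv v) x1 \<rho> r C K" by blast
 have vR: "(\<Sum>j<nG. norm (v (crd j))) \<le> R" by (simp add: R_def)
 note ob = box[OF v vR]
 define Sol where "Sol w \<gamma> \<longleftrightarrow> \<gamma> 0 = x1 \<and>
   (\<forall>z\<in>ball 0 r. \<gamma> z \<in> kbox nG x1 \<rho> \<and> (\<forall>i<nG. ((%z. \<gamma> z i) has_field_derivative Fv w i (\<gamma> z)) (at z))) \<and>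
   (\<forall>z\<in>ball 0 r. ps (\<gamma> z) = lie_exp G (z *\<^sub>F w))" for w \<gamma>
 have SolD: "\<gamma> 0 = x1" "z \<in> ball 0 r ==> \<gamma> z \<in> kbox nG x1 \<rho>"
   "i < nG ==> z \<in> ball 0 r ==> ((%z. \<gamma> z i) has_field_derivative Fv w i (\<gamma> z)) (at z)"
   "z \<in> ball 0 r ==> ps (\<gamma> z) = lie_exp G (z *\<^sub>F w)" if h: "Sol w \<gamma>" for w \<gamma> z i
 proof -
  note h = h[unfolded Sol_def]
  note c = h[THEN conjunct2, THEN conjunct1] and d = h[THEN conjunct2, THEN conjunct2]
  show "\<gamma> 0 = x1" by (rule conjunct1[OF h])
  assume z: "z \<in> ball 0 r"
  show "\<gamma> z \<in> kbox nG x1 \<rho>" by (rule conjunct1[OF bspec[OF c z]])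
  show "ps (\<gamma> z) = lie_exp G (z *\<^sub>F w)" by (rule bspec[OF d z])
  assume "i < nG"
  then show "((%z. \<gamma> z i) has_field_derivative Fv w i (\<gamma> z)) (at z)" by (rule conjunct2[OF bspec[OF c z], rule_format])
 qed
 have sol: "\<exists>\<gamma>. Sol w \<gamma>" if w: "w \<in> L" "(\<Sum>j<nG. norm (w (crd j))) \<le> R" for w
 proof -
  from ode_box.local_solution[OF box[OF w]] obtain \<gamma> where \<gamma>: "\<gamma> 0 = x1" "\<And>z. z \<in> ball 0 r ==> \<gamma> z \<in> kbox nG x1 \<rho>"
   "\<And>z i. z \<in> ball 0 r ==> i < nG ==> ((%z. \<gamma> z i) has_field_derivative Fv w i (\<gamma> z)) (at z)" by blast
  from flow_of_solution[OF w(1) \<rho>(2) this] have "flow w r (%z. ps (\<gamma> z))" by simp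
  from flow_eq_exp[OF this w(1)] show ?thesis unfolding Sol_def using \<gamma> by (intro exI[of _ \<gamma>]) auto
 qed
 from sol[OF v vR] obtain \<gamma> where g: "Sol v \<gamma>" by (rule exE)
 note \<gamma> = SolD[OF g]
 from reals_Archimedean2 obtain m :: nat where m: "1 / r < real m" ..
 have "0 < 1 / r" using r by simp
 then have m0: "m > 0" using m by (cases m) auto
 define z :: 'k where "z = 1 / of_nat m"
 have z: "z \<in> ball 0 r" using m m0 r by (simp add: z_def norm_divide field_simps)
 define W' where "W' = {x \<in> topspace (mtop M). x [^] m \<in> W}"
 have "continuous_map (mtop M) (mtop M) (%x. x [^] k)" for k :: nat
 proof (induction k)
  case 0 then show ?case by (simp add: top)
 next
  case (Suc k)
  have "smooth_map M M (%x. x [^] k)" for k :: nat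
  proof (induction k)
   case 0 then show ?case using smooth_const[OF cM one_closed] by simp
  next
   case (Suc k) then show ?case using smooth_mult[OF cM Suc smooth_id] by simp
  qed
  then show ?case by (rule smooth_map_continuous)
 qed
 from openin_continuous_map_preimage[OF this W(1)] have W'o: "openin (mtop M) W'" by (simp add: W'_def)
 have "lie_exp G (z *\<^sub>F v) [^] m = lie_exp G v"
  using gexp_pow[OF L_scale[OF v], of m z] m0 by (simp add: z_def)
 then have W'v: "ps (\<gamma> z) \<in> W'" using W(2) \<gamma>(4)[OF z] gexp_in[OF L_scale[OF v]] by (simp add: W'_def top)
 have inU: "ps (\<gamma> z) \<in> U1" "phi1 (ps (\<gamma> z)) = \<gamma> z"
  using \<gamma>(2)[OF z] \<rho>(2) by (auto simp: subset_iff intro: inv_into_into f_inv_into_f)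
 have "kopen nG (phi1 ` (W' \<inter> U1))" by (rule chart_open_image[OF cM chart1(1)]) (use W'o U1_open in auto)
 moreover have "\<gamma> z \<in> phi1 ` (W' \<inter> U1)" using inU W'v by (metis IntI imageI)
 ultimately obtain e where e: "e > 0" "kbox nG (\<gamma> z) e \<subseteq> phi1 ` (W' \<inter> U1)" using kopen_contains_kbox by blast
 \<comment> \<open>A bound for the basis fields is read off from the box belonging to
   \<open>bas j\<close>.\<close>
 obtain CE where CE: "CE \<ge> 0" "\<And>i j w. i < nG ==> j < nG ==> w \<in> kbox nG x1 \<rho> ==> norm (Ef i j w) \<le> CE"
 proof (rule that[of "max C 0"])
  fix i j w assume ij: "i < nG" "j < nG" "w \<in> kbox nG x1 \<rho>"
  have eF: "Fv (bas j) i w = Ef i j w" using ij bas(2) by (simp add: Fv_def if_distrib[of "%x. x * _"] cong: if_cong)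
  have "(\<Sum>l<nG. norm (bas j (crd l))) = (\<Sum>l<nG. if l = j then 1 else 0)" by (rule sum.cong) (simp_all add: bas(2))
  then have "(\<Sum>l<nG. norm (bas j (crd l))) \<le> R" using ij(2) by (simp add: R_def sum_nonneg)
  from ode_box.bF[OF box[OF bas(1) this] ij(1,3)] show "norm (Ef i j w) \<le> max C 0" by (simp add: eF)
 qed simp
 define \<epsilon> where "\<epsilon> k = (\<Sum>j<nG. norm (vk k (crd j) - v (crd j))) * CE" for k
 have "(%k. (\<Sum>j<nG. norm (vk k (crd j) - v (crd j)))) \<longlonglongrightarrow> (\<Sum>j<nG. 0)"
  by (intro tendsto_sum tendsto_norm_zero) (use lim in \<open>auto simp: LIM_zero\<close>)
 then have sum0: "(%k. (\<Sum>j<nG. norm (vk k (crd j) - v (crd j)))) \<longlonglongrightarrow> 0" by simp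
 have "(%k. 2 * real nG * r * \<epsilon> k) \<longlonglongrightarrow> 2 * real nG * r * (0 * CE)"
  unfolding \<epsilon>_def by (intro tendsto_mult tendsto_const sum0)
 then have ev1: "\<forall>\<^sub>F k in sequentially. 2 * real nG * r * \<epsilon> k < e" using order_tendstoD(2)[of _ "2 * real nG * r * (0 * CE)"] e(1) by simp
 have ev2: "\<forall>\<^sub>F k in sequentially. (\<Sum>j<nG. norm (vk k (crd j) - v (crd j))) < 1" using order_tendstoD(2)[OF sum0] by simp
 show ?thesis using ev1 ev2
 proof eventually_elim
  case (elim k)
  have "(\<Sum>j<nG. norm (vk k (crd j))) \<le> (\<Sum>j<nG. norm (v (crd j)) + norm (vk k (crd j) - v (crd j)))"
   by (rule sum_mono) (metis norm_triangle_sub)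
  also have "\<dots> \<le> R" using elim(2) by (simp add: sum.distrib R_def)
  finally have "(\<Sum>j<nG. norm (vk k (crd j))) \<le> R" .
  from sol[OF vk this] obtain \<delta> where d: "Sol (vk k) \<delta>" by (rule exE)
  note \<delta> = SolD[OF d]
  have "norm (\<delta> z i - \<gamma> z i) \<le> 2 * real nG * r * \<epsilon> k" if i: "i < nG" for i
  proof (rule ode_box.solution_dependence[OF ob \<gamma>(1-3) \<delta>(1-3) _ z i])
   fix i w assume iw: "i < nG" "w \<in> kbox nG x1 \<rho>"
   have "Fv (vk k) i w - Fv v i w = (\<Sum>j<nG. (vk k (crd j) - v (crd j)) * Ef i j w)"
    by (simp add: Fv_def sum_subtractf[symmetric] algebra_simps)
   also have "norm \<dots> \<le> (\<Sum>j<nG. norm (vk k (crd j) - v (crd j)) * CE)"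
    by (rule sum_norm_le) (use CE iw in \<open>auto simp: norm_mult intro!: mult_left_mono\<close>)
   finally show "norm (Fv (vk k) i w - Fv v i w) \<le> \<epsilon> k" by (simp add: \<epsilon>_def sum_distrib_right)
  qed
  then have "\<delta> z \<in> kbox nG (\<gamma> z) e" using elim(1) \<delta>(2)[OF z] by (force simp: kbox_def dist_norm)
  then obtain q where "q \<in> W'" "q \<in> U1" "\<delta> z = phi1 q" using e(2) by blast
  then have "lie_exp G (z *\<^sub>F vk k) \<in> W'" using \<delta>(4)[OF z] ps_phi1 by simp
  then have "lie_exp G (z *\<^sub>F vk k) [^] m \<in> W" by (simp add: W'_def)
  then show ?case using gexp_pow[OF L_scale[OF vk], of m z] m0 by (simp add: z_def)
 qed
qed

end

declare zero_fun_def [simp del] zero_fun_apply [simp]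

section \<open>Cartan decompositions and restricted roots\<close>

locale lie_alg =
 fixes L :: "('x => real) set" and br :: "('x => real) => ('x => real) => ('x => real)"
 assumes sub: "fnvs.subspace L"
  and br_in: "\<And>x y. x \<in> L ==> y \<in> L ==> br x y \<in> L"
  and br_anti: "\<And>x y. x \<in> L ==> y \<in> L ==> br x y = - br y x"
  and br_add: "\<And>x y z. x \<in> L ==> y \<in> L ==> z \<in> L ==> br x (y + z) = br x y + br x z"
  and br_scale: "\<And>c x y. x \<in> L ==> y \<in> L ==> br x (c *\<^sub>F y) = c *\<^sub>F br x y"
  and jacobi: "\<And>x y z. x \<in> L ==> y \<in> L ==> z \<in> L ==> br (br x y) z = br x (br y z) - br y (br x z)"
  and simple: "simple_lie_algebra L br"

locale cartan = lie_alg L br for L :: "('x => real) set" and br +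
 fixes \<theta> and kk pp aa :: "('x => real) set"
 assumes cart: "cartan_involution L br \<theta>"
  and kk: "kk = {X \<in> L. \<theta> X = X}" and pp: "pp = {X \<in> L. \<theta> X = - X}"
  and maxab: "maximal_abelian_in br pp aa"
begin

lemma L_add: "u \<in> L ==> v \<in> L ==> u + v \<in> L"
 and L_scale: "u \<in> L ==> c *\<^sub>F u \<in> L"
 and L_diff: "u \<in> L ==> v \<in> L ==> u - v \<in> L"
 and L_0: "0 \<in> L"
 and L_uminus: "u \<in> L ==> - u \<in> L"
 using sub by (auto intro: fnvs.subspace_add fnvs.subspace_scale fnvs.subspace_diff fnvs.subspace_0 fnvs.subspace_neg)

lemma br_diff: "x \<in> L ==> y \<in> L ==> z \<in> L ==> br x (y - z) = br x y - br x z"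
 using br_add[of x "y - z" z] by (simp add: L_diff algebra_simps)

lemma br_add_left: "x \<in> L ==> y \<in> L ==> z \<in> L ==> br (x + y) z = br x z + br y z"
 using br_add[of z x y] br_anti[of "x + y" z] br_anti[of x z] br_anti[of y z] by (simp add: L_add)

lemma br_scale_left: "x \<in> L ==> y \<in> L ==> br (c *\<^sub>F x) y = c *\<^sub>F br x y"
 using br_scale[of y x c] br_anti[of "c *\<^sub>F x" y] br_anti[of x y] by (simp add: L_scale)

lemma br_uminus_left: "x \<in> L ==> y \<in> L ==> br (- x) y = - br x y"
 using br_scale_left[of x y "-1"] by simp

lemma br_self: "x \<in> L ==> br x x = 0"
proof -
 assume "x \<in> L"
 then have "br x x f = - br x x f" for f using br_anti[of x x] by (metis uminus_apply)
 then show ?thesis by (auto simp: fun_eq_iff)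
qed

lemma th_in: "x \<in> L ==> \<theta> x \<in> L" and th_th: "x \<in> L ==> \<theta> (\<theta> x) = x"
 and th_add: "x \<in> L ==> y \<in> L ==> \<theta> (x + y) = \<theta> x + \<theta> y"
 and th_br: "x \<in> L ==> y \<in> L ==> \<theta> (br x y) = br (\<theta> x) (\<theta> y)"
 and th_scale: "x \<in> L ==> \<theta> (c *\<^sub>F x) = c *\<^sub>F \<theta> x"
 and th_pos: "x \<in> L ==> x \<noteq> 0 ==> - killing_form L br x (\<theta> x) > 0"
 using cart unfolding cartan_involution_def by simp_all

lemma th_uminus: "x \<in> L ==> \<theta> (- x) = - \<theta> x"
 using th_scale[of x "-1"] by simp

lemma th_diff: "x \<in> L ==> y \<in> L ==> \<theta> (x - y) = \<theta> x - \<theta> y"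
 using th_add[of "x - y" y] by (simp add: L_diff algebra_simps)

lemma th_0: "\<theta> 0 = 0"
 using th_scale[OF L_0, of 0] by simp

lemma aa_sub: "fnvs.subspace aa" and aa_pp: "aa \<subseteq> pp" and aa_ab: "x \<in> aa ==> y \<in> aa ==> br x y = 0"
 using maxab unfolding maximal_abelian_in_def abelian_on_def by simp_all

lemma aa_max: "fnvs.subspace b ==> b \<subseteq> pp ==> abelian_on br b ==> aa \<subseteq> b ==> b = aa"
 using maxab unfolding maximal_abelian_in_def by simp

lemma pp_L: "x \<in> pp ==> x \<in> L" and aa_L: "x \<in> aa ==> x \<in> L" and th_pp: "x \<in> pp ==> \<theta> x = - x" and th_aa: "x \<in> aa ==> \<theta> x = - x"
 using aa_pp by (auto simp: pp)

lemma aa_scale: "x \<in> aa ==> c *\<^sub>F x \<in> aa"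
 using aa_sub by (rule fnvs.subspace_scale)

subsection \<open>The Killing form\<close>

text \<open>The very basis that \<open>trace_on\<close> picks, so the Killing form unfolds to
  \<open>tr\<close> and independence of the basis never becomes a question.\<close>

definition B0 :: "('x => real) set" where "B0 = (SOME B. fnvs.independent B \<and> fnvs.span B = L)"

lemma B0: "fnvs.independent B0" "fnvs.span B0 = L"
proof -
 obtain B where "B \<subseteq> L" "fnvs.independent B" "L \<subseteq> fnvs.span B" using fnvs.maximal_independent_subset by blast
 then have "fnvs.independent B \<and> fnvs.span B = L" using fnvs.span_minimal[OF _ sub] by blast
 then have "fnvs.independent B0 \<and> fnvs.span B0 = L" unfolding B0_def by (rule someI)
 then show "fnvs.independent B0" "fnvs.span B0 = L" by auto
qed

lemma B0_L: "b \<in> B0 ==> b \<in> L"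
 using B0(2) fnvs.span_base by blast

abbreviation "rep \<equiv> fnvs.representation B0"

definition tr :: "(('x => real) => ('x => real)) => real" where
 "tr F = (\<Sum>b\<in>B0. rep (F b) b)"

lemma killing_tr: "killing_form L br x y = tr (%z. br x (br y z))"
 unfolding killing_form_def trace_on_def tr_def B0_def Let_def ..

lemma ex_nonzero: "\<exists>x\<in>L. x \<noteq> 0"
proof -
 obtain x y where "x \<in> L" "y \<in> L" "br x y \<noteq> 0" using simple unfolding simple_lie_algebra_def abelian_on_def by blast
 then show ?thesis using br_in by blast
qed

text \<open>Over an infinite basis the sum defining the trace is 0 by convention, so the Killing
  form would vanish, against the positivity demanded of \<theta>. Finite dimension thus comes from
  the Cartan involution.\<close>

lemma fin_B0: "finite B0"
proof (rule ccontr)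
 assume "infinite B0"
 obtain x where x: "x \<in> L" "x \<noteq> 0" using ex_nonzero by blast
 have "killing_form L br x (\<theta> x) = 0" unfolding killing_tr tr_def using \<open>infinite B0\<close> by simp
 then show False using th_pos[OF x] by simp
qed

definition lin :: "(('x => real) => ('x => real)) => bool" where
 "lin F \<longleftrightarrow> (\<forall>x\<in>L. F x \<in> L) \<and> (\<forall>x\<in>L. \<forall>y\<in>L. F (x + y) = F x + F y) \<and> (\<forall>c. \<forall>x\<in>L. F (c *\<^sub>F x) = c *\<^sub>F F x)"

lemma lin_br: "x \<in> L ==> lin (br x)"
 by (simp add: lin_def br_in br_add br_scale)

lemma lin_th: "lin \<theta>"
 by (simp add: lin_def th_in th_add th_scale)

lemma lin_comp: "lin F ==> lin H ==> lin (%z. F (H z))"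
 by (simp add: lin_def)

lemma rep_add: "x \<in> L ==> y \<in> L ==> rep (x + y) b = rep x b + rep y b"
 using fnvs.representation_add[OF B0(1), of y x] B0(2) by simp

lemma rep_scale: "x \<in> L ==> rep (c *\<^sub>F x) b = c * rep x b"
 using fnvs.representation_scale[OF B0(1), of x c] B0(2) by simp

lemma expand: "x \<in> L ==> x = (\<Sum>c\<in>B0. rep x c *\<^sub>F c)"
 using fnvs.sum_representation_eq[OF B0(1) _ fin_B0] B0(2) by simp

lemma lin_sum:
 assumes F: "lin F" and "finite I" "\<And>i. i \<in> I ==> g i \<in> L"
 shows "F (\<Sum>i\<in>I. c i *\<^sub>F g i) = (\<Sum>i\<in>I. c i *\<^sub>F F (g i)) \<and> (\<Sum>i\<in>I. c i *\<^sub>F g i) \<in> L"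
 using assms(2,3)
proof (induction I rule: finite_induct)
 case empty
 have "F (0 *\<^sub>F 0) = 0 *\<^sub>F F 0" using F L_0 unfolding lin_def by blast
 then have "F 0 = 0" by (simp only: fnvs.scale_zero_left)
 then show ?case unfolding sum.empty using L_0 by blast
next
 case (insert i I)
 then have gi: "g i \<in> L" and IH: "F (\<Sum>i\<in>I. c i *\<^sub>F g i) = (\<Sum>i\<in>I. c i *\<^sub>F F (g i))" "(\<Sum>i\<in>I. c i *\<^sub>F g i) \<in> L" by auto
 have "F (c i *\<^sub>F g i + (\<Sum>i\<in>I. c i *\<^sub>F g i)) = c i *\<^sub>F F (g i) + (\<Sum>i\<in>I. c i *\<^sub>F F (g i))"
  using F gi IH L_scale[OF gi] unfolding lin_def by metis
 then show ?case unfolding sum.insert[OF insert(1,2)] using L_add[OF L_scale[OF gi] IH(2)] by blast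
qed

lemma rep_sum:
 assumes "finite I" "\<And>i. i \<in> I ==> g i \<in> L"
 shows "rep (\<Sum>i\<in>I. c i *\<^sub>F g i) b = (\<Sum>i\<in>I. c i * rep (g i) b)"
 using assms
proof (induction I rule: finite_induct)
 case empty show ?case unfolding sum.empty fnvs.representation_zero by (rule refl)
next
 case (insert i I)
 have "(\<Sum>i\<in>I. c i *\<^sub>F g i) \<in> L" using sub insert by (intro fnvs.subspace_sum) (auto intro: L_scale)
 note S = this
 have gi: "g i \<in> L" and IH: "rep (\<Sum>i\<in>I. c i *\<^sub>F g i) b = (\<Sum>i\<in>I. c i * rep (g i) b)" using insert by auto
 show ?case unfolding sum.insert[OF insert(1,2)] by (simp only: rep_add[OF L_scale[OF gi] S] rep_scale[OF gi] IH)
qed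

lemma tr_expand:
 assumes F: "lin F" and H: "lin H"
 shows "tr (%z. F (H z)) = (\<Sum>b\<in>B0. \<Sum>c\<in>B0. rep (H b) c * rep (F c) b)"
 unfolding tr_def
proof (rule sum.cong[OF refl])
 fix b assume b: "b \<in> B0"
 have "H b \<in> L" using H B0_L[OF b] by (simp add: lin_def)
 then have "F (H b) = F (\<Sum>c\<in>B0. rep (H b) c *\<^sub>F c)" using expand by metis
 also have "\<dots> = (\<Sum>c\<in>B0. rep (H b) c *\<^sub>F F c)" using lin_sum[OF F fin_B0, of "%c. c" "rep (H b)"] B0_L by simp
 finally show "rep (F (H b)) b = (\<Sum>c\<in>B0. rep (H b) c * rep (F c) b)"
  using rep_sum[OF fin_B0, of F "rep (H b)" b] F B0_L by (simp add: lin_def)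
qed

lemma tr_comm: "lin F ==> lin H ==> tr (%z. F (H z)) = tr (%z. H (F z))"
 by (simp add: tr_expand) (subst sum.swap, simp add: mult.commute)

lemma tr_cong: "(\<And>z. z \<in> L ==> F z = H z) ==> tr F = tr H"
 unfolding tr_def by (rule sum.cong) (auto simp: B0_L)

lemma tr_add: "lin F ==> lin H ==> tr (%z. F z + H z) = tr F + tr H"
 unfolding tr_def by (simp add: rep_add lin_def B0_L sum.distrib)

lemma tr_scale: "lin F ==> tr (%z. c *\<^sub>F F z) = c * tr F"
 unfolding tr_def by (simp add: rep_scale lin_def B0_L sum_distrib_left)

abbreviation "KF \<equiv> killing_form L br"

lemma KF_sym: "x \<in> L ==> y \<in> L ==> KF x y = KF y x"
 unfolding killing_tr by (rule tr_comm[OF lin_br lin_br])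

lemma KF_add: "x \<in> L ==> y \<in> L ==> z \<in> L ==> KF (x + y) z = KF x z + KF y z"
proof -
 assume h: "x \<in> L" "y \<in> L" "z \<in> L"
 have "KF (x + y) z = tr (%w. br x (br z w) + br y (br z w))"
  unfolding killing_tr by (rule tr_cong) (simp add: br_add_left h br_in)
 also have "\<dots> = KF x z + KF y z" unfolding killing_tr by (rule tr_add) (intro lin_comp[OF lin_br lin_br] h)+
 finally show ?thesis .
qed

lemma KF_scale: "x \<in> L ==> y \<in> L ==> KF (c *\<^sub>F x) y = c * KF x y"
proof -
 assume h: "x \<in> L" "y \<in> L"
 have "KF (c *\<^sub>F x) y = tr (%w. c *\<^sub>F br x (br y w))"
  unfolding killing_tr by (rule tr_cong) (simp add: br_scale_left h br_in)
 also have "\<dots> = c * KF x y" unfolding killing_tr by (rule tr_scale) (intro lin_comp[OF lin_br lin_br] h)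
 finally show ?thesis .
qed

lemma KF_th: "x \<in> L ==> y \<in> L ==> KF (\<theta> x) y = KF x (\<theta> y)"
proof -
 assume h: "x \<in> L" "y \<in> L"
 have "KF (\<theta> x) y = tr (%w. \<theta> (br x (\<theta> (br y w))))"
  unfolding killing_tr by (rule tr_cong) (simp add: th_br h br_in th_in th_th)
 also have "\<dots> = tr (%w. br x (\<theta> (br y (\<theta> w))))"
  using tr_comm[OF lin_th lin_comp[OF lin_br[OF h(1)] lin_comp[OF lin_th lin_br[OF h(2)]]]] .
 also have "\<dots> = KF x (\<theta> y)"
  unfolding killing_tr by (rule tr_cong) (simp add: th_br h br_in th_in th_th)
 finally show ?thesis .
qed

text \<open>Invariance follows from \<open>ad [x, y] = [ad x, ad y]\<close> and cyclicity of the trace.\<close>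

lemma KF_inv: "x \<in> L ==> y \<in> L ==> z \<in> L ==> KF (br x y) z = KF x (br y z)"
proof -
 assume h: "x \<in> L" "y \<in> L" "z \<in> L"
 note l = lin_comp[OF lin_br lin_comp[OF lin_br lin_br]]
 have l': "lin (%w. (- 1) *\<^sub>F F w)" if "lin F" for F
  using that unfolding lin_def by (auto simp: L_scale L_uminus algebra_simps)
 have "KF (br x y) z = tr (%w. br x (br y (br z w)) + (- 1) *\<^sub>F br y (br x (br z w)))"
  unfolding killing_tr by (rule tr_cong) (simp add: jacobi h br_in)
 also have "\<dots> = tr (%w. br x (br y (br z w))) + (- 1) * tr (%w. br y (br x (br z w)))"
  using tr_add[OF l[OF h] l'[OF l[OF h(2,1,3)]]] tr_scale[OF l[OF h(2,1,3)], of "-1"] by simp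
 also have "tr (%w. br y (br x (br z w))) = tr (%w. br x (br z (br y w)))"
  using tr_comm[OF lin_br[OF h(2)] lin_comp[OF lin_br[OF h(1)] lin_br[OF h(3)]]] .
 also have "tr (%w. br x (br y (br z w))) + (- 1) * tr (%w. br x (br z (br y w))) = tr (%w. br x (br y (br z w)) + (- 1) *\<^sub>F br x (br z (br y w)))"
  using tr_add[OF l[OF h] l'[OF l[OF h(1,3,2)]]] tr_scale[OF l[OF h(1,3,2)], of "-1"] by simp
 also have "\<dots> = KF x (br y z)"
  unfolding killing_tr by (rule tr_cong) (simp add: jacobi h br_in br_diff)
 finally show ?thesis .
qed

definition ip :: "('x => real) => ('x => real) => real" where
 "ip x y = - KF x (\<theta> y)"

lemma ip_sym: "x \<in> L ==> y \<in> L ==> ip x y = ip y x"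
 unfolding ip_def using KF_th[of x y] KF_sym[of "\<theta> x" y] by (simp add: th_in)

lemma ip_add: "x \<in> L ==> y \<in> L ==> z \<in> L ==> ip (x + y) z = ip x z + ip y z"
 by (simp add: ip_def KF_add th_in)

lemma ip_scale: "x \<in> L ==> y \<in> L ==> ip (c *\<^sub>F x) y = c * ip x y"
 by (simp add: ip_def KF_scale th_in)

lemma ip_pos: "x \<in> L ==> x \<noteq> 0 ==> ip x x > 0"
 using th_pos by (simp add: ip_def)

lemma ip_0: "x \<in> L ==> ip 0 x = 0"
 using ip_scale[OF L_0, of x 0] by simp

lemma ip_add_right: "x \<in> L ==> y \<in> L ==> z \<in> L ==> ip z (x + y) = ip z x + ip z y"
 using ip_add[of x y z] ip_sym by (simp add: L_add)

lemma ip_scale_right: "x \<in> L ==> y \<in> L ==> ip y (c *\<^sub>F x) = c * ip y x"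
 using ip_scale[of x y] ip_sym by (simp add: L_scale)

lemma ip_diff: "x \<in> L ==> y \<in> L ==> z \<in> L ==> ip (x - y) z = ip x z - ip y z"
 using ip_add[of "x - y" y z] by (simp add: L_diff)

lemma ip_nonneg: "x \<in> L ==> ip x x \<ge> 0"
 using ip_pos[of x] ip_0[OF L_0] by (cases "x = 0") auto

text \<open>Invariance of the Killing form moves \<open>br Y\<close> to the other side with a minus
  sign, and \<theta> Y = - Y removes it.\<close>

lemma ad_sym:
 assumes Y: "Y \<in> pp" and x: "x \<in> L" and z: "z \<in> L"
 shows "ip (br Y x) z = ip x (br Y z)"
proof -
 have YL: "Y \<in> L" using Y pp_L by blast
 have "KF (br Y x) (\<theta> z) = - KF (br x Y) (\<theta> z)"
  using KF_scale[of "br x Y" "\<theta> z" "-1"] br_anti[OF YL x] x z YL by (simp add: br_in th_in)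
 also have "\<dots> = - KF x (br Y (\<theta> z))" using KF_inv[OF x YL th_in[OF z]] by simp
 also have "br Y (\<theta> z) = - \<theta> (br Y z)" using th_br[OF YL z] th_pp[OF Y] br_uminus_left[OF YL th_in[OF z]] by simp
 also have "- KF x (- \<theta> (br Y z)) = KF x (\<theta> (br Y z))"
  using KF_scale[of "\<theta> (br Y z)" x "-1"] KF_sym[of x "\<theta> (br Y z)"] KF_sym[of x "- \<theta> (br Y z)"] x z YL
  by (simp add: br_in th_in L_uminus)
 finally show ?thesis by (simp add: ip_def)
qed

subsection \<open>Root vectors\<close>

text \<open>The functional may be any function agreeing with a root on \<open>aa\<close>, so
  \<theta> E can be paired with \<open>%H. - \<beta> H\<close> directly instead of with its
  restriction to \<open>aa\<close>.\<close>

definition root_vector :: "('x => real) => (('x => real) => real) => bool" where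
 "root_vector E \<beta> \<longleftrightarrow> E \<in> L \<and> E \<noteq> 0 \<and> (\<forall>H\<in>aa. br H E = \<beta> H *\<^sub>F E)"

lemma th_root:
 assumes E: "root_vector E \<beta>" shows "root_vector (\<theta> E) (%H. - \<beta> H)"
proof -
 have EL: "E \<in> L" "E \<noteq> 0" using E by (auto simp: root_vector_def)
 have "br H (\<theta> E) = - \<beta> H *\<^sub>F \<theta> E" if H: "H \<in> aa" for H
 proof -
  have "br H (\<theta> E) = \<theta> (br (\<theta> H) E)" using th_br[OF th_in[OF aa_L[OF H]] EL(1)] th_th[OF aa_L[OF H]] by simp
  also have "br (\<theta> H) E = - (\<beta> H *\<^sub>F E)" using th_aa[OF H] br_uminus_left[OF aa_L[OF H] EL(1)] E H by (simp add: root_vector_def)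
  also have "\<theta> (- (\<beta> H *\<^sub>F E)) = - \<beta> H *\<^sub>F \<theta> E" using EL by (simp add: th_uminus th_scale L_scale)
  finally show ?thesis .
 qed
 moreover have "\<theta> E \<noteq> 0" using EL th_th[OF EL(1)] th_0 by metis
 ultimately show ?thesis using EL th_in by (simp add: root_vector_def)
qed

text \<open>The bracket [\<theta> E, E] is in p and commutes with \<open>aa\<close>, so it lies in
  \<open>aa\<close> by maximality. Its Killing product with H in \<open>aa\<close> is \<beta>(H)
  times the norm square of E: for H = Y this shows that it is non-zero, and for the bracket itself,
  whose norm is positive, that \<beta> is positive on it. Rescaling it to an H with \<beta>(H) = 1
  leaves the factor that is called \<omega> squared.\<close>

lemma sl2_triple:
 assumes E: "root_vector E \<beta>" and Y: "Y \<in> aa" "\<beta> Y = 1"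
 shows "\<exists>H \<omega>. H \<in> aa \<and> \<omega> > 0 \<and> br H E = E \<and> br H (\<theta> E) = - \<theta> E \<and> 2 *\<^sub>F br (\<theta> E) E = \<omega>\<^sup>2 *\<^sub>F H \<and> H \<noteq> 0"
proof -
 have EL: "E \<in> L" "E \<noteq> 0" and EH: "\<And>H. H \<in> aa ==> br H E = \<beta> H *\<^sub>F E" using E by (auto simp: root_vector_def)
 have FL: "\<theta> E \<in> L" and FH: "\<And>H. H \<in> aa ==> br H (\<theta> E) = - \<beta> H *\<^sub>F \<theta> E" using th_root[OF E] by (auto simp: root_vector_def)
 let ?H0 = "br (\<theta> E) E"
 have H0L: "?H0 \<in> L" by (rule br_in[OF FL EL(1)])
 have thH0: "\<theta> ?H0 = - ?H0" using th_br[OF FL EL(1)] th_th[OF EL(1)] br_anti[OF EL(1) FL] by simp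
 have comm: "br H ?H0 = 0" if H: "H \<in> aa" for H
 proof -
  have "br (br H (\<theta> E)) E = br H ?H0 - br (\<theta> E) (br H E)" by (rule jacobi[OF aa_L[OF H] FL EL(1)])
  moreover have "br (br H (\<theta> E)) E = - \<beta> H *\<^sub>F ?H0" unfolding FH[OF H] by (rule br_scale_left[OF FL EL(1)])
  moreover have "br (\<theta> E) (br H E) = \<beta> H *\<^sub>F ?H0" unfolding EH[OF H] by (rule br_scale[OF FL EL(1)])
  ultimately show ?thesis by simp
 qed
 have H0a: "?H0 \<in> aa"
 proof -
  \<comment> \<open>Adjoining the bracket to \<open>aa\<close> gives an abelian subspace of p, to
    which maximality applies.\<close>
  define b where "b = {H + c *\<^sub>F ?H0 | H c. H \<in> aa}"
  have comm2: "br ?H0 H = 0" if "H \<in> aa" for H using comm[OF that] br_anti[OF H0L aa_L[OF that]] by simp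
  have "fnvs.subspace b"
  proof (rule fnvs.subspaceI)
   have "0 = 0 + 0 *\<^sub>F ?H0" by simp
   then show "0 \<in> b" unfolding b_def using fnvs.subspace_0[OF aa_sub] by blast
   fix u v assume "u \<in> b" "v \<in> b"
   then obtain H c H' c' where u: "u = H + c *\<^sub>F ?H0" "v = H' + c' *\<^sub>F ?H0" "H \<in> aa" "H' \<in> aa" by (auto simp: b_def)
   then have "u + v = (H + H') + (c + c') *\<^sub>F ?H0" by (simp add: fnvs.scale_left_distrib)
   then show "u + v \<in> b" unfolding b_def using fnvs.subspace_add[OF aa_sub u(3,4)] by blast
  next
   fix d u assume "u \<in> b"
   then obtain H c where u: "u = H + c *\<^sub>F ?H0" "H \<in> aa" by (auto simp: b_def)
   then have "d *\<^sub>F u = d *\<^sub>F H + (d * c) *\<^sub>F ?H0" by (simp add: fnvs.scale_right_distrib)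
   then show "d *\<^sub>F u \<in> b" unfolding b_def using aa_scale[OF u(2)] by blast
  qed
  moreover have "b \<subseteq> pp"
  proof
   fix u assume "u \<in> b"
   then obtain H c where u: "u = H + c *\<^sub>F ?H0" "H \<in> aa" by (auto simp: b_def)
   have "\<theta> u = - u" unfolding u(1) using th_add[OF aa_L[OF u(2)] L_scale[OF H0L]] th_aa[OF u(2)] th_scale[OF H0L] thH0 by simp
   then show "u \<in> pp" using u by (simp add: pp L_add aa_L L_scale H0L)
  qed
  moreover have "abelian_on br b"
   unfolding abelian_on_def
  proof (intro ballI)
   fix u v assume "u \<in> b" "v \<in> b"
   then obtain H c H' c' where u: "u = H + c *\<^sub>F ?H0" "v = H' + c' *\<^sub>F ?H0" "H \<in> aa" "H' \<in> aa" by (auto simp: b_def)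
   show "br u v = 0" unfolding u
    using u(3,4) by (simp add: br_add br_add_left br_scale br_scale_left aa_L H0L L_add L_scale aa_ab comm comm2 br_self)
  qed
  moreover have "aa \<subseteq> b"
  proof
   fix x assume "x \<in> aa"
   moreover have "x = x + 0 *\<^sub>F ?H0" by simp
   ultimately show "x \<in> b" unfolding b_def by blast
  qed
  ultimately have "b = aa" by (rule aa_max)
  moreover have "?H0 = 0 + 1 *\<^sub>F ?H0" by simp
  then have "?H0 \<in> b" unfolding b_def using fnvs.subspace_0[OF aa_sub] by blast
  ultimately show ?thesis by simp
 qed
 have EE: "ip E E > 0" by (rule ip_pos[OF EL])
 have KFE: "KF (\<theta> E) E = - ip E E" unfolding ip_def using KF_sym[OF FL EL(1)] by simp
 have K: "KF ?H0 H = \<beta> H * ip E E" if H: "H \<in> aa" for H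
 proof -
  have "KF ?H0 H = KF (\<theta> E) (br E H)" by (rule KF_inv[OF FL EL(1) aa_L[OF H]])
  also have "br E H = (- \<beta> H) *\<^sub>F E" using br_anti[OF EL(1) aa_L[OF H]] EH[OF H] by simp
  also have "KF (\<theta> E) ((- \<beta> H) *\<^sub>F E) = (- \<beta> H) * KF (\<theta> E) E"
   using KF_scale[OF EL(1) FL, of "- \<beta> H"] KF_sym[OF FL EL(1)] KF_sym[OF FL L_scale[OF EL(1)], of "- \<beta> H"] by simp
  finally show ?thesis using KFE by simp
 qed
 have "?H0 \<noteq> 0"
 proof
  assume "?H0 = 0"
  then have "KF 0 Y = ip E E" using K[OF Y(1)] Y(2) by simp
  moreover have "KF 0 Y = 0" using KF_scale[OF L_0 aa_L[OF Y(1)], of 0] by simp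
  ultimately show False using EE by simp
 qed
 then have "ip ?H0 ?H0 > 0" by (rule ip_pos[OF H0L])
 moreover have "ip ?H0 ?H0 = KF ?H0 ?H0"
  unfolding ip_def thH0 using KF_scale[OF H0L H0L, of "-1"] KF_sym[OF H0L L_uminus[OF H0L]] by simp
 ultimately have b0: "\<beta> ?H0 > 0" using K[OF H0a] EE by (simp add: zero_less_mult_iff)
 let ?b = "\<beta> ?H0"
 define H where "H = (1 / ?b) *\<^sub>F ?H0"
 have "H \<in> aa" unfolding H_def by (rule aa_scale[OF H0a])
 moreover have "br H E = E" unfolding H_def br_scale_left[OF H0L EL(1)] EH[OF H0a] using b0 by simp
 moreover have "br H (\<theta> E) = - \<theta> E" unfolding H_def br_scale_left[OF H0L FL] FH[OF H0a] using b0 by simp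
 moreover have "2 *\<^sub>F ?H0 = (sqrt (2 * ?b))\<^sup>2 *\<^sub>F H" using b0 by (simp add: H_def)
 moreover have "sqrt (2 * ?b) > 0" using b0 by simp
 moreover have "H \<noteq> 0" using \<open>br H E = E\<close> EL br_scale_left[OF L_0 EL(1), of 0] by auto
 ultimately show ?thesis by blast
qed

subsection \<open>Finiteness and existence of restricted roots\<close>

abbreviation "roots \<equiv> restricted_roots L br aa"

lemma roots_vector: "\<alpha> \<in> roots ==> \<exists>E. root_vector E \<alpha>"
 unfolding restricted_roots_def root_vector_def by blast

lemma root_orth:
 assumes "root_vector E \<alpha>" "root_vector F \<beta>" "H \<in> aa" "\<alpha> H \<noteq> \<beta> H"
 shows "ip E F = 0"
proof -
 have h: "E \<in> L" "F \<in> L" "br H E = \<alpha> H *\<^sub>F E" "br H F = \<beta> H *\<^sub>F F" using assms by (auto simp: root_vector_def)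
 have "H \<in> pp" using assms aa_pp by blast
 from ad_sym[OF this h(1,2)] have "\<alpha> H * ip E F = \<beta> H * ip E F" by (simp add: h ip_scale ip_scale_right)
 then show ?thesis using assms(4) by simp
qed

text \<open>Since \<open>aa\<close> acts by symmetric operators, root vectors of different roots are
  orthogonal and hence independent; their number is at most the dimension.\<close>

lemma finite_roots: "finite roots"
proof -
 obtain ev where ev: "\<And>\<alpha>. \<alpha> \<in> roots ==> root_vector (ev \<alpha>) \<alpha>" using roots_vector by metis
 have evL: "ev \<alpha> \<in> L" "ev \<alpha> \<noteq> 0" if "\<alpha> \<in> roots" for \<alpha> using ev[OF that] by (auto simp: root_vector_def)
 have orth: "ip (ev \<alpha>) (ev \<beta>) = 0" if r: "\<alpha> \<in> roots" "\<beta> \<in> roots" "\<alpha> \<noteq> \<beta>" for \<alpha> \<beta>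
 proof -
  have "\<alpha> \<in> extensional aa" "\<beta> \<in> extensional aa" using r by (auto simp: restricted_roots_def)
  \<comment> \<open>Extensionality is what makes different roots differ at a point of
    \<open>aa\<close>.\<close>
  then obtain H where "H \<in> aa" "\<alpha> H \<noteq> \<beta> H" using r(3) by (meson extensionalityI)
  then show ?thesis using root_orth[OF ev[OF r(1)] ev[OF r(2)]] by blast
 qed
 have inj: "inj_on ev roots"
 proof (rule inj_onI, rule ccontr)
  fix \<alpha> \<beta> assume h: "\<alpha> \<in> roots" "\<beta> \<in> roots" "ev \<alpha> = ev \<beta>" "\<alpha> \<noteq> \<beta>"
  then have "ip (ev \<alpha>) (ev \<alpha>) = 0" using orth by metis
  then show False using ip_pos[OF evL[OF h(1)]] by simp
 qed
 have "fnvs.independent (ev ` roots)"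
  unfolding fnvs.dependent_def
 proof (rule notI, elim bexE)
  fix e assume e: "e \<in> ev ` roots" "e \<in> fnvs.span (ev ` roots - {e})"
  then obtain \<alpha> where \<alpha>: "\<alpha> \<in> roots" "e = ev \<alpha>" by blast
  have "e \<in> {x \<in> L. ip x (ev \<alpha>) = 0}"
  proof (rule subsetD[OF fnvs.span_minimal e(2)])
   show "ev ` roots - {e} \<subseteq> {x \<in> L. ip x (ev \<alpha>) = 0}" using evL orth \<alpha> by blast
   show "fnvs.subspace {x \<in> L. ip x (ev \<alpha>) = 0}"
    by (rule fnvs.subspaceI) (auto simp: L_0 L_add L_scale ip_0 ip_add ip_scale evL[OF \<alpha>(1)])
  qed
  then show False using ip_pos[OF evL[OF \<alpha>(1)]] \<alpha>(2) by simp
 qed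
 moreover have "ev ` roots \<subseteq> fnvs.span B0" using evL B0(2) by blast
 ultimately have "finite (ev ` roots)" using fnvs.independent_span_bound[OF fin_B0] by blast
 then show ?thesis using inj finite_image_iff by blast
qed

text \<open>The matrix of \<open>br H\<close> on \<open>V\<close> has a complex eigenvector.
  Symmetry forces its eigenvalue to be real, and then the real or the imaginary part, whichever is
  non-zero, is a real eigenvector.\<close>

lemma sym_eigenvector:
 assumes V: "fnvs.subspace V" "V \<subseteq> L" "v0 \<in> V" "v0 \<noteq> 0" and H: "H \<in> aa" and inv: "\<And>v. v \<in> V ==> br H v \<in> V"
 shows "\<exists>\<mu> v. v \<in> V \<and> v \<noteq> 0 \<and> br H v = \<mu> *\<^sub>F v"
proof -
 note HL = aa_L[OF H]
 obtain C where C: "C \<subseteq> V" "fnvs.independent C" "V \<subseteq> fnvs.span C" using fnvs.maximal_independent_subset by blast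
 have finC: "finite C" using fnvs.independent_span_bound[OF fin_B0 C(2)] C(1) V(2) B0(2) by blast
 obtain f where f: "bij_betw f {0..<card C} C" using ex_bij_betw_nat_finite[OF finC] by blast
 define n where "n = card C"
 have n0: "n > 0"
 proof (rule ccontr)
  assume "\<not> n > 0"
  then have "C = {}" using finC by (simp add: n_def)
  then show False using C(3) V(3,4) by auto
 qed
 have fC1: "f i \<in> C" if "i < n" for i using f that by (auto simp: bij_betw_def n_def)
 have fC: "f i \<in> C" "f i \<in> V" "f i \<in> L" if "i < n" for i using fC1[OF that] C(1) V(2) by blast+
 let ?r = "fnvs.representation C"
 have ex: "v = (\<Sum>i<n. ?r v (f i) *\<^sub>F f i)" if v: "v \<in> V" for v
 proof -
  have "v = (\<Sum>c\<in>C. ?r v c *\<^sub>F c)" using fnvs.sum_representation_eq[OF C(2) _ finC] v C(3) by auto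
  also have "\<dots> = (\<Sum>i\<in>{0..<n}. ?r v (f i) *\<^sub>F f i)" unfolding n_def by (rule sum.reindex_bij_betw[OF f, symmetric])
  finally show ?thesis by (simp add: lessThan_atLeast0)
 qed
 define A where "A = mat n n (%(i, j). complex_of_real (?r (br H (f j)) (f i)))"
 have A: "A \<in> carrier_mat n n" by (simp add: A_def)
 obtain \<mu> x where x: "x \<in> carrier_vec n" "x \<noteq> 0\<^sub>v n" "A *\<^sub>v x = \<mu> \<cdot>\<^sub>v x"
  using spectrum_non_empty[OF A n0] A by (auto simp: spectrum_def eigenvalue_def eigenvector_def)
 have Ax: "(\<Sum>j<n. complex_of_real (?r (br H (f j)) (f i)) * x $ j) = \<mu> * x $ i" if i: "i < n" for i
 proof -
  have "(A *\<^sub>v x) $ i = (\<mu> \<cdot>\<^sub>v x) $ i" using x(3) by simp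
  then show ?thesis using i x(1) A by (simp add: A_def scalar_prod_def lessThan_atLeast0)
 qed
 define w where "w g = (\<Sum>j<n. g (x $ j) *\<^sub>F f j)" for g :: "complex => real"
 have wV: "w g \<in> V" for g unfolding w_def using fC by (intro fnvs.subspace_sum[OF V(1)] fnvs.subspace_scale[OF V(1)]) auto
 have wL: "w g \<in> L" for g using wV V(2) by blast
 have Hw: "br H (w g) = (\<Sum>i<n. (\<Sum>j<n. g (x $ j) * ?r (br H (f j)) (f i)) *\<^sub>F f i)" for g
 proof -
  have "br H (w g) = (\<Sum>j<n. g (x $ j) *\<^sub>F br H (f j))"
   unfolding w_def using lin_sum[OF lin_br[OF HL], of "{..<n}" f "%j. g (x $ j)"] fC by simp
  also have "\<dots> = (\<Sum>j<n. \<Sum>i<n. (g (x $ j) * ?r (br H (f j)) (f i)) *\<^sub>F f i)"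
  proof (rule sum.cong[OF refl])
   fix j assume "j \<in> {..<n}"
   then have "br H (f j) = (\<Sum>i<n. ?r (br H (f j)) (f i) *\<^sub>F f i)" using ex inv fC by simp
   then have "g (x $ j) *\<^sub>F br H (f j) = g (x $ j) *\<^sub>F (\<Sum>i<n. ?r (br H (f j)) (f i) *\<^sub>F f i)" by simp
   then show "g (x $ j) *\<^sub>F br H (f j) = (\<Sum>i<n. (g (x $ j) * ?r (br H (f j)) (f i)) *\<^sub>F f i)"
    by (simp add: fnvs.scale_sum_right)
  qed
  also have "\<dots> = (\<Sum>i<n. (\<Sum>j<n. g (x $ j) * ?r (br H (f j)) (f i)) *\<^sub>F f i)"
   by (subst sum.swap) (simp add: fnvs.scale_sum_left)
  finally show ?thesis .
 qed
 have re: "(\<Sum>j<n. Re (x $ j) * ?r (br H (f j)) (f i)) = Re \<mu> * Re (x $ i) - Im \<mu> * Im (x $ i)"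
  and im: "(\<Sum>j<n. Im (x $ j) * ?r (br H (f j)) (f i)) = Im \<mu> * Re (x $ i) + Re \<mu> * Im (x $ i)" if "i < n" for i
  using arg_cong[OF Ax[OF that], of Re] arg_cong[OF Ax[OF that], of Im] by (simp_all add: mult.commute)
 have Hre: "br H (w Re) = Re \<mu> *\<^sub>F w Re - Im \<mu> *\<^sub>F w Im"
  unfolding Hw unfolding w_def fnvs.scale_sum_right sum_subtractf[symmetric]
  by (rule sum.cong[OF refl]) (simp add: re fnvs.scale_left_diff_distrib)
 have Him: "br H (w Im) = Im \<mu> *\<^sub>F w Re + Re \<mu> *\<^sub>F w Im"
  unfolding Hw unfolding w_def fnvs.scale_sum_right sum.distrib[symmetric]
  by (rule sum.cong[OF refl]) (simp add: im fnvs.scale_left_distrib)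
 have nz: "w Re \<noteq> 0 \<or> w Im \<noteq> 0"
 proof (rule ccontr)
  assume "\<not> ?thesis"
  then have z: "w Re = 0" "w Im = 0" by auto
  have "g (x $ i) = 0" if "i < n" and wz: "w g = 0" for g i
  proof -
   have "(\<Sum>c\<in>C. g (x $ (inv_into {0..<n} f c)) *\<^sub>F c) = (\<Sum>i\<in>{0..<n}. g (x $ (inv_into {0..<n} f (f i))) *\<^sub>F f i)"
    unfolding n_def by (rule sum.reindex_bij_betw[OF f, symmetric])
   also have "\<dots> = w g" unfolding w_def lessThan_atLeast0
    by (rule sum.cong[OF refl]) (use f in \<open>simp add: bij_betw_def inv_into_f_f n_def\<close>)
   finally have "(\<Sum>c\<in>C. g (x $ (inv_into {0..<n} f c)) *\<^sub>F c) = 0" using wz by simp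
   then have "g (x $ (inv_into {0..<n} f (f i))) = 0"
    using fnvs.independentD[OF C(2) finC subset_refl _ fC(1)[OF that(1)], of "%c. g (x $ (inv_into {0..<n} f c))"] by simp
   then show ?thesis using f that(1) by (simp add: bij_betw_def inv_into_f_f n_def)
  qed
  then have "x $ i = 0" if "i < n" for i using z that by (simp add: complex_eq_iff)
  then have "x = 0\<^sub>v n" using x(1) by (intro eq_vecI) auto
  then show False using x(2) by simp
 qed
 \<comment> \<open>When both sides are expanded, the terms with the real part of \<mu> cancel and
   \<open>Im \<mu>\<close> times the sum of the two norm squares remains.\<close>
 have "ip (br H (w Re)) (w Im) = ip (w Re) (br H (w Im))" using ad_sym[of H "w Re" "w Im"] H aa_pp wL by blast
 then have "Im \<mu> * (ip (w Re) (w Re) + ip (w Im) (w Im)) = 0"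
  unfolding Hre Him
  by (simp add: ip_diff[OF L_scale[OF wL] L_scale[OF wL] wL] ip_add_right[OF L_scale[OF wL] L_scale[OF wL] wL] ip_scale[OF wL wL] ip_scale_right[OF wL wL] algebra_simps)
 moreover have "ip (w Re) (w Re) + ip (w Im) (w Im) > 0"
  using nz ip_pos[OF wL] ip_nonneg[OF wL] by (metis add_nonneg_pos add_pos_nonneg)
 ultimately have "Im \<mu> = 0" by simp
 then have "br H (w Re) = Re \<mu> *\<^sub>F w Re" "br H (w Im) = Re \<mu> *\<^sub>F w Im" using Hre Him by auto
 then show ?thesis using nz wV by blast
qed

text \<open>If \<open>aa\<close> were 0, the line through a non-zero element of p would be a larger
  abelian subspace.\<close>

lemma aa_nonzero:
 assumes "pp \<noteq> {0}" shows "\<exists>Y\<in>aa. Y \<noteq> 0"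
proof (rule ccontr)
 assume "\<not> ?thesis"
 then have a0: "aa = {0}" using fnvs.subspace_0[OF aa_sub] by blast
 have "0 \<in> pp" using aa_pp a0 by blast
 then obtain X where X: "X \<in> pp" "X \<noteq> 0" using assms by blast
 have XL: "X \<in> L" using X pp_L by blast
 have sp: "u \<in> fnvs.span {X} \<longleftrightarrow> (\<exists>c. u = c *\<^sub>F X)" for u unfolding fnvs.span_singleton by blast
 have "fnvs.span {X} = aa"
 proof (rule aa_max)
  show "fnvs.span {X} \<subseteq> pp"
  proof
   fix u assume "u \<in> fnvs.span {X}"
   then obtain c where "u = c *\<^sub>F X" using sp by blast
   then show "u \<in> pp" unfolding pp using th_pp[OF X(1)] by (simp add: L_scale[OF XL] th_scale[OF XL])
  qed
  show "abelian_on br (fnvs.span {X})"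
   unfolding abelian_on_def by (auto simp: sp br_scale br_scale_left XL L_scale br_self)
  show "aa \<subseteq> fnvs.span {X}" using a0 fnvs.span_zero by blast
 qed simp
 then show False using a0 X fnvs.span_base[of X "{X}"] by blast
qed

text \<open>For a non-zero Y in \<open>aa\<close> the operator ad Y is not 0, as the centre is an
  ideal. Its image is stable under \<open>aa\<close>, whose commuting symmetric operators have a
  common eigenvector E there. By symmetry the image of ad Y meets its kernel only in 0, so the root
  of E does not vanish at Y.\<close>

lemma root_exists:
 assumes "pp \<noteq> {0}" shows "\<exists>\<alpha>\<in>roots. \<exists>Y\<in>aa. \<alpha> Y \<noteq> 0"
proof -
 obtain Y where Y: "Y \<in> aa" "Y \<noteq> 0" using aa_nonzero[OF assms] by blast
 note YL = aa_L[OF Y(1)]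
 have "\<exists>Z\<in>L. br Y Z \<noteq> 0"
 proof (rule ccontr)
  assume n: "\<not> ?thesis"
  define I where "I = {x \<in> L. \<forall>z\<in>L. br z x = 0}"
  have "br z 0 = 0" if "z \<in> L" for z using br_scale[OF that L_0, of 0] by (simp only: fnvs.scale_zero_left)
  then have "fnvs.subspace I"
   by (intro fnvs.subspaceI) (auto simp: I_def L_0 L_add L_scale br_add br_scale)
  moreover have "I \<subseteq> L" "\<forall>X\<in>L. \<forall>Z\<in>I. br X Z \<in> I"
   using \<open>fnvs.subspace I\<close> fnvs.subspace_0 by (auto simp: I_def)
  ultimately have "I = {0} \<or> I = L" using simple unfolding simple_lie_algebra_def by blast
  moreover have "Y \<in> I" using n YL br_anti[OF _ YL] by (auto simp: I_def)
  ultimately have "I = L" using Y(2) by blast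
  then have "abelian_on br L" unfolding abelian_on_def I_def by blast
  then show False using simple unfolding simple_lie_algebra_def by blast
 qed
 then obtain Z where Z: "Z \<in> L" "br Y Z \<noteq> 0" by blast
 obtain C where C: "C \<subseteq> aa" "fnvs.independent C" "aa \<subseteq> fnvs.span C" using fnvs.maximal_independent_subset by blast
 have "C \<subseteq> fnvs.span B0" using C(1) aa_L B0(2) by blast
 then have finC: "finite C" using fnvs.independent_span_bound[OF fin_B0 C(2)] by blast
 \<comment> \<open>Induction over finite subsets of \<open>aa\<close>: each step passes to an
   eigenspace of one more element inside the image of ad Y. It is applied to a spanning set.\<close>
 have "\<exists>V. fnvs.subspace V \<and> V \<subseteq> (%z. br Y z) ` L \<and> (\<exists>v\<in>V. v \<noteq> 0) \<and> (\<forall>H\<in>aa. \<forall>v\<in>V. br H v \<in> V) \<and>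
   (\<forall>H\<in>S. \<exists>\<mu>. \<forall>v\<in>V. br H v = \<mu> *\<^sub>F v)" if "finite S" "S \<subseteq> aa" for S
  using that
 proof (induction S rule: finite_induct)
  case empty
  have "fnvs.subspace ((%z. br Y z) ` L)"
  proof (rule fnvs.subspaceI)
   show "0 \<in> br Y ` L" using br_self[OF YL] YL by (metis imageI)
   show "u + v \<in> br Y ` L" if "u \<in> br Y ` L" "v \<in> br Y ` L" for u v
    using that br_add[OF YL] L_add by (auto simp: image_iff) metis
   show "c *\<^sub>F u \<in> br Y ` L" if "u \<in> br Y ` L" for c u
    using that br_scale[OF YL] L_scale by (auto simp: image_iff) metis
  qed
  moreover have "br H v \<in> br Y ` L" if H: "H \<in> aa" and v: "v \<in> br Y ` L" for H v
  proof -
   obtain z where z: "z \<in> L" "v = br Y z" using v by blast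
   have "br (br H Y) z = br H (br Y z) - br Y (br H z)" by (rule jacobi[OF aa_L[OF H] YL z(1)])
   moreover have "br (br H Y) z = 0" using aa_ab[OF H Y(1)] br_scale_left[OF L_0 z(1), of 0] by simp
   ultimately show ?thesis using z br_in[OF aa_L[OF H] z(1)] by auto
  qed
  ultimately show ?case using Z by (intro exI[of _ "br Y ` L"]) auto
 next
  case (insert H S)
  then have "S \<subseteq> aa" by simp
  from insert.IH[OF this] obtain V where V: "fnvs.subspace V" "V \<subseteq> br Y ` L" "\<exists>v\<in>V. v \<noteq> 0" "\<forall>H\<in>aa. \<forall>v\<in>V. br H v \<in> V"
   "\<forall>H\<in>S. \<exists>\<mu>. \<forall>v\<in>V. br H v = \<mu> *\<^sub>F v" by (elim exE conjE) (rule that; assumption)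
  have VL: "V \<subseteq> L" using V(2) br_in[OF YL] by blast
  have H: "H \<in> aa" using insert by blast
  obtain \<mu> v where v: "v \<in> V" "v \<noteq> 0" "br H v = \<mu> *\<^sub>F v" using sym_eigenvector[OF V(1) VL _ _ H] V(3,4) H by blast
  define V' where "V' = {v \<in> V. br H v = \<mu> *\<^sub>F v}"
  have V'1: "fnvs.subspace V'"
  proof (rule fnvs.subspaceI)
   show "0 \<in> V'" using fnvs.subspace_0[OF V(1)] br_scale[OF aa_L[OF H] L_0, of 0] by (simp add: V'_def)
   show "u + v \<in> V'" if "u \<in> V'" "v \<in> V'" for u v
   proof -
    have uv: "u \<in> V" "v \<in> V" "u \<in> L" "v \<in> L" "br H u = \<mu> *\<^sub>F u" "br H v = \<mu> *\<^sub>F v" using that VL by (auto simp: V'_def)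
    have "br H (u + v) = \<mu> *\<^sub>F (u + v)" by (simp only: br_add[OF aa_L[OF H] uv(3,4)] uv(5,6) fnvs.scale_right_distrib)
    then show ?thesis using fnvs.subspace_add[OF V(1) uv(1,2)] by (simp add: V'_def)
   qed
   show "c *\<^sub>F u \<in> V'" if "u \<in> V'" for c u
   proof -
    have u: "u \<in> V" "u \<in> L" "br H u = \<mu> *\<^sub>F u" using that VL by (auto simp: V'_def)
    have "br H (c *\<^sub>F u) = \<mu> *\<^sub>F (c *\<^sub>F u)" by (simp only: br_scale[OF aa_L[OF H] u(2)] u(3) fnvs.scale_scale mult.commute)
    then show ?thesis using fnvs.subspace_scale[OF V(1) u(1)] by (simp add: V'_def)
   qed
  qed
  have V'2: "br H' v \<in> V'" if H': "H' \<in> aa" and v: "v \<in> V'" for H' v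
  proof -
   have vL: "v \<in> L" "v \<in> V" "br H v = \<mu> *\<^sub>F v" using v VL by (auto simp: V'_def)
   have "br (br H H') v = br H (br H' v) - br H' (br H v)" by (rule jacobi[OF aa_L[OF H] aa_L[OF H'] vL(1)])
   moreover have "br (br H H') v = 0" using aa_ab[OF H H'] br_scale_left[OF L_0 vL(1), of 0] by simp
   ultimately have "br H (br H' v) = \<mu> *\<^sub>F br H' v" using vL br_scale[OF aa_L[OF H'] vL(1)] by simp
   then show ?thesis using V(4) H' vL by (simp add: V'_def)
  qed
  have V'3: "v \<in> V'" using v by (simp add: V'_def)
  have V'4: "V' \<subseteq> V" by (auto simp: V'_def)
  show ?case
  proof (intro exI[of _ V'] conjI ballI)
   show "fnvs.subspace V'" by (rule V'1)
   show "V' \<subseteq> br Y ` L" using V'4 V(2) by blast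
   show "\<exists>v\<in>V'. v \<noteq> 0" using V'3 v(2) by blast
   show "br H' v \<in> V'" if "H' \<in> aa" "v \<in> V'" for H' v by (rule V'2[OF that])
   show "\<exists>\<mu>. \<forall>v\<in>V'. br H' v = \<mu> *\<^sub>F v" if H': "H' \<in> insert H S" for H'
   proof (cases "H' = H")
    case True
    then show ?thesis unfolding V'_def by blast
   next
    case False
    then have "H' \<in> S" using H' by blast
    then obtain m where "\<forall>v\<in>V. br H' v = m *\<^sub>F v" using V(5) by blast
    then show ?thesis using V'4 by blast
   qed
  qed
 qed
 from this[OF finC C(1)] obtain V where V: "V \<subseteq> br Y ` L" "\<exists>v\<in>V. v \<noteq> 0" "\<forall>H\<in>C. \<exists>\<mu>. \<forall>v\<in>V. br H v = \<mu> *\<^sub>F v" by blast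
 then obtain E where E: "E \<in> V" "E \<noteq> 0" by blast
 have EL: "E \<in> L" using E V(1) br_in[OF YL] by blast
 have ev: "\<exists>\<mu>. br H E = \<mu> *\<^sub>F E" if "H \<in> aa" for H
 proof -
  have "H \<in> {H \<in> L. \<exists>\<mu>. br H E = \<mu> *\<^sub>F E}"
  proof (rule subsetD[OF fnvs.span_minimal])
   show "H \<in> fnvs.span C" using that C(3) by blast
   show "C \<subseteq> {H \<in> L. \<exists>\<mu>. br H E = \<mu> *\<^sub>F E}" using V(3) E(1) C(1) aa_L by blast
   show "fnvs.subspace {H \<in> L. \<exists>\<mu>. br H E = \<mu> *\<^sub>F E}"
   proof (rule fnvs.subspaceI)
    show "0 \<in> {H \<in> L. \<exists>\<mu>. br H E = \<mu> *\<^sub>F E}" using br_scale_left[OF L_0 EL, of 0] by (auto simp: L_0 intro!: exI[of _ 0])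
    fix u v assume u: "u \<in> {H \<in> L. \<exists>\<mu>. br H E = \<mu> *\<^sub>F E}" and v: "v \<in> {H \<in> L. \<exists>\<mu>. br H E = \<mu> *\<^sub>F E}"
    then obtain m m' where "br u E = m *\<^sub>F E" "br v E = m' *\<^sub>F E" by blast
    then have "br (u + v) E = (m + m') *\<^sub>F E" using u v br_add_left[OF _ _ EL] by (simp add: fnvs.scale_left_distrib)
    then show "u + v \<in> {H \<in> L. \<exists>\<mu>. br H E = \<mu> *\<^sub>F E}" using u v L_add by blast
   next
    fix c u assume u: "u \<in> {H \<in> L. \<exists>\<mu>. br H E = \<mu> *\<^sub>F E}"
    then obtain m where "br u E = m *\<^sub>F E" by blast
    then have "br (c *\<^sub>F u) E = (c * m) *\<^sub>F E" using u br_scale_left[OF _ EL] by simp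
    then show "c *\<^sub>F u \<in> {H \<in> L. \<exists>\<mu>. br H E = \<mu> *\<^sub>F E}" using u L_scale by blast
   qed
  qed
  then show ?thesis by blast
 qed
 define \<alpha> where "\<alpha> = restrict (%H. SOME \<mu>. br H E = \<mu> *\<^sub>F E) aa"
 have al: "br H E = \<alpha> H *\<^sub>F E" if "H \<in> aa" for H
  using someI_ex[OF ev[OF that]] that by (simp add: \<alpha>_def)
 have cancel: "c = d" if "c *\<^sub>F E = d *\<^sub>F E" for c d using that E(2) fnvs.scale_cancel_right by blast
 have aY: "\<alpha> Y \<noteq> 0"
 proof
  assume "\<alpha> Y = 0"
  then have Y0: "br Y E = 0" using al[OF Y(1)] by simp
  obtain z where z: "z \<in> L" "E = br Y z" using E V(1) by blast
  have "ip E E = ip (br Y z) E" using z by simp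
  also have "\<dots> = ip z (br Y E)" using ad_sym[OF _ z(1) EL] Y(1) aa_pp by blast
  also have "\<dots> = 0" unfolding Y0 using ip_sym[OF z(1) L_0] ip_0[OF z(1)] by simp
  finally show False using ip_pos[OF EL E(2)] by simp
 qed
 have "\<alpha> \<in> roots"
  unfolding restricted_roots_def
 proof (intro CollectI conjI ballI allI)
  show "\<alpha> \<in> extensional aa" by (simp add: \<alpha>_def)
  show "\<alpha> (X + Y') = \<alpha> X + \<alpha> Y'" if "X \<in> aa" "Y' \<in> aa" for X Y'
   using al[OF fnvs.subspace_add[OF aa_sub that]] al[OF that(1)] al[OF that(2)] br_add_left[OF aa_L aa_L EL] that
   by (intro cancel) (simp add: fnvs.scale_left_distrib)
  show "\<alpha> (c *\<^sub>F X) = c * \<alpha> X" if "X \<in> aa" for c X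
   by (rule cancel) (use al[OF aa_scale[OF that]] al[OF that] br_scale_left[OF aa_L[OF that] EL] fnvs.scale_scale in metis)
  show "\<exists>H\<in>aa. \<alpha> H \<noteq> 0" using aY Y(1) by blast
  show "\<exists>X\<in>L. X \<noteq> 0 \<and> (\<forall>H\<in>aa. br H X = \<alpha> H *\<^sub>F X)" using EL E(2) al by blast
 qed
 then show ?thesis using aY Y(1) by blast
qed

text \<open>A vector is divided by its root value of largest modulus. Dividing by the signed value
  makes the root in question exactly 1, and all other roots stay within 1 by maximality.\<close>

lemma extremal_point:
 assumes "pp \<noteq> {0}"
 shows "\<exists>Y E \<beta>. Y \<in> aa \<and> root_vector E \<beta> \<and> \<beta> Y = 1 \<and> (\<forall>\<alpha>\<in>roots. \<forall>t. \<alpha> (t *\<^sub>F Y) = t * \<alpha> Y \<and> \<bar>\<alpha> Y\<bar> \<le> 1)"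
proof -
 obtain \<alpha>0 Y0 where a0: "\<alpha>0 \<in> roots" "Y0 \<in> aa" "\<alpha>0 Y0 \<noteq> 0" using root_exists[OF assms] by blast
 have ne: "(%\<alpha>. \<bar>\<alpha> Y0\<bar>) ` roots \<noteq> {}" "finite ((%\<alpha>. \<bar>\<alpha> Y0\<bar>) ` roots)" using a0 finite_roots by auto
 obtain \<gamma> where g: "\<gamma> \<in> roots" "\<bar>\<gamma> Y0\<bar> = Max ((%\<alpha>. \<bar>\<alpha> Y0\<bar>) ` roots)" using Max_in[OF ne(2,1)] by auto
 have gm: "\<bar>\<alpha> Y0\<bar> \<le> \<bar>\<gamma> Y0\<bar>" if "\<alpha> \<in> roots" for \<alpha> unfolding g(2) using ne that by (intro Max_ge) auto
 have g0: "\<gamma> Y0 \<noteq> 0" using gm[OF a0(1)] a0(3) by auto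
 have sc: "\<alpha> (c *\<^sub>F X) = c * \<alpha> X" if "\<alpha> \<in> roots" "X \<in> aa" for \<alpha> c X using that unfolding restricted_roots_def by blast
 obtain E where E: "root_vector E \<gamma>" using roots_vector[OF g(1)] by blast
 define Y where "Y = (1 / \<gamma> Y0) *\<^sub>F Y0"
 have Ya: "Y \<in> aa" unfolding Y_def by (rule aa_scale[OF a0(2)])
 have "\<gamma> Y = 1" unfolding Y_def sc[OF g(1) a0(2)] using g0 by simp
 moreover have "\<bar>\<alpha> Y\<bar> \<le> 1" if "\<alpha> \<in> roots" for \<alpha>
  unfolding Y_def sc[OF that a0(2)] using gm[OF that] g0 by (simp add: abs_mult divide_le_eq)
 ultimately show ?thesis using Ya E sc[OF _ Ya] by blast
qed

end

section \<open>Complex manifolds as real ones\<close>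

definition cx :: "(nat => real) => nat => complex" where
 "cx x = (%i. Complex (x (2 * i)) (x (2 * i + 1)))"

definition rl :: "(nat => complex) => nat => real" where
 "rl z = (%i. if even i then Re (z (i div 2)) else Im (z (i div 2)))"

lemma cx_rl: "cx (rl z) = z"
 by (auto simp: cx_def rl_def fun_eq_iff complex_eq_iff)

lemma rl_cx: "rl (cx x) = x"
proof
 fix i
 show "rl (cx x) i = x i"
 proof (cases "even i")
  case True then show ?thesis by (simp add: rl_def cx_def)
 next
  case False
  then have "2 * (i div 2) + 1 = i" by presburger
  then show ?thesis using False by (simp add: rl_def cx_def)
 qed
qed

lemma cx_kspace: "x \<in> kspace (2 * n) ==> cx x \<in> kspace n"
 by (auto simp: kspace_def cx_def complex_eq_iff)

lemma rl_kspace: "z \<in> kspace n ==> rl z \<in> kspace (2 * n)"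
proof -
 assume z: "z \<in> kspace n"
 have "n \<le> i div 2" if "2 * n \<le> i" for i using that by linarith
 then show ?thesis using z by (auto simp: kspace_def rl_def)
qed

lemma continuous_on_cx: "continuous_on S cx"
proof (rule continuous_on_coordinatewise_then_product)
 show "continuous_on S (%x. cx x i)" for i
  unfolding cx_def Complex_eq by (intro continuous_intros)
qed

lemma continuous_on_rl: "continuous_on S rl"
proof (rule continuous_on_coordinatewise_then_product)
 show "continuous_on S (%x. rl x i)" for i
  by (cases "even i") (auto simp: rl_def intro!: continuous_intros)
qed

lemma rl_image: "V \<subseteq> kspace n ==> rl ` V = {x \<in> kspace (2 * n). cx x \<in> V}"
proof (intro equalityI subsetI)
 fix x assume V: "V \<subseteq> kspace n" and x: "x \<in> {x \<in> kspace (2 * n). cx x \<in> V}"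
 then have "x = rl (cx x)" "cx x \<in> V" by (auto simp: rl_cx)
 then show "x \<in> rl ` V" by blast
qed (auto simp: cx_rl rl_kspace)

lemma kopen_rl: "kopen n V ==> kopen (2 * n) (rl ` V)"
proof -
 assume V: "kopen n V"
 have "kopen (2 * n) (kspace (2 * n) \<inter> cx -` V)"
  by (rule continuous_openin_preimage[OF continuous_on_cx _ V]) (auto simp: cx_kspace)
 moreover have "rl ` V = kspace (2 * n) \<inter> cx -` V" using rl_image[OF kopen_subset[OF V]] by auto
 ultimately show ?thesis by simp
qed

text \<open>A complex derivative d yields the real partial derivatives d and i d, whose real and
  imaginary parts are, up to sign, again parts of a holomorphic function. Multiplication by i
  exchanges the two parts, so both are treated in one induction.\<close>

lemma Ck_on_Re_Im:
 assumes V: "kopen n V" and f: "Ck_on n m V f"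
 shows "Ck_on (2 * n) m (rl ` V) (%x. Re (f (cx x))) \<and> Ck_on (2 * n) m (rl ` V) (%x. Im (f (cx x)))"
 using f
proof (induction m arbitrary: f)
 case 0
 have "continuous_on (rl ` V) (%x. f (cx x))"
  by (rule continuous_on_compose2[of V f]) (use 0 in \<open>auto simp: cx_rl continuous_on_cx\<close>)
 then show ?case by (auto intro!: continuous_intros)
next
 case (Suc m)
 have c: "continuous_on (rl ` V) (%x. f (cx x))"
  by (rule continuous_on_compose2[of V f]) (use Ck_on_continuous[OF Suc.prems] in \<open>auto simp: cx_rl continuous_on_cx\<close>)
 let ?j = "%i::nat. i div 2"
 have j: "?j i < n" if "i < 2 * n" for i using that by linarith
 have IH: "Ck_on (2 * n) m (rl ` V) (%x. Re (pd (?j i) f (cx x)))" "Ck_on (2 * n) m (rl ` V) (%x. Im (pd (?j i) f (cx x)))" if "i < 2 * n" for i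
  using Suc.IH[OF Ck_on_SucD(2)[OF V Suc.prems j[OF that]]] by auto
 have IHm: "Ck_on (2 * n) m (rl ` V) (%x. - Im (pd (?j i) f (cx x)))" if "i < 2 * n" for i
  using Ck_on_mult[OF Ck_on_const[of _ _ _ "-1"] IH(2)[OF that]] by simp
 have vd: "((%t. f (cx (x(i := t)))) has_vector_derivative (if even i then 1 else \<i>) * pd (?j i) f (cx x)) (at (x i))"
  if i: "i < 2 * n" and x: "x \<in> rl ` V" for i x
 proof -
  have cxV: "cx x \<in> V" using x by (auto simp: cx_rl)
  let ?w = "%t. if even i then Complex t (x (i + 1)) else Complex (x (i - 1)) t"
  have upd: "cx (x(i := t)) = (cx x)(?j i := ?w t)" for t
  proof
   fix l
   show "cx (x(i := t)) l = ((cx x)(?j i := ?w t)) l"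
   proof (cases "even i")
    case True
    then have "2 * (i div 2) = i" by simp
    then show ?thesis using True by (auto simp: cx_def)
   next
    case False
    then have a: "2 * (i div 2) = i - 1" "i > 0" "2 * l \<noteq> i" "2 * l + 1 = i \<longleftrightarrow> l = i div 2" by (presburger | auto elim: oddE)+
    then show ?thesis using False by (auto simp: cx_def)
   qed
  qed
  have w0: "?w (x i) = cx x (?j i)"
  proof (cases "even i")
   case True then show ?thesis by (simp add: cx_def)
  next
   case False
   then have "2 * (i div 2) = i - 1" "i > 0" by (presburger | auto elim: oddE)+
   then show ?thesis using False by (simp add: cx_def)
  qed
  have weq: "?w = (%t. (if even i then \<i> * of_real (x (i + 1)) else of_real (x (i - 1))) + (if even i then 1 else \<i>) * of_real t)"
   by (auto simp: Complex_eq fun_eq_iff)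
  have dw: "(?w has_vector_derivative (if even i then 1 else \<i>)) (at (x i))"
   unfolding weq by (auto intro!: derivative_eq_intros)
  have dg: "((%u. f ((cx x)(?j i := u))) has_field_derivative pd (?j i) f (cx x)) (at (?w (x i)))"
   unfolding w0 by (rule Ck_on_SucD(1)[OF V Suc.prems j[OF i] cxV])
  from field_vector_diff_chain_at[OF dw dg] show ?thesis unfolding upd by (simp add: o_def)
 qed
 have dRe: "((%t. Re (f (cx (x(i := t))))) has_field_derivative (if even i then Re (pd (?j i) f (cx x)) else - Im (pd (?j i) f (cx x)))) (at (x i))"
  and dIm: "((%t. Im (f (cx (x(i := t))))) has_field_derivative (if even i then Im (pd (?j i) f (cx x)) else Re (pd (?j i) f (cx x)))) (at (x i))"
  if i: "i < 2 * n" and x: "x \<in> rl ` V" for i x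
  unfolding has_real_derivative_iff_has_vector_derivative
  using bounded_linear.has_vector_derivative[OF bounded_linear_Re vd[OF that]] bounded_linear.has_vector_derivative[OF bounded_linear_Im vd[OF that]]
  by (auto split: if_splits)
 show ?case unfolding Ck_on.simps(2)
 proof (intro conjI)
  show "continuous_on (rl ` V) (%x. Re (f (cx x)))" "continuous_on (rl ` V) (%x. Im (f (cx x)))"
   using c by (auto intro!: continuous_intros)
  show "\<exists>D. \<forall>i<2 * n. (\<forall>x\<in>rl ` V. ((%t. Re (f (cx (x(i := t))))) has_field_derivative D i x) (at (x i))) \<and> Ck_on (2 * n) m (rl ` V) (D i)"
  proof (intro exI[of _ "%i x. if even i then Re (pd (?j i) f (cx x)) else - Im (pd (?j i) f (cx x))"] allI impI conjI ballI dRe)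
   show "Ck_on (2 * n) m (rl ` V) (%x. if even i then Re (pd (?j i) f (cx x)) else - Im (pd (?j i) f (cx x)))" if "i < 2 * n" for i
    using IH[OF that] IHm[OF that] by (cases "even i") auto
  qed
  show "\<exists>D. \<forall>i<2 * n. (\<forall>x\<in>rl ` V. ((%t. Im (f (cx (x(i := t))))) has_field_derivative D i x) (at (x i))) \<and> Ck_on (2 * n) m (rl ` V) (D i)"
  proof (intro exI[of _ "%i x. if even i then Im (pd (?j i) f (cx x)) else Re (pd (?j i) f (cx x))"] allI impI conjI ballI dIm)
   show "Ck_on (2 * n) m (rl ` V) (%x. if even i then Im (pd (?j i) f (cx x)) else Re (pd (?j i) f (cx x)))" if "i < 2 * n" for i
    using IH[OF that] by (cases "even i") auto
  qed
 qed
qed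

lemma realification_simps:
 "mtop (realification M) = mtop M" "mdim (realification M) = 2 * mdim M"
 "atlas (realification M) = (%(U, \<phi>). (U, %a. rl (\<phi> a))) ` atlas M"
 by (auto simp: realification_def rl_def)

lemma charted_realification:
 assumes M: "charted M" shows "charted (realification M)"
 unfolding charted_def realification_simps
proof (intro conjI ballI)
 show "topspace (mtop M) = (\<Union>(U, \<phi>)\<in>(%(U, \<phi>). (U, %a. rl (\<phi> a))) ` atlas M. U)"
  using M unfolding charted_def by auto
 fix c assume "c \<in> (%(U, \<phi>). (U, %a. rl (\<phi> a))) ` atlas M"
 then obtain U \<phi> where U: "(U, \<phi>) \<in> atlas M" and c: "c = (U, %a. rl (\<phi> a))" by auto
 have im: "(%a. rl (\<phi> a)) ` U = rl ` (\<phi> ` U)" by auto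
 have m: "homeomorphic_maps (subtopology (mtop M) U) (top_of_set (\<phi> ` U)) \<phi> (inv_into U \<phi>)" by (rule chart_maps[OF M U])
 have r: "homeomorphic_maps (top_of_set (\<phi> ` U)) (top_of_set (rl ` (\<phi> ` U))) rl cx"
  unfolding homeomorphic_maps_def by (auto simp: continuous_map_in_subtopology continuous_on_rl continuous_on_cx cx_rl)
 have "homeomorphic_map (subtopology (mtop M) U) (top_of_set (rl ` (\<phi> ` U))) (rl \<circ> \<phi>)"
  by (rule homeomorphic_map_compose[OF homeomorphic_maps_imp_map[OF m] homeomorphic_maps_imp_map[OF r]])
 then show "case c of (U, \<phi>) => openin (mtop M) U \<and> kopen (2 * mdim M) (\<phi> ` U) \<and> homeomorphic_map (subtopology (mtop M) U) (top_of_set (\<phi> ` U)) \<phi>"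
  using chart_open[OF M U] kopen_rl[OF chart_image[OF M U]] by (simp add: c im o_def)
qed

lemma smooth_at_Re_Im:
 assumes M: "charted M" and f: "smooth_at M p f"
 shows "smooth_at (realification M) p (%x. Re (f x))" "smooth_at (realification M) p (%x. Im (f x))"
proof -
 obtain W where W: "openin (mtop M) W" "p \<in> W" "smooth_fun M W f" using f unfolding smooth_at_def by blast
 have *: "smooth_fun (realification M) W (%x. h (f x))" if h: "h = Re \<or> h = Im" for h
  unfolding smooth_fun_def
 proof (intro ballI, clarify)
  fix T \<xi> assume "(T, \<xi>) \<in> atlas (realification M)"
  then obtain U \<phi> where U: "(U, \<phi>) \<in> atlas M" and c: "T = U" "\<xi> = (%a. rl (\<phi> a))" by (auto simp: realification_simps)
  have im: "\<xi> ` (W \<inter> T) = rl ` (\<phi> ` (W \<inter> U))" by (auto simp: c)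
  have o: "kopen (mdim M) (\<phi> ` (W \<inter> U))"
   by (rule chart_open_image[OF M U]) (use W chart_open[OF M U] in auto)
  have "smooth_on (2 * mdim M) (rl ` (\<phi> ` (W \<inter> U))) (%x. h (f (inv_into U \<phi> (cx x))))"
   using smooth_funD[OF M U W(3)] Ck_on_Re_Im[OF o] h unfolding smooth_on_def by blast
  then show "smooth_on (mdim (realification M)) (\<xi> ` (W \<inter> T)) (%x. h (f (inv_into T \<xi> x)))"
   unfolding im realification_simps
  proof (rule smooth_on_cong[OF kopen_rl[OF o]])
   fix x assume "x \<in> rl ` (\<phi> ` (W \<inter> U))"
   then obtain q where q: "q \<in> W" "q \<in> U" "x = rl (\<phi> q)" by auto
   have "inj_on \<xi> U" unfolding c using chart_inj[OF M U] by (metis (no_types, lifting) cx_rl inj_on_def)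
   then have "inv_into T \<xi> x = q" using q by (simp add: c inv_into_f_f[of "%a. rl (\<phi> a)"])
   then show "h (f (inv_into U \<phi> (cx x))) = h (f (inv_into T \<xi> x))" using q by (simp add: cx_rl chart_inv[OF M U])
  qed
 qed
 show "smooth_at (realification M) p (%x. Re (f x))" "smooth_at (realification M) p (%x. Im (f x))"
  unfolding smooth_at_def realification_simps using *[of Re] *[of Im] W by blast+
qed

lemma smooth_continuous_map:
 fixes f :: "'a => 'k::real_normed_field"
 assumes M: "charted M" and f: "\<And>p. p \<in> topspace (mtop M) ==> smooth_at M p f"
 shows "continuous_map (mtop M) euclidean f"
 unfolding continuous_map
proof (intro conjI allI impI)
 fix T :: "'k set" assume T: "openin euclidean T"
 show "openin (mtop M) {x \<in> topspace (mtop M). f x \<in> T}"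
 proof (subst openin_subopen, intro ballI)
  fix p assume p: "p \<in> {x \<in> topspace (mtop M). f x \<in> T}"
  then obtain e where e: "e > 0" "ball (f p) e \<subseteq> T" using T by (auto simp: open_contains_ball)
  obtain W where W: "openin (mtop M) W" "p \<in> W" "\<forall>q\<in>W. dist (f q) (f p) < e"
   using smooth_at_continuous[OF M f e(1)] p by blast
  have "f q \<in> T" if "q \<in> W" for q using W(3) that e(2) by (auto simp: dist_commute subset_iff)
  then show "\<exists>T'. openin (mtop M) T' \<and> p \<in> T' \<and> T' \<subseteq> {x \<in> topspace (mtop M). f x \<in> T}"
   using W openin_subset[OF W(1)] by (intro exI[of _ W]) auto
 qed
qed simp

section \<open>The general linear group as a complex Lie group\<close>

text \<open>The universal property tests only groups carried by sets of reals. Hence an open set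
  \<open>S\<close> of complex vectors is transported along an arbitrary injection \<open>e\<close>
  into the reals and keeps its own topology and chart.\<close>

definition emfd :: "nat => (nat => complex) set => ((nat => complex) => real) => (real, complex) manifold" where
 "emfd N S e = \<lparr>mtop = quotient_topology (top_of_set S) e, mdim = N, atlas = {(e ` S, inv_into S e)}\<rparr>"

context
 fixes N S and e :: "(nat => complex) => real"
 assumes S: "kopen N S" and inj: "inj_on e S"
begin

abbreviation "EM \<equiv> emfd N S e"
abbreviation "de \<equiv> inv_into S e"

lemma de_e: "x \<in> S ==> de (e x) = x"
 by (rule inv_into_f_f[OF inj])

lemma e_homeo: "homeomorphic_map (top_of_set S) (mtop EM) e"
 unfolding homeomorphic_map_def emfd_def using quotient_map_quotient_topology[of "top_of_set S" e] inj by simp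

lemma EM_top: "topspace (mtop EM) = e ` S"
 using homeomorphic_imp_surjective_map[OF e_homeo] by simp

lemma e_maps: "homeomorphic_maps (top_of_set S) (mtop EM) e de"
proof -
 obtain g where g: "homeomorphic_maps (top_of_set S) (mtop EM) e g" using e_homeo homeomorphic_map_maps by blast
 then have "\<forall>x\<in>S. g (e x) = x" unfolding homeomorphic_maps_def by simp
 then show ?thesis by (intro homeomorphic_maps_eq[OF g]) (auto simp: EM_top de_e)
qed

lemma de_image: "de ` (e ` S) = S"
 by (auto simp: image_image de_e)

lemma EM_manifold: "is_manifold EM"
 unfolding is_manifold_def
proof (intro conjI)
 have hs: "top_of_set S homeomorphic_space mtop EM" using e_maps homeomorphic_space_def by blast
 show "Hausdorff_space (mtop EM)"
  using homeomorphic_Hausdorff_space[OF hs] Hausdorff_space_subtopology[OF Hausdorff_space_euclidean] by blast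
 have "second_countable (euclidean :: (nat => complex) topology)"
 proof -
  obtain B :: "(nat => complex) set set" where B: "countable B" "topological_basis B" using ex_countable_basis by blast
  show ?thesis unfolding second_countable_def
   using B topological_basis_open[OF B(2)] topological_basisE[OF B(2)] by (intro exI[of _ B]) (metis open_openin)
 qed
 then show "second_countable (mtop EM)"
  using homeomorphic_space_second_countability[OF hs] second_countable_subtopology by blast
 show "topspace (mtop EM) = (\<Union>(U, \<phi>)\<in>atlas EM. U)" using EM_top by (simp add: emfd_def)
 have st: "subtopology (mtop EM) (e ` S) = mtop EM" using EM_top subtopology_topspace by metis
 have "openin (mtop EM) (e ` S)" using EM_top openin_topspace by metis
 moreover have "homeomorphic_map (mtop EM) (top_of_set S) de"
  using e_maps homeomorphic_maps_sym homeomorphic_maps_imp_map by blast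
 moreover have "smooth_fun EM (e ` S) (%x. de x i)" for i
 proof -
  have "smooth_on N S (%x. de (inv_into (e ` S) de x) i)"
  proof (rule smooth_on_cong[OF S smooth_on_coord[of N S i]])
   fix x assume x: "x \<in> S"
   have "inv_into (e ` S) de (de (e x)) = e x"
    by (rule inv_into_f_f) (use x in \<open>auto simp: inj_on_def de_e\<close>)
   then show "x i = de (inv_into (e ` S) de x) i" using x by (simp add: de_e)
  qed
  then show ?thesis by (simp add: smooth_fun_def emfd_def de_image)
 qed
 ultimately show "\<forall>(U, \<phi>)\<in>atlas EM. openin (mtop EM) U \<and> kopen (mdim EM) (\<phi> ` U) \<and>
   homeomorphic_map (subtopology (mtop EM) U) (top_of_set (\<phi> ` U)) \<phi> \<and> (\<forall>i<mdim EM. smooth_fun EM U (%x. \<phi> x i))"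
  using S st de_image by (simp add: emfd_def)
qed

lemma EM_premfd: "premfd EM" and EM_charted: "charted EM"
 using is_manifold_premfd[OF EM_manifold] premfd_charted by auto

lemma EM_atlas: "atlas EM = {(e ` S, de)}" "mdim EM = N"
 by (simp_all add: emfd_def)

lemma EM_coord: "p \<in> e ` S ==> i < N ==> smooth_at EM p (%x. de x i)"
 using smooth_at_coord[OF EM_premfd, of "e ` S" de p i] by (simp add: EM_atlas)

lemma EM_continuous:
 assumes "\<And>p. p \<in> topspace X ==> F p \<in> e ` S" "\<And>i. i < N ==> continuous_map X euclidean (%p. de (F p) i)"
 shows "continuous_map X (mtop EM) F"
proof -
 have inS: "de (F p) \<in> S" if "p \<in> topspace X" for p using assms(1)[OF that] by (auto simp: de_e)
 have "continuous_map X euclidean (%p. de (F p) i)" for i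
 proof (cases "i < N")
  case False
  have z: "0 = de (F p) i" if "p \<in> topspace X" for p
   using False inS[OF that] kopen_subset[OF S] by (auto simp: kspace_def)
  have c0: "continuous_map X euclidean (%_. 0::complex)" by simp
  show ?thesis by (rule continuous_map_eq[OF c0]) (rule z)
 next
  case True then show ?thesis by (rule assms(2))
 qed
 then have "continuous_map X (product_topology (%_. euclidean) UNIV) (%p. de (F p))"
  unfolding continuous_map_componentwise_UNIV by blast
 then have "continuous_map X euclidean (%p. de (F p))"
  unfolding euclidean_product_topology .
 then have "continuous_map X (top_of_set S) (%p. de (F p))"
  unfolding continuous_map_in_subtopology using inS by blast
 from continuous_map_compose[OF this, of "mtop EM" e] e_homeo have "continuous_map X (mtop EM) (e \<circ> (%p. de (F p)))"
  using homeomorphic_imp_continuous_map by blast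
 then show ?thesis
  by (rule continuous_map_eq) (simp add: f_inv_into_f[OF assms(1)])
qed

lemma EM_smooth_map:
 assumes M: "charted M" and F: "\<And>p. p \<in> topspace (mtop M) ==> F p \<in> e ` S"
  and c: "\<And>p i. p \<in> topspace (mtop M) ==> i < N ==> smooth_at M p (%p. de (F p) i)"
 shows "smooth_map M EM F"
 by (rule smooth_mapI[OF M EM_charted EM_continuous[OF F smooth_continuous_map[OF M]]]) (use c in \<open>auto simp: EM_atlas\<close>)

lemma EM_smooth_fun:
 assumes "smooth_on N S f" "p \<in> e ` S" shows "smooth_at EM p (%x. f (de x))"
proof -
 have "smooth_fun EM (e ` S) (%x. f (de x))"
 proof (rule smooth_fun_chartI[OF EM_premfd, of "e ` S" de])
  show "smooth_on (mdim EM) (de ` (e ` S)) (%x. f (de (inv_into (e ` S) de x)))"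
   unfolding de_image EM_atlas
  proof (rule smooth_on_cong[OF S assms(1)])
   fix x assume x: "x \<in> S"
   have "inv_into (e ` S) de (de (e x)) = e x"
    by (rule inv_into_f_f) (use x in \<open>auto simp: inj_on_def de_e\<close>)
   then show "f x = f (de (inv_into (e ` S) de x))" using x by (simp add: de_e)
  qed
 qed (use EM_top in \<open>auto simp: EM_atlas intro: openin_topspace[of "mtop EM", unfolded EM_top]\<close>)
 then show ?thesis unfolding smooth_at_def using assms(2) EM_top openin_topspace by metis
qed

end

text \<open>A point is determined by the members of a countable basis that contain it, and sets of
  naturals embed in the reals.\<close>

lemma ex_inj_real: "\<exists>e :: (nat => complex) => real. inj e"
proof -
 obtain B :: "(nat => complex) set set" where B: "countable B" "topological_basis B"
  using ex_countable_basis by blast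
 let ?s = "%x. {m::nat. x \<in> from_nat_into B m}"
 have "inj ?s"
 proof (rule injI, rule ccontr)
  fix x y assume eq: "?s x = ?s y" and "x \<noteq> y"
  then have "open (- {y})" "x \<in> - {y}" by auto
  then obtain b where b: "b \<in> B" "x \<in> b" "b \<subseteq> - {y}" using topological_basisE[OF B(2)] by metis
  then have "b = from_nat_into B (to_nat_on B b)" using B(1) by simp
  then have "to_nat_on B b \<in> ?s x" "to_nat_on B b \<notin> ?s y" using b by auto
  then show False using eq by blast
 qed
 moreover obtain f :: "nat set => real" where "bij f"
  using nat_sets_eqpoll_reals unfolding eqpoll_def by blast
 ultimately have "inj (f \<circ> ?s)" using inj_compose bij_is_inj by blast
 then show ?thesis by blast
qed

section \<open>Invertible matrices as a complex Lie group\<close>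

definition toM :: "nat => (nat => complex) => complex mat" where
 "toM n x = mat n n (%(i, j). x (i * n + j))"

definition ofM :: "nat => complex mat => nat => complex" where
 "ofM n A = (%k. if k < n * n then A $$ (k div n, k mod n) else 0)"

definition GLS :: "nat => (nat => complex) set" where
 "GLS n = {x \<in> kspace (n * n). Determinant.det (toM n x) \<noteq> 0}"

lemma idx: "i < n ==> j < n ==> i * n + j < n * (n::nat)"
proof -
 assume "i < n" "j < n"
 then have "i * n + j < i * n + n" "i * n + n \<le> n * n" using mult_le_mono1[of "Suc i" n n] by auto
 then show ?thesis by linarith
qed

lemma idx_div: "k < n * n ==> k div n < n \<and> k mod n < (n::nat)"
 by (metis less_mult_imp_div_less mod_less_divisor mult_0 not_gr_zero not_less_zero)

lemma toM_carrier [simp]: "toM n x \<in> carrier_mat n n"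
 by (simp add: toM_def)

lemma toM_index: "i < n ==> j < n ==> toM n x $$ (i, j) = x (i * n + j)"
 by (simp add: toM_def)

lemma toM_ofM: "A \<in> carrier_mat n n ==> toM n (ofM n A) = A"
 by (rule eq_matI) (auto simp: toM_def ofM_def idx)

lemma ofM_toM: "x \<in> kspace (n * n) ==> ofM n (toM n x) = x"
proof
 fix k assume x: "x \<in> kspace (n * n)"
 show "ofM n (toM n x) k = x k"
  using idx_div[of k n] x by (cases "k < n * n") (auto simp: ofM_def toM_def kspace_def)
qed

lemma ofM_GLS: "A \<in> carrier_mat n n ==> Determinant.det A \<noteq> 0 ==> ofM n A \<in> GLS n"
 by (simp add: GLS_def toM_ofM) (simp add: kspace_def ofM_def)

text \<open>By the Leibniz formula the determinant is a polynomial in the entries.\<close>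

lemma Ck_on_det:
 assumes A: "\<And>x. A x \<in> carrier_mat d d" "\<And>i j. i < d ==> j < d ==> Ck_on N m U (%x. A x $$ (i, j))"
 shows "Ck_on N m U (%x. Determinant.det (A x))"
proof -
 have "(%x. Determinant.det (A x)) = (%x. \<Sum>p\<in>{p. p permutes {0..<d}}. signof p * (\<Prod>i = 0..<d. A x $$ (i, p i)))"
  by (rule ext) (rule det_def'[OF A(1)])
 moreover have "Ck_on N m U \<dots>"
 proof (intro Ck_on_sum Ck_on_mult Ck_on_const Ck_on_prod)
  show "Ck_on N m U (%x. A x $$ (i, p i))" if "p \<in> {p. p permutes {0..<d}}" "i \<in> {0..<d}" for p i
  proof (rule A(2))
   show "i < d" using that by simp
   show "p i < d" using that permutes_in_image[of p "{0..<d}" i] by simp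
  qed
 qed (auto simp: finite_permutations)
 ultimately show ?thesis by simp
qed

lemma Ck_on_toM: "i < n ==> j < n ==> Ck_on N m U (%x. toM n x $$ (i, j))"
 by (simp add: toM_index Ck_on_coord)

lemma Ck_on_cofactor:
 "Ck_on N m U (%x. cofactor (toM n x) i j)"
 unfolding cofactor_def
proof (intro Ck_on_mult Ck_on_const Ck_on_det[of _ "n - 1"] mat_delete_carrier toM_carrier)
 fix i' j' assume "i' < n - 1" "j' < n - 1"
 \<comment> \<open>Deleting row \<open>i\<close> and column \<open>j\<close> shifts the later
   indices by one.\<close>
 then have "(%x. mat_delete (toM n x) i j $$ (i', j')) =
   (%x. x ((if i' < i then i' else Suc i') * n + (if j' < j then j' else Suc j')))"
  by (auto simp: mat_delete_def toM_def fun_eq_iff)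
 then show "Ck_on N m U (%x. mat_delete (toM n x) i j $$ (i', j'))" by (simp add: Ck_on_coord)
qed

lemma kopen_GLS: "kopen (n * n) (GLS n)"
proof -
 have "Ck_on (n * n) 0 (kspace (n * n)) (%x. Determinant.det (toM n x))"
  by (intro Ck_on_det[of _ n] toM_carrier Ck_on_toM)
 then have "continuous_on (kspace (n * n)) (%x. Determinant.det (toM n x))" by simp
 moreover have "GLS n = kspace (n * n) \<inter> (%x. Determinant.det (toM n x)) -` (- {0})"
  unfolding GLS_def by blast
 ultimately show ?thesis using continuous_openin_preimage_gen[of _ _ "- {0}"] by (metis open_delete Compl_eq_Diff_UNIV open_UNIV)
qed

definition GLc :: "((nat => complex) => real) => nat => (real, complex) lie_group" where
 "GLc e n = \<lparr>carrier = e ` GLS n,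
   mult = %a b. e (ofM n (toM n (inv_into (GLS n) e a) * toM n (inv_into (GLS n) e b))),
   one = e (ofM n (1\<^sub>m n)), mfd = emfd (n * n) (GLS n) e\<rparr>"

context
 fixes n :: nat and e :: "(nat => complex) => real"
 assumes inj: "inj e"
begin

definition "mm a = toM n (inv_into (GLS n) e a)"
definition "elt A = e (ofM n A)"

lemma injS: "inj_on e (GLS n)"
 using inj by (rule inj_on_subset) simp

lemma mm_elt: "A \<in> carrier_mat n n ==> Determinant.det A \<noteq> 0 ==> mm (elt A) = A"
 by (simp add: mm_def elt_def inv_into_f_f[OF injS ofM_GLS] toM_ofM)

lemma elt_in: "A \<in> carrier_mat n n ==> Determinant.det A \<noteq> 0 ==> elt A \<in> carrier (GLc e n)"
 by (simp add: elt_def GLc_def ofM_GLS)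

lemma mm_carrier [simp]: "mm a \<in> carrier_mat n n"
 by (simp add: mm_def)

lemma mm_props:
 assumes "a \<in> carrier (GLc e n)"
 shows "Determinant.det (mm a) \<noteq> 0" "elt (mm a) = a" "inv_into (GLS n) e a \<in> GLS n"
proof -
 obtain x where x: "x \<in> GLS n" "a = e x" using assms by (auto simp: GLc_def)
 then have d: "inv_into (GLS n) e a = x" by (simp add: inv_into_f_f[OF injS])
 show "Determinant.det (mm a) \<noteq> 0" "elt (mm a) = a" "inv_into (GLS n) e a \<in> GLS n"
  using x ofM_toM[of x n] unfolding mm_def elt_def d by (simp_all add: GLS_def)
qed

lemma GLc_simps: "a \<otimes>\<^bsub>GLc e n\<^esub> b = elt (mm a * mm b)" "\<one>\<^bsub>GLc e n\<^esub> = elt (1\<^sub>m n)"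
  "carrier (GLc e n) = e ` GLS n" "mfd (GLc e n) = emfd (n * n) (GLS n) e"
 by (simp_all add: GLc_def elt_def mm_def)

lemma det_mm: "a \<in> carrier (GLc e n) ==> b \<in> carrier (GLc e n) ==> Determinant.det (mm a * mm b) \<noteq> 0"
 using det_mult[of "mm a" n "mm b"] mm_props(1) by simp

text \<open>Inversion by cofactors: the entries are polynomials divided by the determinant, so
  holomorphy of the group inverse can be read off.\<close>

definition "invM (A :: complex mat) = inverse (Determinant.det A) \<cdot>\<^sub>m adj_mat A"

lemma invM:
 assumes A: "A \<in> carrier_mat n n" "Determinant.det A \<noteq> 0"
 shows "invM A \<in> carrier_mat n n" "invM A * A = 1\<^sub>m n" "Determinant.det (invM A) \<noteq> 0"
proof -
 show c: "invM A \<in> carrier_mat n n" using adj_mat(1)[OF A(1)] by (simp add: invM_def)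
 have "invM A * A = inverse (Determinant.det A) \<cdot>\<^sub>m (adj_mat A * A)"
  unfolding invM_def by (rule mult_smult_assoc_mat[OF adj_mat(1)[OF A(1)] A(1)])
 also have "\<dots> = 1\<^sub>m n" unfolding adj_mat(3)[OF A(1)] using left_inverse[OF A(2)] by (intro eq_matI) auto
 finally show eq: "invM A * A = 1\<^sub>m n" .
 have "Determinant.det (invM A) * Determinant.det A = 1" using det_mult[OF c A(1)] eq by simp
 then show "Determinant.det (invM A) \<noteq> 0" by auto
qed

lemma GLc_group: "group (GLc e n)"
proof (rule groupI)
 show "\<one>\<^bsub>GLc e n\<^esub> \<in> carrier (GLc e n)" unfolding GLc_simps(2) by (rule elt_in) auto
 fix a assume a: "a \<in> carrier (GLc e n)"
 show "\<one>\<^bsub>GLc e n\<^esub> \<otimes>\<^bsub>GLc e n\<^esub> a = a"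
  unfolding GLc_simps(1,2) using mm_props[OF a] by (simp add: mm_elt left_mult_one_mat[OF mm_carrier])
 have "elt (invM (mm a)) \<otimes>\<^bsub>GLc e n\<^esub> a = \<one>\<^bsub>GLc e n\<^esub>"
  unfolding GLc_simps(1,2) using invM[OF mm_carrier mm_props(1)[OF a]] by (simp add: mm_elt)
 then show "\<exists>y\<in>carrier (GLc e n). y \<otimes>\<^bsub>GLc e n\<^esub> a = \<one>\<^bsub>GLc e n\<^esub>"
  using elt_in[OF invM(1,3)[OF mm_carrier mm_props(1)[OF a]]] by blast
 fix b assume b: "b \<in> carrier (GLc e n)"
 show "a \<otimes>\<^bsub>GLc e n\<^esub> b \<in> carrier (GLc e n)"
  unfolding GLc_simps(1) by (rule elt_in[OF mult_carrier_mat[OF mm_carrier mm_carrier] det_mm[OF a b]])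
 fix c assume c: "c \<in> carrier (GLc e n)"
 show "a \<otimes>\<^bsub>GLc e n\<^esub> b \<otimes>\<^bsub>GLc e n\<^esub> c = a \<otimes>\<^bsub>GLc e n\<^esub> (b \<otimes>\<^bsub>GLc e n\<^esub> c)"
  unfolding GLc_simps(1) mm_elt[OF mult_carrier_mat[OF mm_carrier mm_carrier] det_mm[OF a b]] mm_elt[OF mult_carrier_mat[OF mm_carrier mm_carrier] det_mm[OF b c]]
   assoc_mult_mat[OF mm_carrier mm_carrier mm_carrier] ..
qed

lemma GLc_inv: "a \<in> carrier (GLc e n) ==> inv\<^bsub>GLc e n\<^esub> a = elt (invM (mm a))"
proof (rule group.inv_equality[OF GLc_group])
 assume a: "a \<in> carrier (GLc e n)"
 note i = invM[OF mm_carrier mm_props(1)[OF a]]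
 show "elt (invM (mm a)) \<otimes>\<^bsub>GLc e n\<^esub> a = \<one>\<^bsub>GLc e n\<^esub>"
  unfolding GLc_simps(1,2) using i by (simp add: mm_elt)
 show "elt (invM (mm a)) \<in> carrier (GLc e n)" by (rule elt_in[OF i(1,3)])
qed

abbreviation "gde \<equiv> inv_into (GLS n) e"
abbreviation "gM \<equiv> mfd (GLc e n)"

lemma gde_elt: "A \<in> carrier_mat n n ==> Determinant.det A \<noteq> 0 ==> gde (elt A) = ofM n A"
 by (simp add: elt_def inv_into_f_f[OF injS ofM_GLS])

lemma GLc_manifold: "is_manifold gM" "premfd gM" "charted gM"
 using EM_manifold[OF kopen_GLS injS] EM_premfd[OF kopen_GLS injS] EM_charted[OF kopen_GLS injS] by (simp_all add: GLc_simps)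

lemma GLc_top: "topspace (mtop gM) = carrier (GLc e n)"
 using EM_top[OF kopen_GLS injS] by (simp add: GLc_simps)

lemma GLc_coord: "a \<in> carrier (GLc e n) ==> k < n * n ==> smooth_at gM a (%x. gde x k)"
 using EM_coord[OF kopen_GLS injS] by (simp add: GLc_simps)

lemma GLc_smooth_map:
 assumes M: "charted M" and F: "\<And>p. p \<in> topspace (mtop M) ==> F p \<in> carrier (GLc e n)"
  and c: "\<And>p k. p \<in> topspace (mtop M) ==> k < n * n ==> smooth_at M p (%p. gde (F p) k)"
 shows "smooth_map M gM F"
 unfolding GLc_simps(4)
proof (rule EM_smooth_map[OF kopen_GLS injS M])
 show "F p \<in> e ` GLS n" if "p \<in> topspace (mtop M)" for p using F[OF that] by (simp only: GLc_simps(3))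
qed (rule c)

lemma GLc_lie: "is_lie_group (GLc e n)"
 unfolding is_lie_group_def
proof (intro conjI GLc_group GLc_manifold(1) GLc_top)
 let ?P = "prod_manifold gM gM"
 have cP: "charted ?P" by (rule charted_prod[OF GLc_manifold(3) GLc_manifold(3)])
 have tP: "topspace (mtop ?P) = carrier (GLc e n) \<times> carrier (GLc e n)"
  by (simp add: prod_manifold_def GLc_top)
 show "smooth_map ?P gM (%(x, y). x \<otimes>\<^bsub>GLc e n\<^esub> y)"
 proof (rule GLc_smooth_map[OF cP])
  show "(case p of (x, y) => x \<otimes>\<^bsub>GLc e n\<^esub> y) \<in> carrier (GLc e n)" if "p \<in> topspace (mtop ?P)" for p
   using that group.is_monoid[OF GLc_group] monoid.m_closed[of "GLc e n"] by (auto simp: tP)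
  fix p k assume p: "p \<in> topspace (mtop ?P)" and k: "k < n * n"
  note kd = idx_div[OF k]
  have "smooth_at ?P p (%q. \<Sum>l<n. gde (fst q) (k div n * n + l) * gde (snd q) (l * n + k mod n))"
  proof (intro smooth_at_sum smooth_at_mult p finite_lessThan)
   fix l assume "l \<in> {..<n}"
   then have l: "l < n" by simp
   show "smooth_at ?P p (%q. gde (fst q) (k div n * n + l))"
    by (rule smooth_at_compose[OF cP GLc_manifold(3) smooth_map_fst[OF GLc_manifold(2) GLc_manifold(2)] p, where f="%a. gde a (k div n * n + l)"])
     (rule GLc_coord, use p tP idx l kd in auto)
   show "smooth_at ?P p (%q. gde (snd q) (l * n + k mod n))"
    by (rule smooth_at_compose[OF cP GLc_manifold(3) smooth_map_snd[OF GLc_manifold(2) GLc_manifold(2)] p, where f="%a. gde a (l * n + k mod n)"])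
     (rule GLc_coord, use p tP idx l kd in auto)
  qed
  moreover have "(\<Sum>l<n. gde (fst q) (k div n * n + l) * gde (snd q) (l * n + k mod n)) = gde (case q of (x, y) => x \<otimes>\<^bsub>GLc e n\<^esub> y) k"
   if q: "q \<in> topspace (mtop ?P)" for q
  proof -
   obtain a b where ab: "q = (a, b)" "a \<in> carrier (GLc e n)" "b \<in> carrier (GLc e n)" using q unfolding tP by blast
   have "gde (a \<otimes>\<^bsub>GLc e n\<^esub> b) k = (mm a * mm b) $$ (k div n, k mod n)"
    unfolding GLc_simps(1) gde_elt[OF mult_carrier_mat[OF mm_carrier mm_carrier] det_mm[OF ab(2,3)]] using k by (simp add: ofM_def)
   also have "\<dots> = (\<Sum>l<n. mm a $$ (k div n, l) * mm b $$ (l, k mod n))"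
    using kd carrier_matD[OF mm_carrier[of a]] carrier_matD[OF mm_carrier[of b]]
    by (simp add: scalar_prod_def atLeast0LessThan)
   finally show ?thesis using kd by (simp add: ab mm_def toM_index)
  qed
  ultimately show "smooth_at ?P p (%q. gde (case q of (x, y) => x \<otimes>\<^bsub>GLc e n\<^esub> y) k)"
   using smooth_at_cong[OF cP openin_topspace p, of "%q. \<Sum>l<n. gde (fst q) (k div n * n + l) * gde (snd q) (l * n + k mod n)" "%q. gde (case q of (x, y) => x \<otimes>\<^bsub>GLc e n\<^esub> y) k"] by blast
 qed
 show "smooth_map gM gM (%x. inv\<^bsub>GLc e n\<^esub> x)"
 proof (rule GLc_smooth_map[OF GLc_manifold(3)])
  show "inv\<^bsub>GLc e n\<^esub> p \<in> carrier (GLc e n)" if "p \<in> topspace (mtop gM)" for p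
   using that group.inv_closed[OF GLc_group] by (simp add: GLc_top)
  fix p k assume p: "p \<in> topspace (mtop gM)" and k: "k < n * n"
  note kd = idx_div[OF k]
  let ?f = "%x. inverse (Determinant.det (toM n x)) * cofactor (toM n x) (k mod n) (k div n)"
  have "smooth_on (n * n) (GLS n) ?f"
   unfolding smooth_on_def
   by (intro allI Ck_on_mult Ck_on_inverse Ck_on_cofactor Ck_on_det[of _ n] toM_carrier Ck_on_toM) (auto simp: GLS_def)
  from EM_smooth_fun[OF kopen_GLS injS this, of p] p
  have "smooth_at gM p (%x. ?f (gde x))" by (simp add: GLc_top) (simp add: GLc_simps)
  moreover have "?f (gde q) = gde (inv\<^bsub>GLc e n\<^esub> q) k" if "q \<in> topspace (mtop gM)" for q
  proof -
   have q: "q \<in> carrier (GLc e n)" using that by (simp add: GLc_top)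
   note i = invM[OF mm_carrier mm_props(1)[OF q]]
   show ?thesis unfolding GLc_inv[OF q] gde_elt[OF i(1,3)] using k kd adj_mat(1)[OF mm_carrier[of q]] carrier_matD[OF mm_carrier[of q]]
    by (simp add: ofM_def invM_def adj_mat_def mm_def)
  qed
  ultimately show "smooth_at gM p (%p. gde (inv\<^bsub>GLc e n\<^esub> p) k)"
   using smooth_at_cong[OF GLc_manifold(3) openin_topspace p, of "%x. ?f (gde x)" "%p. gde (inv\<^bsub>GLc e n\<^esub> p) k"] by blast
 qed
qed

end

section \<open>The universal complexification and the extension of the adjoint
  representation\<close>

locale ucx = G: lie G + C: lie GC for G :: "('a, real) lie_group" and GC :: "('b, complex) lie_group" +
 fixes \<iota> :: "'a => 'b"
 assumes u: "universal_complexification G GC \<iota>"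
begin

abbreviation "dl \<equiv> lie_diff GC \<iota>"

lemma iota_hom: "\<iota> \<in> hom G GC" and iota_smooth: "smooth_map (mfd G) (realification (mfd GC)) \<iota>"
 using u unfolding universal_complexification_def real_to_complex_lie_hom_def by auto

lemma iota_in: "g \<in> carrier G ==> \<iota> g \<in> carrier GC"
 using iota_hom by (auto simp: hom_def)

lemma iota_mult: "g \<in> carrier G ==> h \<in> carrier G ==> \<iota> (g \<otimes>\<^bsub>G\<^esub> h) = \<iota> g \<otimes>\<^bsub>GC\<^esub> \<iota> h"
 using iota_hom by (auto simp: hom_def)

lemma iota_one: "\<iota> \<one>\<^bsub>G\<^esub> = \<one>\<^bsub>GC\<^esub>"
 using hom_one[OF iota_hom] G.is_group C.is_group by blast

lemma iota_inv: "g \<in> carrier G ==> \<iota> (inv\<^bsub>G\<^esub> g) = inv\<^bsub>GC\<^esub> (\<iota> g)"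
 using group_hom.hom_inv[of G GC \<iota> g] iota_hom G.is_group C.is_group
 by (simp add: group_hom_def group_hom_axioms_def)

lemma pullback:
 assumes "g \<in> carrier G" "smooth_at (mfd GC) (\<iota> g) f"
 shows "smooth_at (mfd G) g (%x. Re (f (\<iota> x)))" "smooth_at (mfd G) g (%x. Im (f (\<iota> x)))"
proof -
 note c = smooth_at_compose[OF G.cM charted_realification[OF C.cM] iota_smooth, of g]
 show "smooth_at (mfd G) g (%x. Re (f (\<iota> x)))"
  by (rule c[where f="%y. Re (f y)"]) (use assms G.top smooth_at_Re_Im(1)[OF C.cM assms(2)] in auto)
 show "smooth_at (mfd G) g (%x. Im (f (\<iota> x)))"
  by (rule c[where f="%y. Im (f y)"]) (use assms G.top smooth_at_Re_Im(2)[OF C.cM assms(2)] in auto)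
qed

lemma pullback_one:
 assumes "C.sm f"
 shows "G.sm (%x. Re (f (\<iota> x)))" "G.sm (%x. Im (f (\<iota> x)))"
 using pullback[of "\<one>\<^bsub>G\<^esub>" f] assms iota_one by auto

lemma iota_open:
 assumes "openin (mtop (mfd GC)) W" shows "openin (mtop (mfd G)) {x \<in> carrier G. \<iota> x \<in> W}"
 using openin_continuous_map_preimage[OF smooth_map_continuous[OF iota_smooth], of W] assms
 by (simp add: realification_simps G.top)

lemma dl_eq: "dl Y f = (if C.sm f then Complex (Y (%x. Re (f (\<iota> x)))) (Y (%x. Im (f (\<iota> x)))) else 0)"
 by (simp add: lie_diff_def smooth_near_one_iff)

lemma dl_in:
 assumes Y: "Y \<in> G.L" shows "dl Y \<in> C.L"
proof (rule C.LI)
 show "dl Y f = 0" if "\<not> C.sm f" for f using that by (simp add: dl_eq)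
next
 fix f g W assume s: "C.sm f" "C.sm g" and W: "openin (mtop (mfd GC)) W" "\<one>\<^bsub>GC\<^esub> \<in> W" and eq: "\<And>x. x \<in> W ==> f x = g x"
 have o: "\<one>\<^bsub>G\<^esub> \<in> {x \<in> carrier G. \<iota> x \<in> W}" using W iota_one by simp
 have "Y (%x. Re (f (\<iota> x))) = Y (%x. Re (g (\<iota> x)))" "Y (%x. Im (f (\<iota> x))) = Y (%x. Im (g (\<iota> x)))"
  by (rule G.der_germ[OF Y iota_open[OF W(1)] o]; simp add: eq)+
 then show "dl Y f = dl Y g" using s by (simp add: dl_eq)
next
 fix f g assume s: "C.sm f" "C.sm g"
 note p = pullback_one[OF s(1)] pullback_one[OF s(2)]
 show "dl Y (%x. f x + g x) = dl Y f + dl Y g"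
  using s G.der_add[OF Y p(1,3)] G.der_add[OF Y p(2,4)] smooth_at_add[OF s] by (simp add: dl_eq complex_eq_iff)
 have "Y (%x. Re (f (\<iota> x) * g (\<iota> x))) = Y (%x. Re (f (\<iota> x)) * Re (g (\<iota> x))) - Y (%x. Im (f (\<iota> x)) * Im (g (\<iota> x)))"
  unfolding times_complex.simps by (rule G.der_diff[OF Y smooth_at_mult[OF p(1,3)] smooth_at_mult[OF p(2,4)]])
 moreover have "Y (%x. Im (f (\<iota> x) * g (\<iota> x))) = Y (%x. Re (f (\<iota> x)) * Im (g (\<iota> x))) + Y (%x. Im (f (\<iota> x)) * Re (g (\<iota> x)))"
  unfolding times_complex.simps by (rule G.der_add[OF Y smooth_at_mult[OF p(1,4)] smooth_at_mult[OF p(2,3)]])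
 ultimately show "dl Y (%x. f x * g x) = dl Y f * g \<one>\<^bsub>GC\<^esub> + f \<one>\<^bsub>GC\<^esub> * dl Y g"
  using s G.der_mult[OF Y p(1,3)] G.der_mult[OF Y p(2,4)] G.der_mult[OF Y p(1,4)] G.der_mult[OF Y p(2,3)] smooth_at_mult[OF s] iota_one
  by (simp add: dl_eq complex_eq_iff algebra_simps)
next
 fix c f assume s: "C.sm f"
 note p = pullback_one[OF s]
 have "Y (%x. Re (c * f (\<iota> x))) = Re c * Y (%x. Re (f (\<iota> x))) - Im c * Y (%x. Im (f (\<iota> x)))"
  unfolding times_complex.simps G.der_diff[OF Y smooth_at_cmult[OF p(1)] smooth_at_cmult[OF p(2)]] G.der_cmult[OF Y p(1)] G.der_cmult[OF Y p(2)] ..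
 moreover have "Y (%x. Im (c * f (\<iota> x))) = Re c * Y (%x. Im (f (\<iota> x))) + Im c * Y (%x. Re (f (\<iota> x)))"
  unfolding times_complex.simps G.der_add[OF Y smooth_at_cmult[OF p(2)] smooth_at_cmult[OF p(1)]] G.der_cmult[OF Y p(1)] G.der_cmult[OF Y p(2)] ..
 ultimately show "dl Y (%x. c * f x) = c * dl Y f" using s smooth_at_cmult[OF s] by (simp add: dl_eq complex_eq_iff)
qed

lemma dl_add: "dl (X + Y) = dl X + dl Y" and dl_diff: "dl (X - Y) = dl X - dl Y"
 and dl_scale: "dl (c *\<^sub>F X) = of_real c *\<^sub>F dl X"
 by (auto simp: dl_eq fun_eq_iff complex_eq_iff fscale_def)

lemma dl_0: "dl 0 = 0"
 using dl_scale[of 0 0] by simp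

lemma hat_dl:
 assumes Y: "Y \<in> G.L" and g: "g \<in> carrier G" and f: "smooth_at (mfd GC) (\<iota> g) f"
 shows "C.hat (dl Y) f (\<iota> g) = Complex (G.hat Y (%x. Re (f (\<iota> x))) g) (G.hat Y (%x. Im (f (\<iota> x))) g)"
proof -
 have "C.sm (%h. f (\<iota> g \<otimes>\<^bsub>GC\<^esub> h))" by (rule C.sm_left_one[OF iota_in[OF g] f])
 moreover have "Y (%x. Re (f (\<iota> g \<otimes>\<^bsub>GC\<^esub> \<iota> x))) = G.hat Y (%x. Re (f (\<iota> x))) g"
  "Y (%x. Im (f (\<iota> g \<otimes>\<^bsub>GC\<^esub> \<iota> x))) = G.hat Y (%x. Im (f (\<iota> x))) g"
  unfolding G.hat_def by (rule G.der_cong[OF Y]; simp add: iota_mult g)+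
 ultimately show ?thesis unfolding C.hat_def by (simp add: dl_eq)
qed

lemma dl_hat:
 assumes X: "X \<in> G.L" and Y: "Y \<in> G.L" and f: "C.sm f"
 shows "dl X (C.hat (dl Y) f) = Complex (X (G.hat Y (%x. Re (f (\<iota> x))))) (X (G.hat Y (%x. Im (f (\<iota> x)))))"
proof -
 obtain W where W: "openin (mtop (mfd GC)) W" "\<one>\<^bsub>GC\<^esub> \<in> W" "\<forall>q\<in>W. smooth_at (mfd GC) q f"
  using C.sm_near[OF f f] by blast
 have o: "\<one>\<^bsub>G\<^esub> \<in> {x \<in> carrier G. \<iota> x \<in> W}" using W iota_one by simp
 have "X (%x. Re (C.hat (dl Y) f (\<iota> x))) = X (G.hat Y (%x. Re (f (\<iota> x))))"
  "X (%x. Im (C.hat (dl Y) f (\<iota> x))) = X (G.hat Y (%x. Im (f (\<iota> x))))"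
  by (rule G.der_germ[OF X iota_open[OF W(1)] o]; use hat_dl[OF Y] W(3) in force)+
 then show ?thesis using C.smooth_hat[OF dl_in[OF Y] f] by (simp add: dl_eq)
qed

text \<open>Evaluated on \<open>f\<close>, both sides are second derivatives of the real and
  imaginary parts of \<open>f\<close> pulled back along \<iota>.\<close>

lemma dl_br:
 assumes X: "X \<in> G.L" and Y: "Y \<in> G.L"
 shows "C.br (dl X) (dl Y) = dl (G.br X Y)"
proof
 fix f
 show "C.br (dl X) (dl Y) f = dl (G.br X Y) f"
 proof (cases "C.sm f")
  case True
  then show ?thesis unfolding C.br_eq dl_hat[OF X Y True] dl_hat[OF Y X True] dl_eq[of "G.br X Y"] G.br_eq
   using pullback_one[OF True] by (simp add: complex_eq_iff)
 qed (simp add: C.br_eq dl_eq)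
qed

text \<open>The image of a real one-parameter subgroup is a \<open>hom_curve\<close> with velocity
  \<open>dl X\<close>, and such curves are unique.\<close>

lemma iota_exp:
 assumes X: "X \<in> G.L" shows "\<iota> (lie_exp G X) = lie_exp GC (dl X)"
proof -
 have L: "t *\<^sub>F X \<in> G.L" for t by (rule G.L_scale[OF X])
 have "C.hom_curve (dl X) (%t. \<iota> (lie_exp G (t *\<^sub>F X)))"
  unfolding C.hom_curve_def
 proof (intro conjI allI impI)
  show "\<iota> (lie_exp G (t *\<^sub>F X)) \<in> carrier GC" for t by (intro iota_in G.gexp_in L)
  show "\<iota> (lie_exp G ((s + t) *\<^sub>F X)) = \<iota> (lie_exp G (s *\<^sub>F X)) \<otimes>\<^bsub>GC\<^esub> \<iota> (lie_exp G (t *\<^sub>F X))" for s t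
   unfolding G.gexp_add[OF X] by (intro iota_mult G.gexp_in L)
  fix f assume f: "C.sm f"
  have e0: "lie_exp G (0 *\<^sub>F X) = \<one>\<^bsub>G\<^esub>" using G.gexp_0 by (metis fnvs.scale_zero_left)
  have "((%t. F (lie_exp G (t *\<^sub>F X))) has_vector_derivative X F) (at 0)" if "G.sm F" for F
   using G.gexp_deriv[OF X, of 0 F] that unfolding e0 G.hat_one[OF X] has_real_derivative_iff_has_vector_derivative .
  from this[OF pullback_one(1)[OF f]] this[OF pullback_one(2)[OF f]]
  show "((%t. f (\<iota> (lie_exp G (t *\<^sub>F X)))) has_vector_derivative dl X f) (at 0)"
   using f by (simp add: has_vector_derivative_complex_iff dl_eq has_real_derivative_iff_has_vector_derivative)
 qed
 from C.hom_curve_exp[OF this dl_in[OF X], of 1] show ?thesis by simp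
qed

abbreviation "n \<equiv> mdim (mfd G)"

definition AdM :: "'a => complex mat" where
 "AdM g = mat n n (%(i, j). of_real (G.Ad g (G.bas j) (G.crd i)))"

lemma AdM_carrier [simp]: "AdM g \<in> carrier_mat n n"
 by (simp add: AdM_def)

lemma AdM_mult:
 assumes g: "g \<in> carrier G" and h: "h \<in> carrier G"
 shows "AdM (g \<otimes>\<^bsub>G\<^esub> h) = AdM g * AdM h"
proof (rule eq_matI)
 fix i j assume "i < dim_row (AdM g * AdM h)" "j < dim_col (AdM g * AdM h)"
 then have i: "i < n" and j: "j < n" by (auto simp: AdM_def)
 note c = G.sm_crd[OF i]
 have "G.Ad (g \<otimes>\<^bsub>G\<^esub> h) (G.bas j) (G.crd i) = G.Ad g (G.Ad h (G.bas j)) (G.crd i)"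
  by (simp add: G.Ad_mult[OF g h G.bas(1)])
 also have "\<dots> = (\<Sum>l<n. G.Ad h (G.bas j) (G.crd l) * G.Ad g (G.bas l) (G.crd i))"
  using G.der_coords[OF G.Ad_in[OF h G.bas(1)[of j]], of "%x. G.crd i (g \<otimes>\<^bsub>G\<^esub> x \<otimes>\<^bsub>G\<^esub> inv\<^bsub>G\<^esub> g)"] c
  by (simp add: G.Ad_def[of g])
 finally show "AdM (g \<otimes>\<^bsub>G\<^esub> h) $$ (i, j) = (AdM g * AdM h) $$ (i, j)"
  using i j by (simp add: AdM_def scalar_prod_def atLeast0LessThan mult.commute)
qed (auto simp: AdM_def)

lemma AdM_one: "AdM \<one>\<^bsub>G\<^esub> = 1\<^sub>m n"
 by (rule eq_matI) (auto simp: AdM_def G.Ad_one[OF G.bas(1)] G.bas(2))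

lemma AdM_det: "g \<in> carrier G ==> Determinant.det (AdM g) \<noteq> 0"
proof -
 assume g: "g \<in> carrier G"
 then have "AdM g * AdM (inv\<^bsub>G\<^esub> g) = 1\<^sub>m n" using AdM_mult[of g "inv\<^bsub>G\<^esub> g"] AdM_one by simp
 then have "Determinant.det (AdM g) * Determinant.det (AdM (inv\<^bsub>G\<^esub> g)) = 1"
  using det_mult[OF AdM_carrier[of g] AdM_carrier[of "inv\<^bsub>G\<^esub> g"]] by simp
 then show ?thesis by auto
qed

text \<open>The universal property is applied to Ad, written in the basis \<open>bas\<close> with
  values in the copy of GL(n) carried by reals. Only the matrix coefficients \<Psi> of the extension
  are kept, so nothing later refers to that copy.\<close>

lemma ex_rep:
 "\<exists>\<Psi>. (\<forall>i<n. \<forall>j<n. \<forall>g\<in>carrier GC. smooth_at (mfd GC) g (\<Psi> i j)) \<and>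
  (\<forall>i<n. \<forall>j<n. \<forall>g\<in>carrier GC. \<forall>h\<in>carrier GC. \<Psi> i j (g \<otimes>\<^bsub>GC\<^esub> h) = (\<Sum>l<n. \<Psi> i l g * \<Psi> l j h)) \<and>
  (\<forall>i<n. \<forall>j<n. \<forall>g\<in>carrier G. \<Psi> i j (\<iota> g) = complex_of_real (G.Ad g (G.bas j) (G.crd i)))"
proof -
 obtain e :: "(nat => complex) => real" where e: "inj e" using ex_inj_real by blast
 let ?H = "GLc e n" and ?de = "inv_into (GLS n) e"
 note cH = GLc_manifold(3)[OF e, of n]
 let ?\<phi> = "%g. elt n e (AdM g)"
 have phi_in: "?\<phi> g \<in> carrier ?H" if "g \<in> carrier G" for g
  by (rule elt_in[OF e AdM_carrier AdM_det[OF that]])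
 have coords: "?de (?\<phi> g) k = of_real (G.Ad g (G.bas (k mod n)) (G.crd (k div n)))" if "g \<in> carrier G" "k < n * n" for g k
  unfolding gde_elt[OF e AdM_carrier AdM_det[OF that(1)]] using that(2) idx_div[OF that(2)] by (simp add: ofM_def AdM_def)
 have sAd: "smooth_at (mfd G) g (%g. G.Ad g (G.bas (k mod n)) (G.crd (k div n)))" if "g \<in> carrier G" "k < n * n" for g k
  by (rule G.smooth_Ad[OF G.bas(1) G.sm_crd that(1)]) (use idx_div[OF that(2)] in auto)
 have hom: "?\<phi> \<in> hom G ?H"
 proof (rule homI)
  show "?\<phi> g \<in> carrier ?H" if "g \<in> carrier G" for g by (rule phi_in[OF that])
  show "?\<phi> (g \<otimes>\<^bsub>G\<^esub> h) = ?\<phi> g \<otimes>\<^bsub>?H\<^esub> ?\<phi> h" if "g \<in> carrier G" "h \<in> carrier G" for g h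
   unfolding GLc_simps(1)[OF e] mm_elt[OF e AdM_carrier AdM_det[OF that(1)]] mm_elt[OF e AdM_carrier AdM_det[OF that(2)]] AdM_mult[OF that] ..
 qed
 have "smooth_map (mfd G) (realification (mfd ?H)) ?\<phi>"
 proof (rule smooth_mapI[OF G.cM charted_realification[OF cH]])
  have "continuous_map (mtop (mfd G)) (mtop (mfd ?H)) ?\<phi>"
   unfolding GLc_simps(4)[OF e]
  proof (rule EM_continuous[OF kopen_GLS injS[OF e]])
   show "?\<phi> p \<in> e ` GLS n" if "p \<in> topspace (mtop (mfd G))" for p
    using phi_in[of p] that unfolding G.top GLc_simps(3)[OF e] .
   fix k assume k: "k < n * n"
   have "continuous_map (mtop (mfd G)) euclidean (%g. G.Ad g (G.bas (k mod n)) (G.crd (k div n)))"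
    by (rule smooth_continuous_map[OF G.cM]) (use sAd k in \<open>simp add: G.top\<close>)
   from continuous_map_compose[OF this, of euclidean complex_of_real]
   have "continuous_map (mtop (mfd G)) euclidean (%g. complex_of_real (G.Ad g (G.bas (k mod n)) (G.crd (k div n))))"
    by (simp add: o_def continuous_on_of_real_id continuous_on_id)
   then show "continuous_map (mtop (mfd G)) euclidean (%p. ?de (?\<phi> p) k)"
    by (rule continuous_map_eq) (use coords k in \<open>simp add: G.top\<close>)
  qed
  then show "continuous_map (mtop (mfd G)) (mtop (realification (mfd ?H))) ?\<phi>" by (simp add: realification_simps)
  fix p V \<xi> i assume p: "p \<in> topspace (mtop (mfd G))" and V: "(V, \<xi>) \<in> atlas (realification (mfd ?H))" and i: "i < mdim (realification (mfd ?H))"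
  have k: "i div 2 < n * n" using i by (simp add: realification_simps GLc_simps(4)[OF e] emfd_def)
  have x: "\<xi> = (%a. rl (?de a))" using V by (simp add: realification_simps GLc_simps(4)[OF e] emfd_def)
  \<comment> \<open>The odd coordinates of the realification are imaginary parts, which are 0 for
    the real matrices of Ad.\<close>
  have "smooth_at (mfd G) p (%g. if even i then G.Ad g (G.bas (i div 2 mod n)) (G.crd (i div 2 div n)) else 0)"
   using sAd[OF _ k, of p] p G.top smooth_at_const[OF p, of 0] by (cases "even i") auto
  moreover have "(if even i then G.Ad g (G.bas (i div 2 mod n)) (G.crd (i div 2 div n)) else 0) = \<xi> (?\<phi> g) i" if "g \<in> topspace (mtop (mfd G))" for g
   using coords[OF _ k, of g] that G.top by (simp add: x rl_def)
  ultimately show "smooth_at (mfd G) p (%g. \<xi> (?\<phi> g) i)"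
   using smooth_at_cong[OF G.cM openin_topspace p, of "%g. if even i then G.Ad g (G.bas (i div 2 mod n)) (G.crd (i div 2 div n)) else 0" "%g. \<xi> (?\<phi> g) i"] by blast
 qed
 then have "real_to_complex_lie_hom G ?H ?\<phi>" unfolding real_to_complex_lie_hom_def using hom by blast
 then have "\<exists>!\<psi>. \<psi> \<in> extensional (carrier GC) \<and> \<psi> \<in> hom GC ?H \<and> smooth_map (mfd GC) (mfd ?H) \<psi> \<and> (\<forall>g\<in>carrier G. \<psi> (\<iota> g) = ?\<phi> g)"
  using u GLc_lie[OF e, of n] unfolding universal_complexification_def by blast
 then obtain \<psi> where psi: "\<psi> \<in> hom GC ?H" "smooth_map (mfd GC) (mfd ?H) \<psi>" "\<forall>g\<in>carrier G. \<psi> (\<iota> g) = ?\<phi> g"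
  by (elim ex1E conjE) (rule that; assumption)
 have psi_in: "\<psi> g \<in> carrier ?H" if "g \<in> carrier GC" for g using psi(1) that by (auto simp: hom_def)
 define \<Psi> where "\<Psi> i j g = ?de (\<psi> g) (i * n + j)" for i j g
 have Psi_mm: "\<Psi> i j g = mm n e (\<psi> g) $$ (i, j)" if "i < n" "j < n" for i j g
  using that unfolding \<Psi>_def mm_def[OF e] by (simp add: toM_index)
 show ?thesis
 proof (intro exI[of _ \<Psi>] conjI allI impI ballI)
  fix i j assume i: "i < n" and j: "j < n"
  show "smooth_at (mfd GC) g (\<Psi> i j)" if g: "g \<in> carrier GC" for g
   unfolding \<Psi>_def
   by (rule smooth_map_coord[OF cH psi(2), of g "e ` GLS n" ?de "i * n + j"])
    (use psi_in[OF g] g idx[OF i j] in \<open>auto simp: C.top GLc_simps[OF e] emfd_def\<close>)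
  show "\<Psi> i j (g \<otimes>\<^bsub>GC\<^esub> h) = (\<Sum>l<n. \<Psi> i l g * \<Psi> l j h)" if g: "g \<in> carrier GC" and h: "h \<in> carrier GC" for g h
  proof -
   have "\<psi> (g \<otimes>\<^bsub>GC\<^esub> h) = elt n e (mm n e (\<psi> g) * mm n e (\<psi> h))"
    using psi(1) g h unfolding GLc_simps(1)[OF e, symmetric] by (auto simp: hom_def)
   then have "mm n e (\<psi> (g \<otimes>\<^bsub>GC\<^esub> h)) = mm n e (\<psi> g) * mm n e (\<psi> h)"
    using mm_elt[OF e mult_carrier_mat[OF mm_carrier[OF e] mm_carrier[OF e]] det_mm[OF e psi_in[OF g] psi_in[OF h]]] by simp
   then show ?thesis using i j carrier_matD[OF mm_carrier[OF e, of n "\<psi> g"]] carrier_matD[OF mm_carrier[OF e, of n "\<psi> h"]]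
    by (simp add: Psi_mm scalar_prod_def atLeast0LessThan)
  qed
  show "\<Psi> i j (\<iota> g) = complex_of_real (G.Ad g (G.bas j) (G.crd i))" if g: "g \<in> carrier G" for g
   using psi(3) g mm_elt[OF e AdM_carrier AdM_det[OF g]] i j by (simp add: Psi_mm AdM_def)
 qed
qed

end

section \<open>The complexified adjoint representation\<close>

declare plus_fun_def [simp del] plus_fun_apply [simp]

lemma sum_apply: "(\<Sum>i\<in>I. f i) x = (\<Sum>i\<in>I. f i x)"
 by (induction I rule: infinite_finite_induct) auto

locale crown_setup = ucx G GC \<iota> for G :: "('a, real) lie_group" and GC :: "('b, complex) lie_group" and \<iota> +
 fixes \<theta> :: "(('a => real) => real) => (('a => real) => real)" and kk pp aa :: "(('a => real) => real) set"
 assumes simple: "simple_lie_algebra (lie_algebra G) (lie_bracket G)"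
  and cart: "cartan_involution (lie_algebra G) (lie_bracket G) \<theta>"
  and kk: "kk = {X \<in> lie_algebra G. \<theta> X = X}" and pp: "pp = {X \<in> lie_algebra G. \<theta> X = - X}"
  and maxab: "maximal_abelian_in (lie_bracket G) pp aa"
begin

sublocale A: cartan "lie_algebra G" "lie_bracket G" \<theta> kk pp aa
 by unfold_locales
  (fact G.subspace_L G.br_in G.br_anti G.br_add_right G.br_scale_right G.jacobi simple cart kk pp maxab
   | rule G.br_in G.br_anti G.br_add_right G.br_scale_right G.jacobi; assumption)+

definition "is_rep \<Psi> \<longleftrightarrow> (\<forall>i<n. \<forall>j<n. \<forall>g\<in>carrier GC. smooth_at (mfd GC) g (\<Psi> i j)) \<and>
  (\<forall>i<n. \<forall>j<n. \<forall>g\<in>carrier GC. \<forall>h\<in>carrier GC. \<Psi> i j (g \<otimes>\<^bsub>GC\<^esub> h) = (\<Sum>l<n. \<Psi> i l g * \<Psi> l j h)) \<and>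
  (\<forall>i<n. \<forall>j<n. \<forall>g\<in>carrier G. \<Psi> i j (\<iota> g) = complex_of_real (G.Ad g (G.bas j) (G.crd i)))"

definition "Psi = (SOME \<Psi>. is_rep \<Psi>)"

lemma Psi: "is_rep Psi"
 unfolding Psi_def using ex_rep unfolding is_rep_def[symmetric] by (rule someI_ex)

lemma Psi_sm: "i < n ==> j < n ==> g \<in> carrier GC ==> smooth_at (mfd GC) g (Psi i j)"
 and Psi_mult: "i < n ==> j < n ==> g \<in> carrier GC ==> h \<in> carrier GC ==> Psi i j (g \<otimes>\<^bsub>GC\<^esub> h) = (\<Sum>l<n. Psi i l g * Psi l j h)"
 and Psi_iota: "i < n ==> j < n ==> x \<in> carrier G ==> Psi i j (\<iota> x) = complex_of_real (G.Ad x (G.bas j) (G.crd i))"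
 using Psi unfolding is_rep_def by simp_all

lemma Psi_one: "i < n ==> j < n ==> Psi i j \<one>\<^bsub>GC\<^esub> = (if i = j then 1 else 0)"
 using Psi_iota[of i j "\<one>\<^bsub>G\<^esub>"] iota_one by (simp add: G.Ad_one[OF G.bas(1)] G.bas(2))

abbreviation "V \<equiv> (kspace n :: (nat => complex) set)"

definition mv :: "(nat => nat => complex) => (nat => complex) => nat => complex" where
 "mv T w = (%i. if i < n then \<Sum>j<n. T i j * w j else 0)"

lemma mv_in: "mv T w \<in> V"
 by (simp add: mv_def kspace_def)

lemma mv_add: "mv T (u + w) = mv T u + mv T w" and mv_scale: "mv T (c *\<^sub>F w) = c *\<^sub>F mv T w"
 by (auto simp: mv_def fun_eq_iff fscale_def algebra_simps sum.distrib sum_distrib_left)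

lemma mv_diff: "mv T (u - w) = mv T u - mv T w"
 using mv_add[of T "u - w" w] by (simp add: algebra_simps)

lemma VI: "u \<in> V ==> w \<in> V ==> (\<And>i. i < n ==> u i = w i) ==> u = w"
 by (rule ext) (metis (mono_tags, lifting) kspace_def leI mem_Collect_eq)

lemma V_add: "u \<in> V ==> w \<in> V ==> u + w \<in> V" and V_scale: "u \<in> V ==> c *\<^sub>F u \<in> V"
 by (auto simp: kspace_def fscale_def)

text \<open>\<open>Op\<close> is the adjoint representation of \<open>GC\<close> on the complexified
  Lie algebra, in coordinates; \<open>Am v\<close> is its derivative at the identity in the
  direction \<open>v\<close>.\<close>

definition "Op g = mv (%i j. Psi i j g)"
definition "Am v = mv (%i j. v (Psi i j))"

lemma Op_in: "Op g w \<in> V" and Am_in: "Am v w \<in> V"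
 by (simp_all add: Op_def Am_def mv_in)

lemma Op_add: "Op g (u + w) = Op g u + Op g w" and Op_scale: "Op g (c *\<^sub>F w) = c *\<^sub>F Op g w"
 and Op_diff: "Op g (u - w) = Op g u - Op g w"
 and Am_add: "Am v (u + w) = Am v u + Am v w" and Am_scale: "Am v (c *\<^sub>F w) = c *\<^sub>F Am v w"
 by (simp_all add: Op_def Am_def mv_add mv_scale mv_diff)

lemma Am_add_left: "Am (u + v) w = Am u w + Am v w" and Am_scale_left: "Am (c *\<^sub>F v) w = c *\<^sub>F Am v w"
 by (auto simp: Am_def mv_def fun_eq_iff fscale_def algebra_simps sum.distrib sum_distrib_left)

lemma Op_mult: "g \<in> carrier GC ==> h \<in> carrier GC ==> Op (g \<otimes>\<^bsub>GC\<^esub> h) w = Op g (Op h w)"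
proof
 fix i assume g: "g \<in> carrier GC" and h: "h \<in> carrier GC"
 show "Op (g \<otimes>\<^bsub>GC\<^esub> h) w i = Op g (Op h w) i"
 proof (cases "i < n")
  case True
  then have "Op (g \<otimes>\<^bsub>GC\<^esub> h) w i = (\<Sum>j<n. \<Sum>l<n. Psi i l g * Psi l j h * w j)"
   using g h by (simp add: Op_def mv_def Psi_mult sum_distrib_right)
  also have "\<dots> = (\<Sum>l<n. \<Sum>j<n. Psi i l g * Psi l j h * w j)" by (rule sum.swap)
  also have "\<dots> = Op g (Op h w) i" using True by (simp add: Op_def mv_def sum_distrib_left mult.assoc)
  finally show ?thesis .
 qed (simp add: Op_def mv_def)
qed

lemma Op_one: "w \<in> V ==> Op \<one>\<^bsub>GC\<^esub> w = w"
proof (rule VI[OF Op_in])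
 fix i assume i: "i < n"
 have "Op \<one>\<^bsub>GC\<^esub> w i = (\<Sum>j<n. (if i = j then 1 else 0) * w j)" using i by (simp add: Op_def mv_def Psi_one)
 also have "\<dots> = w i" using i by (simp add: if_distrib[of "%x. x * _"] sum.delta cong: if_cong)
 finally show "Op \<one>\<^bsub>GC\<^esub> w i = w i" .
qed

lemma Op_inv: "g \<in> carrier GC ==> w \<in> V ==> Op g (Op (inv\<^bsub>GC\<^esub> g) w) = w"
 "g \<in> carrier GC ==> w \<in> V ==> Op (inv\<^bsub>GC\<^esub> g) (Op g w) = w"
 by (simp_all add: Op_mult[symmetric] Op_one)

abbreviation "cexp v \<equiv> lie_exp GC v"

lemma cexp_in: "v \<in> C.L ==> cexp (t *\<^sub>F v) \<in> carrier GC"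
 by (intro C.gexp_in C.L_scale)

lemma Psi_deriv:
 assumes v: "v \<in> C.L" and i: "i < n" and j: "j < n"
 shows "((%t. Psi i j (cexp (t *\<^sub>F v))) has_field_derivative (\<Sum>l<n. Psi i l (cexp (t *\<^sub>F v)) * v (Psi l j))) (at t)"
proof -
 note e = cexp_in[OF v, of t]
 have "C.hat v (Psi i j) (cexp (t *\<^sub>F v)) = v (%h. \<Sum>l<n. Psi i l (cexp (t *\<^sub>F v)) * Psi l j h)"
  unfolding C.hat_def by (rule C.der_cong[OF v]) (rule Psi_mult[OF i j e])
 also have "\<dots> = (\<Sum>l<n. v (%h. Psi i l (cexp (t *\<^sub>F v)) * Psi l j h))"
  by (rule C.der_sum[OF v]) (auto intro!: smooth_at_cmult Psi_sm j)
 also have "\<dots> = (\<Sum>l<n. Psi i l (cexp (t *\<^sub>F v)) * v (Psi l j))"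
  by (intro sum.cong refl C.der_cmult[OF v] Psi_sm j) auto
 finally show ?thesis using C.gexp_deriv[OF v Psi_sm[OF i j e]] by simp
qed

lemma Op_deriv:
 assumes v: "v \<in> C.L" and w: "\<And>j. j < n ==> ((%t. w t j) has_field_derivative w' j) (at t)" and i: "i < n"
 shows "((%t. Op (cexp (t *\<^sub>F v)) (w t) i) has_field_derivative Op (cexp (t *\<^sub>F v)) (Am v (w t) + w') i) (at t)"
proof -
 let ?P = "%i j. Psi i j (cexp (t *\<^sub>F v))"
 have "((%t. \<Sum>j<n. Psi i j (cexp (t *\<^sub>F v)) * w t j) has_field_derivative
   (\<Sum>j<n. (\<Sum>l<n. ?P i l * v (Psi l j)) * w t j + w' j * ?P i j)) (at t)"
  by (intro DERIV_sum DERIV_mult Psi_deriv[OF v i] w) auto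
 moreover have "(\<Sum>j<n. (\<Sum>l<n. ?P i l * v (Psi l j)) * w t j + w' j * ?P i j) = (\<Sum>l<n. ?P i l * ((\<Sum>j<n. v (Psi l j) * w t j) + w' l))"
 proof -
  have "(\<Sum>j<n. (\<Sum>l<n. ?P i l * v (Psi l j)) * w t j) = (\<Sum>l<n. ?P i l * (\<Sum>j<n. v (Psi l j) * w t j))"
   unfolding sum_distrib_right sum_distrib_left by (subst sum.swap) (simp add: mult.assoc)
  then show ?thesis by (simp add: sum.distrib algebra_simps)
 qed
 ultimately show ?thesis using i by (simp add: Op_def Am_def mv_def)
qed

lemma Op_cexp_0: "w \<in> V ==> Op (cexp (0 *\<^sub>F v)) w = w"
 using Op_one by (simp add: C.gexp_0)

text \<open>Uniqueness for linear equations: applying the operator of the inverse exponential to a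
  solution gives a constant. The values of \<open>Op\<close> on explicit vectors are found by
  guessing a solution.\<close>

lemma Op_flow:
 assumes v: "v \<in> C.L" and wV: "\<And>t. w t \<in> V"
  and w: "\<And>t j. j < n ==> ((%t. w t j) has_field_derivative Am v (w t) j) (at t)"
 shows "w t = Op (cexp (t *\<^sub>F v)) (w 0)"
proof -
 have v': "- v \<in> C.L" by (rule C.L_uminus[OF v])
 have neg: "Am (- v) u = - Am v u" for u using Am_scale_left[of "-1" v u] by simp
 have "Op (cexp (t *\<^sub>F (- v))) (w t) = w 0"
 proof (rule VI[OF Op_in wV])
  fix i assume i: "i < n"
  have "((%t. Op (cexp (t *\<^sub>F (- v))) (w t) i) has_field_derivative 0) (at t within UNIV)" for t
  proof -
   have z: "Am (- v) (w t) + Am v (w t) = 0 *\<^sub>F w t" by (simp add: neg)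
   have "Op (cexp (t *\<^sub>F (- v))) (Am (- v) (w t) + Am v (w t)) i = 0"
    unfolding z Op_scale by simp
   then show ?thesis using Op_deriv[where w=w and w'="Am v (w t)" and t=t, OF v' w i] by simp
  qed
  then obtain c where "\<forall>t. Op (cexp (t *\<^sub>F (- v))) (w t) i = c"
   using has_field_derivative_zero_constant[OF convex_UNIV, of "%t. Op (cexp (t *\<^sub>F (- v))) (w t) i"] by auto
  then show "Op (cexp (t *\<^sub>F (- v))) (w t) i = w 0 i" using Op_cexp_0[OF wV, of "- v" 0] by metis
 qed
 moreover have "cexp (t *\<^sub>F (- v)) = inv\<^bsub>GC\<^esub> cexp (t *\<^sub>F v)"
  using C.gexp_minus[OF C.L_scale[OF v, of t]] by (simp add: fnvs.scale_minus_right)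
 ultimately show ?thesis using Op_inv(1)[OF cexp_in[OF v] wV] by metis
qed

text \<open>A one-parameter group is commutative; differentiating at 0 in one of the two parameters
  gives the claim.\<close>

lemma Op_Am:
 assumes v: "v \<in> C.L" and w: "w \<in> V"
 shows "Op (cexp (t *\<^sub>F v)) (Am v w) = Am v (Op (cexp (t *\<^sub>F v)) w)"
proof (rule VI[OF Op_in Am_in])
 fix i assume i: "i < n"
 let ?g = "cexp (t *\<^sub>F v)"
 have comm: "Op (cexp (s *\<^sub>F v)) (Op ?g w) = Op ?g (Op (cexp (s *\<^sub>F v)) w)" for s
  using C.gexp_add[OF v, of s t] C.gexp_add[OF v, of t s] by (simp add: Op_mult[symmetric] cexp_in[OF v] add.commute)
 have d: "((%s. Op (cexp (s *\<^sub>F v)) u j) has_field_derivative Am v u j) (at 0)" if "j < n" for u j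
  using Op_deriv[OF v, of "%_. u" "%_. 0" 0 j] that Op_cexp_0[of "Am v u + (%_. 0)" v] Am_in[of v u]
  by (simp add: zero_fun_def[symmetric])
 have "((%s. Op ?g (Op (cexp (s *\<^sub>F v)) w) i) has_field_derivative Op ?g (Am v w) i) (at 0)"
  using i d unfolding Op_def[of ?g] mv_def by (auto intro!: DERIV_sum DERIV_cmult)
 then show "Op ?g (Am v w) i = Am v (Op ?g w) i"
  using d[OF i, of "Op ?g w"] DERIV_unique unfolding comm by blast
qed

lemma Op_deriv':
 assumes v: "v \<in> C.L" and w: "w \<in> V" and i: "i < n"
 shows "((%t. Op (cexp (t *\<^sub>F v)) w i) has_field_derivative Am v (Op (cexp (t *\<^sub>F v)) w) i) (at t)"
 using Op_deriv[OF v, of "%_. w" "%_. 0" t i] i Op_Am[OF v w] by (simp add: zero_fun_def[symmetric])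

lemma Op_eigen:
 assumes v: "v \<in> C.L" and w: "w \<in> V" "Am v w = \<alpha> *\<^sub>F w"
 shows "Op (cexp (t *\<^sub>F v)) w = exp (t * \<alpha>) *\<^sub>F w"
proof -
 have "((%t. (exp (t * \<alpha>) *\<^sub>F w) j) has_field_derivative Am v (exp (t * \<alpha>) *\<^sub>F w) j) (at t)" for t j
  unfolding Am_scale w(2) unfolding fscale_def by (auto intro!: derivative_eq_intros)
 from Op_flow[where w="%t. exp (t * \<alpha>) *\<^sub>F w" and t=t, OF v V_scale[OF w(1)] this] show ?thesis by simp
qed

lemma Op_nilpotent:
 assumes v: "v \<in> C.L" and w: "w \<in> V" "u \<in> V" "Am v w = u" "Am v u = 0"
 shows "Op (cexp (t *\<^sub>F v)) w = w + t *\<^sub>F u"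
proof -
 have "((%t. (w + t *\<^sub>F u) j) has_field_derivative Am v (w + t *\<^sub>F u) j) (at t)" for t j
  unfolding Am_add Am_scale w(3,4) by (auto simp: fscale_def intro!: derivative_eq_intros)
 from Op_flow[where w="%t. w + t *\<^sub>F u" and t=t, OF v V_add[OF w(1) V_scale[OF w(2)]] this] show ?thesis by simp
qed

subsection \<open>The real form\<close>

text \<open>Embeds the real Lie algebra as the real vectors; \<open>reL\<close> and
  \<open>imL\<close> below take the real and imaginary parts of a complex vector back to it.\<close>

definition vec :: "(('a => real) => real) => nat => complex" where
 "vec Z = (%i. if i < n then of_real (Z (G.crd i)) else 0)"

definition LL :: "(nat => real) => ('a => real) => real" where
 "LL a = (\<Sum>j<n. a j *\<^sub>F G.bas j)"

definition "reL w = LL (%i. Re (w i))"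
definition "imL w = LL (%i. Im (w i))"

lemma vec_in: "vec Z \<in> V"
 by (simp add: vec_def kspace_def)

lemma vec_add: "vec (X + Y) = vec X + vec Y" and vec_diff: "vec (X - Y) = vec X - vec Y"
 and vec_scale: "vec (c *\<^sub>F X) = of_real c *\<^sub>F vec X" and vec_uminus: "vec (- X) = - vec X" and vec_0: "vec 0 = 0"
 by (auto simp: vec_def fun_eq_iff fscale_def)

lemma LL_in: "LL a \<in> G.L"
 unfolding LL_def by (rule fnvs.subspace_sum[OF G.subspace_L]) (intro G.L_scale G.bas)

lemma LL_crd: "i < n ==> LL a (G.crd i) = a i"
 unfolding LL_def sum_apply by (simp add: fscale_def G.bas(2) if_distrib sum.delta cong: if_cong)

lemma LL_coords: "Z \<in> G.L ==> LL (%i. Z (G.crd i)) = Z"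
 by (rule G.der_eqI[OF LL_in]) (auto simp: LL_crd)

lemma decomp: "w \<in> V ==> w = vec (reL w) + \<i> *\<^sub>F vec (imL w)"
proof (rule VI)
 show "vec (reL w) + \<i> *\<^sub>F vec (imL w) \<in> V" by (intro V_add V_scale vec_in)
 show "w i = (vec (reL w) + \<i> *\<^sub>F vec (imL w)) i" if "i < n" for i
  using that by (simp add: vec_def reL_def imL_def LL_crd fscale_def complex_eq_iff)
qed

lemma reL_vec: "X \<in> G.L ==> reL (vec X + \<i> *\<^sub>F vec Y) = X" and imL_vec: "Y \<in> G.L ==> imL (vec X + \<i> *\<^sub>F vec Y) = Y"
 by (rule G.der_eqI; simp add: LL_in reL_def imL_def LL_crd vec_def fscale_def)+

lemma mv_vec:
 assumes F: "A.lin F" and T: "\<And>i j. i < n ==> j < n ==> T i j = of_real (F (G.bas j) (G.crd i))" and Z: "Z \<in> G.L"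
 shows "mv T (vec Z) = vec (F Z)"
proof (rule VI[OF mv_in vec_in])
 fix i assume i: "i < n"
 have "F Z = (\<Sum>j<n. Z (G.crd j) *\<^sub>F F (G.bas j))"
  using A.lin_sum[where g=G.bas and c="%j. Z (G.crd j)", OF F finite_lessThan[of n] G.bas(1)] LL_coords[OF Z] unfolding LL_def by simp
 then have "F Z (G.crd i) = (\<Sum>j<n. Z (G.crd j) * F (G.bas j) (G.crd i))" by (simp add: sum_apply fscale_def)
 then show "mv T (vec Z) i = vec (F Z) i" using i by (simp add: mv_def vec_def T mult.commute)
qed

lemma Op_iota: "g \<in> carrier G ==> Z \<in> G.L ==> Op (\<iota> g) (vec Z) = vec (G.Ad g Z)"
 unfolding Op_def by (rule mv_vec) (auto simp: A.lin_def G.Ad_in G.Ad_add G.Ad_scale Psi_iota)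

text \<open>The matrix of \<open>Am (dl X)\<close> is the derivative of the matrix of Ad in the
  direction \<open>X\<close>, which is ad X by \<open>G.der_Ad\<close>; the entries of Ad are real,
  so no imaginary part arises.\<close>

lemma Am_dl:
 assumes X: "X \<in> G.L" and Z: "Z \<in> G.L" shows "Am (dl X) (vec Z) = vec (G.br X Z)"
 unfolding Am_def
proof (rule mv_vec[OF A.lin_br[OF X] _ Z])
 fix i j assume i: "i < n" and j: "j < n"
 have "X (%x. Re (Psi i j (\<iota> x))) = X (%g. G.Ad g (G.bas j) (G.crd i))" "X (%x. Im (Psi i j (\<iota> x))) = X (%_. 0)"
  by (rule G.der_cong[OF X]; simp add: Psi_iota i j)+
 then show "dl X (Psi i j) = complex_of_real (G.br X (G.bas j) (G.crd i))"
  using Psi_sm[OF i j C.one_closed] G.der_const[OF X, of 0] G.der_Ad[OF X G.bas(1) G.sm_crd[OF i]]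
  by (simp add: dl_eq complex_eq_iff)
qed

text \<open>The complex linear extension of \<theta>.\<close>

definition "thm = mv (%i j. of_real (\<theta> (G.bas j) (G.crd i)))"

lemma thm_vec: "Z \<in> G.L ==> thm (vec Z) = vec (\<theta> Z)"
 unfolding thm_def by (rule mv_vec[OF A.lin_th]) auto

lemma thm_add: "thm (u + w) = thm u + thm w" and thm_scale: "thm (c *\<^sub>F w) = c *\<^sub>F thm w" and thm_in: "thm w \<in> V"
 by (simp_all add: thm_def mv_add mv_scale mv_in)

lemma re_im_L: "reL w \<in> G.L" "imL w \<in> G.L"
 by (simp_all add: reL_def imL_def LL_in)

lemma thm_Am_kk: "X \<in> kk ==> w \<in> V ==> thm (Am (dl X) w) = Am (dl X) (thm w)"
proof -
 assume "X \<in> kk" and w: "w \<in> V"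
 then have X: "X \<in> G.L" "\<theta> X = X" by (auto simp: kk)
 show ?thesis
  by (subst (1 2) decomp[OF w]) (simp add: Am_add Am_scale thm_add thm_scale Am_dl[OF X(1)] thm_vec re_im_L A.br_in A.th_in A.th_br X)
qed

lemma thm_Am:
 assumes v: "v \<in> fnvs.span (dl ` kk)" and w: "w \<in> V"
 shows "thm (Am v w) = Am v (thm w)"
 using v
proof (induction rule: fnvs.span_induct_alt)
 case base
 have "Am 0 u = 0" for u by (simp add: Am_def mv_def fun_eq_iff)
 moreover have "thm 0 = 0" by (simp add: thm_def mv_def fun_eq_iff)
 ultimately show ?case by (simp only:)
next
 case (step c x y)
 then obtain X where X: "X \<in> kk" "x = dl X" by blast
 show ?case unfolding Am_add_left Am_scale_left thm_add thm_scale step.IH X(2) thm_Am_kk[OF X(1) w] ..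
qed

lemma span_dl_in: "S \<subseteq> G.L ==> fnvs.span (dl ` S) \<subseteq> C.L"
 by (rule fnvs.span_minimal[OF _ C.subspace_L]) (auto intro: dl_in)

text \<open>As \<open>Am v\<close> commutes with \<theta>, the image of a solution under \<theta> is
  again a solution, and both sides start at \<open>thm w\<close>.\<close>

lemma thm_Op_exp:
 assumes v: "v \<in> fnvs.span (dl ` kk)" and w: "w \<in> V"
 shows "Op (cexp v) (thm w) = thm (Op (cexp v) w)"
proof -
 have vL: "v \<in> C.L" using span_dl_in[of kk] v by (auto simp: kk)
 let ?w = "%t. thm (Op (cexp (t *\<^sub>F v)) w)"
 have "((%t. ?w t j) has_field_derivative Am v (?w t) j) (at t)" if j: "j < n" for t j
  unfolding thm_Am[OF v Op_in, symmetric] unfolding thm_def mv_def using j Op_deriv'[OF vL w]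
  by (auto intro!: DERIV_sum DERIV_cmult)
 from Op_flow[of v ?w 1, OF vL thm_in this] Op_cexp_0[OF w] show ?thesis by simp
qed

text \<open>Commutation with \<theta> holds for exponentials of the complexified k and passes to
  inverses and products. It is the property by which points outside the orbits are
  recognised.\<close>

lemma K_C_carrier_thm:
 assumes "\<kappa> \<in> K_C GC \<iota> kk"
 shows "\<kappa> \<in> carrier GC \<and> (\<forall>w\<in>V. Op \<kappa> (thm w) = thm (Op \<kappa> w))"
 using assms unfolding K_C_def
proof (induction rule: generate.induct)
 case one
 then show ?case using Op_one thm_in by simp
next
 case (incl h)
 then obtain v where v: "v \<in> fnvs.span (dl ` kk)" "h = cexp v" by blast
 then have "v \<in> C.L" using span_dl_in[of kk] by (auto simp: kk)
 then show ?case using v thm_Op_exp C.gexp_in by blast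
next
 case (inv h)
 then obtain v where v: "v \<in> fnvs.span (dl ` kk)" "h = cexp v" by blast
 then have vL: "v \<in> C.L" using span_dl_in[of kk] by (auto simp: kk)
 have "- v \<in> fnvs.span (dl ` kk)" using v by (simp add: fnvs.span_neg)
 then show ?case unfolding v(2) C.gexp_minus[OF vL, symmetric] using thm_Op_exp C.gexp_in[OF C.L_uminus[OF vL]] by blast
next
 case (eng h1 h2)
 then show ?case using Op_in by (simp add: Op_mult)
qed

section \<open>The Hermitian norm and its isometries\<close>

definition "Q i j = A.ip (G.bas i) (G.bas j)"
text \<open>The square of the Hermitian norm on the complexified Lie algebra that extends
  \<open>A.ip\<close>.\<close>

definition "nn w = A.ip (reL w) (reL w) + A.ip (imL w) (imL w)"

lemma ip_sum: "finite I ==> (\<And>i. i \<in> I ==> g i \<in> G.L) ==> z \<in> G.L ==> A.ip (\<Sum>i\<in>I. c i *\<^sub>F g i) z = (\<Sum>i\<in>I. c i * A.ip (g i) z)"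
proof (induction I rule: finite_induct)
 case (insert x F)
 have "(\<Sum>i\<in>F. c i *\<^sub>F g i) \<in> G.L" by (rule fnvs.subspace_sum[OF G.subspace_L]) (simp add: insert G.L_scale)
 then show ?case unfolding sum.insert[OF insert(1,2)] using insert
  by (subst A.ip_add) (simp_all add: A.ip_scale G.L_scale)
qed (simp add: A.ip_0)

lemma ip_LL: "A.ip (LL a) (LL b) = (\<Sum>i<n. \<Sum>j<n. a i * b j * Q i j)"
proof -
 have "A.ip (LL a) (LL b) = (\<Sum>i<n. a i * A.ip (G.bas i) (LL b))"
  unfolding LL_def[of a] by (rule ip_sum) (auto simp: G.bas LL_in)
 also have "\<dots> = (\<Sum>i<n. a i * (\<Sum>j<n. b j * A.ip (G.bas j) (G.bas i)))"
  unfolding A.ip_sym[OF G.bas(1) LL_in] unfolding LL_def[of b] by (subst ip_sum) (auto simp: G.bas)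
 also have "\<dots> = (\<Sum>i<n. \<Sum>j<n. a i * b j * Q i j)"
  unfolding Q_def by (simp add: sum_distrib_left mult.assoc A.ip_sym[OF G.bas(1) G.bas(1)])
 finally show ?thesis .
qed

lemma nn_thm: "w \<in> V ==> nn (thm w) = nn w"
proof -
 assume w: "w \<in> V"
 have t: "thm w = vec (\<theta> (reL w)) + \<i> *\<^sub>F vec (\<theta> (imL w))"
  by (subst decomp[OF w]) (simp add: thm_add thm_scale thm_vec re_im_L)
 have i: "A.ip (\<theta> x) (\<theta> x) = A.ip x x" if "x \<in> G.L" for x
  using A.KF_th[OF that that] that unfolding A.ip_def by (simp add: A.th_th A.th_in)
 show ?thesis unfolding nn_def t by (simp add: reL_vec imL_vec A.th_in re_im_L i)
qed

text \<open>For Y in p the operator ad Y is symmetric, so i ad Y is skew-Hermitian and generates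
  unitary operators: in the derivative of \<open>nn\<close> along the flow the terms cancel by
  \<open>A.ad_sym\<close>.\<close>

lemma nn_unitary:
 assumes Y: "Y \<in> pp" and w: "w \<in> V"
 shows "nn (Op (cexp ((\<i> * of_real s) *\<^sub>F dl Y)) w) = nn w"
proof -
 have YL: "Y \<in> G.L" using Y by (auto simp: pp)
 define v where "v = \<i> *\<^sub>F dl Y"
 have v: "v \<in> C.L" unfolding v_def by (intro C.L_scale dl_in YL)
 define W where "W t = Op (cexp (of_real t *\<^sub>F v)) w" for t
 define D where "D t = Am v (W t)" for t
 have WV: "W t \<in> V" for t unfolding W_def by (rule Op_in)
 have vd: "((%t. W t j) has_vector_derivative D t j) (at t)" if "j < n" for t j
  using has_vector_derivative_real_field[OF Op_deriv'[OF v w that, where t="of_real t"]] unfolding W_def D_def .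
 have dRe: "((%t. Re (W t j)) has_real_derivative Re (D t j)) (at t)"
  and dIm: "((%t. Im (W t j)) has_real_derivative Im (D t j)) (at t)" if "j < n" for t j
  using vd[OF that, of t] unfolding has_vector_derivative_complex_iff by auto
 have Dr: "reL (D t) = - G.br Y (imL (W t))" "imL (D t) = G.br Y (reL (W t))" for t
 proof -
  have "D t = vec (- G.br Y (imL (W t))) + \<i> *\<^sub>F vec (G.br Y (reL (W t)))"
   unfolding D_def v_def Am_scale_left
   by (subst decomp[OF WV], simp only: Am_add Am_scale Am_dl[OF YL] re_im_L vec_uminus)
    (simp add: fun_eq_iff fscale_def algebra_simps complex_eq_iff)
  then show "reL (D t) = - G.br Y (imL (W t))" "imL (D t) = G.br Y (reL (W t))"
   by (simp_all add: reL_vec imL_vec A.L_uminus A.br_in YL re_im_L)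
 qed
 have "((%t. nn (W t)) has_real_derivative 0) (at t)" for t
 proof -
  have "((%t. \<Sum>i<n. \<Sum>j<n. Re (W t i) * Re (W t j) * Q i j) has_real_derivative
    (\<Sum>i<n. \<Sum>j<n. Re (D t i) * Re (W t j) * Q i j + Re (W t i) * Re (D t j) * Q i j)) (at t)"
   by (intro DERIV_sum, rule DERIV_cong[OF DERIV_cmult_right[OF DERIV_mult[OF dRe dRe]]]) (auto simp: algebra_simps)
  moreover have "((%t. \<Sum>i<n. \<Sum>j<n. Im (W t i) * Im (W t j) * Q i j) has_real_derivative
    (\<Sum>i<n. \<Sum>j<n. Im (D t i) * Im (W t j) * Q i j + Im (W t i) * Im (D t j) * Q i j)) (at t)"
   by (intro DERIV_sum, rule DERIV_cong[OF DERIV_cmult_right[OF DERIV_mult[OF dIm dIm]]]) (auto simp: algebra_simps)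
  ultimately have d: "((%t. nn (W t)) has_real_derivative
    (A.ip (reL (D t)) (reL (W t)) + A.ip (reL (W t)) (reL (D t))) + (A.ip (imL (D t)) (imL (W t)) + A.ip (imL (W t)) (imL (D t)))) (at t)"
   unfolding nn_def reL_def imL_def ip_LL sum.distrib by (rule DERIV_add)
  let ?x = "reL (W t)" and ?y = "imL (W t)"
  have L: "G.br Y ?x \<in> G.L" "G.br Y ?y \<in> G.L" "?x \<in> G.L" "?y \<in> G.L" by (auto simp: A.br_in YL re_im_L)
  have m: "A.ip (- z) u = - A.ip z u" "A.ip u (- z) = - A.ip u z" if "z \<in> G.L" "u \<in> G.L" for z u
   using A.ip_scale[OF that, of "-1"] A.ip_scale_right[OF that, of "-1"] by simp_all
  show ?thesis using d unfolding Dr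
   using A.ad_sym[OF Y L(3,4)] A.ad_sym[OF Y L(4,3)] A.ip_sym[OF L(1,4)] A.ip_sym[OF L(2,3)] L
   by (simp add: m)
 qed
 then have "nn (W s) = nn (W 0)" using DERIV_isconst_all by blast
 moreover have "W 0 = w" unfolding W_def using Op_cexp_0[OF w] by simp
 ultimately show ?thesis unfolding W_def v_def by (simp add: mult.commute)
qed

end

section \<open>Points of the symmetric space\<close>

lemma exp_half_pi: "exp (\<i> * complex_of_real pi / 2) = \<i>" "exp (- (\<i> * complex_of_real pi / 2)) = - \<i>"
proof -
 show e: "exp (\<i> * complex_of_real pi / 2) = \<i>"
  using cis_conv_exp[of "pi / 2"] by simp
 show "exp (- (\<i> * complex_of_real pi / 2)) = - \<i>"
  unfolding exp_minus e by simp
qed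

lemma (in cartan) root_vectorD:
 assumes "root_vector E \<beta>"
 shows "E \<in> L" "E \<noteq> 0" "H \<in> aa ==> br H E = \<beta> H *\<^sub>F E"
 using assms unfolding root_vector_def by simp_all

context crown_setup
begin

abbreviation "KC \<equiv> K_C GC \<iota> kk"
definition "pt z = z <#\<^bsub>GC\<^esub> KC"

lemma exp_span_carrier: "lie_exp GC ` fnvs.span (dl ` kk) \<subseteq> carrier GC"
 using span_dl_in[of kk] C.gexp_in by (auto simp: kk)

lemma KC_subgroup: "subgroup KC GC"
 unfolding K_C_def by (rule C.generate_is_subgroup[OF exp_span_carrier])

lemma KC_sub: "KC \<subseteq> carrier GC"
 using KC_subgroup subgroup.subset by blast

lemma KC_exp: "X \<in> kk ==> cexp (c *\<^sub>F dl X) \<in> KC"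
 unfolding K_C_def by (intro generate.incl imageI fnvs.span_scale fnvs.span_base) auto

lemma base_pt: "base_point GC \<iota> kk = pt \<one>\<^bsub>GC\<^esub>"
 by (simp add: base_point_def pt_def)

lemma pt_mult: "a \<in> carrier GC ==> z \<in> carrier GC ==> a <#\<^bsub>GC\<^esub> pt z = pt (a \<otimes>\<^bsub>GC\<^esub> z)"
 unfolding pt_def by (rule C.lcos_m_assoc[OF KC_sub])

lemma act_pt: "g \<in> carrier G ==> z \<in> carrier GC ==> act GC \<iota> g (pt z) = pt (\<iota> g \<otimes>\<^bsub>GC\<^esub> z)"
 by (simp add: act_def pt_mult iota_in)

lemma pt_eqD: "pt z = pt z' ==> z \<in> carrier GC ==> \<exists>\<kappa>\<in>KC. z = z' \<otimes>\<^bsub>GC\<^esub> \<kappa>"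
proof -
 assume eq: "pt z = pt z'" and z: "z \<in> carrier GC"
 have "z \<in> pt z" unfolding pt_def l_coset_def using subgroup.one_closed[OF KC_subgroup] C.r_one[OF z] by force
 then show ?thesis unfolding eq unfolding pt_def l_coset_def by blast
qed

lemma pt_KC: "\<kappa> \<in> KC ==> z \<in> carrier GC ==> pt (z \<otimes>\<^bsub>GC\<^esub> \<kappa>) = pt z"
 using C.lcos_m_assoc[OF KC_sub, of z \<kappa>] C.coset_join3[OF _ KC_subgroup, of \<kappa>] KC_sub by (auto simp: pt_def)

abbreviation "bb Y \<equiv> cexp ((\<i> * complex_of_real pi / 2) *\<^sub>F dl Y)"

lemma bb_in: "Y \<in> G.L ==> bb Y \<in> carrier GC"
 by (intro cexp_in dl_in)

lemma orbit_iff: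
 assumes "S \<subseteq> G.L"
 shows "x \<in> G_exp_orbit G GC \<iota> kk S \<longleftrightarrow> (\<exists>g\<in>carrier G. \<exists>Y\<in>S. x = pt (\<iota> g \<otimes>\<^bsub>GC\<^esub> bb Y))"
proof -
 have e: "act GC \<iota> g (bb Y <#\<^bsub>GC\<^esub> base_point GC \<iota> kk) = pt (\<iota> g \<otimes>\<^bsub>GC\<^esub> bb Y)" if "g \<in> carrier G" "Y \<in> S" for g Y
 proof -
  have b: "bb Y \<in> carrier GC" by (rule bb_in) (use that assms in blast)
  show ?thesis unfolding base_pt pt_mult[OF b C.one_closed] C.r_one[OF b] by (rule act_pt[OF that(1) b])
 qed
 show ?thesis
 proof
  assume "x \<in> G_exp_orbit G GC \<iota> kk S"
  then obtain g Y where "g \<in> carrier G" "Y \<in> S" "x = act GC \<iota> g (bb Y <#\<^bsub>GC\<^esub> base_point GC \<iota> kk)"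
   unfolding G_exp_orbit_def by (elim CollectE exE conjE) (rule that; assumption)
  then show "\<exists>g\<in>carrier G. \<exists>Y\<in>S. x = pt (\<iota> g \<otimes>\<^bsub>GC\<^esub> bb Y)" using e by (intro bexI[of _ g] bexI[of _ Y]) simp_all
 next
  assume "\<exists>g\<in>carrier G. \<exists>Y\<in>S. x = pt (\<iota> g \<otimes>\<^bsub>GC\<^esub> bb Y)"
  then obtain g Y where "g \<in> carrier G" "Y \<in> S" "x = pt (\<iota> g \<otimes>\<^bsub>GC\<^esub> bb Y)"
   by (elim bexE) (rule that; assumption)
  then show "x \<in> G_exp_orbit G GC \<iota> kk S" unfolding G_exp_orbit_def mem_Collect_eq
   using e by (intro exI[of _ g] exI[of _ Y] conjI) simp_all
 qed
qed

subsection \<open>The rank one reduction\<close>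

text \<open>The sign of \<omega> is left free: the same triple with - \<omega> turns
  \<open>N\<close> into its conjugate, so every statement about one of the two limit points is also
  one about the other.\<close>

definition sl2 :: "(('a => real) => real) => (('a => real) => real) => (('a => real) => real) => real => bool" where
 "sl2 Y E H \<omega> \<longleftrightarrow> Y \<in> aa \<and> E \<in> G.L \<and> G.br Y E = E \<and> G.br Y (\<theta> E) = - \<theta> E \<and> H \<in> aa \<and> G.br H E = E \<and>
   G.br H (\<theta> E) = - \<theta> E \<and> 2 *\<^sub>F G.br (\<theta> E) E = \<omega>\<^sup>2 *\<^sub>F H \<and> H \<noteq> 0 \<and> \<omega> \<noteq> 0"

lemma sl2_exists:
 assumes E: "A.root_vector E \<beta>" and Y: "Y \<in> aa" "\<beta> Y = 1"
 shows "\<exists>H \<omega>. \<omega> > 0 \<and> sl2 Y E H \<omega>"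
proof -
 obtain H where "\<exists>\<omega>. H \<in> aa \<and> \<omega> > 0 \<and> G.br H E = E \<and> G.br H (\<theta> E) = - \<theta> E \<and> 2 *\<^sub>F G.br (\<theta> E) E = \<omega>\<^sup>2 *\<^sub>F H \<and> H \<noteq> 0"
  using A.sl2_triple[where E=E and \<beta>=\<beta> and Y=Y, OF E Y] by (rule exE)
 then obtain \<omega> where h: "H \<in> aa \<and> \<omega> > 0 \<and> G.br H E = E \<and> G.br H (\<theta> E) = - \<theta> E \<and> 2 *\<^sub>F G.br (\<theta> E) E = \<omega>\<^sup>2 *\<^sub>F H \<and> H \<noteq> 0"
  by (rule exE)
 have e: "E \<in> G.L" by (rule A.root_vectorD(1)[OF E])
 have e2: "G.br Y E = E" unfolding A.root_vectorD(3)[OF E Y(1)] Y(2) by (rule fnvs.scale_one)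
 have e3: "G.br Y (\<theta> E) = - \<theta> E" unfolding A.root_vectorD(3)[OF A.th_root[OF E] Y(1)] Y(2) by simp
 have "\<omega> > 0 \<and> sl2 Y E H \<omega>" unfolding sl2_def using h e e2 e3 Y(1) by (intro conjI) (elim conjE, (assumption | simp))+
 then show ?thesis by (intro exI)
qed

lemma sl2_minus: "sl2 Y E H \<omega> ==> sl2 Y E H (- \<omega>)"
 by (simp add: sl2_def)

context
 fixes Y E H \<omega>
 assumes sl2: "sl2 Y E H \<omega>"
begin

abbreviation "P \<equiv> E - \<theta> E"
abbreviation "U \<equiv> E + \<theta> E"
abbreviation "N \<equiv> dl H + (\<i> / complex_of_real \<omega>) *\<^sub>F dl P"

lemma sl2_L: "Y \<in> G.L" "E \<in> G.L" "\<theta> E \<in> G.L" "H \<in> G.L" "P \<in> G.L" "U \<in> G.L" "\<omega> \<noteq> 0"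
 using sl2 unfolding sl2_def by (auto simp: A.aa_L A.th_in A.L_add A.L_diff)

lemma sl2_br:
 "G.br Y E = E" "G.br Y (\<theta> E) = - \<theta> E" "G.br H P = U" "G.br H U = P" "G.br U H = - P" "G.br P H = - U"
 "G.br U P = \<omega>\<^sup>2 *\<^sub>F H" "G.br P U = - (\<omega>\<^sup>2 *\<^sub>F H)" "G.br Y H = 0" "G.br U Y = - P"
proof -
 note s = sl2[unfolded sl2_def]
 note L = sl2_L
 show y: "G.br Y E = E" "G.br Y (\<theta> E) = - \<theta> E" "G.br Y H = 0" using s A.aa_ab by auto
 show h: "G.br H P = U" "G.br H U = P" using s L by (simp_all add: A.br_diff A.br_add)
 show "G.br U H = - P" "G.br P H = - U" using h A.br_anti[OF L(6,4)] A.br_anti[OF L(5,4)] by simp_all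
 have "G.br U P = 2 *\<^sub>F G.br (\<theta> E) E"
  using L A.br_anti[OF L(2,3)] A.br_self[OF L(2)] A.br_self[OF L(3)]
  by (simp add: A.br_diff A.br_add_left fun_eq_iff fscale_def)
 then show up: "G.br U P = \<omega>\<^sup>2 *\<^sub>F H" using s by simp
 show "G.br P U = - (\<omega>\<^sup>2 *\<^sub>F H)" using up A.br_anti[OF L(5,6)] by simp
 have "G.br Y U = P" using y L by (simp add: A.br_add)
 then show "G.br U Y = - P" using A.br_anti[OF L(6,1)] by simp
qed

lemma sl2_theta: "\<theta> P = - P" "\<theta> U = U" "\<theta> H = - H" "U \<in> kk"
proof -
 note L = sl2_L
 show "\<theta> P = - P" "\<theta> U = U" using L by (simp_all add: A.th_diff A.th_add A.th_th add.commute)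
 then show "U \<in> kk" using L by (simp add: kk)
 show "\<theta> H = - H" using sl2 A.th_aa by (simp add: sl2_def)
qed

lemma N_in: "N \<in> C.L"
 by (intro C.L_add C.L_scale dl_in sl2_L)

definition "vN = vec H + (\<i> / complex_of_real \<omega>) *\<^sub>F vec P"

lemma Am_N: "Am N w = Am (dl H) w + (\<i> / complex_of_real \<omega>) *\<^sub>F Am (dl P) w"
 by (simp add: Am_add_left Am_scale_left)

text \<open>Together with \<open>Am_N_vN\<close> this makes ad N nilpotent on the span of U and N,
  so its exponential stops after the linear term.\<close>

lemma Am_N_U: "Am N (vec U) = (- \<i> * of_real \<omega>) *\<^sub>F vN"
proof -
 note L = sl2_L
 have a: "Am (dl H) (vec U) = vec P" "Am (dl P) (vec U) = - (of_real (\<omega>\<^sup>2) *\<^sub>F vec H)"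
  using Am_dl[OF L(4,6)] Am_dl[OF L(5,6)] by (simp_all add: sl2_br vec_uminus vec_scale)
 show ?thesis unfolding Am_N a vN_def using L(7) by (simp add: fun_eq_iff fscale_def power2_eq_square field_simps)
qed

lemma Am_N_vN: "Am N vN = 0"
proof -
 note L = sl2_L
 have a: "Am (dl H) (vec H) = 0" "Am (dl H) (vec P) = vec U" "Am (dl P) (vec H) = - vec U" "Am (dl P) (vec P) = 0"
  by (simp_all only: Am_dl L sl2_br vec_uminus A.br_self[OF L(4)] A.br_self[OF L(5)] vec_0)
 show ?thesis unfolding Am_N vN_def Am_add Am_scale a by (simp add: fun_eq_iff fscale_def)
qed

lemma vN_in: "vN \<in> V"
 unfolding vN_def by (intro V_add V_scale vec_in)

text \<open>The factor pi / 2 is made for this: E and \<theta> E have the eigenvalues 1 and -1 under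
  ad Y, so b multiplies them by i and - i and thereby exchanges P and U up to the factor i.\<close>

lemma Op_b: "Op (bb Y) (vec U) = \<i> *\<^sub>F vec P" "Op (bb Y) (vec P) = \<i> *\<^sub>F vec U" "Op (bb Y) (vec H) = vec H"
proof -
 note L = sl2_L and d = dl_in[OF sl2_L(1)]
 have "Am (dl Y) (vec E) = 1 *\<^sub>F vec E" "Am (dl Y) (vec (\<theta> E)) = (- 1) *\<^sub>F vec (\<theta> E)" "Am (dl Y) (vec H) = 0 *\<^sub>F vec H"
  using Am_dl[OF L(1,2)] Am_dl[OF L(1,3)] Am_dl[OF L(1,4)] by (simp_all add: sl2_br vec_uminus vec_0)
 note e = Op_eigen[OF d vec_in this(1), of "\<i> * complex_of_real pi / 2"] Op_eigen[OF d vec_in this(2), of "\<i> * complex_of_real pi / 2"]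
  Op_eigen[OF d vec_in this(3), of "\<i> * complex_of_real pi / 2"]
 have e': "Op (bb Y) (vec E) = \<i> *\<^sub>F vec E" "Op (bb Y) (vec (\<theta> E)) = (- \<i>) *\<^sub>F vec (\<theta> E)" "Op (bb Y) (vec H) = vec H"
  using e by (simp_all add: exp_half_pi)
 then show "Op (bb Y) (vec H) = vec H" by simp
 show "Op (bb Y) (vec U) = \<i> *\<^sub>F vec P" "Op (bb Y) (vec P) = \<i> *\<^sub>F vec U"
  unfolding vec_add vec_diff Op_add Op_diff e' by (simp_all add: fun_eq_iff fscale_def algebra_simps)
qed

text \<open>Chosen so that exp(-i ad N), which sends U to U - \<omega> N and fixes N, maps
  \<open>w1\<close> to U. As \<theta> changes the sign of \<open>vN\<close>, it maps
  \<open>thm w1\<close> to U - 2 \<omega> N.\<close>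

definition "w1 = vec U + of_real \<omega> *\<^sub>F vN"
definition "zz = bb Y \<otimes>\<^bsub>GC\<^esub> cexp ((- \<i>) *\<^sub>F N)"

lemma zz_in: "zz \<in> carrier GC"
 unfolding zz_def by (intro C.m_closed bb_in sl2_L cexp_in N_in)

lemma w1_in: "w1 \<in> V"
 unfolding w1_def by (intro V_add V_scale vec_in vN_in)

lemma thm_w1: "thm w1 = vec U - of_real \<omega> *\<^sub>F vN"
proof -
 have t: "thm (vec U) = vec U" "thm (vec H) = - vec H" "thm (vec P) = - vec P"
  by (simp_all only: thm_vec sl2_L sl2_theta vec_uminus)
 show ?thesis unfolding w1_def vN_def thm_add thm_scale t by (simp add: fun_eq_iff fscale_def algebra_simps)
qed

text \<open>\<omega> times the image of \<open>vN\<close> under \<open>Op (bb Y)\<close>. It is also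
  an eigenvector of ad P with eigenvalue \<omega>, which serves to detect escape to
  infinity.\<close>

definition "RR = \<omega> *\<^sub>F H - U"

lemma Op_zz: "Op zz w1 = \<i> *\<^sub>F vec P" "Op zz (thm w1) = \<i> *\<^sub>F vec P - 2 *\<^sub>F vec RR"
proof -
 have mU: "Op (cexp ((- \<i>) *\<^sub>F N)) (vec U) = vec U - of_real \<omega> *\<^sub>F vN"
 proof -
  have "Am N ((- \<i> * of_real \<omega>) *\<^sub>F vN) = 0" by (simp only: Am_scale Am_N_vN fnvs.scale_zero_right)
  then have "Op (cexp ((- \<i>) *\<^sub>F N)) (vec U) = vec U + (- \<i>) *\<^sub>F ((- \<i> * of_real \<omega>) *\<^sub>F vN)"
   by (rule Op_nilpotent[OF N_in vec_in V_scale[OF vN_in] Am_N_U])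
  also have "\<dots> = vec U - of_real \<omega> *\<^sub>F vN" unfolding fnvs.scale_scale by simp
  finally show ?thesis .
 qed
 have mN: "Op (cexp ((- \<i>) *\<^sub>F N)) vN = vN"
  using Op_eigen[OF N_in vN_in, of 0 "- \<i>"] Am_N_vN by simp
 have bN: "Op (bb Y) vN = vec H - (1 / of_real \<omega>) *\<^sub>F vec U"
  unfolding vN_def Op_add Op_scale Op_b by (simp add: fun_eq_iff fscale_def)
 have z: "Op zz w = Op (bb Y) (Op (cexp ((- \<i>) *\<^sub>F N)) w)" for w
  unfolding zz_def by (rule Op_mult[OF bb_in[OF sl2_L(1)] cexp_in[OF N_in]])
 show "Op zz w1 = \<i> *\<^sub>F vec P"
  unfolding z w1_def Op_add Op_scale mU mN Op_b Op_diff by (simp add: fun_eq_iff fscale_def)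
 show "Op zz (thm w1) = \<i> *\<^sub>F vec P - 2 *\<^sub>F vec RR"
  unfolding z thm_w1 Op_diff Op_scale mU mN Op_b bN RR_def vec_diff vec_scale using sl2_L(7)
  by (simp add: fun_eq_iff fscale_def field_simps)
qed

lemma RR: "RR \<in> G.L" "RR \<noteq> 0"
proof -
 note L = sl2_L
 show "RR \<in> G.L" unfolding RR_def by (intro A.L_diff A.L_scale L)
 show "RR \<noteq> 0"
 proof
  assume z: "RR = 0"
  then have "\<theta> RR = 0" by (simp add: A.th_0)
  then have "- (\<omega> *\<^sub>F H) - U = 0" unfolding RR_def using L by (simp add: A.th_diff A.th_scale A.L_scale sl2_theta)
  with z have "\<omega> * H f = 0" for f unfolding RR_def by (simp add: fun_eq_iff fscale_def) (smt (verit))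
  then have "H = 0" using L(7) by (auto simp: fun_eq_iff)
  then show False using sl2 by (simp add: sl2_def)
 qed
qed

text \<open>\<open>w1\<close> and \<open>thm w1\<close> are the test vectors. At a point of the
  orbit their images after removal of g have equal norms, because \<kappa> commutes with \<theta>,
  \<theta> is an isometry and \<open>bb Z\<close> acts unitarily. For \<open>zz\<close> these images
  are i P' and i P' - 2 R' with P' and R' real, so the norm squares differ by that of 2 R'.\<close>

lemma zz_not_in_orbit: "pt zz \<notin> G_exp_orbit G GC \<iota> kk aa"
proof
 assume "pt zz \<in> G_exp_orbit G GC \<iota> kk aa"
 then obtain g Z where g: "g \<in> carrier G" and Z: "Z \<in> aa" and eq: "pt zz = pt (\<iota> g \<otimes>\<^bsub>GC\<^esub> bb Z)"
  using orbit_iff[of aa] A.aa_L by blast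
 note ZL = A.aa_L[OF Z]
 obtain \<kappa> where k: "\<kappa> \<in> KC" and zk: "zz = \<iota> g \<otimes>\<^bsub>GC\<^esub> bb Z \<otimes>\<^bsub>GC\<^esub> \<kappa>" using pt_eqD[OF eq zz_in] by blast
 have kc: "\<kappa> \<in> carrier GC" and kt: "\<And>w. w \<in> V ==> Op \<kappa> (thm w) = thm (Op \<kappa> w)" using K_C_carrier_thm[OF k] by auto
 note gi = iota_in[OF g] and gi' = G.inv_closed[OF g]
 have z: "Op (\<iota> (inv\<^bsub>G\<^esub> g)) (Op zz w) = Op (bb Z) (Op \<kappa> w)" for w
  unfolding zk iota_inv[OF g] using gi kc bb_in[OF ZL] by (simp add: Op_mult Op_inv(2)[OF gi Op_in])
 have nb: "nn (Op (bb Z) u) = nn u" if "u \<in> V" for u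
  using nn_unitary[of Z u "pi / 2"] that Z A.aa_pp by auto
 have "nn (Op (bb Z) (Op \<kappa> (thm w1))) = nn (Op (bb Z) (Op \<kappa> w1))"
  by (simp only: nb Op_in thm_in kt w1_in nn_thm)
 then have n: "nn (Op (\<iota> (inv\<^bsub>G\<^esub> g)) (\<i> *\<^sub>F vec P - 2 *\<^sub>F vec RR)) = nn (Op (\<iota> (inv\<^bsub>G\<^esub> g)) (\<i> *\<^sub>F vec P))"
  unfolding z[symmetric] Op_zz .
 let ?P = "G.Ad (inv\<^bsub>G\<^esub> g) P" and ?R = "G.Ad (inv\<^bsub>G\<^esub> g) RR"
 have L: "?P \<in> G.L" "?R \<in> G.L" using G.Ad_in[OF gi'] sl2_L RR by auto
 have 1: "Op (\<iota> (inv\<^bsub>G\<^esub> g)) (\<i> *\<^sub>F vec P) = vec 0 + \<i> *\<^sub>F vec ?P"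
  using Op_iota[OF gi' sl2_L(5)] by (simp add: Op_scale vec_0)
 have 2: "Op (\<iota> (inv\<^bsub>G\<^esub> g)) (\<i> *\<^sub>F vec P - 2 *\<^sub>F vec RR) = vec ((- 2) *\<^sub>F ?R) + \<i> *\<^sub>F vec ?P"
  using Op_iota[OF gi' sl2_L(5)] Op_iota[OF gi' RR(1)] unfolding Op_diff Op_scale vec_scale
  by (simp add: fun_eq_iff fscale_def)
 have L2: "(- 2) *\<^sub>F ?R \<in> G.L" by (rule G.L_scale[OF L(2)])
 have "A.ip ((- 2) *\<^sub>F ?R) ((- 2) *\<^sub>F ?R) = 0"
  using n unfolding 1 2 nn_def reL_vec[OF L2] reL_vec[OF G.L_0] imL_vec[OF L(1)] by (simp add: A.ip_0[OF G.L_0])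
 then have "(- 2) *\<^sub>F ?R = 0" using A.ip_pos[OF L2] by force
 then have "?R = 0" by (simp add: fnvs.scale_eq_0_iff)
 then have "G.Ad g ?R = 0 *\<^sub>F G.Ad g 0" using G.Ad_scale[of g 0 0] by simp
 moreover have "G.Ad g ?R = RR" using G.Ad_mult[OF g gi' RR(1)] g by (simp add: G.Ad_one RR)
 ultimately show False using RR(2) by simp
qed

end

end

section \<open>Translation by exp(s P) and the limits it produces\<close>

context crown_setup
begin

abbreviation "XC \<equiv> X_C GC \<iota> kk"

lemma quotient_pt: "quotient_map (gtop GC) XC pt"
 using quotient_map_quotient_topology[of "gtop GC" pt] unfolding X_C_def pt_def[abs_def] .

lemma XC_top: "topspace XC = pt ` carrier GC"
 using quotient_imp_surjective_map[OF quotient_pt] C.top by simp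

lemma XC_preimage: "openin XC B ==> openin (gtop GC) {x \<in> carrier GC. pt x \<in> B}"
 using openin_continuous_map_preimage[OF quotient_imp_continuous_map[OF quotient_pt], of B] C.top by simp

lemma left_preimage:
 assumes a: "a \<in> carrier GC" and W: "openin (gtop GC) W"
 shows "openin (gtop GC) {x \<in> carrier GC. a \<otimes>\<^bsub>GC\<^esub> x \<in> W}"
 using openin_continuous_map_preimage[OF smooth_map_continuous[OF C.smooth_mult[OF C.cM C.smooth_const[OF C.cM a] C.smooth_id]] W] C.top
 by simp

lemma dl_diff': "dl (X - Z) = dl X + (- 1) *\<^sub>F dl Z"
 unfolding dl_diff by simp

lemma dl_uminus: "dl (- X) = - dl X"
 by (auto simp: dl_eq fun_eq_iff complex_eq_iff)

context
 fixes Y E H \<omega>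
 assumes sl2: "sl2 Y E H \<omega>"
begin

lemmas sL = sl2_L[OF sl2] and sB = sl2_br[OF sl2]

lemma iota_expP: "\<iota> (lie_exp G (s *\<^sub>F P E)) = cexp (of_real s *\<^sub>F dl (P E))" "lie_exp G (s *\<^sub>F P E) \<in> carrier G"
 using iota_exp[OF G.L_scale[OF sL(5)]] G.gexp_in[OF G.L_scale[OF sL(5)]] by (simp_all add: dl_scale)

text \<open>This form puts a factor from \<open>K_C\<close> on the right: at the base point it
  disappears, and past exp(-i \<delta> Y) it can be moved by conjugation.\<close>

lemma shift_b:
 "\<iota> (lie_exp G (s *\<^sub>F P E)) \<otimes>\<^bsub>GC\<^esub> bb Y = bb Y \<otimes>\<^bsub>GC\<^esub> cexp ((- \<i> * of_real s) *\<^sub>F dl (U E))"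
proof -
 let ?b = "bb Y" and ?e = "cexp (of_real s *\<^sub>F dl (P E))"
 have b: "?b \<in> carrier GC" by (rule bb_in[OF sL(1)])
 have e: "?e \<in> carrier GC" by (intro cexp_in dl_in sL)
 have ib: "inv\<^bsub>GC\<^esub> ?b = cexp ((- (\<i> * complex_of_real pi / 2)) *\<^sub>F dl Y)"
  using C.gexp_minus[OF C.L_scale[OF dl_in[OF sL(1)]], of "\<i> * complex_of_real pi / 2"] by (simp add: fnvs.scale_minus_left)
 have y: "C.br (dl Y) (dl E) = 1 *\<^sub>F dl E" "C.br (dl Y) (dl (\<theta> E)) = (- 1) *\<^sub>F dl (\<theta> E)"
  unfolding dl_br[OF sL(1,2)] dl_br[OF sL(1,3)] sB using dl_scale[of "-1" "\<theta> E"] by simp_all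
 have AE: "C.Ad (inv\<^bsub>GC\<^esub> ?b) (dl E) = (- \<i>) *\<^sub>F dl E"
  unfolding ib C.Ad_exp_eigen[OF dl_in[OF sL(1)] dl_in[OF sL(2)] y(1)] by (simp add: exp_half_pi)
 have AT: "C.Ad (inv\<^bsub>GC\<^esub> ?b) (dl (\<theta> E)) = \<i> *\<^sub>F dl (\<theta> E)"
  unfolding ib C.Ad_exp_eigen[OF dl_in[OF sL(1)] dl_in[OF sL(3)] y(2)] by (simp add: exp_half_pi)
 have "inv\<^bsub>GC\<^esub> ?b \<otimes>\<^bsub>GC\<^esub> ?e \<otimes>\<^bsub>GC\<^esub> inv\<^bsub>GC\<^esub> (inv\<^bsub>GC\<^esub> ?b) = cexp (C.Ad (inv\<^bsub>GC\<^esub> ?b) (of_real s *\<^sub>F dl (P E)))"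
  by (rule C.gexp_conj) (intro C.inv_closed b C.L_scale dl_in sL)+
 also have "C.Ad (inv\<^bsub>GC\<^esub> ?b) (of_real s *\<^sub>F dl (P E)) = of_real s *\<^sub>F ((- \<i>) *\<^sub>F dl E + (- 1) *\<^sub>F (\<i> *\<^sub>F dl (\<theta> E)))"
  unfolding dl_diff' C.Ad_scale C.Ad_add AE AT ..
 also have "\<dots> = (- \<i> * of_real s) *\<^sub>F dl (U E)"
  unfolding dl_add by (simp add: fun_eq_iff fscale_def algebra_simps)
 finally have c: "inv\<^bsub>GC\<^esub> ?b \<otimes>\<^bsub>GC\<^esub> ?e \<otimes>\<^bsub>GC\<^esub> ?b = cexp ((- \<i> * of_real s) *\<^sub>F dl (U E))" unfolding C.inv_inv[OF b] .
 have "?b \<otimes>\<^bsub>GC\<^esub> (inv\<^bsub>GC\<^esub> ?b \<otimes>\<^bsub>GC\<^esub> ?e \<otimes>\<^bsub>GC\<^esub> ?b) = ?e \<otimes>\<^bsub>GC\<^esub> ?b"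
  using b e by (simp add: C.m_assoc[symmetric])
 then show ?thesis unfolding iota_expP c by (rule sym)
qed

lemma U_KC: "cexp (c *\<^sub>F dl (U E)) \<in> KC"
 by (rule KC_exp[OF sl2_theta(4)[OF sl2]])

lemma fixed_point: "pt (\<iota> (lie_exp G (s *\<^sub>F P E)) \<otimes>\<^bsub>GC\<^esub> bb Y) = pt (bb Y)"
 unfolding shift_b by (rule pt_KC[OF U_KC bb_in[OF sL(1)]])

lemma br_U_N: "C.br (dl (U E)) (N E H \<omega>) = (\<i> * of_real \<omega>) *\<^sub>F N E H \<omega>"
proof -
 note d = dl_in[OF sL(6)] dl_in[OF sL(4)] dl_in[OF sL(5)]
 have "C.br (dl (U E)) (N E H \<omega>) = dl (G.br (U E) H) + (\<i> / of_real \<omega>) *\<^sub>F dl (G.br (U E) (P E))"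
  using d sL by (simp add: C.br_add_right C.br_scale_right C.L_scale dl_br)
 also have "\<dots> = (\<i> * of_real \<omega>) *\<^sub>F N E H \<omega>"
  unfolding sB dl_scale dl_uminus using sL(7) by (simp add: fun_eq_iff fscale_def field_simps power2_eq_square)
 finally show ?thesis .
qed

end

context
 fixes Y E H \<omega>
 assumes sl2: "sl2 Y E H \<omega>"
begin

text \<open>The sum Y = (Y - H) + N_+ / 2 + N_- / 2 decomposes Y into eigenvectors of ad U with
  eigenvalues 0, i \<omega> and - i \<omega>; Ad(exp(-i s U)) multiplies them by 1, exp(s \<omega>)
  and exp(- s \<omega>).\<close>

definition "rest s = dl (Y - H) + (exp (of_real (s * \<omega>)) / 2) *\<^sub>F N E H \<omega> + (exp (- of_real (s * \<omega>)) / 2) *\<^sub>F N E H (- \<omega>)"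

lemma Ad_U_Y: "C.Ad (cexp ((- \<i> * of_real s) *\<^sub>F dl (U E))) (dl Y) = rest s"
proof -
 note L = sl2_L[OF sl2]
 let ?u = "cexp ((- \<i> * of_real s) *\<^sub>F dl (U E))"
 note e = C.Ad_exp_eigen[OF dl_in[OF L(6)]]
 have z: "G.br (U E) (Y - H) = 0" using L sl2_br[OF sl2] by (simp add: A.br_diff)
 have "C.br (dl (U E)) (dl (Y - H)) = 0 *\<^sub>F dl (Y - H)"
  using dl_br[OF L(6) A.L_diff[OF L(1,4)]] z dl_0 by simp
 from e[OF dl_in[OF A.L_diff[OF L(1,4)]] this, of "- \<i> * of_real s"]
 have 1: "C.Ad ?u (dl (Y - H)) = dl (Y - H)" by simp
 have 2: "C.Ad ?u (N E H \<omega>) = exp (of_real (s * \<omega>)) *\<^sub>F N E H \<omega>"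
  unfolding e[OF N_in[OF sl2] br_U_N[OF sl2], of "- \<i> * of_real s"] by (simp add: algebra_simps)
 have 3: "C.Ad ?u (N E H (- \<omega>)) = exp (- of_real (s * \<omega>)) *\<^sub>F N E H (- \<omega>)"
  unfolding e[OF N_in[OF sl2_minus[OF sl2]] br_U_N[OF sl2_minus[OF sl2]], of "- \<i> * of_real s"] by (simp add: algebra_simps)
 have g: "C.Ad g (a + x *\<^sub>F b + y *\<^sub>F c) = C.Ad g a + x *\<^sub>F C.Ad g b + y *\<^sub>F C.Ad g c" for g a b c x y
  by (simp only: C.Ad_add C.Ad_scale)
 have "dl Y = dl (Y - H) + (1 / 2) *\<^sub>F N E H \<omega> + (1 / 2) *\<^sub>F N E H (- \<omega>)"
  unfolding dl_diff[of Y H] by (simp add: fun_eq_iff fscale_def field_simps)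
 then have "C.Ad ?u (dl Y) = C.Ad ?u (dl (Y - H) + (1 / 2) *\<^sub>F N E H \<omega> + (1 / 2) *\<^sub>F N E H (- \<omega>))" by (rule arg_cong)
 also have "\<dots> = C.Ad ?u (dl (Y - H)) + (1 / 2) *\<^sub>F C.Ad ?u (N E H \<omega>) + (1 / 2) *\<^sub>F C.Ad ?u (N E H (- \<omega>))"
  by (rule g)
 also have "\<dots> = rest s" unfolding 1 2 3 rest_def fnvs.scale_scale by simp
 finally show ?thesis .
qed

definition "qq \<delta> = bb Y \<otimes>\<^bsub>GC\<^esub> cexp ((- \<i> * of_real \<delta>) *\<^sub>F dl Y)"

lemma qq_in: "qq \<delta> \<in> carrier GC"
 unfolding qq_def by (intro C.m_closed bb_in cexp_in dl_in sl2_L[OF sl2])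

lemma shift_qq:
 "pt (\<iota> (lie_exp G (s *\<^sub>F P E)) \<otimes>\<^bsub>GC\<^esub> qq \<delta>) = pt (bb Y \<otimes>\<^bsub>GC\<^esub> cexp ((- \<i> * of_real \<delta>) *\<^sub>F rest s))"
proof -
 note L = sl2_L[OF sl2]
 let ?u = "cexp ((- \<i> * of_real s) *\<^sub>F dl (U E))" and ?v = "(- \<i> * of_real \<delta>) *\<^sub>F dl Y" and ?g = "\<iota> (lie_exp G (s *\<^sub>F P E))"
 have u: "?u \<in> carrier GC" and v: "cexp ?v \<in> carrier GC" "?v \<in> C.L" by (intro cexp_in dl_in L C.L_scale)+
 note b = bb_in[OF L(1)]
 have g: "?g \<in> carrier GC" by (rule iota_in[OF iota_expP(2)[OF sl2]])
 have c: "?u \<otimes>\<^bsub>GC\<^esub> cexp ?v \<otimes>\<^bsub>GC\<^esub> inv\<^bsub>GC\<^esub> ?u = cexp ((- \<i> * of_real \<delta>) *\<^sub>F rest s)"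
  unfolding C.gexp_conj[OF u v(2)] C.Ad_scale Ad_U_Y ..
 then have ci: "cexp ((- \<i> * of_real \<delta>) *\<^sub>F rest s) \<in> carrier GC" using u v by (metis C.inv_closed C.m_closed)
 have "?g \<otimes>\<^bsub>GC\<^esub> qq \<delta> = (?g \<otimes>\<^bsub>GC\<^esub> bb Y) \<otimes>\<^bsub>GC\<^esub> cexp ?v"
  unfolding qq_def by (rule C.m_assoc[symmetric]) (intro g b v)+
 also have "\<dots> = bb Y \<otimes>\<^bsub>GC\<^esub> ?u \<otimes>\<^bsub>GC\<^esub> cexp ?v" unfolding shift_b[OF sl2] ..
 also have "\<dots> = (bb Y \<otimes>\<^bsub>GC\<^esub> (?u \<otimes>\<^bsub>GC\<^esub> cexp ?v \<otimes>\<^bsub>GC\<^esub> inv\<^bsub>GC\<^esub> ?u)) \<otimes>\<^bsub>GC\<^esub> ?u"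
  using b u v by (simp add: C.m_assoc)
 finally have f: "?g \<otimes>\<^bsub>GC\<^esub> qq \<delta> = (bb Y \<otimes>\<^bsub>GC\<^esub> cexp ((- \<i> * of_real \<delta>) *\<^sub>F rest s)) \<otimes>\<^bsub>GC\<^esub> ?u" unfolding c .
 show ?thesis unfolding f by (rule pt_KC[OF U_KC[OF sl2] C.m_closed[OF b ci]])
qed

text \<open>\<open>sg k * \<omega>\<close> is \<open>k\<close> times the modulus of \<omega>,
  whatever its sign, and \<open>dlt k\<close> is the reciprocal of the coefficient of N in
  \<open>rest (sg k)\<close>. With q = exp(- k |\<omega>|), the remaining coefficients become 2 q
  and q squared, and both tend to 0.\<close>

definition "dlt k = 2 * exp (- (real k * \<bar>\<omega>\<bar>))"
definition "sg k = real k * \<bar>\<omega>\<bar> / \<omega>"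

text \<open>The convergence takes place in \<open>GC\<close>, by continuity of the exponential map,
  and is pushed down by taking preimages of \<open>B\<close> under the quotient map and under left
  translation by \<open>bb Y\<close>.\<close>

lemma limit_pt:
 assumes B: "openin XC B" "pt (zz Y E H \<omega>) \<in> B"
 shows "\<forall>\<^sub>F k in sequentially. pt (\<iota> (lie_exp G (sg k *\<^sub>F P E)) \<otimes>\<^bsub>GC\<^esub> qq (dlt k)) \<in> B"
proof -
 note L = sl2_L[OF sl2]
 let ?W = "{x \<in> carrier GC. bb Y \<otimes>\<^bsub>GC\<^esub> x \<in> {x \<in> carrier GC. pt x \<in> B}}"
 let ?v = "(- \<i>) *\<^sub>F N E H \<omega>" and ?vk = "%k. (- \<i> * of_real (dlt k)) *\<^sub>F rest (sg k)"
 have W: "openin (gtop GC) ?W" by (intro left_preimage bb_in L XC_preimage B)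
 have vW: "cexp ?v \<in> ?W"
  using zz_in[OF sl2] B(2) cexp_in[OF N_in[OF sl2]] unfolding zz_def[OF sl2] by blast
 note NL = N_in[OF sl2] N_in[OF sl2_minus[OF sl2]]
 have rL: "rest s \<in> C.L" for s unfolding rest_def by (intro C.L_add C.L_scale NL dl_in A.L_diff L)
 have lim0: "(%k. exp (- (real k * \<bar>\<omega>\<bar>))) \<longlonglongrightarrow> 0"
 proof -
  have "(%k. exp (- \<bar>\<omega>\<bar>) ^ k) \<longlonglongrightarrow> 0" by (rule LIMSEQ_power_zero) (use L(7) in simp)
  then show ?thesis by (simp add: exp_of_nat_mult[symmetric])
 qed
 have "(%k. ?vk k f) \<longlonglongrightarrow> ?v f" for f
 proof -
  have eq: "?vk k f = - \<i> * (of_real (2 * exp (- (real k * \<bar>\<omega>\<bar>))) * dl (Y - H) f + N E H \<omega> f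
    + of_real (exp (- (real k * \<bar>\<omega>\<bar>)) * exp (- (real k * \<bar>\<omega>\<bar>))) * N E H (- \<omega>) f)" for k
  proof -
   have s: "sg k * \<omega> = real k * \<bar>\<omega>\<bar>" using L(7) by (simp add: sg_def)
   have x: "exp (- (complex_of_real (real k * \<bar>\<omega>\<bar>))) = of_real (exp (- (real k * \<bar>\<omega>\<bar>)))"
    "exp (complex_of_real (real k * \<bar>\<omega>\<bar>)) = of_real (inverse (exp (- (real k * \<bar>\<omega>\<bar>))))"
    by (simp_all only: exp_minus exp_of_real of_real_inverse inverse_inverse_eq)
   define q where "q = exp (- (real k * \<bar>\<omega>\<bar>))"
   have q: "q \<noteq> 0" by (simp add: q_def)
   show ?thesis unfolding rest_def s dlt_def x q_def[symmetric] fscale_def plus_fun_apply using q by (simp add: field_simps)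
  qed
  have "(%k. - \<i> * (of_real (2 * exp (- (real k * \<bar>\<omega>\<bar>))) * dl (Y - H) f + N E H \<omega> f
    + of_real (exp (- (real k * \<bar>\<omega>\<bar>)) * exp (- (real k * \<bar>\<omega>\<bar>))) * N E H (- \<omega>) f))
    \<longlonglongrightarrow> - \<i> * (of_real (2 * 0) * dl (Y - H) f + N E H \<omega> f + of_real (0 * 0) * N E H (- \<omega>) f)"
   by (intro tendsto_intros lim0)
  then show ?thesis unfolding eq by (simp add: fscale_def)
 qed
 then have "\<forall>\<^sub>F k in sequentially. cexp (?vk k) \<in> ?W"
  by (intro C.gexp_continuous[OF C.L_scale[OF NL(1)] C.L_scale[OF rL] _ W vW])
 then show ?thesis
 proof (rule eventually_mono)
  fix k assume "cexp (?vk k) \<in> ?W"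
  then show "pt (\<iota> (lie_exp G (sg k *\<^sub>F P E)) \<otimes>\<^bsub>GC\<^esub> qq (dlt k)) \<in> B" unfolding shift_qq by simp
 qed
qed

text \<open>Ad(exp(t P)) multiplies \<open>RR\<close> by exp(t \<omega>), whereas a coordinate of Ad
  g applied to \<open>RR\<close> is continuous in g and hence bounded near \<open>h\<close>.\<close>

lemma no_cluster:
 assumes h: "h \<in> carrier G" and w: "\<omega> > 0" and s: "filterlim s at_top sequentially"
 shows "\<exists>W. openin (gtop G) W \<and> h \<in> W \<and> (\<forall>\<^sub>F k in sequentially. lie_exp G (s k *\<^sub>F P E) \<notin> W)"
proof -
 note L = sl2_L[OF sl2] and R = RR[OF sl2]
 let ?R = "RR E H \<omega>"
 have "\<exists>j<n. ?R (G.crd j) \<noteq> 0"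
  using G.der_eqI[OF R(1) G.L_0] R(2) by force
 then obtain j where j: "j < n" "?R (G.crd j) \<noteq> 0" by blast
 define c where "c = \<bar>?R (G.crd j)\<bar>"
 have c: "c > 0" using j(2) by (simp add: c_def)
 have "G.br (P E) ?R = \<omega> *\<^sub>F ?R"
  unfolding RR_def[OF sl2] A.br_diff[OF L(5) A.L_scale[OF L(4)] L(6)] A.br_scale[OF L(5,4)] sl2_br(6,8)[OF sl2]
  by (simp add: fun_eq_iff fscale_def power2_eq_square algebra_simps)
 from G.Ad_exp_eigen[OF L(5) R(1) this]
 have Ad: "G.Ad (lie_exp G (t *\<^sub>F P E)) ?R = exp (t * \<omega>) *\<^sub>F ?R" for t .
 let ?\<Phi> = "%g. G.Ad g ?R (G.crd j)"
 obtain W where W: "openin (gtop G) W" "h \<in> W" "\<forall>q\<in>W. dist (?\<Phi> q) (?\<Phi> h) < 1"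
  using smooth_at_continuous[OF G.cM G.smooth_Ad[OF R(1) G.sm_crd[OF j(1)] h], of 1] by auto
 have "filterlim (%k. exp (s k * \<omega>) * c) at_top sequentially"
  using s w c by (intro filterlim_at_top_mult_tendsto_pos[OF tendsto_const] filterlim_compose[OF exp_at_top])
 then have "\<forall>\<^sub>F k in sequentially. exp (s k * \<omega>) * c \<ge> \<bar>?\<Phi> h\<bar> + 1" by (simp add: filterlim_at_top)
 then have "\<forall>\<^sub>F k in sequentially. lie_exp G (s k *\<^sub>F P E) \<notin> W"
 proof (rule eventually_mono)
  fix k assume k: "exp (s k * \<omega>) * c \<ge> \<bar>?\<Phi> h\<bar> + 1"
  show "lie_exp G (s k *\<^sub>F P E) \<notin> W"
  proof
   assume "lie_exp G (s k *\<^sub>F P E) \<in> W"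
   then have "\<bar>?\<Phi> (lie_exp G (s k *\<^sub>F P E)) - ?\<Phi> h\<bar> < 1" using W(3) by (simp add: dist_real_def)
   moreover have "\<bar>?\<Phi> (lie_exp G (s k *\<^sub>F P E))\<bar> = exp (s k * \<omega>) * c" unfolding Ad c_def by (simp add: fscale_def abs_mult)
   ultimately show False using k by linarith
  qed
 qed
 then show ?thesis using W by blast
qed

end

end

section \<open>Proper actions\<close>

text \<open>Let \<open>s\<close> be a point of \<open>S\<close> nearest to \<open>g\<close> in the
  chart. If it were not \<open>g\<close>, moving along
  \<open>s \<otimes> lie_exp G (t *\<^sub>F v)\<close>, with \<open>v\<close> pointing from
  \<open>s\<close> to \<open>g\<close>, would stay in \<open>S\<close> and decrease the
  distance.\<close>

lemma nearest_point_neighbourhood: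
 fixes G :: "('a, real) lie_group"
 assumes G: "is_lie_group G" and S: "compactin (gtop G) S" "\<one>\<^bsub>G\<^esub> \<in> S"
  and exp: "\<And>s v. s \<in> S ==> v \<in> lie_algebra G ==> s \<otimes>\<^bsub>G\<^esub> lie_exp G v \<in> S"
 shows "\<exists>W. openin (gtop G) W \<and> \<one>\<^bsub>G\<^esub> \<in> W \<and> W \<subseteq> S"
proof -
 interpret lie G using G by unfold_locales
 let ?n = "mdim (mfd G)"
 have haus: "Hausdorff_space (gtop G)" using G unfolding is_lie_group_def is_manifold_def by blast
 have SC: "S \<subseteq> carrier G" using compactin_subset_topspace[OF S(1)] top by simp
 obtain r where r: "r > 0" "kbox ?n x1 r \<subseteq> phi1 ` U1" using kopen_contains_kbox[OF phi1_open x1_in(1)] by blast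
 define \<rho> where "\<rho> = r / 2"
 have \<rho>: "\<rho> > 0" "\<rho> < r" using r by (auto simp: \<rho>_def)
 define Cb where "Cb = {y \<in> kspace ?n. \<forall>i<?n. \<bar>y i - x1 i\<bar> \<le> \<rho>}"
 have Cb_sub: "Cb \<subseteq> phi1 ` U1" using r(2) \<rho> unfolding Cb_def kbox_def dist_real_def by force
 have "Cb = PiE UNIV (%i. if i < ?n then cball (x1 i) \<rho> else {0})"
  unfolding Cb_def kspace_def by (auto simp: PiE_def Pi_def dist_real_def abs_minus_commute not_less[symmetric])
 then have "compactin (product_topology (%_. euclidean) UNIV) Cb"
  by (simp add: compactin_PiE)
 then have Cb_compact: "compact Cb" unfolding euclidean_product_topology by simp
 have maps: "homeomorphic_maps (subtopology (gtop G) U1) (top_of_set (phi1 ` U1)) phi1 ps" by (rule chart_maps[OF cM chart1(1)])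
 have cphi: "continuous_map (subtopology (gtop G) U1) (top_of_set (phi1 ` U1)) phi1"
  and cps: "continuous_map (top_of_set (phi1 ` U1)) (subtopology (gtop G) U1) ps"
  using maps unfolding homeomorphic_maps_def by auto
 have B: "compactin (subtopology (gtop G) U1) (ps ` Cb)"
  by (rule image_compactin[OF _ cps]) (simp add: compactin_subtopology Cb_compact Cb_sub)
 then have B': "compactin (gtop G) (ps ` Cb)" "ps ` Cb \<subseteq> U1" by (auto simp: compactin_subtopology)
 define T where "T = S \<inter> ps ` Cb"
 have Tc: "compactin (gtop G) T" unfolding T_def
  by (rule closed_Int_compactin[OF compactin_imp_closedin[OF haus S(1)] B'(1)])
 have TU: "T \<subseteq> U1" using B'(2) by (auto simp: T_def)
 have inT: "s \<in> T" if "s \<in> S" "s \<in> U1" "\<And>i. i < ?n ==> \<bar>phi1 s i - x1 i\<bar> \<le> \<rho>" for s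
 proof -
  have "phi1 s \<in> Cb" using that(3) chart_kspace[OF cM chart1(1) that(2)] by (simp add: Cb_def)
  then show ?thesis unfolding T_def using that(1) ps_phi1[OF that(2)] by (metis IntI imageI)
 qed
 have oneT: "\<one>\<^bsub>G\<^esub> \<in> T" by (rule inT[OF S(2) chart1(2)]) (use \<rho> in simp)
 \<comment> \<open>So small that the identity is closer to \<open>g\<close> than \<rho> / 2. The
   minimiser is then within \<rho> / 2 of \<open>g\<close>, hence in the interior of the box, and
   small moves from it stay in \<open>T\<close>.\<close>
 define \<epsilon> where "\<epsilon> = \<rho> / (2 * (real ?n + 1))"
 have \<epsilon>: "\<epsilon> > 0" using \<rho> by (simp add: \<epsilon>_def)
 define W where "W = {q \<in> U1. phi1 q \<in> kbox ?n x1 \<epsilon>}"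
 have "W \<subseteq> S"
 proof
  fix g assume g: "g \<in> W"
  then have gU: "g \<in> U1" and gb: "\<And>i. i < ?n ==> \<bar>phi1 g i - x1 i\<bar> < \<epsilon>" by (auto simp: W_def kbox_def dist_real_def)
  define d where "d s = (\<Sum>i<?n. (phi1 s i - phi1 g i)\<^sup>2)" for s
  have "continuous_map (subtopology (gtop G) U1) euclidean (%s. phi1 s i)" for i
   using continuous_map_compose[OF continuous_map_into_fulltopology[OF cphi], of euclidean "%x. x i"] by (simp add: o_def continuous_on_coord)
  then have "continuous_map (subtopology (gtop G) U1) euclidean d"
   unfolding d_def power2_eq_square
   by (intro continuous_map_sum continuous_map_real_mult continuous_map_diff) auto
  from image_compactin[OF _ this, of T] have "compact (d ` T)"
   using Tc TU by (simp add: compactin_subtopology)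
  then obtain s where s: "s \<in> T" "\<And>t. t \<in> T ==> d s \<le> d t"
   using compact_attains_inf[of "d ` T"] oneT by blast
  have sU: "s \<in> U1" and sS: "s \<in> S" using s(1) TU by (auto simp: T_def)
  have d1: "d \<one>\<^bsub>G\<^esub> < (\<rho> / 2)\<^sup>2"
  proof -
   have "d \<one>\<^bsub>G\<^esub> \<le> (\<Sum>i<?n. \<epsilon>\<^sup>2)"
    unfolding d_def
   proof (rule sum_mono)
    fix i assume "i \<in> {..<?n}"
    then have "\<bar>x1 i - phi1 g i\<bar> \<le> \<epsilon>" using gb[of i] by (simp add: abs_minus_commute)
    then show "(x1 i - phi1 g i)\<^sup>2 \<le> \<epsilon>\<^sup>2" using abs_le_square_iff[of "x1 i - phi1 g i" \<epsilon>] \<epsilon> by simp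
   qed
   also have "\<dots> = real ?n * \<epsilon>\<^sup>2" by simp
   also have "\<dots> < (real ?n + 1)\<^sup>2 * \<epsilon>\<^sup>2"
    using \<epsilon> by (intro mult_strict_right_mono) (auto simp: power2_eq_square algebra_simps intro!: add_pos_nonneg)
   also have "\<dots> = (\<rho> / 2)\<^sup>2"
   proof -
    have "real ?n + 1 \<noteq> 0" by linarith
    then have "(real ?n + 1) * \<epsilon> = \<rho> / 2" unfolding \<epsilon>_def by (simp add: field_simps)
    then show ?thesis unfolding power_mult_distrib[symmetric] by (rule arg_cong)
   qed
   finally show ?thesis .
  qed
  have near: "\<bar>phi1 s i - x1 i\<bar> < \<rho>" if i: "i < ?n" for i
  proof -
   have "(phi1 s i - phi1 g i)\<^sup>2 \<le> d s" unfolding d_def using i by (intro member_le_sum) auto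
   also have "\<dots> < (\<rho> / 2)\<^sup>2" using s(2)[OF oneT] d1 by linarith
   finally have "\<bar>phi1 s i - phi1 g i\<bar> < \<rho> / 2" using abs_le_square_iff[of "\<rho> / 2" "phi1 s i - phi1 g i"] \<rho> by linarith
   moreover have "\<epsilon> \<le> \<rho> / 2" using \<rho> unfolding \<epsilon>_def by (simp add: field_simps)
   ultimately show ?thesis using gb[OF i] by linarith
  qed
  obtain v where v: "v \<in> lie_algebra G" "\<forall>i<?n. v (%h. phi1 (s \<otimes>\<^bsub>G\<^esub> h) i) = phi1 g i - phi1 s i"
   using exists_derivation[OF chart1(1) sU, of "%i. phi1 g i - phi1 s i"] by blast
  have sC: "s \<in> carrier G" using sS SC by blast
  define c where "c t = s \<otimes>\<^bsub>G\<^esub> lie_exp G (t *\<^sub>F v)" for t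
  have e0: "lie_exp G (0 *\<^sub>F v) = \<one>\<^bsub>G\<^esub>" using gexp_0 by (metis fnvs.scale_zero_left)
  have c0: "c 0 = s" unfolding c_def e0 using sC by simp
  have cd: "((%t. f (c t)) has_real_derivative v (%h. f (s \<otimes>\<^bsub>G\<^esub> h))) (at 0)" if f: "smooth_at (mfd G) s f" for f
  proof -
   have "smooth_at (mfd G) \<one>\<^bsub>G\<^esub> (%h. f (s \<otimes>\<^bsub>G\<^esub> h))" by (rule sm_left_one[OF sC f])
   then show ?thesis using gexp_deriv[OF v(1), of 0 "%h. f (s \<otimes>\<^bsub>G\<^esub> h)"] unfolding e0 hat_one[OF v(1)] c_def by blast
  qed
  have cS: "c t \<in> S" for t unfolding c_def by (rule exp[OF sS L_scale[OF v(1)]])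
  have Wo: "openin (gtop G) {q \<in> U1. phi1 q \<in> kbox ?n x1 \<rho>}" by (rule chart_open_preimage[OF cM chart1(1) kopen_kbox])
  have "\<forall>\<^sub>F t in nhds 0. c t \<in> {q \<in> U1. phi1 q \<in> kbox ?n x1 \<rho>}"
  proof (rule curve_continuous[OF _ _ Wo])
   show "c 0 \<in> carrier G" using c0 sC by simp
   show "isCont (%t. f (c t)) 0" if "smooth_at (mfd G) (c 0) f" for f
    using DERIV_isCont[OF cd[of f]] that c0 by simp
   show "c 0 \<in> {q \<in> U1. phi1 q \<in> kbox ?n x1 \<rho>}"
    unfolding c0 using sU near chart_kspace[OF cM chart1(1) sU] by (simp add: kbox_def dist_real_def)
  qed
  then obtain \<eta> where \<eta>: "\<eta> > 0" "\<And>t. dist t 0 < \<eta> ==> c t \<in> {q \<in> U1. phi1 q \<in> kbox ?n x1 \<rho>}"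
   unfolding eventually_nhds_metric by blast
  have min: "d (c 0) \<le> d (c t)" if "\<bar>0 - t\<bar> < \<eta>" for t
  proof -
   have "c t \<in> {q \<in> U1. phi1 q \<in> kbox ?n x1 \<rho>}" by (rule \<eta>(2)) (use that in \<open>simp add: dist_real_def\<close>)
   then have "c t \<in> T" by (intro inT[OF cS]) (auto simp: kbox_def dist_real_def intro: less_imp_le)
   then show ?thesis unfolding c0 by (rule s(2))
  qed
  have D: "((%t. d (c t)) has_real_derivative (\<Sum>i<?n. 2 * (phi1 s i - phi1 g i) * (phi1 g i - phi1 s i))) (at 0)"
   unfolding d_def
  proof (rule DERIV_sum)
   fix i assume "i \<in> {..<?n}"
   then have i: "i < ?n" by simp
   have "((%t. phi1 (c t) i) has_real_derivative (phi1 g i - phi1 s i)) (at 0)"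
    using cd[OF sm_coord1[OF i sU]] v(2) i by simp
   then have "((%t. (phi1 (c t) i - phi1 g i)\<^sup>2) has_real_derivative 2 * (phi1 (c 0) i - phi1 g i) * (phi1 g i - phi1 s i)) (at 0)"
    by (auto intro!: derivative_eq_intros)
   then show "((%t. (phi1 (c t) i - phi1 g i)\<^sup>2) has_real_derivative 2 * (phi1 s i - phi1 g i) * (phi1 g i - phi1 s i)) (at 0)"
    unfolding c0 .
  qed
  \<comment> \<open>At the minimum the derivative vanishes; it is minus twice the square of the
    chart distance from \<open>s\<close> to \<open>g\<close>.\<close>
  have "(\<Sum>i<?n. 2 * (phi1 s i - phi1 g i) * (phi1 g i - phi1 s i)) = 0"
   by (rule DERIV_local_min[OF D \<eta>(1)]) (use min in blast)
  then have "(\<Sum>i<?n. 2 * (phi1 g i - phi1 s i)\<^sup>2) = 0"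
   by (simp add: power2_eq_square algebra_simps sum_negf[symmetric] sum_subtractf sum.distrib)
  then have "\<forall>i<?n. phi1 g i = phi1 s i" by (subst (asm) sum_nonneg_eq_0_iff) auto
  moreover have "phi1 g i = phi1 s i" if "\<not> i < ?n" for i
   using chart_kspace[OF cM chart1(1) gU] chart_kspace[OF cM chart1(1) sU] that by (simp add: kspace_def)
  ultimately have "phi1 g = phi1 s" by (intro ext) blast
  then have "g = s" using ps_phi1[OF gU] ps_phi1[OF sU] by metis
  then show "g \<in> S" using sS by simp
 qed
 moreover have "openin (gtop G) W" unfolding W_def by (rule chart_open_preimage[OF cM chart1(1) kopen_kbox])
 moreover have "\<one>\<^bsub>G\<^esub> \<in> W" unfolding W_def using chart1(2) x1_in(2) \<epsilon> by (simp add: kbox_def)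
 ultimately show ?thesis by blast
qed

context crown_setup
begin

text \<open>Properness enters as closedness of the map with compact fibres. Finitely many
  \<open>W h\<close> cover the fibre over \<open>(q, p)\<close>. The group elements outside their
  union \<open>V\<close> have a closed image that misses \<open>(q, p)\<close>, yet almost all
  \<open>g k\<close> lie outside \<open>V\<close> while the images of \<open>(g k, x k)\<close>
  approach \<open>(q, p)\<close>.\<close>

lemma proper_no_cluster:
 assumes pr: "acts_properly_on G GC \<iota> kk D" and D: "openin XC D" and p: "p \<in> D" and q: "q \<in> D"
  and g: "\<And>k. g k \<in> carrier G"
  and x: "\<And>B. openin XC B ==> p \<in> B ==> \<forall>\<^sub>F k in sequentially. x k \<in> B"
  and gx: "\<And>B. openin XC B ==> q \<in> B ==> \<forall>\<^sub>F k in sequentially. act GC \<iota> (g k) (x k) \<in> B"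
  and nc: "\<And>h. h \<in> carrier G ==> \<exists>W. openin (gtop G) W \<and> h \<in> W \<and> (\<forall>\<^sub>F k in sequentially. g k \<notin> W)"
 shows False
proof -
 let ?X = "subtopology XC D" and ?f = "%(g, x). (act GC \<iota> g x, x)"
 let ?T = "prod_topology (gtop G) ?X" and ?Y = "prod_topology ?X ?X"
 have tX: "topspace ?X = D" using openin_subset[OF D] by auto
 have tT: "topspace ?T = carrier G \<times> D" by (simp only: topspace_prod_topology tX G.top)
 have tY: "topspace ?Y = D \<times> D" by (simp only: topspace_prod_topology tX)
 have pm: "closed_map ?T ?Y ?f" "\<forall>y\<in>topspace ?Y. compactin ?T {z \<in> topspace ?T. ?f z = y}"
  using pr unfolding acts_properly_on_def proper_map_def by blast+
 have "\<forall>h\<in>carrier G. \<exists>W. openin (gtop G) W \<and> h \<in> W \<and> (\<forall>\<^sub>F k in sequentially. g k \<notin> W)" using nc by (rule ballI)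
 from bchoice[OF this] obtain W where W: "\<forall>h\<in>carrier G. openin (gtop G) (W h) \<and> h \<in> W h \<and> (\<forall>\<^sub>F k in sequentially. g k \<notin> W h)" ..
 let ?F = "{z \<in> topspace ?T. ?f z = (q, p)}" and ?U = "(%h. W h \<times> D) ` carrier G"
 have oD: "openin ?X D" using openin_topspace[of ?X] unfolding tX .
 have "(q, p) \<in> topspace ?Y" unfolding tY using p q by simp
 then have "compactin ?T ?F" by (rule bspec[OF pm(2)])
 moreover have "\<forall>u\<in>?U. openin ?T u" using W oD by (auto simp: openin_prod_Times_iff)
 moreover have "?F \<subseteq> \<Union>?U" using W tT by auto
 ultimately have "\<exists>\<F>. finite \<F> \<and> \<F> \<subseteq> ?U \<and> ?F \<subseteq> \<Union>\<F>" unfolding compactin_def by simp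
 then obtain \<F> where F: "finite \<F>" "\<F> \<subseteq> ?U" "?F \<subseteq> \<Union>\<F>" by (elim exE conjE) (rule that; assumption)
 obtain C where C: "finite C" "C \<subseteq> carrier G" "\<F> = (%h. W h \<times> D) ` C"
  using finite_subset_image[OF F(1,2)] by (elim exE conjE) (rule that; assumption)
 define V where "V = \<Union>(W ` C)"
 have V: "openin (gtop G) V" unfolding V_def using W C(2) by (intro openin_Union) auto
 have "\<forall>\<^sub>F k in sequentially. \<forall>h\<in>C. g k \<notin> W h" using W C by (intro eventually_ball_finite) auto
 then have ev: "\<forall>\<^sub>F k in sequentially. g k \<notin> V" unfolding V_def by simp
 have "closedin ?T ((carrier G - V) \<times> D)"
  unfolding closedin_prod_Times_iff using closedin_diff[OF closedin_topspace V] closedin_topspace[of ?X] unfolding tX G.top by simp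
 then have cl: "closedin ?Y (?f ` ((carrier G - V) \<times> D))" using pm(1) unfolding closed_map_def by (elim allE impE)
 have nin: "(q, p) \<notin> ?f ` ((carrier G - V) \<times> D)"
 proof
  assume "(q, p) \<in> ?f ` ((carrier G - V) \<times> D)"
  then obtain h where h: "h \<in> carrier G" "h \<notin> V" "act GC \<iota> h p = q" by auto
  then have "(h, p) \<in> ?F" using p tT by simp
  then have "(h, p) \<in> \<Union>\<F>" using F(3) by (rule subsetD[rotated])
  then show False using h(2) unfolding C(3) V_def by auto
 qed
 have o: "openin ?Y (D \<times> D - ?f ` ((carrier G - V) \<times> D))" using openin_diff[OF openin_topspace cl] unfolding tY .
 have i: "(q, p) \<in> D \<times> D - ?f ` ((carrier G - V) \<times> D)" using nin p q by simp
 obtain A B where AB: "openin ?X A" "openin ?X B" "q \<in> A" "p \<in> B" "A \<times> B \<subseteq> D \<times> D - ?f ` ((carrier G - V) \<times> D)"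
  using o[unfolded openin_prod_topology_alt, THEN spec, THEN spec, THEN mp, OF i] by (elim exE conjE) (rule that; assumption)
 have A: "openin XC A" and B: "openin XC B" and BD: "B \<subseteq> D" using AB(1,2) openin_open_subtopology[OF D] by auto
 have "\<forall>\<^sub>F k in sequentially. g k \<notin> V \<and> x k \<in> B \<and> act GC \<iota> (g k) (x k) \<in> A"
  using ev x[OF B AB(4)] gx[OF A AB(3)] by (intro eventually_conj)
 from eventually_happens'[OF sequentially_bot this]
 obtain k where k: "g k \<notin> V" "x k \<in> B" "act GC \<iota> (g k) (x k) \<in> A" by (elim exE conjE) (rule that; assumption)
 have "(act GC \<iota> (g k) (x k), x k) \<in> A \<times> B" by (rule SigmaI[OF k(3,2)])
 from subsetD[OF AB(5) this] have ni: "(act GC \<iota> (g k) (x k), x k) \<notin> ?f ` ((carrier G - V) \<times> D)" unfolding Diff_iff by (rule conjunct2)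
 have "(g k, x k) \<in> (carrier G - V) \<times> D" by (intro SigmaI DiffI g k(1) subsetD[OF BD k(2)])
 from imageI[OF this, of ?f] ni show False by simp
qed

lemma stabiliser_compact:
 assumes pr: "acts_properly_on G GC \<iota> kk D" and D: "openin XC D" and p: "p \<in> D"
 shows "compactin (gtop G) {g \<in> carrier G. act GC \<iota> g p = p}"
proof -
 let ?X = "subtopology XC D" and ?f = "%(g, x). (act GC \<iota> g x, x)"
 let ?T = "prod_topology (gtop G) ?X" and ?Y = "prod_topology ?X ?X"
 have tX: "topspace ?X = D" using openin_subset[OF D] by auto
 have pm: "\<forall>y\<in>topspace ?Y. compactin ?T {z \<in> topspace ?T. ?f z = y}"
  using pr unfolding acts_properly_on_def proper_map_def by blast
 have "(p, p) \<in> topspace ?Y" unfolding topspace_prod_topology tX using p by simp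
 then have "compactin ?T {z \<in> topspace ?T. ?f z = (p, p)}" by (rule bspec[OF pm])
 from image_compactin[OF this continuous_map_fst]
 have "compactin (gtop G) (fst ` {z \<in> topspace ?T. ?f z = (p, p)})" .
 moreover have "fst ` {z \<in> topspace ?T. ?f z = (p, p)} = {g \<in> carrier G. act GC \<iota> g p = p}"
  unfolding topspace_prod_topology tX G.top using p by force
 ultimately show ?thesis by simp
qed

lemma compact_if_p_trivial:
 assumes pr: "acts_properly_on G GC \<iota> kk D" and D: "openin XC D" and p: "pt \<one>\<^bsub>GC\<^esub> \<in> D"
  and conn: "connected_space (gtop G)" and pp0: "pp = {0}"
 shows "compact_space (gtop G)"
proof -
 define S where "S = {g \<in> carrier G. act GC \<iota> g (pt \<one>\<^bsub>GC\<^esub>) = pt \<one>\<^bsub>GC\<^esub>}"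
 have S: "compactin (gtop G) S" unfolding S_def by (rule stabiliser_compact[OF pr D p])
 have S_iff: "g \<in> S \<longleftrightarrow> g \<in> carrier G \<and> pt (\<iota> g) = pt \<one>\<^bsub>GC\<^esub>" for g
  unfolding S_def using act_pt[of g "\<one>\<^bsub>GC\<^esub>"] iota_in[of g] by auto
 have mult: "g \<otimes>\<^bsub>G\<^esub> h \<in> S" if "g \<in> S" "h \<in> S" for g h
 proof -
  have g: "g \<in> carrier G" "pt (\<iota> g) = pt \<one>\<^bsub>GC\<^esub>" and h: "h \<in> carrier G" "pt (\<iota> h) = pt \<one>\<^bsub>GC\<^esub>" using that S_iff by auto
  have "pt (\<iota> (g \<otimes>\<^bsub>G\<^esub> h)) = act GC \<iota> g (pt (\<iota> h))" unfolding act_pt[OF g(1) iota_in[OF h(1)]] iota_mult[OF g(1) h(1)] ..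
  then show ?thesis using g h act_pt[OF g(1), of "\<one>\<^bsub>GC\<^esub>"] iota_in[OF g(1)] by (simp add: S_iff)
 qed
 \<comment> \<open>X - \<theta> X is always in p, so p = 0 makes \<theta> the identity and k the
   whole Lie algebra.\<close>
 have kL: "X \<in> kk" if X: "X \<in> G.L" for X
 proof -
  have "X - \<theta> X \<in> pp" using X by (simp add: pp A.th_diff A.th_th A.th_in A.L_diff)
  then have "X - \<theta> X = 0" using pp0 by blast
  then show ?thesis using X by (simp add: kk)
 qed
 have exp: "lie_exp G X \<in> S" if X: "X \<in> G.L" for X
 proof -
  have "cexp (dl X) \<in> KC" using KC_exp[OF kL[OF X], of 1] by simp
  from pt_KC[OF this C.one_closed] have "pt (\<iota> (lie_exp G X)) = pt \<one>\<^bsub>GC\<^esub>"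
   unfolding iota_exp[OF X] using C.gexp_in[OF dl_in[OF X]] by simp
  then show ?thesis unfolding S_iff using G.gexp_in[OF X] by simp
 qed
 have one: "\<one>\<^bsub>G\<^esub> \<in> S" using exp[OF G.L_0] by (simp add: G.gexp_0)
 obtain W where W: "openin (gtop G) W" "\<one>\<^bsub>G\<^esub> \<in> W" "W \<subseteq> S"
  using nearest_point_neighbourhood[OF G.lie S one] mult exp by blast
 have SC: "s \<in> carrier G" if "s \<in> S" for s using that S_iff by blast
 have "openin (gtop G) S"
 proof (subst openin_subopen, intro ballI)
  fix s assume s: "s \<in> S"
  note sc = SC[OF s]
  let ?V = "{x \<in> carrier G. inv\<^bsub>G\<^esub> s \<otimes>\<^bsub>G\<^esub> x \<in> W}"
  have "openin (gtop G) ?V"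
   using openin_continuous_map_preimage[OF smooth_map_continuous[OF G.smooth_mult[OF G.cM G.smooth_const[OF G.cM G.inv_closed[OF sc]] G.smooth_id]] W(1)] G.top
   by simp
  moreover have "s \<in> ?V" using sc W by simp
  moreover have "?V \<subseteq> S"
  proof
   fix x assume x: "x \<in> ?V"
   then have "s \<otimes>\<^bsub>G\<^esub> (inv\<^bsub>G\<^esub> s \<otimes>\<^bsub>G\<^esub> x) \<in> S" using mult[OF s] W(3) by blast
   then show "x \<in> S" using sc x by (simp add: G.m_assoc[symmetric])
  qed
  ultimately show "\<exists>T. openin (gtop G) T \<and> s \<in> T \<and> T \<subseteq> S" by (intro exI[of _ ?V] conjI)
 qed
 moreover have "closedin (gtop G) S"
  using compactin_imp_closedin[OF _ S] G.lie unfolding is_lie_group_def is_manifold_def by blast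
 ultimately have "S = topspace (gtop G)" using conn one unfolding connected_space_clopen_in by blast
 then show ?thesis using S unfolding compact_space_def by simp
qed

end

section \<open>The boundary of the crown domain\<close>

context crown_setup
begin

lemma root_scale: "\<alpha> \<in> A.roots ==> X \<in> aa ==> \<alpha> (c *\<^sub>F X) = c * \<alpha> X"
 unfolding restricted_roots_def by simp

text \<open>The topology of \<open>aa\<close> is that of pointwise convergence, so \<alpha>(H) has
  to be written through values of H at fixed functions. Evaluating [H, E] = \<alpha>(H) E at a
  coordinate where E does not vanish and exchanging the order of the derivations does this.\<close>

lemma root_continuous:
 assumes "\<alpha> \<in> A.roots" shows "continuous_on aa \<alpha>"
proof -
 obtain E where E: "A.root_vector E \<alpha>" using A.roots_vector[OF assms] ..
 note EL = A.root_vectorD(1)[OF E]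
 have "\<exists>j<n. E (G.crd j) \<noteq> 0" using G.der_eqI[OF EL G.L_0] A.root_vectorD(2)[OF E] by force
 then obtain j where j: "j < n" "E (G.crd j) \<noteq> 0" by blast
 let ?f = "G.crd j"
 note sf = G.sm_crd[OF j(1)]
 let ?F = "%p. ?f (fst p \<otimes>\<^bsub>G\<^esub> snd p)"
 have F: "smooth_at (prod_manifold (mfd G) (mfd G)) (\<one>\<^bsub>G\<^esub>, \<one>\<^bsub>G\<^esub>) ?F"
  by (rule G.smooth_at_two[OF G.pM G.smooth_mult[OF G.cMM smooth_map_fst[OF G.pM G.pM] smooth_map_snd[OF G.pM G.pM]]])
   (use sf in \<open>auto simp: G.topP G.top\<close>)
 define f2 where "f2 = (%h. E (%g. ?f (g \<otimes>\<^bsub>G\<^esub> h)))"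
 have "(H (G.hat E ?f) - H f2) / E ?f = \<alpha> H" if H: "H \<in> aa" for H
 proof -
  have "\<alpha> H * E ?f = G.br H E ?f" unfolding A.root_vectorD(3)[OF E H] by (simp add: fscale_def)
  also have "\<dots> = H (G.hat E ?f) - E (G.hat H ?f)" using sf by (simp add: G.br_eq)
  also have "E (G.hat H ?f) = H f2"
   using G.der_commute[OF F EL A.aa_L[OF H]] by (simp add: G.hat_def[abs_def] f2_def)
  finally show ?thesis using j(2) by (simp add: field_simps)
 qed
 moreover have "continuous_on aa (%H. (H (G.hat E ?f) - H f2) / E ?f)"
  by (intro continuous_intros continuous_on_subset[OF continuous_on_product_coordinates]) (use j in auto)
 ultimately show ?thesis using continuous_on_eq[of aa _ \<alpha>] by blast
qed

text \<open>Finitely many continuous roots make Omega open, so a boundary point violates one of the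
  strict inequalities; the weak one survives in the closure and leaves equality.\<close>

lemma boundary_Omega_root:
 assumes "Y \<in> boundary_Omega G aa"
 shows "Y \<in> aa" "\<exists>\<alpha>\<in>A.roots. \<bar>\<alpha> Y\<bar> = 1"
proof -
 let ?X = "top_of_set aa"
 have c: "continuous_on aa (%Y. \<bar>\<alpha> Y\<bar>)" if "\<alpha> \<in> A.roots" for \<alpha>
  by (intro continuous_intros root_continuous that)
 have Y: "Y \<in> ?X closure_of Omega G aa" "Y \<notin> ?X interior_of Omega G aa"
  using assms by (auto simp: boundary_Omega_def frontier_of_def)
 show Ya: "Y \<in> aa" using subsetD[OF closure_of_subset_topspace Y(1)] by simp
 have "Omega G aa = aa \<inter> \<Inter>((%\<alpha>. aa \<inter> (%Y. \<bar>\<alpha> Y\<bar>) -` {..<1}) ` A.roots)"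
  unfolding Omega_def by auto
 moreover have "openin ?X \<dots>"
  by (rule openin_Int_Inter) (use A.finite_roots continuous_openin_preimage_gen[OF c open_lessThan] in auto)
 ultimately have "openin ?X (Omega G aa)" by simp
 then have "Y \<notin> Omega G aa" using Y(2) by (simp add: interior_of_openin)
 then obtain \<alpha> where a: "\<alpha> \<in> A.roots" "\<not> \<bar>\<alpha> Y\<bar> < 1" using Ya unfolding Omega_def by blast
 have "closedin ?X (aa \<inter> (%Y. \<bar>\<alpha> Y\<bar>) -` {..1})" by (rule continuous_closedin_preimage[OF c[OF a(1)] closed_atMost])
 moreover have "Omega G aa \<subseteq> aa \<inter> (%Y. \<bar>\<alpha> Y\<bar>) -` {..1}" using a(1) unfolding Omega_def by force
 ultimately have "Y \<in> aa \<inter> (%Y. \<bar>\<alpha> Y\<bar>) -` {..1}" using closure_of_minimal Y(1) by blast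
 then have "\<bar>\<alpha> Y\<bar> = 1" using a(2) by simp
 then show "\<exists>\<alpha>\<in>A.roots. \<bar>\<alpha> Y\<bar> = 1" using a(1) by blast
qed

lemma boundary_Omega_sub: "boundary_Omega G aa \<subseteq> aa" and Omega_sub: "Omega G aa \<subseteq> aa"
 using boundary_Omega_root(1) by (auto simp: Omega_def)

lemma aa_sub_L: "aa \<subseteq> G.L"
 using A.aa_L by blast

lemma orbit_mono: "S \<subseteq> S' ==> G_exp_orbit G GC \<iota> kk S \<subseteq> G_exp_orbit G GC \<iota> kk S'"
 unfolding G_exp_orbit_def by blast

lemma real_at_top: "filterlim (%k. c * real k) at_top sequentially" if "c > 0"
 using that by (intro filterlim_tendsto_pos_mult_at_top[OF tendsto_const] filterlim_real_sequentially)

lemma semisimple_point_not_in: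
 assumes pr: "acts_properly_on G GC \<iota> kk D" and D: "openin XC D"
  and inv: "\<And>g x. g \<in> carrier G ==> x \<in> D ==> act GC \<iota> g x \<in> D"
  and a: "\<alpha> \<in> A.roots" "Y \<in> aa" "\<bar>\<alpha> Y\<bar> = 1" and g: "g \<in> carrier G"
 shows "pt (\<iota> g \<otimes>\<^bsub>GC\<^esub> bb Y) \<notin> D"
proof
 assume x: "pt (\<iota> g \<otimes>\<^bsub>GC\<^esub> bb Y) \<in> D"
 note b = bb_in[OF A.aa_L[OF a(2)]]
 have "act GC \<iota> (inv\<^bsub>G\<^esub> g) (pt (\<iota> g \<otimes>\<^bsub>GC\<^esub> bb Y)) = pt (bb Y)"
  using act_pt[of "inv\<^bsub>G\<^esub> g" "\<iota> g \<otimes>\<^bsub>GC\<^esub> bb Y"] g b iota_in[OF g] by (simp add: iota_inv C.m_assoc[symmetric])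
 then have xD: "pt (bb Y) \<in> D" using inv[OF G.inv_closed[OF g] x] by simp
 obtain E0 where E0: "A.root_vector E0 \<alpha>" using A.roots_vector[OF a(1)] ..
 \<comment> \<open>If the root has the value -1 at Y, then \<theta> E belongs to the opposite root,
   with value 1.\<close>
 have "\<exists>E \<beta>. A.root_vector E \<beta> \<and> \<beta> Y = 1"
 proof (cases "\<alpha> Y = 1")
  case True then show ?thesis using E0 by (intro exI conjI)
 next
  case False
  then have "- \<alpha> Y = 1" using a(3) by linarith
  then show ?thesis using A.th_root[OF E0] by (intro exI[of _ "\<theta> E0"] exI[of _ "%H. - \<alpha> H"] conjI)
 qed
 then obtain E \<beta> where E: "A.root_vector E \<beta>" "\<beta> Y = 1" by (elim exE conjE) (rule that)
 obtain H \<omega> where H: "\<omega> > 0" "sl2 Y E H \<omega>" using sl2_exists[where E=E and \<beta>=\<beta> and Y=Y, OF E(1) a(2) E(2)] by (elim exE conjE) (rule that)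
 show False
 \<comment> \<open>The point is fixed by the escaping elements, so the constant sequence serves for
   both limits.\<close>
 proof (rule proper_no_cluster[where g="%k. lie_exp G (real k *\<^sub>F P E)" and x="%_. pt (bb Y)", OF pr D xD xD])
  show "lie_exp G (real k *\<^sub>F P E) \<in> carrier G" for k by (rule iota_expP(2)[OF H(2)])
  show "\<forall>\<^sub>F k in sequentially. pt (bb Y) \<in> B" if "pt (bb Y) \<in> B" for B using that by simp
  show "\<forall>\<^sub>F k in sequentially. act GC \<iota> (lie_exp G (real k *\<^sub>F P E)) (pt (bb Y)) \<in> B" if "pt (bb Y) \<in> B" for B
   using that unfolding act_pt[OF iota_expP(2)[OF H(2)] b] fixed_point[OF H(2)] by simp
  show "\<exists>W. openin (gtop G) W \<and> h \<in> W \<and> (\<forall>\<^sub>F k in sequentially. lie_exp G (real k *\<^sub>F P E) \<notin> W)" if "h \<in> carrier G" for h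
   by (rule no_cluster[OF H(2) that H(1) filterlim_real_sequentially])
 qed
qed

lemma zz_in_boundary_n:
 assumes sl2: "sl2 Y E H \<omega>" and r: "\<forall>\<alpha>\<in>A.roots. \<bar>\<alpha> Y\<bar> \<le> 1"
 shows "pt (zz Y E H \<omega>) \<in> crown_boundary_n G GC \<iota> kk aa"
proof -
 note L = sl2_L[OF sl2]
 have Ya: "Y \<in> aa" using sl2 by (simp add: sl2_def)
 have nin: "pt (zz Y E H \<omega>) \<notin> G_exp_orbit G GC \<iota> kk S" if "S \<subseteq> aa" for S
  using zz_not_in_orbit[OF sl2] orbit_mono[OF that] by blast
 have inX: "pt (\<iota> g \<otimes>\<^bsub>GC\<^esub> qq Y (dlt \<omega> k)) \<in> crown G GC \<iota> kk aa" if g: "g \<in> carrier G" for g k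
 proof -
  define \<delta> where "\<delta> = dlt \<omega> k"
  have d: "0 < \<delta>" "\<delta> \<le> 2" unfolding \<delta>_def dlt_def[OF sl2] by simp_all
  \<comment> \<open>With this value bb(Y) exp(-i \<delta> Y) = exp(i (pi / 2) t Y). From 0 <
    \<delta> \<le> 2 < pi it follows that |t| < 1, which turns the weak root inequalities for Y into
    strict ones for t Y.\<close>
  define t where "t = 1 - 2 * \<delta> / pi"
  have t: "\<bar>t\<bar> < 1" using d pi_gt3 unfolding t_def by (auto simp: abs_less_iff field_simps)
  have "\<bar>\<alpha> (t *\<^sub>F Y)\<bar> < 1" if a: "\<alpha> \<in> A.roots" for \<alpha>
  proof -
   have "\<bar>\<alpha> (t *\<^sub>F Y)\<bar> = \<bar>t\<bar> * \<bar>\<alpha> Y\<bar>" by (simp add: root_scale[OF a Ya] abs_mult)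
   also have "\<dots> \<le> \<bar>t\<bar> * 1" using bspec[OF r a] by (intro mult_left_mono) auto
   finally show ?thesis using t by simp
  qed
  then have O: "t *\<^sub>F Y \<in> Omega G aa" unfolding Omega_def using A.aa_scale[OF Ya] by blast
  have eq: "\<i> * complex_of_real pi / 2 + - \<i> * of_real \<delta> = (\<i> * complex_of_real pi / 2) * of_real t"
   unfolding t_def by (simp add: field_simps)
  have "bb (t *\<^sub>F Y) = cexp ((\<i> * complex_of_real pi / 2 + - \<i> * of_real \<delta>) *\<^sub>F dl Y)"
   unfolding dl_scale fnvs.scale_scale eq ..
  also have "\<dots> = qq Y \<delta>" unfolding qq_def[OF sl2] by (rule C.gexp_add[OF dl_in[OF L(1)]])
  finally show ?thesis unfolding crown_def orbit_iff[OF subset_trans[OF Omega_sub aa_sub_L]] \<delta>_def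
   using g O by (metis (no_types))
 qed
 have cl: "pt (zz Y E H \<omega>) \<in> XC closure_of crown G GC \<iota> kk aa"
  unfolding in_closure_of
 proof (intro conjI allI impI)
  show "pt (zz Y E H \<omega>) \<in> topspace XC" unfolding XC_top using zz_in[OF sl2] by blast
  fix B assume "pt (zz Y E H \<omega>) \<in> B \<and> openin XC B"
  then have "\<forall>\<^sub>F k in sequentially. pt (\<iota> (lie_exp G (sg \<omega> k *\<^sub>F P E)) \<otimes>\<^bsub>GC\<^esub> qq Y (dlt \<omega> k)) \<in> B"
   using limit_pt[OF sl2] by blast
  then obtain k where "pt (\<iota> (lie_exp G (sg \<omega> k *\<^sub>F P E)) \<otimes>\<^bsub>GC\<^esub> qq Y (dlt \<omega> k)) \<in> B"
   using eventually_happens'[OF sequentially_bot] by blast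
  then show "\<exists>y. y \<in> crown G GC \<iota> kk aa \<and> y \<in> B" using inX[OF iota_expP(2)[OF sl2]] by blast
 qed
 have ni: "pt (zz Y E H \<omega>) \<notin> XC interior_of crown G GC \<iota> kk aa"
 proof
  assume "pt (zz Y E H \<omega>) \<in> XC interior_of crown G GC \<iota> kk aa"
  from subsetD[OF interior_of_subset this] nin[OF Omega_sub] show False unfolding crown_def by (rule notE[rotated])
 qed
 show ?thesis
  unfolding crown_boundary_n_def crown_boundary_def crown_boundary_s_def frontier_of_def
  by (intro DiffI cl ni nin[OF boundary_Omega_sub])
qed

lemma boundary_n_not_subset:
 assumes pr: "acts_properly_on G GC \<iota> kk D" and D: "openin XC D" and p0: "pp \<noteq> {0}"
 shows "\<not> crown_boundary_n G GC \<iota> kk aa \<subseteq> D"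
proof
 assume sub: "crown_boundary_n G GC \<iota> kk aa \<subseteq> D"
 obtain Y E \<beta> where Y: "Y \<in> aa \<and> A.root_vector E \<beta> \<and> \<beta> Y = 1 \<and> (\<forall>\<alpha>\<in>A.roots. \<forall>t. \<alpha> (t *\<^sub>F Y) = t * \<alpha> Y \<and> \<bar>\<alpha> Y\<bar> \<le> 1)"
  using A.extremal_point[OF p0] by (elim exE) (rule that)
 have E: "A.root_vector E \<beta>" and Ya: "Y \<in> aa" and b: "\<beta> Y = 1" and r: "\<forall>\<alpha>\<in>A.roots. \<bar>\<alpha> Y\<bar> \<le> 1" using Y by simp_all
 obtain H \<omega> where H: "\<omega> > 0" "sl2 Y E H \<omega>" using sl2_exists[where E=E and \<beta>=\<beta> and Y=Y, OF E Ya b] by (elim exE conjE) (rule that)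
 note H' = sl2_minus[OF H(2)]
 have q: "pt (zz Y E H \<omega>) \<in> D" and p: "pt (zz Y E H (- \<omega>)) \<in> D"
  using zz_in_boundary_n[OF H(2) r] zz_in_boundary_n[OF H' r] sub by auto
 have PL: "P E \<in> G.L" by (rule sl2_L(5)[OF H(2)])
 have sg: "sg \<omega> k = real k" "sg (- \<omega>) k = - real k" "dlt (- \<omega>) k = dlt \<omega> k" for k
  using H(1) by (simp_all add: sg_def[OF H(2)] sg_def[OF H'] dlt_def[OF H(2)] dlt_def[OF H'])
 \<comment> \<open>The sequence approaching the point for - \<omega>. As \<open>dlt\<close> depends
   only on the modulus of \<omega>, translating it by exp(2 k P) gives exactly the sequence
   approaching the point for \<omega>.\<close>
 let ?x = "%k. pt (\<iota> (lie_exp G ((- real k) *\<^sub>F P E)) \<otimes>\<^bsub>GC\<^esub> qq Y (dlt \<omega> k))"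
 have step: "act GC \<iota> (lie_exp G ((2 * real k) *\<^sub>F P E)) (?x k) = pt (\<iota> (lie_exp G (real k *\<^sub>F P E)) \<otimes>\<^bsub>GC\<^esub> qq Y (dlt \<omega> k))" for k
 proof -
  note e = iota_expP(2)[OF H(2)]
  have "lie_exp G (real k *\<^sub>F P E) = lie_exp G ((2 * real k) *\<^sub>F P E) \<otimes>\<^bsub>G\<^esub> lie_exp G ((- real k) *\<^sub>F P E)"
   using G.gexp_add[OF PL, of "2 * real k" "- real k"] by (simp add: algebra_simps)
  then show ?thesis
   using iota_mult[OF e[of "2 * real k"] e[of "- real k"]] iota_in[OF e] qq_in[OF H(2)]
   by (simp only: act_pt[OF e C.m_closed] C.m_assoc)
 qed
 show False
 proof (rule proper_no_cluster[where g="%k. lie_exp G ((2 * real k) *\<^sub>F P E)" and x="?x", OF pr D p q])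
  show "lie_exp G ((2 * real k) *\<^sub>F P E) \<in> carrier G" for k by (rule iota_expP(2)[OF H(2)])
  show "\<forall>\<^sub>F k in sequentially. ?x k \<in> B" if "openin XC B" "pt (zz Y E H (- \<omega>)) \<in> B" for B
   using limit_pt[OF H' that] unfolding sg .
  show "\<forall>\<^sub>F k in sequentially. act GC \<iota> (lie_exp G ((2 * real k) *\<^sub>F P E)) (?x k) \<in> B" if "openin XC B" "pt (zz Y E H \<omega>) \<in> B" for B
   using limit_pt[OF H(2) that] unfolding sg step .
  show "\<exists>W. openin (gtop G) W \<and> h \<in> W \<and> (\<forall>\<^sub>F k in sequentially. lie_exp G ((2 * real k) *\<^sub>F P E) \<notin> W)" if "h \<in> carrier G" for h
   by (rule no_cluster[OF H(2) that H(1) real_at_top]) simp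
 qed
qed

lemma base_in_crown: "pt \<one>\<^bsub>GC\<^esub> \<in> crown G GC \<iota> kk aa"
proof -
 have z: "0 \<in> aa" by (rule fnvs.subspace_0[OF A.aa_sub])
 have "\<bar>\<alpha> 0\<bar> < 1" if "\<alpha> \<in> A.roots" for \<alpha> using root_scale[OF that z, of 0] by simp
 then have O: "0 \<in> Omega G aa" unfolding Omega_def using z by blast
 have "\<iota> \<one>\<^bsub>G\<^esub> \<otimes>\<^bsub>GC\<^esub> bb 0 = \<one>\<^bsub>GC\<^esub>" by (simp add: iota_one dl_0 C.gexp_0)
 then show ?thesis unfolding crown_def orbit_iff[OF subset_trans[OF Omega_sub aa_sub_L]]
  using O G.one_closed by metis
qed

end

theorem theorem4p1:
  fixes G :: "('a, real) lie_group"
    and GC :: "('b, complex) lie_group"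
    and \<iota> :: "'a \<Rightarrow> 'b"
    and k p a :: "(('a \<Rightarrow> real) \<Rightarrow> real) set"
    and D :: "'b set set"
  assumes "is_lie_group G"
    and "connected_space (gtop G)"
    and "\<not> compact_space (gtop G)"
    and "simple_lie_algebra (lie_algebra G) (lie_bracket G)"
    and "cartan_decomposition (lie_algebra G) (lie_bracket G) k p"
    and "maximal_abelian_in (lie_bracket G) p a"
    and "universal_complexification G GC \<iota>"
    and "openin (X_C GC \<iota> k) D"
    and "connectedin (X_C GC \<iota> k) D"
    and "\<And>g x. g \<in> carrier G \<Longrightarrow> x \<in> D \<Longrightarrow> act GC \<iota> g x \<in> D"
    and "X_real G GC \<iota> k \<subseteq> D"
    and "acts_properly_on G GC \<iota> k D"
  shows "crown_boundary_s G GC \<iota> k a \<inter> D = {} \<and>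
         \<not> crown_boundary_n G GC \<iota> k a \<subseteq> D \<and>
         (crown_boundary_n G GC \<iota> k a \<inter> D = {} \<longrightarrow> D \<subseteq> crown G GC \<iota> k a)"
proof -
 obtain \<theta> where th: "cartan_involution (lie_algebra G) (lie_bracket G) \<theta>" and k: "k = {X \<in> lie_algebra G. \<theta> X = X}"
  and p: "p = {X \<in> lie_algebra G. \<theta> X = - X}"
  using assms(5) unfolding cartan_decomposition_def by (elim exE conjE) (rule that)
 have GC: "is_lie_group GC" using assms(7) unfolding universal_complexification_def by (rule conjunct1)
 interpret crown_setup G GC \<iota> \<theta> k p a
  by unfold_locales (rule assms(1) GC assms(7) assms(4) th k p assms(6))+
 have x0: "pt \<one>\<^bsub>GC\<^esub> \<in> D"
 proof -
  have "act GC \<iota> \<one>\<^bsub>G\<^esub> (base_point GC \<iota> k) = pt \<one>\<^bsub>GC\<^esub>"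
   unfolding base_pt using act_pt[of "\<one>\<^bsub>G\<^esub>" "\<one>\<^bsub>GC\<^esub>"] iota_one by simp
  then show ?thesis using assms(11) G.one_closed unfolding X_real_def by blast
 qed
 have i: "crown_boundary_s G GC \<iota> k a \<inter> D = {}"
 proof (rule equals0I)
  fix x assume "x \<in> crown_boundary_s G GC \<iota> k a \<inter> D"
  then have xb: "x \<in> G_exp_orbit G GC \<iota> k (boundary_Omega G a)" and xD: "x \<in> D" unfolding crown_boundary_s_def by auto
  obtain g Y where g: "g \<in> carrier G" and Y: "Y \<in> boundary_Omega G a" and x: "x = pt (\<iota> g \<otimes>\<^bsub>GC\<^esub> bb Y)"
   using xb unfolding orbit_iff[OF subset_trans[OF boundary_Omega_sub aa_sub_L]] by (elim bexE) (rule that)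
  obtain \<alpha> where al: "\<alpha> \<in> restricted_roots (lie_algebra G) (lie_bracket G) a" "\<bar>\<alpha> Y\<bar> = 1" using boundary_Omega_root(2)[OF Y] by (elim bexE) (rule that)
  have "pt (\<iota> g \<otimes>\<^bsub>GC\<^esub> bb Y) \<notin> D"
   by (rule semisimple_point_not_in[where \<alpha>=\<alpha> and Y=Y and g=g and D=D])
    (fact assms(12) assms(8) assms(10) al boundary_Omega_root(1)[OF Y] g)+
  then show False using xD x by simp
 qed
 \<comment> \<open>The construction of the two limit points starts from a root, hence from a
   non-zero p; for p = 0 the group would be compact.\<close>
 have ii: "\<not> crown_boundary_n G GC \<iota> k a \<subseteq> D"
 proof (cases "p = {0}")
  case True
  then show ?thesis using compact_if_p_trivial[OF assms(12,8) x0 assms(2)] assms(3) by blast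
 next
  case False
  then show ?thesis by (rule boundary_n_not_subset[OF assms(12,8)])
 qed
 have iii: "D \<subseteq> crown G GC \<iota> k a" if n: "crown_boundary_n G GC \<iota> k a \<inter> D = {}"
 proof (rule ccontr)
  assume "\<not> D \<subseteq> crown G GC \<iota> k a"
  then have "D - crown G GC \<iota> k a \<noteq> {}" by blast
  moreover have "D \<inter> crown G GC \<iota> k a \<noteq> {}" using x0 base_in_crown by blast
  \<comment> \<open>A connected set that meets both a set and its complement meets the frontier. By
    (i) such a point of \<open>D\<close> is not in the semisimple part, so it lies in the remaining
    part of the boundary.\<close>
  ultimately have "D \<inter> XC frontier_of crown G GC \<iota> k a \<noteq> {}"
   using connectedin_Int_frontier_of[OF assms(9)] by blast
  then show False using n i unfolding crown_boundary_n_def crown_boundary_def by blast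
 qed
 show ?thesis using i ii iii by blast
qed

end
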